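(* Consider the distributionally robust 2-stage problem with a central distribution $\hat p$ of polynomial-size support (described in the context). Suppose that we have a polynomial-time separation oracle for $\mathcal{P}$, a local $\rho$-approximation algorithm, and a $(\beta_1,\beta_2)$-approximation algorithm for $g(x,y,A)$ for every $(x,y,A)\in X\times\mathbb{R}_{\ge0}\times\mathcal{A}$. Then for any $\varepsilon>0$, in time polynomial in $\mathcal{I}$ and $\log(1/\varepsilon)$, we can compute $\tilde x\in X$ and a number $\tilde f$ such that $\tilde f\le h_{\hat p}(\tilde x)\le \beta_1\beta_2\tilde f$ and $\tilde f\le\rho(1+\varepsilon)\min_{x\in X}h_{\hat p}(x)$.
   Context: $\mathcal{A}$ is a finite set of scenarios; $\mathcal{P}\subseteq\mathbb{R}^m_{\ge0}$ is a polytope, $X=\mathcal{P}\cap\mathbb{Z}^m$; $c\in\mathbb{R}^m$; $g(x,A)\ge0$ is the optimal fractional second-stage cost of scenario $A$ given first-stage decision $x\in\mathcal{P}$. $\kappa_{sc}:\mathcal{A}\times\mathcal{A}\to\mathbb{R}_{\ge0}$ is a scenario metric with $\kappa_{sc}(A,A)=0$, $r>0$, and $\kappa_{\max}=\max_{A,A'}\kappa_{sc}(A,A')$ (or an upper bound on it) is given. $\hat p$ is an explicitly given distribution on $\mathcal{A}$ with polynomial-size support $\mathcal{A}_{sup}$. For $x\in\mathcal{P}$, $z_{\hat p}(x)=\max\{\sum_{(A,A')\in\mathcal{A}_{sup}\times\mathcal{A}}\gamma_{A,A'}g(x,A'):\gamma\ge0,\ \sum_{A'}\gamma_{A,A'}\le\hat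 p_A\ \forall A\in\mathcal{A}_{sup},\ \sum_{A,A'}\kappa_{sc}(A,A')\gamma_{A,A'}\le r\}$ and $h_{\hat p}(x)=c^\top x+z_{\hat p}(x)$. $\mathcal{I}$ is the input size. Standing assumptions: (P1) $0\in X$, $c\ge0$, $\log|X|$ polynomial in $\mathcal{I}$, $0\le g(x,A)\le g(0,A)$; (P2) $g(0,A)\le g(x,A)+\lambda c^\top x$ for a known $\lambda\ge1$; (P3) known $R$, $V\le1$ with $\mathcal{P}\subseteq\{\|x\|_2\le R\}$, $\mathcal{P}$ containing a ball of radius $V$, $\ln(R/V)$ polynomial in $\mathcal{I}$; (P4) $g(\cdot,A)$ convex on $\mathcal{P}$ and efficiently computable; (P5) a subgradient of $g(\cdot,A)$ at any $x\in\mathcal{P}$ of norm at most $K$, $\ln K$ polynomial in $\mathcal{I}$, is efficiently computable. A scenario $A$ is null if $g(x,A)=g(0,A)$ for all $x\in\mathcal{P}$; it is assumed that every non-null scenario $A$ satisfies $c^\top x+g(x,A)\ge1$ for all $x\in\mathcal{P}$. Definitions: $g(x,y,A)=\max_{A'\in\mathcal{A}}(g(x,A')-y\,\kappa_{sc}(A,A'))$. A $(\beta_1,\beta_2)$-approximation algorithm for $g(x,y,A)$ ($\beta_1,\beta_2\ge1$) returns $\bar A\in\mathcal{A}$ with $g(x,\bar A)-y\kappa_{sc}(A,\bar A)\ge g(x,A')/\beta_1-\beta_2 y\kappa_{sc}(A,A')$ for all $A'\in\mathcal{A}$. A local $\rho$-approximation algorithm, given $x\in\mathcal{P}$, returns $\tilde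 x\in X$ and (implicitly) integral recourse actions for every scenario $A$ such that $c^\top\tilde x\le\rho c^\top x$ and the cost of the recourse actions for $A$ is at most $\rho\, g(x,A)$ for every $A\in\mathcal{A}$.
   Formalization: Time is bit complexity: the input numbers (c, p̂, r, κ_max, λ, R, V) and the values of g, κ_sc and subgradients at rational points are rational; κ_sc is assumed exactly computable in polynomial time and scenarios to have polynomial-size encodings, else f̃ = h (β₁=β₂=1) may not be computable. *)

theory Defs
  imports
    Complex_Main
    "HOL-Library.Log_Nat"
    "HOL-Computational_Algebra.Polynomial"
    "Jordan_Normal_Form.Matrix"
begin

section \<open>Computations and running time\<close>

text \<open>
  A while-language on trees with rational leaves. Each step is charged the bit sizes of the data it
  reads and writes. All primitives are computable by a Turing machine in time polynomial in these
  sizes (and they include list access, branching, unbounded iteration and exact arithmetic), so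
  running times agree with Turing machine times up to a polynomial.
\<close>

datatype val = Atom rat | Node val val

definition int_bits :: "int \<Rightarrow> nat" where
  "int_bits k = nat (bitlen \<bar>k\<bar>)"

fun vsize :: "val \<Rightarrow> nat" where
  "vsize (Atom a) = 1 + int_bits (fst (quotient_of a)) + int_bits (snd (quotient_of a))"
| "vsize (Node u v) = 1 + vsize u + vsize v"

datatype prim = Ident | First | Second | IsAtom | Same | Less | Add | Sub | Mul | Divide | Floor

abbreviation truth :: "bool \<Rightarrow> val" where
  "truth b \<equiv> Atom (if b then 1 else 0)"

text \<open>Primitives return \<open>Atom 0\<close> on arguments of the wrong shape.\<close>

fun apply_prim :: "prim \<Rightarrow> val \<Rightarrow> val" where
  "apply_prim Ident v = v"
| "apply_prim First (Node u v) = u"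
| "apply_prim Second (Node u v) = v"
| "apply_prim IsAtom (Atom a) = truth True"
| "apply_prim Same (Node u v) = truth (u = v)"
| "apply_prim Less (Node (Atom a) (Atom b)) = truth (a < b)"
| "apply_prim Add (Node (Atom a) (Atom b)) = Atom (a + b)"
| "apply_prim Sub (Node (Atom a) (Atom b)) = Atom (a - b)"
| "apply_prim Mul (Node (Atom a) (Atom b)) = Atom (a * b)"
| "apply_prim Divide (Node (Atom a) (Atom b)) = Atom (a / b)"
| "apply_prim Floor (Atom a) = Atom (of_int \<lfloor>a\<rfloor>)"
| "apply_prim _ _ = Atom 0"

datatype prog =
    Prim prim
  | Const val
  | Seq prog prog
  | Fork prog prog
  | Cond prog prog prog
  | While prog prog

text \<open>\<open>runs p v u t\<close>: started on \<open>v\<close>, the program \<open>p\<close> halts with result \<open>u\<close> after time \<open>t\<close>.\<close>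

inductive runs :: "prog \<Rightarrow> val \<Rightarrow> val \<Rightarrow> nat \<Rightarrow> bool" where
  Prim: "runs (Prim f) v (apply_prim f v) (vsize v + vsize (apply_prim f v))"
| Const: "runs (Const k) v k (vsize v + vsize k)"
| Seq: "runs p v u s \<Longrightarrow> runs q u w t \<Longrightarrow> runs (Seq p q) v w (1 + s + t)"
| Fork: "runs p v a s \<Longrightarrow> runs q v b t \<Longrightarrow> runs (Fork p q) v (Node a b) (vsize v + s + t)"
| CondTrue: "runs b v u s \<Longrightarrow> u \<noteq> truth False \<Longrightarrow> runs p v w t
    \<Longrightarrow> runs (Cond b p q) v w (vsize v + s + t)"
| CondFalse: "runs b v (truth False) s \<Longrightarrow> runs q v w t
    \<Longrightarrow> runs (Cond b p q) v w (vsize v + s + t)"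
| WhileFalse: "runs b v (truth False) s \<Longrightarrow> runs (While b p) v v (vsize v + s)"
| WhileTrue: "runs b v u s \<Longrightarrow> u \<noteq> truth False \<Longrightarrow> runs p v v' t \<Longrightarrow> runs (While b p) v' w t'
    \<Longrightarrow> runs (While b p) v w (vsize v + s + t + t')"

lemma runs_deterministic:
  "runs p v u t \<Longrightarrow> runs p v u' t' \<Longrightarrow> u' = u \<and> t' = t"
proof (induction arbitrary: u' t' rule: runs.induct)
  case (Prim f v)
  then show ?case by (auto elim: runs.cases)
next
  case (Const k v)
  then show ?case by (auto elim: runs.cases)
next
  case (Seq p v u s q w t)
  from Seq.prems show ?case by (cases rule: runs.cases) (use Seq.IH in blast)
next
  case (Fork p v a s q b t)
  from Fork.prems show ?case by (cases rule: runs.cases) (use Fork.IH in blast)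
next
  case (CondTrue b v u s p w t q)
  from CondTrue.prems show ?case
    by (cases rule: runs.cases) (use CondTrue.IH CondTrue.hyps in blast)+
next
  case (CondFalse b v s q w t p)
  from CondFalse.prems show ?case
    by (cases rule: runs.cases) (use CondFalse.IH CondFalse.hyps in blast)+
next
  case (WhileFalse b v s p)
  from WhileFalse.prems show ?case
    by (cases rule: runs.cases) (use WhileFalse.IH WhileFalse.hyps in blast)+
next
  case (WhileTrue b v u s p v' t w t')
  from WhileTrue.prems show ?case
    by (cases rule: runs.cases) (use WhileTrue.IH WhileTrue.hyps in blast)+
qed

text \<open>
  \<open>p\<close> solves, in time polynomial in the size of its input, the task given by the set \<open>D\<close> of
  admissible inputs, their encoding \<open>enc\<close>, and the relation \<open>S\<close> between inputs and correct outputs.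
\<close>

definition polytime_solves :: "prog \<Rightarrow> 'i set \<Rightarrow> ('i \<Rightarrow> val) \<Rightarrow> ('i \<Rightarrow> val \<Rightarrow> bool) \<Rightarrow> bool" where
  "polytime_solves p D enc S \<longleftrightarrow>
     (\<exists>q :: nat poly. \<forall>i\<in>D. \<exists>u t. runs p (enc i) u t \<and> t \<le> poly q (vsize (enc i)) \<and> S i u)"

fun enc_list :: "val list \<Rightarrow> val" where
  "enc_list [] = Atom 0"
| "enc_list (v # vs) = Node v (enc_list vs)"

definition enc_vec :: "rat vec \<Rightarrow> val" where
  "enc_vec x = enc_list (map Atom (list_of_vec x))"

abbreviation real_vec :: "rat vec \<Rightarrow> real vec" where
  "real_vec \<equiv> map_vec real_of_rat"


section \<open>Geometry in a dimension that depends on the instance\<close>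

definition vnorm :: "real vec \<Rightarrow> real" where
  "vnorm x = sqrt (x \<bullet> x)"

definition convex_hull_vec :: "nat \<Rightarrow> real vec set \<Rightarrow> real vec set" where
  "convex_hull_vec m W =
     {x \<in> carrier_vec m. \<exists>u. (\<forall>w\<in>W. 0 \<le> u w) \<and> (\<Sum>w\<in>W. u w) = 1 \<and>
        (\<forall>i<m. x $ i = (\<Sum>w\<in>W. u w * w $ i))}"

definition polytope_vec :: "nat \<Rightarrow> real vec set \<Rightarrow> bool" where
  "polytope_vec m P \<longleftrightarrow> (\<exists>W. finite W \<and> W \<subseteq> carrier_vec m \<and> P = convex_hull_vec m W)"

definition convex_fun_on :: "real vec set \<Rightarrow> (real vec \<Rightarrow> real) \<Rightarrow> bool" where
  "convex_fun_on P f \<longleftrightarrow>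
     (\<forall>x\<in>P. \<forall>y\<in>P. \<forall>u. 0 \<le> u \<and> u \<le> 1 \<longrightarrow>
        f (u \<cdot>\<^sub>v x + (1 - u) \<cdot>\<^sub>v y) \<le> u * f x + (1 - u) * f y)"

definition subgradient_at :: "real vec set \<Rightarrow> (real vec \<Rightarrow> real) \<Rightarrow> real vec \<Rightarrow> real vec \<Rightarrow> bool" where
  "subgradient_at P f x d \<longleftrightarrow> (\<forall>x'\<in>P. f x' - f x \<ge> d \<bullet> (x' - x))"


section \<open>Distributionally robust 2-stage problems\<close>

text \<open>
  The fields up to \<open>descr\<close> are the input that algorithms get to see; \<open>descr\<close> stands for whatever
  further description of the instance (of the polytope, the scenarios, the costs and the metric) the
  algorithms at hand work with. The remaining fields are the mathematical objects so described.
  Scenarios are identified with their encodings. \<open>actions I x A\<close> are the fractional recourse actions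
  that are feasible for scenario \<open>A\<close> after the first-stage decision \<open>x\<close>.
\<close>

record 'z dr_instance =
  first_cost :: "rat vec"
  central :: "(val \<times> rat) list"
  radius :: rat
  kappa_max :: rat
  inflation :: rat
  outer_radius :: rat
  inner_radius :: rat
  descr :: val
  feasible :: "real vec set"
  scenarios :: "val set"
  kappa :: "val \<Rightarrow> val \<Rightarrow> real"
  actions :: "real vec \<Rightarrow> val \<Rightarrow> 'z set"
  integral_actions :: "real vec \<Rightarrow> val \<Rightarrow> 'z set"
  action_cost :: "val \<Rightarrow> 'z \<Rightarrow> real"

definition encode :: "'z dr_instance \<Rightarrow> val" where
  "encode I = enc_list
     [enc_vec (first_cost I), enc_list (map (\<lambda>(A, p). Node A (Atom p)) (central I)),
      Atom (radius I), Atom (kappa_max I), Atom (inflation I),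
      Atom (outer_radius I), Atom (inner_radius I), descr I]"

definition input_size :: "'z dr_instance \<Rightarrow> nat" where
  "input_size I = vsize (encode I)"

abbreviation dimension :: "'z dr_instance \<Rightarrow> nat" where
  "dimension I \<equiv> dim_vec (first_cost I)"

abbreviation cvec :: "'z dr_instance \<Rightarrow> real vec" where
  "cvec I \<equiv> real_vec (first_cost I)"

definition int_feasible :: "'z dr_instance \<Rightarrow> real vec set" where
  "int_feasible I = {x \<in> feasible I. \<forall>i<dimension I. x $ i \<in> \<int>}"

definition support :: "'z dr_instance \<Rightarrow> val set" where
  "support I = fst ` set (central I)"

definition phat :: "'z dr_instance \<Rightarrow> val \<Rightarrow> real" where
  "phat I A = (case map_of (central I) A of None \<Rightarrow> 0 | Some p \<Rightarrow> real_of_rat p)"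

text \<open>The optimal fractional second-stage cost; the infimum is assumed to be attained below.\<close>

definition gcost :: "'z dr_instance \<Rightarrow> real vec \<Rightarrow> val \<Rightarrow> real" where
  "gcost I x A = (INF a\<in>actions I x A. action_cost I A a)"

definition null_scenario :: "'z dr_instance \<Rightarrow> val \<Rightarrow> bool" where
  "null_scenario I A \<longleftrightarrow> (\<forall>x\<in>feasible I. gcost I x A = gcost I (0\<^sub>v (dimension I)) A)"

definition plans :: "'z dr_instance \<Rightarrow> (val \<Rightarrow> val \<Rightarrow> real) set" where
  "plans I = {\<gamma>.
     (\<forall>A\<in>support I. \<forall>A'\<in>scenarios I. 0 \<le> \<gamma> A A') \<and>
     (\<forall>A\<in>support I. (\<Sum>A'\<in>scenarios I. \<gamma> A A') \<le> phat I A) \<and>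
     (\<Sum>A\<in>support I. \<Sum>A'\<in>scenarios I. kappa I A A' * \<gamma> A A') \<le> real_of_rat (radius I)}"

text \<open>The supremum is a maximum: the objective of a linear program with compact feasible region.\<close>

definition z_central :: "'z dr_instance \<Rightarrow> real vec \<Rightarrow> real" where
  "z_central I x = (SUP \<gamma>\<in>plans I. \<Sum>A\<in>support I. \<Sum>A'\<in>scenarios I. \<gamma> A A' * gcost I x A')"

definition h_central :: "'z dr_instance \<Rightarrow> real vec \<Rightarrow> real" where
  "h_central I x = cvec I \<bullet> x + z_central I x"


subsection \<open>Standing assumptions\<close>

definition well_formed :: "'z dr_instance \<Rightarrow> bool" where
  "well_formed I \<longleftrightarrow>
     finite (scenarios I) \<and>
     polytope_vec (dimension I) (feasible I) \<and>
     (\<forall>x\<in>feasible I. 0\<^sub>v (dimension I) \<le> x) \<and>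
     (\<forall>x\<in>feasible I. \<forall>A\<in>scenarios I.
        integral_actions I x A \<subseteq> actions I x A \<and>
        (\<exists>a\<in>actions I x A. \<forall>b\<in>actions I x A. action_cost I A a \<le> action_cost I A b)) \<and>
     (\<forall>A\<in>scenarios I. \<forall>A'\<in>scenarios I.
        0 \<le> kappa I A A' \<and> kappa I A A' \<le> real_of_rat (kappa_max I)) \<and>
     (\<forall>A\<in>scenarios I. kappa I A A = 0) \<and>
     0 < radius I \<and>
     distinct (map fst (central I)) \<and>
     support I \<subseteq> scenarios I \<and>
     (\<forall>A\<in>support I. 0 < phat I A) \<and>
     (\<Sum>A\<in>support I. phat I A) = 1"

definition P1 :: "'z dr_instance \<Rightarrow> bool" where
  "P1 I \<longleftrightarrow>
     0\<^sub>v (dimension I) \<in> int_feasible I \<and>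
     0\<^sub>v (dimension I) \<le> first_cost I \<and>
     (\<forall>x\<in>feasible I. \<forall>A\<in>scenarios I. 0 \<le> gcost I x A \<and> gcost I x A \<le> gcost I (0\<^sub>v (dimension I)) A)"

definition P2 :: "'z dr_instance \<Rightarrow> bool" where
  "P2 I \<longleftrightarrow>
     1 \<le> inflation I \<and>
     (\<forall>x\<in>feasible I. \<forall>A\<in>scenarios I.
        gcost I (0\<^sub>v (dimension I)) A \<le> gcost I x A + real_of_rat (inflation I) * (cvec I \<bullet> x))"

definition P3 :: "'z dr_instance \<Rightarrow> bool" where
  "P3 I \<longleftrightarrow>
     0 < inner_radius I \<and> inner_radius I \<le> 1 \<and> 0 < outer_radius I \<and>
     (\<forall>x\<in>feasible I. vnorm x \<le> real_of_rat (outer_radius I)) \<and>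
     (\<exists>s\<in>carrier_vec (dimension I). \<forall>x\<in>carrier_vec (dimension I).
        vnorm (x - s) \<le> real_of_rat (inner_radius I) \<longrightarrow> x \<in> feasible I)"

definition P4 :: "'z dr_instance \<Rightarrow> bool" where
  "P4 I \<longleftrightarrow> (\<forall>A\<in>scenarios I. convex_fun_on (feasible I) (\<lambda>x. gcost I x A))"

definition nonnull_cost_ge_1 :: "'z dr_instance \<Rightarrow> bool" where
  "nonnull_cost_ge_1 I \<longleftrightarrow>
     (\<forall>A\<in>scenarios I. \<not> null_scenario I A \<longrightarrow> (\<forall>x\<in>feasible I. 1 \<le> cvec I \<bullet> x + gcost I x A))"

definition poly_bounded :: "'z dr_instance set \<Rightarrow> ('z dr_instance \<Rightarrow> real) \<Rightarrow> bool" where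
  "poly_bounded J f \<longleftrightarrow> (\<exists>q :: nat poly. \<forall>I\<in>J. f I \<le> real (poly q (input_size I)))"

definition g_algorithm :: "'z dr_instance set \<Rightarrow> prog \<Rightarrow> bool" where
  "g_algorithm J p \<longleftrightarrow> polytime_solves p
     {(I, x, A). I \<in> J \<and> real_vec x \<in> feasible I \<and> A \<in> scenarios I}
     (\<lambda>(I, x, A). enc_list [encode I, enc_vec x, A])
     (\<lambda>(I, x, A) u. \<exists>v. u = Atom v \<and> real_of_rat v = gcost I (real_vec x) A)"

definition subgradient_algorithm ::
  "'z dr_instance set \<Rightarrow> ('z dr_instance \<Rightarrow> real) \<Rightarrow> prog \<Rightarrow> bool" where
  "subgradient_algorithm J K p \<longleftrightarrow> polytime_solves p
     {(I, x, A). I \<in> J \<and> real_vec x \<in> feasible I \<and> A \<in> scenarios I}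
     (\<lambda>(I, x, A). enc_list [encode I, enc_vec x, A])
     (\<lambda>(I, x, A) u. \<exists>d\<in>carrier_vec (dimension I). u = enc_vec d \<and>
        subgradient_at (feasible I) (\<lambda>x. gcost I x A) (real_vec x) (real_vec d) \<and>
        vnorm (real_vec d) \<le> K I)"

definition kappa_algorithm :: "'z dr_instance set \<Rightarrow> prog \<Rightarrow> bool" where
  "kappa_algorithm J p \<longleftrightarrow> polytime_solves p
     {(I, A, A'). I \<in> J \<and> A \<in> scenarios I \<and> A' \<in> scenarios I}
     (\<lambda>(I, A, A'). enc_list [encode I, A, A'])
     (\<lambda>(I, A, A') u. \<exists>v. u = Atom v \<and> real_of_rat v = kappa I A A')"

text \<open>
  Assumptions on a class \<open>J\<close> of instances; being polynomial in the input size is a property of the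
  class, not of a single instance. Scenarios have encodings of polynomial size, though there may be
  exponentially many of them.
\<close>

definition dr_problem :: "'z dr_instance set \<Rightarrow> ('z dr_instance \<Rightarrow> real) \<Rightarrow> bool" where
  "dr_problem J K \<longleftrightarrow>
     (\<forall>I\<in>J. well_formed I \<and> P1 I \<and> P2 I \<and> P3 I \<and> P4 I \<and> nonnull_cost_ge_1 I \<and> 0 < K I) \<and>
     (\<exists>q :: nat poly. \<forall>I\<in>J. \<forall>A\<in>scenarios I. vsize A \<le> poly q (input_size I)) \<and>
     poly_bounded J (\<lambda>I. ln (real (card (int_feasible I)))) \<and>
     poly_bounded J (\<lambda>I. ln (real_of_rat (outer_radius I) / real_of_rat (inner_radius I))) \<and>
     poly_bounded J (\<lambda>I. ln (K I)) \<and>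
     (\<exists>p. g_algorithm J p) \<and>
     (\<exists>p. subgradient_algorithm J K p) \<and>
     (\<exists>p. kappa_algorithm J p)"


subsection \<open>Algorithms assumed by the theorem\<close>

text \<open>The answer \<open>Atom 1\<close> certifies membership; it is not the encoding of a vector.\<close>

definition separation_oracle :: "'z dr_instance set \<Rightarrow> prog \<Rightarrow> bool" where
  "separation_oracle J p \<longleftrightarrow> polytime_solves p
     {(I, x). I \<in> J \<and> x \<in> carrier_vec (dimension I)}
     (\<lambda>(I, x). enc_list [encode I, enc_vec x])
     (\<lambda>(I, x) u. if real_vec x \<in> feasible I then u = Atom 1
        else \<exists>d\<in>carrier_vec (dimension I). u = enc_vec d \<and>
          (\<forall>x'\<in>feasible I. real_vec d \<bullet> x' < real_vec d \<bullet> real_vec x))"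

text \<open>The integral recourse actions are returned implicitly: only their existence is required.\<close>

definition local_approximation ::
  "'z dr_instance set \<Rightarrow> ('z dr_instance \<Rightarrow> real) \<Rightarrow> prog \<Rightarrow> bool" where
  "local_approximation J \<rho> p \<longleftrightarrow> polytime_solves p
     {(I, x). I \<in> J \<and> real_vec x \<in> feasible I}
     (\<lambda>(I, x). enc_list [encode I, enc_vec x])
     (\<lambda>(I, x) u. \<exists>x'. u = enc_vec x' \<and> real_vec x' \<in> int_feasible I \<and>
        cvec I \<bullet> real_vec x' \<le> \<rho> I * (cvec I \<bullet> real_vec x) \<and>
        (\<forall>A\<in>scenarios I. \<exists>a\<in>integral_actions I (real_vec x') A.
           action_cost I A a \<le> \<rho> I * gcost I (real_vec x) A))"

text \<open>
  \<open>(\<beta>\<^sub>1, \<beta>\<^sub>2)\<close>-approximation of \<open>g(x, y, A)\<close>, the maximum of \<open>g(x, A') - y \<kappa>(A, A')\<close> over all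
  scenarios \<open>A'\<close>, at integral \<open>x\<close> only.
\<close>

definition penalized_approximation ::
  "'z dr_instance set \<Rightarrow> ('z dr_instance \<Rightarrow> real) \<Rightarrow> ('z dr_instance \<Rightarrow> real) \<Rightarrow> prog \<Rightarrow> bool" where
  "penalized_approximation J \<beta>\<^sub>1 \<beta>\<^sub>2 p \<longleftrightarrow>
     (\<forall>I\<in>J. 1 \<le> \<beta>\<^sub>1 I \<and> 1 \<le> \<beta>\<^sub>2 I) \<and>
     polytime_solves p
     {(I, x, y, A). I \<in> J \<and> real_vec x \<in> int_feasible I \<and> 0 \<le> y \<and> A \<in> scenarios I}
     (\<lambda>(I, x, y, A). enc_list [encode I, enc_vec x, Atom y, A])
     (\<lambda>(I, x, y, A) B. B \<in> scenarios I \<and>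
        (\<forall>A'\<in>scenarios I.
           gcost I (real_vec x) B - real_of_rat y * kappa I A B
             \<ge> gcost I (real_vec x) A' / \<beta>\<^sub>1 I - \<beta>\<^sub>2 I * real_of_rat y * kappa I A A'))"

end

theory Submission
  imports Defs "Jordan_Normal_Form.Determinant"
begin

text \<open>
  The first-stage problem is solved by cutting planes. For \<open>x \<in> X\<close>, a transport plan \<open>\<gamma>\<close> of small
  support with \<open>z(x) \<le> \<beta>\<^sub>1 \<beta>\<^sub>2 \<Sum> \<gamma> g(x, \<cdot>)\<close> can be computed. As every plan gives a convex lower bound
  \<open>h\<^sub>\<gamma>(x') = c x' + \<Sum> \<gamma> g(x', \<cdot>)\<close> of \<open>h\<close>, one may round the current fractional point \<open>x\<close> to
  \<open>x\<^sub>1 \<in> X\<close>, take a plan \<open>\<gamma>\<close> for \<open>x\<^sub>1\<close>, and cut with a subgradient of \<open>h\<^sub>\<gamma>\<close> at \<open>x\<close>: points \<open>x'\<close> that are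
  cut off have \<open>h(x') \<ge> h\<^sub>\<gamma>(x') \<ge> h\<^sub>\<gamma>(x) \<ge> h\<^sub>\<gamma>(x\<^sub>1) / \<rho>\<close>, and \<open>h\<^sub>\<gamma>(x\<^sub>1)\<close> is the value reported for \<open>x\<^sub>1\<close>.

  Cutting uses simplices instead of ellipsoids (Yamnitsky and Levin), which needs no square roots. If a
  simplex is cut through its centroid, moving one facet yields a simplex that contains the remaining
  part and is smaller by a factor of \<open>1 - 1 / poly(m)\<close>. All rounding happens in barycentric coordinates,
  so each step multiplies the common denominator of the vertices by a factor of bounded size.
  Volumes are determinants: a simplex containing the corners of a small simplex has a determinant that is
  bounded below. The small simplex is a copy of the inner ball scaled towards an optimal solution; the
  lower bound \<open>r / (r + \<kappa>\<^sub>m\<^sub>a\<^sub>x)\<close> on the optimum, valid if some scenario is not null, makes the additive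
  error relative. If all scenarios are null, then \<open>x = 0\<close> is optimal.

  The plan for \<open>x\<close> comes from a line search in the dual variable \<open>y\<close> of the transport budget. The answers of
  the approximation algorithm at \<open>y\<close> form a plan with gain \<open>G\<close> and transport cost \<open>C\<close>, and the line
  \<open>t \<mapsto> G + t (r - C)\<close> has value at least \<open>z(x) / (\<beta>\<^sub>1 \<beta>\<^sub>2)\<close> at \<open>t = y\<close>. Mixing a plan with \<open>C > r\<close> and one
  with \<open>C \<le> r\<close> so that the cost is \<open>r\<close> yields the value at the crossing of their lines. Bisection brackets the
  crossing; since crossings have bounded bit size, two different ones cannot both lie in a short
  bracket, and this makes the result exact.
\<close>

section \<open>Bit sizes of rational numbers\<close>

text \<open>Two requirements shape the construction. What survives is a dichotomy for a fixed tiny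
  simplex near an optimum: a cut either spares all its corners or certifies the decision from which
  the cut was built. Moreover, the factor between the reported number and the cost of the reported
  decision leaves no room for a further error term, so the plan for a fixed decision must reach its
  dual bound exactly, not up to the width of a bracket. As time is measured in bits, each loop needs
  a size bound for its states that comes from an invariant: composing the size bounds of single
  operations may double the estimate in every round. The accuracy enters only as the integer above 1
  / \<epsilon>. That \<rho> is at least 1 is not among the assumptions; it is derived when the
  optimum is positive.\<close>

lemma int_bits_le_iff: "int_bits k \<le> n \<longleftrightarrow> \<bar>k\<bar> < 2 ^ n"
proof -
  have "int_bits k \<le> n \<longleftrightarrow> bitlen \<bar>k\<bar> \<le> int n"
    unfolding int_bits_def by (simp add: nat_le_iff)
  also have "\<dots> \<longleftrightarrow> \<bar>k\<bar> < 2 ^ n"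
    by (simp add: bitlen_le_iff_power)
  finally show ?thesis .
qed

text \<open>Some fraction for \<open>a\<close> is small; it need not be in lowest terms. Arithmetic
  can then be bounded without tracking common divisors, whereas \<open>vsize\<close> refers to the
  reduced fraction.\<close>

definition rat_bits :: "nat \<Rightarrow> rat \<Rightarrow> bool" where
  "rat_bits n a \<longleftrightarrow>
     (\<exists>x y :: int. a = of_int x / of_int y \<and> \<bar>x\<bar> < 2 ^ n \<and> 0 < y \<and> y < 2 ^ n)"

lemma rat_bitsI:
  "a = of_int x / of_int y \<Longrightarrow> \<bar>x\<bar> < 2 ^ n \<Longrightarrow> 0 < y \<Longrightarrow> y < 2 ^ n \<Longrightarrow> rat_bits n a"
  unfolding rat_bits_def by blast

text \<open>Cancelling the gcd enlarges neither numerator nor denominator, so any small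
  representation bounds the reduced one that \<open>vsize\<close> measures.\<close>

lemma quotient_of_bounds:
  assumes "a = of_int x / of_int y" "0 < y"
  shows "\<bar>fst (quotient_of a)\<bar> \<le> \<bar>x\<bar>" "snd (quotient_of a) \<le> y"
proof -
  have a: "a = Rat.Fract x y" using assms by (simp add: Fract_of_int_quotient)
  have q: "quotient_of a = (x div gcd x y, y div gcd x y)"
    using assms(2) by (simp add: a quotient_of_Fract normalize_def Let_def)
  have g: "gcd x y > 0" using assms(2) by simp
  obtain k where k: "x = gcd x y * k" by (meson dvdE gcd_dvd1)
  have "\<bar>x div gcd x y\<bar> \<le> \<bar>x\<bar>"
  proof -
    have "x div gcd x y = k" using k g by (metis less_irrefl nonzero_mult_div_cancel_left)
    moreover have "\<bar>x\<bar> = gcd x y * \<bar>k\<bar>" using k g by (metis abs_mult abs_of_pos)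
    moreover have "1 * \<bar>k\<bar> \<le> gcd x y * \<bar>k\<bar>" using g by (intro mult_right_mono) linarith+
    ultimately show ?thesis by simp
  qed
  then show "\<bar>fst (quotient_of a)\<bar> \<le> \<bar>x\<bar>" by (simp add: q)
  have "y div gcd x y \<le> y" using zdiv_mono2[of y 1 "gcd x y"] assms(2) g by simp
  then show "snd (quotient_of a) \<le> y" by (simp add: q)
qed

lemma vsize_le_of_rat_bits: "rat_bits n a \<Longrightarrow> vsize (Atom a) \<le> 1 + 2 * n"
proof -
  assume "rat_bits n a"
  then obtain x y where h: "a = of_int x / of_int y" "\<bar>x\<bar> < 2 ^ n" "0 < y" "y < 2 ^ n"
    unfolding rat_bits_def by blast
  have "int_bits (fst (quotient_of a)) \<le> n" "int_bits (snd (quotient_of a)) \<le> n"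
    unfolding int_bits_le_iff
    using quotient_of_bounds[OF h(1,3)] quotient_of_denom_pos'[of a] h by auto
  then show ?thesis by simp
qed

lemma rat_bits_vsize: "rat_bits (vsize (Atom a)) a"
proof -
  let ?n = "vsize (Atom a)"
  have "a = Rat.Fract (fst (quotient_of a)) (snd (quotient_of a))" by simp
  then have "a = of_int (fst (quotient_of a)) / of_int (snd (quotient_of a))"
    by (metis Fract_of_int_quotient)
  moreover have "\<bar>fst (quotient_of a)\<bar> < 2 ^ ?n" "\<bar>snd (quotient_of a)\<bar> < 2 ^ ?n"
    unfolding int_bits_le_iff[symmetric] by auto
  moreover have "0 < snd (quotient_of a)" by (rule quotient_of_denom_pos')
  ultimately show ?thesis by (metis rat_bitsI abs_of_pos)
qed

lemma rat_bits_mono: "rat_bits n a \<Longrightarrow> n \<le> k \<Longrightarrow> rat_bits k a"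
proof -
  assume "rat_bits n a" "n \<le> k"
  moreover have "(2::int) ^ n \<le> 2 ^ k" using \<open>n \<le> k\<close> by (intro power_increasing) auto
  ultimately show ?thesis unfolding rat_bits_def using order_less_le_trans by blast
qed

lemma rat_bits_of_vsize_le: "vsize (Atom a) \<le> n \<Longrightarrow> rat_bits n a"
  using rat_bits_mono rat_bits_vsize by blast

lemma rat_bits_pos: "rat_bits n a \<Longrightarrow> n \<ge> 1"
  unfolding rat_bits_def by (cases n) auto

lemma abs_less_of_rat_bits: assumes "rat_bits n a" shows "\<bar>a\<bar> < 2 ^ n"
proof -
  obtain x y where h: "a = of_int x / of_int y" "\<bar>x\<bar> < 2 ^ n" "0 < y" "y < 2 ^ n"
    using assms unfolding rat_bits_def by blast
  have "\<bar>a\<bar> = of_int \<bar>x\<bar> / of_int y" using h by (simp add: abs_divide)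
  also have "\<dots> \<le> of_int \<bar>x\<bar> / 1" using h by (intro divide_left_mono) auto
  also have "\<dots> < of_int (2 ^ n)" using h(2) by (simp only: div_by_1 of_int_less_iff)
  finally show ?thesis by simp
qed

text \<open>The difference is a nonzero integer divided by the product of the two denominators. This
  gap forces the line search to stop.\<close>

lemma rat_bits_separation:
  assumes "rat_bits n a" "rat_bits k b" "a \<noteq> b"
  shows "1 < 2 ^ (n + k) * \<bar>a - b\<bar>"
proof -
  obtain x y where h: "a = of_int x / of_int y" "0 < y" "y < 2 ^ n"
    using assms(1) unfolding rat_bits_def by blast
  obtain x' y' where h': "b = of_int x' / of_int y'" "0 < y'" "y' < 2 ^ k"
    using assms(2) unfolding rat_bits_def by blast
  have e: "(a - b) * of_int (y * y') = of_int (x * y' - x' * y)" using h h' by (simp add: field_simps)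
  have "x * y' - x' * y \<noteq> 0"
  proof
    assume "x * y' - x' * y = 0"
    then have "(a - b) * of_int (y * y') = 0" using e by simp
    then show False using h h' assms(3) by auto
  qed
  then have "1 \<le> \<bar>x * y' - x' * y\<bar>" by linarith
  then have "1 \<le> \<bar>(a - b) * of_int (y * y')\<bar>"
    unfolding e by (metis of_int_1_le_iff of_int_abs)
  also have "\<dots> = \<bar>a - b\<bar> * of_int (y * y')" using h h' by (simp add: abs_mult)
  also have "\<dots> < \<bar>a - b\<bar> * 2 ^ (n + k)"
  proof (rule mult_strict_left_mono)
    have "y * y' < 2 ^ n * 2 ^ k" using h h' by (intro mult_strict_mono) auto
    then have "y * y' < 2 ^ (n + k)" by (simp add: power_add)
    then show "(of_int (y * y') :: rat) < 2 ^ (n + k)" by (metis of_int_less_numeral_power_cancel_iff)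
    show "0 < \<bar>a - b\<bar>" using assms(3) by simp
  qed
  finally show ?thesis by (simp add: mult.commute)
qed

lemma rat_bits_of_int: "\<bar>z\<bar> < 2 ^ n \<Longrightarrow> n \<ge> 1 \<Longrightarrow> rat_bits n (of_int z)"
  by (rule rat_bitsI[where x = z and y = 1]) (auto intro: one_less_power)

lemma rat_bits_uminus: "rat_bits n a \<Longrightarrow> rat_bits n (- a)"
  unfolding rat_bits_def by (metis abs_minus_cancel minus_divide_left of_int_minus)

lemma rat_bits_add:
  assumes "rat_bits n a" "rat_bits k b" shows "rat_bits (n + k + 1) (a + b)"
proof -
  obtain x y where h: "a = of_int x / of_int y" "\<bar>x\<bar> < 2 ^ n" "0 < y" "y < 2 ^ n"
    using assms(1) unfolding rat_bits_def by blast
  obtain x' y' where h': "b = of_int x' / of_int y'" "\<bar>x'\<bar> < 2 ^ k" "0 < y'" "y' < 2 ^ k"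
    using assms(2) unfolding rat_bits_def by blast
  have 1: "\<bar>x\<bar> * y' < 2 ^ n * 2 ^ k" "\<bar>x'\<bar> * y < 2 ^ k * 2 ^ n" "y * y' < 2 ^ n * 2 ^ k"
    using h h' by (auto intro: mult_strict_mono)
  have "\<bar>x * y' + x' * y\<bar> \<le> \<bar>x\<bar> * y' + \<bar>x'\<bar> * y"
    using abs_triangle_ineq[of "x * y'" "x' * y"] h h' by (simp add: abs_mult)
  also have "\<dots> < 2 ^ n * 2 ^ k + 2 ^ k * 2 ^ n" using 1 by linarith
  also have "\<dots> = 2 ^ (n + k + 1)" by (simp add: power_add)
  finally have 2: "\<bar>x * y' + x' * y\<bar> < 2 ^ (n + k + 1)" .
  show ?thesis
  proof (rule rat_bitsI)
    show "a + b = of_int (x * y' + x' * y) / of_int (y * y')" using h h' by (simp add: add_frac_eq)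
    show "y * y' < 2 ^ (n + k + 1)" using 1(3) by (simp add: power_add) (smt (verit) h h' mult_pos_pos)
  qed (use 2 h h' in auto)
qed

lemma rat_bits_diff: "rat_bits n a \<Longrightarrow> rat_bits k b \<Longrightarrow> rat_bits (n + k + 1) (a - b)"
  using rat_bits_add[OF _ rat_bits_uminus] by fastforce

lemma rat_bits_mult:
  assumes "rat_bits n a" "rat_bits k b" shows "rat_bits (n + k) (a * b)"
proof -
  obtain x y where h: "a = of_int x / of_int y" "\<bar>x\<bar> < 2 ^ n" "0 < y" "y < 2 ^ n"
    using assms(1) unfolding rat_bits_def by blast
  obtain x' y' where h': "b = of_int x' / of_int y'" "\<bar>x'\<bar> < 2 ^ k" "0 < y'" "y' < 2 ^ k"
    using assms(2) unfolding rat_bits_def by blast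
  have 1: "\<bar>x\<bar> * \<bar>x'\<bar> < 2 ^ n * 2 ^ k" "y * y' < 2 ^ n * 2 ^ k"
    using h h' by (auto intro: mult_strict_mono)
  show ?thesis
    by (rule rat_bitsI[where x = "x * x'" and y = "y * y'"]) (use 1 h h' in \<open>auto simp: power_add abs_mult\<close>)
qed

lemma rat_bits_inverse: assumes "rat_bits n a" shows "rat_bits n (inverse a)"
proof -
  obtain x y where h: "a = of_int x / of_int y" "\<bar>x\<bar> < 2 ^ n" "0 < y" "y < 2 ^ n"
    using assms unfolding rat_bits_def by blast
  have n: "n \<ge> 1" using assms by (rule rat_bits_pos)
  consider "x = 0" | "x > 0" | "x < 0" by linarith
  then show ?thesis
  proof cases
    case 1
    then have "inverse a = of_int 0" using h by simp
    then show ?thesis using rat_bits_of_int[of 0 n] n by simp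
  next
    case 2
    then show ?thesis by (intro rat_bitsI[where x = y and y = x]) (use h in auto)
  next
    case 3
    then show ?thesis by (intro rat_bitsI[where x = "- y" and y = "- x"]) (use h in auto)
  qed
qed

lemma rat_bits_divide: "rat_bits n a \<Longrightarrow> rat_bits k b \<Longrightarrow> rat_bits (n + k) (a / b)"
  using rat_bits_mult[OF _ rat_bits_inverse] by (simp add: divide_inverse)

lemma rat_bits_floor: assumes "rat_bits n a" shows "rat_bits n (of_int \<lfloor>a\<rfloor>)"
proof -
  obtain x y where h: "a = of_int x / of_int y" "\<bar>x\<bar> < 2 ^ n" "0 < y" "y < 2 ^ n"
    using assms unfolding rat_bits_def by blast
  have "\<bar>x div y\<bar> \<le> \<bar>x\<bar>"
  proof (cases "x \<ge> 0")
    case True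
    then show ?thesis using zdiv_mono2[of x 1 y] h(3) by (simp add: pos_imp_zdiv_nonneg_iff)
  next
    \<comment> \<open>For a negative numerator the floor rounds away from zero, but dividing by
      \<open>y\<close> at least 1 cannot go below dividing by 1.\<close>
    case False
    then have "x div y \<le> 0" using h(3) by (simp add: div_nonpos_pos_le0)
    moreover have "x div 1 \<le> x div y" using False h(3) by (intro zdiv_mono2_neg) auto
    ultimately show ?thesis by simp
  qed
  then show ?thesis using h rat_bits_pos[OF assms]
    by (intro rat_bits_of_int) (auto simp: floor_divide_of_int_eq)
qed

lemma rat_bits_sum_list:
  "(\<And>a. a \<in> set as \<Longrightarrow> rat_bits n a) \<Longrightarrow> rat_bits (length as * (n + 1) + 1) (sum_list as)"
proof (induction as)
  case Nil
  then show ?case using rat_bits_of_int[of 0 1] by simp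
next
  case (Cons a as)
  have "rat_bits (n + (length as * (n + 1) + 1) + 1) (a + sum_list as)"
    using Cons by (intro rat_bits_add) auto
  then have "rat_bits (length (a # as) * (n + 1) + 1) (a + sum_list as)" by (rule rat_bits_mono) simp
  then show ?case by simp
qed

text \<open>Magnitude and denominator are controlled separately. In iterations this replaces the
  arithmetic rules, which add up the sizes of all operands and would yield exponential
  bounds.\<close>

lemma rat_bits_of_denominator:
  assumes "a * of_int y = of_int x" "0 < y" "\<bar>a\<bar> \<le> 2 ^ n" "y < 2 ^ k"
  shows "rat_bits (n + k) a"
proof (rule rat_bitsI)
  show "a = of_int x / of_int y" using assms by (simp add: field_simps)
  have "of_int \<bar>x\<bar> = \<bar>a\<bar> * of_int y" using assms(1,2) by (simp add: abs_mult flip: assms(1))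
  also have "\<dots> \<le> 2 ^ n * of_int y" using assms by (intro mult_right_mono) auto
  also have "\<dots> < 2 ^ n * 2 ^ k"
    using assms by (intro mult_strict_left_mono) (auto simp: of_int_less_numeral_power_cancel_iff)
  finally show "\<bar>x\<bar> < 2 ^ (n + k)"
    by (metis of_int_less_numeral_power_cancel_iff power_add)
  have "(2::int) ^ k \<le> 2 ^ (n + k)" by (intro power_increasing) auto
  then show "y < 2 ^ (n + k)" using assms by linarith
qed (use assms in auto)

section \<open>Sizes of encoded values\<close>

lemma vsize_pos: "1 \<le> vsize v"
  by (cases v) auto

lemma vsize_enc_list: "vsize (enc_list vs) = 2 + (\<Sum>v\<leftarrow>vs. 1 + vsize v)"
  by (induction vs) (auto simp: int_bits_def bitlen_def floorlog_def)

lemma length_le_vsize: "length vs \<le> vsize (enc_list vs)"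
proof -
  have "length vs \<le> (\<Sum>v\<leftarrow>vs. 1 + vsize v)" by (induction vs) auto
  then show ?thesis by (simp add: vsize_enc_list)
qed

lemma vsize_mem_enc_list: "v \<in> set vs \<Longrightarrow> vsize v \<le> vsize (enc_list vs)"
proof -
  assume "v \<in> set vs"
  then have "1 + vsize v \<le> (\<Sum>v\<leftarrow>vs. 1 + vsize v)" by (induction vs) auto
  then show ?thesis by (simp add: vsize_enc_list)
qed

lemma vsize_enc_list_le:
  "(\<And>v. v \<in> set vs \<Longrightarrow> vsize v \<le> b) \<Longrightarrow> vsize (enc_list vs) \<le> 2 + length vs * (1 + b)"
proof -
  assume "\<And>v. v \<in> set vs \<Longrightarrow> vsize v \<le> b"
  then have "(\<Sum>v\<leftarrow>vs. 1 + vsize v) \<le> length vs * (1 + b)"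
  proof (induction vs)
    case (Cons v vs)
    from Cons.IH Cons.prems have "(\<Sum>v\<leftarrow>vs. 1 + vsize v) \<le> length vs * (1 + b)" by simp
    moreover have "vsize v \<le> b" using Cons.prems by simp
    ultimately show ?case by simp
  qed simp
  then show ?thesis by (simp add: vsize_enc_list)
qed

lemma vsize_truth: "vsize (truth b) \<le> 3"
  using vsize_le_of_rat_bits[OF rat_bits_of_int[of 0 1]] vsize_le_of_rat_bits[OF rat_bits_of_int[of 1 1]]
  by (cases b) (simp_all del: vsize.simps)

text \<open>Growth by a constant factor is harmless for a fixed number of primitives but not inside
  a loop, which is why the loop rule asks for its own size bound.\<close>

lemma vsize_apply_prim: "vsize (apply_prim f v) \<le> 4 * vsize v + 4"
proof -
  have z: "vsize (Atom 0) \<le> 3" "vsize (Atom 1) \<le> 3" using vsize_truth[of False] vsize_truth[of True] by auto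
  have at: "rat_bits n a \<Longrightarrow> n \<le> 2 * m + 1 \<Longrightarrow> vsize (Atom a) \<le> 4 * m + 4" for n m :: nat and a
    using vsize_le_of_rat_bits[of n a] by (simp del: vsize.simps)
  show ?thesis
  proof (induction f v rule: apply_prim.induct)
    case (7 a b)
    show ?case unfolding apply_prim.simps
      by (rule at[OF rat_bits_add[OF rat_bits_vsize rat_bits_vsize]]) simp
  next
    case (8 a b)
    show ?case unfolding apply_prim.simps
      by (rule at[OF rat_bits_diff[OF rat_bits_vsize rat_bits_vsize]]) simp
  next
    case (9 a b)
    show ?case unfolding apply_prim.simps
      by (rule at[OF rat_bits_mult[OF rat_bits_vsize rat_bits_vsize]]) simp
  next
    case (10 a b)
    show ?case unfolding apply_prim.simps
      by (rule at[OF rat_bits_divide[OF rat_bits_vsize rat_bits_vsize]]) simp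
  next
    case (11 a)
    show ?case unfolding apply_prim.simps
      by (rule at[OF rat_bits_floor[OF rat_bits_vsize]]) simp
  qed (use z in \<open>auto simp del: vsize.simps(1)\<close>)
qed

text \<open>Writing the result is charged, so a time bound is also a bound on the size of the
  output; this lets polynomial-time functions be composed.\<close>

lemma vsize_le_time: "runs p v u t \<Longrightarrow> vsize u \<le> t"
proof (induction rule: runs.induct)
  case (Fork p v a s q b t)
  then show ?case using vsize_pos[of v] by simp
qed auto

section \<open>Polynomial bounds and polynomial-time computability\<close>

text \<open>Uniformity is the point: one polynomial serves the whole family \<open>D\<close>, with
  \<open>s\<close> in the role of the input size.\<close>

definition pbound :: "'i set \<Rightarrow> ('i \<Rightarrow> nat) \<Rightarrow> ('i \<Rightarrow> nat) \<Rightarrow> bool" where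
  "pbound D s b \<longleftrightarrow> (\<exists>q :: nat poly. \<forall>i\<in>D. b i \<le> poly q (s i))"

text \<open>Natural coefficients are what allows one size bound to be substituted into
  another.\<close>

lemma poly_nat_mono: "x \<le> y \<Longrightarrow> poly (q :: nat poly) x \<le> poly q y"
  by (induction q) (auto intro!: add_mono mult_mono)

lemma pbound_const: "pbound D s (\<lambda>i. c)"
  unfolding pbound_def by (rule exI[of _ "[:c:]"]) simp

lemma pbound_self: "pbound D s s"
  unfolding pbound_def by (rule exI[of _ "[:0, 1:]"]) simp

lemma pbound_add: "pbound D s a \<Longrightarrow> pbound D s b \<Longrightarrow> pbound D s (\<lambda>i. a i + b i)"
  unfolding pbound_def by (metis add_mono poly_add)

lemma pbound_mult: "pbound D s a \<Longrightarrow> pbound D s b \<Longrightarrow> pbound D s (\<lambda>i. a i * b i)"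
  unfolding pbound_def by (metis mult_le_mono poly_mult)

lemma pbound_Suc: "pbound D s a \<Longrightarrow> pbound D s (\<lambda>i. Suc (a i))"
  using pbound_add[OF _ pbound_const[of D s 1]] by simp

lemma pbound_power: "pbound D s a \<Longrightarrow> pbound D s (\<lambda>i. a i ^ n)"
  by (induction n) (auto intro: pbound_const pbound_mult)

lemma pbound_mono: "pbound D s b' \<Longrightarrow> (\<And>i. i \<in> D \<Longrightarrow> b i \<le> b' i) \<Longrightarrow> pbound D s b"
  unfolding pbound_def using order_trans by blast

lemma pbound_comp:
  assumes "pbound E s' b" "\<And>i. i \<in> D \<Longrightarrow> h i \<in> E" "pbound D s (\<lambda>i. s' (h i))"
  shows "pbound D s (\<lambda>i. b (h i))"
proof -
  obtain q q' where q: "\<forall>i\<in>E. b i \<le> poly q (s' i)" and q': "\<forall>i\<in>D. s' (h i) \<le> poly q' (s i)"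
    using assms unfolding pbound_def by blast
  have "b (h i) \<le> poly (pcompose q q') (s i)" if "i \<in> D" for i
  proof -
    have "b (h i) \<le> poly q (s' (h i))" using q assms(2) that by blast
    also have "\<dots> \<le> poly q (poly q' (s i))" using q' that by (intro poly_nat_mono) blast
    finally show ?thesis by (simp add: poly_pcompose)
  qed
  then show ?thesis unfolding pbound_def by blast
qed

lemma pbound_poly: "pbound D s b \<Longrightarrow> pbound D s (\<lambda>i. poly q (b i))"
  using pbound_comp[of UNIV "\<lambda>n. n" "poly q" D b s] unfolding pbound_def by auto

lemma pbound_subset: "pbound E s b \<Longrightarrow> D \<subseteq> E \<Longrightarrow> pbound D s b"
  unfolding pbound_def by blast

lemmas pbound_intros = pbound_const pbound_self pbound_add pbound_mult pbound_Suc pbound_power pbound_poly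

text \<open>Inputs are indexed by \<open>i\<close> and reach the program only through
  \<open>e i\<close>. Programs stay hidden behind the existential, so algorithms are assembled from
  closure properties, and values outside the admissible set \<open>D\<close> do not matter.\<close>

definition ptime :: "'i set \<Rightarrow> ('i \<Rightarrow> val) \<Rightarrow> ('i \<Rightarrow> val) \<Rightarrow> bool" where
  "ptime D e f \<longleftrightarrow>
     (\<exists>p T. (\<forall>i\<in>D. runs p (e i) (f i) (T i)) \<and> pbound D (\<lambda>i. vsize (e i)) T)"

lemma ptimeI:
  "(\<And>i. i \<in> D \<Longrightarrow> runs p (e i) (f i) (T i)) \<Longrightarrow> pbound D (\<lambda>i. vsize (e i)) T \<Longrightarrow> ptime D e f"
  unfolding ptime_def by blast

text \<open>A task may admit many correct answers. Choosing the one that the program actually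
  returns turns the relation \<open>S\<close> into a function that later definitions can
  call.\<close>

lemma ptime_of_polytime_solves:
  assumes "polytime_solves p D e S"
  obtains F where "ptime D e F" "\<And>i. i \<in> D \<Longrightarrow> S i (F i)"
proof -
  obtain q :: "nat poly" where
    "\<forall>i\<in>D. \<exists>u t. runs p (e i) u t \<and> t \<le> poly q (vsize (e i)) \<and> S i u"
    using assms unfolding polytime_solves_def by blast
  then obtain F T where
    "\<forall>i\<in>D. runs p (e i) (F i) (T i) \<and> T i \<le> poly q (vsize (e i)) \<and> S i (F i)"
    by metis
  then show ?thesis by (intro that[of F] ptimeI[of D p e F T]) (auto simp: pbound_def)
qed

lemma ptime_size: "ptime D e f \<Longrightarrow> pbound D (\<lambda>i. vsize (e i)) (\<lambda>i. vsize (f i))"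
  unfolding ptime_def using vsize_le_time by (blast intro: pbound_mono)

lemma ptime_cong: "ptime D e f \<Longrightarrow> (\<And>i. i \<in> D \<Longrightarrow> f i = g i) \<Longrightarrow> ptime D e g"
  unfolding ptime_def by fastforce

lemma ptime_subset: "ptime E e f \<Longrightarrow> D \<subseteq> E \<Longrightarrow> ptime D e f"
  unfolding ptime_def using pbound_subset by (metis subsetD)

text \<open>The rule for calling a subroutine: \<open>h\<close> prepares its argument, and the size
  of that argument is polynomial because it was computed in polynomial time.\<close>

lemma ptime_comp:
  assumes g: "ptime E e' g" and h: "\<And>i. i \<in> D \<Longrightarrow> h i \<in> E" and f: "ptime D e (\<lambda>i. e' (h i))"
  shows "ptime D e (\<lambda>i. g (h i))"
proof -
  obtain p T where p: "\<forall>i\<in>E. runs p (e' i) (g i) (T i)" "pbound E (\<lambda>i. vsize (e' i)) T"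
    using g unfolding ptime_def by blast
  obtain p' T' where p': "\<forall>i\<in>D. runs p' (e i) (e' (h i)) (T' i)" "pbound D (\<lambda>i. vsize (e i)) T'"
    using f unfolding ptime_def by blast
  show ?thesis
  proof (rule ptimeI)
    fix i assume "i \<in> D"
    then show "runs (Seq p' p) (e i) (g (h i)) (1 + T' i + T (h i))"
      using p p' h by (intro runs.Seq) auto
  next
    have "pbound D (\<lambda>i. vsize (e i)) (\<lambda>i. T (h i))"
      by (rule pbound_comp[OF p(2) h ptime_size[OF f]])
    then show "pbound D (\<lambda>i. vsize (e i)) (\<lambda>i. 1 + T' i + T (h i))"
      using p' by (intro pbound_intros)
  qed
qed

lemma ptime_prim:
  assumes "ptime D e f" shows "ptime D e (\<lambda>i. apply_prim P (f i))"
proof -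
  have "ptime D f (\<lambda>i. apply_prim P (f i))"
  proof (rule ptimeI)
    show "runs (Prim P) (f i) (apply_prim P (f i)) (vsize (f i) + vsize (apply_prim P (f i)))" for i
      by (rule runs.Prim)
    have "pbound D (\<lambda>i. vsize (f i)) (\<lambda>i. vsize (f i) + (4 * vsize (f i) + 4))"
      by (intro pbound_intros)
    then show "pbound D (\<lambda>i. vsize (f i)) (\<lambda>i. vsize (f i) + vsize (apply_prim P (f i)))"
      by (rule pbound_mono) (use vsize_apply_prim in auto)
  qed
  from ptime_comp[OF this, of D "\<lambda>i. i" e] assms show ?thesis by simp
qed

lemma ptime_input: "ptime D e e"
proof (rule ptimeI)
  show "runs (Prim Ident) (e i) (e i) (vsize (e i) + vsize (e i))" for i
    using runs.Prim[of Ident "e i"] by simp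
qed (intro pbound_intros)

lemma ptime_const: "ptime D e (\<lambda>i. k)"
  by (rule ptimeI[OF runs.Const]) (intro pbound_intros)

lemma ptime_Node: 
  assumes "ptime D e f" "ptime D e g" shows "ptime D e (\<lambda>i. Node (f i) (g i))"
proof -
  obtain p T p' T' where p: "\<forall>i\<in>D. runs p (e i) (f i) (T i)" "pbound D (\<lambda>i. vsize (e i)) T"
     "\<forall>i\<in>D. runs p' (e i) (g i) (T' i)" "pbound D (\<lambda>i. vsize (e i)) T'"
    using assms unfolding ptime_def by blast
  show ?thesis
    by (rule ptimeI[of _ "Fork p p'" _ _ "\<lambda>i. vsize (e i) + T i + T' i"])
       (use p in \<open>auto intro!: runs.Fork pbound_intros\<close>)
qed

text \<open>A constant, in contrast to the abbreviation \<open>truth\<close>, so that the rules for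
  tests apply by plain resolution.\<close>

definition tv :: "bool \<Rightarrow> val" where "tv b = truth b"

text \<open>Each branch has to be computable only on the inputs that reach it. Algorithms with
  preconditions, such as rounding of a feasible point, can thus be called behind a test.\<close>

lemma ptime_if:
  assumes "ptime D e (\<lambda>i. tv (b i))" "ptime {i \<in> D. b i} e f" "ptime {i \<in> D. \<not> b i} e g"
  shows "ptime D e (\<lambda>i. if b i then f i else g i)"
proof -
  obtain p T where p: "\<forall>i\<in>D. runs p (e i) (tv (b i)) (T i)" "pbound D (\<lambda>i. vsize (e i)) T"
    using assms(1) unfolding ptime_def by blast
  obtain p1 T1 where p1: "\<forall>i\<in>{i\<in>D. b i}. runs p1 (e i) (f i) (T1 i)"
      "pbound {i\<in>D. b i} (\<lambda>i. vsize (e i)) T1"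
    using assms(2) unfolding ptime_def by blast
  obtain p2 T2 where p2: "\<forall>i\<in>{i\<in>D. \<not> b i}. runs p2 (e i) (g i) (T2 i)"
      "pbound {i\<in>D. \<not> b i} (\<lambda>i. vsize (e i)) T2"
    using assms(3) unfolding ptime_def by blast
  define T3 where "T3 i = (if b i then T1 i else T2 i)" for i
  obtain q1 q2 where q: "\<forall>i\<in>{i\<in>D. b i}. T1 i \<le> poly q1 (vsize (e i))"
     "\<forall>i\<in>{i\<in>D. \<not> b i}. T2 i \<le> poly q2 (vsize (e i))"
    using p1(2) p2(2) unfolding pbound_def by blast
  have "pbound D (\<lambda>i. vsize (e i)) (\<lambda>i. poly q1 (vsize (e i)) + poly q2 (vsize (e i)))"
    by (intro pbound_intros)
  then have "pbound D (\<lambda>i. vsize (e i)) T3"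
    by (rule pbound_mono) (use q in \<open>auto simp: T3_def trans_le_add1 trans_le_add2\<close>)
  then have "pbound D (\<lambda>i. vsize (e i)) (\<lambda>i. vsize (e i) + T i + T3 i)"
    using p(2) by (intro pbound_intros)
  then show ?thesis
  proof (rule ptimeI[rotated])
    fix i assume i: "i \<in> D"
    show "runs (Cond p p1 p2) (e i) (if b i then f i else g i) (vsize (e i) + T i + T3 i)"
    proof (cases "b i")
      case True
      then have "runs p (e i) (truth True) (T i)" using p(1) i by (force simp: tv_def)
      then show ?thesis using True p1(1) i
        by (auto simp: T3_def intro: runs.CondTrue[of p "e i" "Atom 1"])
    next
      case False
      then have "runs p (e i) (truth False) (T i)" using p(1) i by (force simp: tv_def)
      then show ?thesis using False p2(1) i
        by (auto simp: T3_def intro: runs.CondFalse)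
    qed
  qed
qed

lemma ptime_if': 
  assumes "ptime D e (\<lambda>i. tv (b i))" "ptime D e f" "ptime D e g"
  shows "ptime D e (\<lambda>i. if b i then f i else g i)"
  by (rule ptime_if[OF assms(1) ptime_subset[OF assms(2)] ptime_subset[OF assms(3)]]) auto

lemma ptime_Node1: "ptime D e (\<lambda>i. Node (f i) (g i)) \<Longrightarrow> ptime D e f"
  using ptime_prim[of D e "\<lambda>i. Node (f i) (g i)" First] by simp

lemma ptime_Node2: "ptime D e (\<lambda>i. Node (f i) (g i)) \<Longrightarrow> ptime D e g"
  using ptime_prim[of D e "\<lambda>i. Node (f i) (g i)" Second] by simp

context
  fixes D :: "'i set" and e :: "'i \<Rightarrow> val" and a b :: "'i \<Rightarrow> rat"
  assumes a: "ptime D e (\<lambda>i. Atom (a i))" and b: "ptime D e (\<lambda>i. Atom (b i))"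
begin

lemma ptime_add: "ptime D e (\<lambda>i. Atom (a i + b i))"
  using ptime_prim[OF ptime_Node[OF a b], of Add] by simp

lemma ptime_diff: "ptime D e (\<lambda>i. Atom (a i - b i))"
  using ptime_prim[OF ptime_Node[OF a b], of Sub] by simp

lemma ptime_mult: "ptime D e (\<lambda>i. Atom (a i * b i))"
  using ptime_prim[OF ptime_Node[OF a b], of Mul] by simp

lemma ptime_divide: "ptime D e (\<lambda>i. Atom (a i / b i))"
  using ptime_prim[OF ptime_Node[OF a b], of Divide] by simp

lemma ptime_less: "ptime D e (\<lambda>i. tv (a i < b i))"
  using ptime_prim[OF ptime_Node[OF a b], of Less] by (simp add: tv_def)

end

lemma ptime_uminus: "ptime D e (\<lambda>i. Atom (a i)) \<Longrightarrow> ptime D e (\<lambda>i. Atom (- a i))"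
  using ptime_diff[OF ptime_const[of D e "Atom 0"]] by simp

lemma ptime_floor: "ptime D e (\<lambda>i. Atom (a i)) \<Longrightarrow> ptime D e (\<lambda>i. Atom (of_int \<lfloor>a i\<rfloor>))"
  using ptime_prim[of D e "\<lambda>i. Atom (a i)" Floor] by simp

lemma ptime_eq: "ptime D e f \<Longrightarrow> ptime D e g \<Longrightarrow> ptime D e (\<lambda>i. tv (f i = g i))"
  using ptime_prim[OF ptime_Node, of D e f g Same] by (simp add: tv_def)

lemma ptime_rat_eq:
  "ptime D e (\<lambda>i. Atom (a i)) \<Longrightarrow> ptime D e (\<lambda>i. Atom (b i)) \<Longrightarrow> ptime D e (\<lambda>i. tv (a i = b i))"
  using ptime_eq[of D e "\<lambda>i. Atom (a i)" "\<lambda>i. Atom (b i)"] by simp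

lemma ptime_not: "ptime D e (\<lambda>i. tv (b i)) \<Longrightarrow> ptime D e (\<lambda>i. tv (\<not> b i))"
  using ptime_if'[OF _ ptime_const[of D e "tv False"] ptime_const[of D e "tv True"], of b]
  by (rule ptime_cong) auto

lemma ptime_le:
  assumes "ptime D e (\<lambda>i. Atom (a i))" "ptime D e (\<lambda>i. Atom (b i))"
  shows "ptime D e (\<lambda>i. tv (a i \<le> b i))"
  using ptime_not[OF ptime_less[OF assms(2,1)]] by (simp add: not_less)

lemma ptime_conj:
  assumes "ptime D e (\<lambda>i. tv (a i))" "ptime D e (\<lambda>i. tv (b i))"
  shows "ptime D e (\<lambda>i. tv (a i \<and> b i))"
  using ptime_if'[OF assms ptime_const[of D e "tv False"]] by (rule ptime_cong) auto

lemma ptime_disj: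
  assumes "ptime D e (\<lambda>i. tv (a i))" "ptime D e (\<lambda>i. tv (b i))"
  shows "ptime D e (\<lambda>i. tv (a i \<or> b i))"
  using ptime_if'[OF assms(1) ptime_const[of D e "tv True"] assms(2)] by (rule ptime_cong) auto

lemmas ptime_ops = ptime_const ptime_Node ptime_add ptime_diff ptime_mult ptime_divide
  ptime_less ptime_le ptime_uminus ptime_floor ptime_rat_eq ptime_not ptime_conj ptime_disj

subsection \<open>Loops\<close>

abbreviation with_arg :: "('i \<Rightarrow> val) \<Rightarrow> ('x \<Rightarrow> val) \<Rightarrow> 'i \<times> 'x \<Rightarrow> val" where
  "with_arg e ex \<equiv> \<lambda>j. Node (e (fst j)) (ex (snd j))"

lemma ptime_outer:
  assumes "ptime D e f" "\<And>j. j \<in> E \<Longrightarrow> fst j \<in> D"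
  shows "ptime E (with_arg e ex) (\<lambda>j. f (fst j))"
  by (rule ptime_comp[OF assms]) (auto intro: ptime_Node1[OF ptime_input])

lemma ptime_inner: "ptime E (with_arg e ex) (\<lambda>j. ex (snd j))"
  by (rule ptime_Node2[OF ptime_input])

text \<open>The time is the number \<open>N\<close> of rounds times the cost of a round on data of
  size at most \<open>B\<close>. Both must be polynomial in the original input, and \<open>B\<close>
  must cover every intermediate state. The invariant \<open>R\<close> says on which states guard and
  body have to be computable, so subroutines with preconditions may occur in them.\<close>

lemma ptime_while:
  fixes st :: "'i \<Rightarrow> 's \<Rightarrow> 's" and s0 :: "'i \<Rightarrow> 's"
  defines "S \<equiv> \<lambda>i k. (st i ^^ k) (s0 i)"
  assumes init: "ptime D e (\<lambda>i. es (s0 i))"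
    and cond: "ptime (Sigma D R) (with_arg e es) (\<lambda>j. tv (b (fst j) (snd j)))"
    and body: "ptime {j \<in> Sigma D R. b (fst j) (snd j)} (with_arg e es) (\<lambda>j. es (st (fst j) (snd j)))"
    and R: "\<And>i k. i \<in> D \<Longrightarrow> k \<le> N i \<Longrightarrow> S i k \<in> R i"
    and bT: "\<And>i k. i \<in> D \<Longrightarrow> k < N i \<Longrightarrow> b i (S i k)"
    and bF: "\<And>i. i \<in> D \<Longrightarrow> \<not> b i (S i (N i))"
    and N: "pbound D (\<lambda>i. vsize (e i)) N"
    and B: "\<And>i k. i \<in> D \<Longrightarrow> k \<le> N i \<Longrightarrow> vsize (es (S i k)) \<le> B i"
    and pB: "pbound D (\<lambda>i. vsize (e i)) B"
  shows "ptime D e (\<lambda>i. es (S i (N i)))"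
proof -
  obtain p0 T0 where p0: "\<forall>i\<in>D. runs p0 (e i) (es (s0 i)) (T0 i)" "pbound D (\<lambda>i. vsize (e i)) T0"
    using init unfolding ptime_def by blast
  obtain pb Tb where pb: "\<forall>j\<in>Sigma D R. runs pb (with_arg e es j) (tv (b (fst j) (snd j))) (Tb j)"
      "pbound (Sigma D R) (\<lambda>j. vsize (with_arg e es j)) Tb"
    using cond unfolding ptime_def by blast
  obtain qb where qb: "\<forall>j\<in>Sigma D R. Tb j \<le> poly qb (vsize (with_arg e es j))"
    using pb(2) unfolding pbound_def by blast
  obtain ps Ts where ps: "\<forall>j\<in>{j \<in> Sigma D R. b (fst j) (snd j)}. runs ps (with_arg e es j) (es (st (fst j) (snd j))) (Ts j)"
      "pbound {j \<in> Sigma D R. b (fst j) (snd j)} (\<lambda>j. vsize (with_arg e es j)) Ts"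
    using body unfolding ptime_def by blast
  obtain qs where qs: "\<forall>j\<in>{j \<in> Sigma D R. b (fst j) (snd j)}. Ts j \<le> poly qs (vsize (with_arg e es j))"
    using ps(2) unfolding pbound_def by blast
  define Z where "Z i = vsize (e i) + B i + 1" for i
  \<comment> \<open>Cost of one round: the loop, the fork and \<open>First\<close> each read the
    pair, and \<open>First\<close> writes the input back, hence four copies of
    \<open>Z\<close>.\<close>
  define X where "X i = 4 * Z i + poly qb (Z i) + poly qs (Z i)" for i
  \<comment> \<open>The program carries the input beside the state, since the body may consult it;
    \<open>First\<close> hands it on to the next round.\<close>
  let ?W = "While pb (Fork (Prim First) ps)"
  \<comment> \<open>Induction on the number \<open>n\<close> of rounds that are still to come,
    because \<open>runs\<close> unfolds a loop from its front.\<close>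
  have loop: "\<exists>t. runs ?W (Node (e i) (es (S i (N i - n)))) (Node (e i) (es (S i (N i)))) t \<and> t \<le> (n + 1) * X i"
    if i: "i \<in> D" and n: "n \<le> N i" for i n
    using n
  proof (induction n)
    case 0
    let ?v = "Node (e i) (es (S i (N i)))"
    have j: "(i, S i (N i)) \<in> Sigma D R" using R i by auto
    have z: "vsize ?v \<le> Z i" using B[OF i] by (simp add: Z_def)
    have t: "Tb (i, S i (N i)) \<le> poly qb (Z i)"
      using qb j poly_nat_mono[OF z, of qb] by fastforce
    have "runs pb ?v (truth False) (Tb (i, S i (N i)))"
      using pb(1) j bF[OF i] by (fastforce simp: tv_def)
    then have "runs ?W ?v ?v (vsize ?v + Tb (i, S i (N i)))" by (rule runs.WhileFalse)
    moreover have "vsize ?v + Tb (i, S i (N i)) \<le> X i" using z t by (simp add: X_def)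
    ultimately show ?case by auto
  next
    case (Suc n)
    define k where "k = N i - Suc n"
    have k: "k < N i" "N i - n = Suc k" using Suc.prems by (auto simp: k_def)
    let ?v = "Node (e i) (es (S i k))"
    have j: "(i, S i k) \<in> Sigma D R" "b i (S i k)" using R bT i k by auto
    have z: "vsize ?v \<le> Z i" using B[OF i, of k] k by (simp add: Z_def)
    have tb: "Tb (i, S i k) \<le> poly qb (Z i)"
      using qb j poly_nat_mono[OF z, of qb] by fastforce
    have ts: "Ts (i, S i k) \<le> poly qs (Z i)"
      using qs j poly_nat_mono[OF z, of qs] by fastforce
    have rb: "runs pb ?v (Atom 1) (Tb (i, S i k))"
      using pb(1) j by (fastforce simp: tv_def)
    have S: "st i (S i k) = S i (Suc k)" by (simp add: S_def)
    have "runs (Fork (Prim First) ps) ?v (Node (e i) (es (S i (Suc k))))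
        (vsize ?v + (vsize ?v + vsize (e i)) + Ts (i, S i k))"
    proof (rule runs.Fork)
      show "runs (Prim First) ?v (e i) (vsize ?v + vsize (e i))"
        using runs.Prim[of First ?v] by simp
      show "runs ps ?v (es (S i (Suc k))) (Ts (i, S i k))" using ps(1) j S by fastforce
    qed
    moreover obtain t where t: "runs ?W (Node (e i) (es (S i (Suc k)))) (Node (e i) (es (S i (N i)))) t"
        "t \<le> (n + 1) * X i"
      using Suc k by auto
    ultimately have "runs ?W ?v (Node (e i) (es (S i (N i))))
        (vsize ?v + Tb (i, S i k) + (vsize ?v + (vsize ?v + vsize (e i)) + Ts (i, S i k)) + t)"
      by (intro runs.WhileTrue[OF rb]) auto
    moreover have "vsize (e i) \<le> Z i" by (simp add: Z_def)
    then have "vsize ?v + Tb (i, S i k) + (vsize ?v + (vsize ?v + vsize (e i)) + Ts (i, S i k)) + t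
        \<le> (Suc n + 1) * X i"
      using z tb ts t(2) by (simp add: X_def)
    ultimately show ?case unfolding k_def by blast
  qed
  have "\<forall>i\<in>D. \<exists>t. runs ?W (Node (e i) (es (s0 i))) (Node (e i) (es (S i (N i)))) t \<and> t \<le> (N i + 1) * X i"
  proof
    fix i assume "i \<in> D"
    from loop[OF this order_refl] show "\<exists>t. runs ?W (Node (e i) (es (s0 i))) (Node (e i) (es (S i (N i)))) t \<and> t \<le> (N i + 1) * X i"
      by (simp add: S_def)
  qed
  then obtain T where T: "\<forall>i\<in>D. runs ?W (Node (e i) (es (s0 i))) (Node (e i) (es (S i (N i)))) (T i) \<and>
      T i \<le> (N i + 1) * X i" by metis
  show ?thesis
  proof (rule ptimeI)
    fix i assume i: "i \<in> D"
    let ?u = "Node (e i) (es (S i (N i)))"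
    have 1: "runs (Fork (Prim Ident) p0) (e i) (Node (e i) (es (s0 i)))
        (vsize (e i) + (vsize (e i) + vsize (e i)) + T0 i)"
      using p0(1) i runs.Prim[of Ident "e i"] by (intro runs.Fork) auto
    have 2: "runs (Prim Second) ?u (es (S i (N i))) (vsize ?u + vsize (es (S i (N i))))"
      using runs.Prim[of Second ?u] by simp
    show "runs (Seq (Fork (Prim Ident) p0) (Seq ?W (Prim Second))) (e i) (es (S i (N i)))
        (1 + (vsize (e i) + (vsize (e i) + vsize (e i)) + T0 i)
          + (1 + T i + (vsize ?u + vsize (es (S i (N i))))))"
      using 1 2 T i by (intro runs.Seq) auto
  next
    have pZ: "pbound D (\<lambda>i. vsize (e i)) Z" unfolding Z_def using pB by (intro pbound_intros)
    then have pX: "pbound D (\<lambda>i. vsize (e i)) X" unfolding X_def by (intro pbound_intros)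
    have "pbound D (\<lambda>i. vsize (e i)) (\<lambda>i. 1 + (vsize (e i) + (vsize (e i) + vsize (e i)) + T0 i)
          + (1 + (N i + 1) * X i + (Z i + B i)))"
      using p0(2) N pX pZ pB by (intro pbound_intros)
    then show "pbound D (\<lambda>i. vsize (e i)) (\<lambda>i. 1 + (vsize (e i) + (vsize (e i) + vsize (e i)) + T0 i)
          + (1 + T i + (vsize (Node (e i) (es (S i (N i)))) + vsize (es (S i (N i))))))"
    proof (rule pbound_mono)
      fix i assume i: "i \<in> D"
      have "T i \<le> (N i + 1) * X i" using T i by blast
      then show "1 + (vsize (e i) + (vsize (e i) + vsize (e i)) + T0 i)
          + (1 + T i + (vsize (Node (e i) (es (S i (N i)))) + vsize (es (S i (N i))))) \<le>
        1 + (vsize (e i) + (vsize (e i) + vsize (e i)) + T0 i) + (1 + (N i + 1) * X i + (Z i + B i))"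
        using B[OF i, of "N i"] by (simp add: Z_def)
    qed
  qed
qed

section \<open>List operations in polynomial time\<close>

lemma ptime_is_Nil:
  "ptime D e (\<lambda>i. enc_list (map ex (xs i))) \<Longrightarrow> ptime D e (\<lambda>i. tv (xs i \<noteq> []))"
proof -
  assume "ptime D e (\<lambda>i. enc_list (map ex (xs i)))"
  then have "ptime D e (\<lambda>i. apply_prim IsAtom (enc_list (map ex (xs i))))" by (rule ptime_prim)
  then have "ptime D e (\<lambda>i. tv (xs i = []))"
    by (rule ptime_cong) (auto simp: tv_def neq_Nil_conv)
  then show ?thesis by (rule ptime_not)
qed

lemma ptime_tl:
  "ptime D e (\<lambda>i. enc_list (map ex (xs i))) \<Longrightarrow> (\<And>i. i \<in> D \<Longrightarrow> xs i \<noteq> []) \<Longrightarrow>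
   ptime D e (\<lambda>i. enc_list (map ex (tl (xs i))))"
  by (rule ptime_cong[OF ptime_prim[of D e "\<lambda>i. enc_list (map ex (xs i))" Second]])
     (simp, metis apply_prim.simps(3) enc_list.simps(2) list.exhaust_sel list.map(2))

lemma ptime_hd:
  "ptime D e (\<lambda>i. enc_list (map ex (xs i))) \<Longrightarrow> (\<And>i. i \<in> D \<Longrightarrow> xs i \<noteq> []) \<Longrightarrow>
   ptime D e (\<lambda>i. ex (hd (xs i)))"
  by (rule ptime_cong[OF ptime_prim[of D e "\<lambda>i. enc_list (map ex (xs i))" First]])
     (simp, metis apply_prim.simps(2) enc_list.simps(2) list.exhaust_sel list.map(2))

text \<open>The loop state pairs the unread rest of the list with the accumulator. \<open>A\<close>
  collects accumulators on which the step is known to be computable, and \<open>B\<close> bounds the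
  accumulators of all prefixes.\<close>

lemma ptime_foldl:
  fixes st :: "'i \<Rightarrow> 'x \<Rightarrow> 'a \<Rightarrow> 'a"
  assumes xs: "ptime D e (\<lambda>i. enc_list (map ex (xs i)))"
    and init: "ptime D e (\<lambda>i. ea (a0 i))"
    and step: "ptime (Sigma (Sigma D (\<lambda>i. set (xs i))) (\<lambda>j. A (fst j))) (with_arg (with_arg e ex) ea)
      (\<lambda>j. ea (st (fst (fst j)) (snd (fst j)) (snd j)))"
    and A: "\<And>i k. i \<in> D \<Longrightarrow> k \<le> length (xs i) \<Longrightarrow> foldl (\<lambda>a x. st i x a) (a0 i) (take k (xs i)) \<in> A i"
    and B: "\<And>i k. i \<in> D \<Longrightarrow> k \<le> length (xs i) \<Longrightarrow>
       vsize (ea (foldl (\<lambda>a x. st i x a) (a0 i) (take k (xs i)))) \<le> B i"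
    and pB: "pbound D (\<lambda>i. vsize (e i)) B"
  shows "ptime D e (\<lambda>i. ea (foldl (\<lambda>a x. st i x a) (a0 i) (xs i)))"
proof -
  define es where "es s = Node (enc_list (map ex (fst s))) (ea (snd s))" for s
  define st' where "st' i s = (tl (fst s), st i (hd (fst s)) (snd s))" for i s
  define s0 where "s0 i = (xs i, a0 i)" for i
  define R where "R i = {s. set (fst s) \<subseteq> set (xs i) \<and> snd s \<in> A i}" for i
  define b where "b i s = (fst s \<noteq> [])" for i :: 'i and s :: "'x list \<times> 'a"
  let ?f = "\<lambda>i k. foldl (\<lambda>a x. st i x a) (a0 i) (take k (xs i))"
  have S: "(st' i ^^ k) (s0 i) = (drop k (xs i), ?f i k)" if "k \<le> length (xs i)" for i k
    using that
  proof (induction k)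
    case 0
    then show ?case by (simp add: s0_def)
  next
    case (Suc k)
    then show ?case
      by (simp add: st'_def take_Suc_conv_app_nth hd_drop_conv_nth tl_drop drop_Suc)
  qed
  let ?E = "{j \<in> Sigma D R. b (fst j) (snd j)}"
  have es': "es = (\<lambda>s. Node (enc_list (map ex (fst s))) (ea (snd s)))" by (rule ext) (simp add: es_def)
  have l: "ptime E (with_arg e es) (\<lambda>j. enc_list (map ex (fst (snd j))))" for E
    unfolding es' by (rule ptime_Node1[OF ptime_inner])
  have ac: "ptime E (with_arg e es) (\<lambda>j. ea (snd (snd j)))" for E
    unfolding es' by (rule ptime_Node2[OF ptime_inner])
  have en: "ptime E (with_arg e es) (\<lambda>j. e (fst j))" for E
    by (rule ptime_Node1[OF ptime_input])
  have "ptime D e (\<lambda>i. es ((st' i ^^ length (xs i)) (s0 i)))"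
  proof (rule ptime_while[where R = R and b = b and B = "\<lambda>i. 1 + vsize (enc_list (map ex (xs i))) + B i"])
    show "ptime D e (\<lambda>i. es (s0 i))" unfolding es' s0_def using xs init by (simp add: ptime_Node)
    show "ptime (Sigma D R) (with_arg e es) (\<lambda>j. tv (b (fst j) (snd j)))"
      unfolding b_def by (rule ptime_is_Nil[OF l])
    have "ptime ?E (with_arg e es) (\<lambda>j. ea (st (fst j) (hd (fst (snd j))) (snd (snd j))))"
    proof -
      have "ptime ?E (with_arg e es) (\<lambda>j. with_arg (with_arg e ex) ea ((fst j, hd (fst (snd j))), snd (snd j)))"
        unfolding fst_conv snd_conv by (intro ptime_Node en ac ptime_hd[OF l]) (auto simp: b_def)
      moreover have "((fst j, hd (fst (snd j))), snd (snd j)) \<in> Sigma (Sigma D (\<lambda>i. set (xs i))) (\<lambda>j. A (fst j))"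
        if "j \<in> ?E" for j
        using that by (auto simp: R_def b_def intro!: subsetD[OF _ hd_in_set])
      ultimately show ?thesis
        using ptime_comp[OF step, of ?E "\<lambda>j. ((fst j, hd (fst (snd j))), snd (snd j))" "with_arg e es"]
        unfolding fst_conv snd_conv by blast
    qed
    then have "ptime ?E (with_arg e es) (\<lambda>j. Node (enc_list (map ex (tl (fst (snd j)))))
        (ea (st (fst j) (hd (fst (snd j))) (snd (snd j)))))"
      by (intro ptime_Node ptime_tl[OF l]) (auto simp: b_def)
    then show "ptime ?E (with_arg e es) (\<lambda>j. es (st' (fst j) (snd j)))"
      by (simp add: st'_def es_def)
    show "(st' i ^^ k) (s0 i) \<in> R i" if "i \<in> D" "k \<le> length (xs i)" for i k
      using A that by (auto simp: S R_def dest: in_set_dropD)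
    show "b i ((st' i ^^ k) (s0 i))" if "i \<in> D" "k < length (xs i)" for i k
      using that by (auto simp: S b_def)
    show "\<not> b i ((st' i ^^ length (xs i)) (s0 i))" if "i \<in> D" for i
      using that by (auto simp: S b_def)
    show "pbound D (\<lambda>i. vsize (e i)) (\<lambda>i. length (xs i))"
      by (rule pbound_mono[OF ptime_size[OF xs]]) (metis length_le_vsize length_map)
    show "pbound D (\<lambda>i. vsize (e i)) (\<lambda>i. 1 + vsize (enc_list (map ex (xs i))) + B i)"
      by (intro pbound_intros ptime_size[OF xs] pB)
    show "vsize (es ((st' i ^^ k) (s0 i))) \<le> 1 + vsize (enc_list (map ex (xs i))) + B i"
      if "i \<in> D" "k \<le> length (xs i)" for i k
    proof -
      have "(\<Sum>v\<leftarrow>map ex (drop k (xs i)). 1 + vsize v) \<le> (\<Sum>v\<leftarrow>map ex (xs i). 1 + vsize v)"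
        by (metis append_take_drop_id drop_map le_add2 map_append sum_list_append)
      then show ?thesis using B[OF that] that by (simp add: S es_def vsize_enc_list)
    qed
  qed
  then have "ptime D e (\<lambda>i. Node (enc_list []) (ea (?f i (length (xs i)))))"
    by (rule ptime_cong) (simp add: S es_def)
  then show ?thesis by (auto dest: ptime_Node2)
qed

text \<open>Moving elements one by one from one list to the other is the only list traversal that
  pairs offer directly; appending and mapping are derived from it by a second reversal.\<close>

lemma ptime_rev_onto:
  assumes xs: "ptime D e (\<lambda>i. enc_list (map ex (xs i)))" and ys: "ptime D e (\<lambda>i. enc_list (map ex (ys i)))"
  shows "ptime D e (\<lambda>i. enc_list (map ex (rev (xs i) @ ys i)))"
proof -
  have f: "foldl (\<lambda>a x. x # a) b ys = rev ys @ b" for ys b :: "'b list"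
    by (induction ys arbitrary: b) auto
  let ?A = "\<lambda>i. UNIV :: 'b list set"
  have "ptime D e (\<lambda>i. enc_list (map ex (foldl (\<lambda>a x. x # a) (ys i) (xs i))))"
  proof (rule ptime_foldl[where A = ?A and B = "\<lambda>i. vsize (enc_list (map ex (xs i))) + vsize (enc_list (map ex (ys i)))", OF xs ys])
    show "ptime (Sigma (Sigma D (\<lambda>i. set (xs i))) (\<lambda>j. ?A (fst j))) (with_arg (with_arg e ex) (\<lambda>a. enc_list (map ex a)))
       (\<lambda>j. enc_list (map ex (snd (fst j) # snd j)))"
      by (auto intro!: ptime_Node ptime_inner ptime_Node2[OF ptime_Node1[OF ptime_input]])
    show "vsize (enc_list (map ex (foldl (\<lambda>a x. x # a) (ys i) (take k (xs i)))))
       \<le> vsize (enc_list (map ex (xs i))) + vsize (enc_list (map ex (ys i)))" for i k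
    proof -
      have "(\<Sum>v\<leftarrow>map ex (take k (xs i)). 1 + vsize v) \<le> (\<Sum>v\<leftarrow>map ex (xs i). 1 + vsize v)"
        by (metis append_take_drop_id le_add1 map_append sum_list_append take_map)
      moreover have "(\<Sum>v\<leftarrow>map ex (rev (take k (xs i))). 1 + vsize v) = (\<Sum>v\<leftarrow>map ex (take k (xs i)). 1 + vsize v)"
        by (simp only: rev_map[symmetric] sum_list_rev)
      ultimately show ?thesis unfolding f vsize_enc_list map_append sum_list_append by linarith
    qed
    show "pbound D (\<lambda>i. vsize (e i)) (\<lambda>i. vsize (enc_list (map ex (xs i))) + vsize (enc_list (map ex (ys i))))"
      by (intro pbound_intros ptime_size[OF xs] ptime_size[OF ys])
  qed auto
  then show ?thesis unfolding f .
qed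

lemma ptime_rev:
  "ptime D e (\<lambda>i. enc_list (map ex (xs i))) \<Longrightarrow> ptime D e (\<lambda>i. enc_list (map ex (rev (xs i))))"
  using ptime_rev_onto[of D e ex xs "\<lambda>i. []"] ptime_const[of D e "Atom 0"] by simp

lemma ptime_append:
  "ptime D e (\<lambda>i. enc_list (map ex (xs i))) \<Longrightarrow> ptime D e (\<lambda>i. enc_list (map ex (ys i))) \<Longrightarrow>
   ptime D e (\<lambda>i. enc_list (map ex (xs i @ ys i)))"
  using ptime_rev_onto[OF ptime_rev, of D e ex xs ys] by simp

text \<open>Images do not feed into each other: each one is polynomial in the size of the input and
  a single element, so the result list remains polynomial.\<close>

lemma ptime_map:
  fixes F :: "'i \<Rightarrow> 'x \<Rightarrow> 'y"
  assumes xs: "ptime D e (\<lambda>i. enc_list (map ex (xs i)))"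
    and F: "ptime (Sigma D (\<lambda>i. set (xs i))) (with_arg e ex) (\<lambda>j. ey (F (fst j) (snd j)))"
  shows "ptime D e (\<lambda>i. enc_list (map ey (map (F i) (xs i))))"
proof -
  have f: "foldl (\<lambda>a x. F i x # a) b ys = rev (map (F i) ys) @ b" for ys b i
    by (induction ys arbitrary: b) auto
  obtain q where q: "\<forall>j\<in>Sigma D (\<lambda>i. set (xs i)). vsize (ey (F (fst j) (snd j))) \<le> poly q (vsize (with_arg e ex j))"
    using ptime_size[OF F] unfolding pbound_def by blast
  let ?A = "\<lambda>i. UNIV :: 'y list set"
  let ?s = "\<lambda>i. vsize (enc_list (map ex (xs i)))"
  let ?B = "\<lambda>i. 2 + ?s i * (1 + poly q (1 + vsize (e i) + ?s i))"
  have "ptime D e (\<lambda>i. enc_list (map ey (foldl (\<lambda>a x. F i x # a) [] (xs i))))"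
  proof (rule ptime_foldl[where A = ?A and B = ?B, OF xs])
    show "ptime D e (\<lambda>i. enc_list (map ey []))" by (simp add: ptime_const)
    let ?E = "Sigma (Sigma D (\<lambda>i. set (xs i))) (\<lambda>j. ?A (fst j))"
    have "ptime ?E (with_arg (with_arg e ex) (\<lambda>a. enc_list (map ey a))) (\<lambda>j. ey (F (fst (fst j)) (snd (fst j))))"
      using ptime_outer[OF F, of ?E] by auto
    then show "ptime ?E (with_arg (with_arg e ex) (\<lambda>a. enc_list (map ey a)))
       (\<lambda>j. enc_list (map ey (F (fst (fst j)) (snd (fst j)) # snd j)))"
      by (auto intro!: ptime_Node ptime_inner)
    show "vsize (enc_list (map ey (foldl (\<lambda>a x. F i x # a) [] (take k (xs i))))) \<le> ?B i"
      if "i \<in> D" "k \<le> length (xs i)" for i k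
    proof -
      have "vsize (enc_list (map ey (rev (map (F i) (take k (xs i))))))
         \<le> 2 + length (map ey (rev (map (F i) (take k (xs i))))) * (1 + poly q (1 + vsize (e i) + ?s i))"
      proof (rule vsize_enc_list_le)
        fix v assume "v \<in> set (map ey (rev (map (F i) (take k (xs i)))))"
        then obtain x where x: "x \<in> set (xs i)" "v = ey (F i x)" by (auto dest: in_set_takeD)
        have "vsize v \<le> poly q (vsize (Node (e i) (ex x)))" using q x that(1) by fastforce
        also have "\<dots> \<le> poly q (1 + vsize (e i) + ?s i)"
          using vsize_mem_enc_list[of "ex x" "map ex (xs i)"] x by (intro poly_nat_mono) auto
        finally show "vsize v \<le> poly q (1 + vsize (e i) + ?s i)" .
      qed
      also have "\<dots> \<le> ?B i"
        using length_le_vsize[of "map ex (xs i)"] by (intro add_mono mult_right_mono) auto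
      finally show ?thesis by (simp add: f)
    qed
    show "pbound D (\<lambda>i. vsize (e i)) ?B" by (intro pbound_intros ptime_size[OF xs])
  qed auto
  then have "ptime D e (\<lambda>i. enc_list (map ey (rev (map (F i) (xs i)))))" unfolding f by simp
  from ptime_rev[OF this] show ?thesis by simp
qed

text \<open>Every partial sum has at most the total number of bits of its summands, up to a constant
  per summand, so the accumulator never blows up.\<close>

lemma ptime_sum_list:
  assumes xs: "ptime D e (\<lambda>i. enc_list (map Atom (xs i)))"
  shows "ptime D e (\<lambda>i. Atom (sum_list (xs i)))"
proof -
  have f: "foldl (\<lambda>a x. a + x) b ys = b + sum_list ys" for ys and b :: rat
    by (induction ys arbitrary: b) auto
  let ?s = "\<lambda>i. vsize (enc_list (map Atom (xs i)))"
  let ?A = "\<lambda>i. UNIV :: rat set"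
  have "ptime D e (\<lambda>i. Atom (foldl (\<lambda>a x. a + x) 0 (xs i)))"
  proof (rule ptime_foldl[where A = ?A and B = "\<lambda>i. 1 + 2 * (?s i * (?s i + 1) + 1)", OF xs ptime_const])
    show "ptime (Sigma (Sigma D (\<lambda>i. set (xs i))) (\<lambda>j. ?A (fst j))) (with_arg (with_arg e Atom) Atom)
       (\<lambda>j. Atom (snd j + snd (fst j)))"
      by (auto intro!: ptime_add ptime_inner ptime_Node2[OF ptime_Node1[OF ptime_input]])
    show "vsize (Atom (foldl (\<lambda>a x. a + x) 0 (take k (xs i)))) \<le> 1 + 2 * (?s i * (?s i + 1) + 1)"
      if "i \<in> D" for i k
    proof -
      have "rat_bits (length (take k (xs i)) * (?s i + 1) + 1) (sum_list (take k (xs i)))"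
        by (rule rat_bits_sum_list)
          (use vsize_mem_enc_list in \<open>force intro!: rat_bits_of_vsize_le dest: in_set_takeD simp del: vsize.simps\<close>)
      then have "rat_bits (?s i * (?s i + 1) + 1) (sum_list (take k (xs i)))"
        by (rule rat_bits_mono)
          (use length_le_vsize[of "map Atom (xs i)"] in \<open>intro add_mono mult_right_mono, auto\<close>)
      from vsize_le_of_rat_bits[OF this] show ?thesis unfolding f by (simp del: vsize.simps)
    qed
    show "pbound D (\<lambda>i. vsize (e i)) (\<lambda>i. 1 + 2 * (?s i * (?s i + 1) + 1))"
      by (intro pbound_intros ptime_size[OF xs])
  qed auto
  then show ?thesis by (simp add: f)
qed

lemma ptime_sum_map:
  assumes xs: "ptime D e (\<lambda>i. enc_list (map ex (xs i)))"
    and F: "ptime (Sigma D (\<lambda>i. set (xs i))) (with_arg e ex) (\<lambda>j. Atom (F (fst j) (snd j)))"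
  shows "ptime D e (\<lambda>i. Atom (\<Sum>x\<leftarrow>xs i. F i x))"
  by (rule ptime_sum_list[OF ptime_map[where ey = Atom, OF assms]])

lemma ptime_length:
  assumes xs: "ptime D e (\<lambda>i. enc_list (map ex (xs i)))"
  shows "ptime D e (\<lambda>i. Atom (of_nat (length (xs i))))"
  using ptime_sum_map[OF xs ptime_const[of _ _ "Atom 1"]] by (simp add: sum_list_triv)

text \<open>Lists are nested pairs, so access means taking tails while a counter runs down; the
  position is below the length and hence polynomial.\<close>

lemma ptime_nth:
  assumes xs: "ptime D e (\<lambda>i. enc_list (map ex (xs i)))"
    and k: "ptime D e (\<lambda>i. Atom (of_nat (k i)))"
    and kl: "\<And>i. i \<in> D \<Longrightarrow> k i < length (xs i)"
  shows "ptime D e (\<lambda>i. ex (xs i ! k i))"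
proof -
  define es where "es = (\<lambda>s :: 'b list \<times> rat. Node (enc_list (map ex (fst s))) (Atom (snd s)))"
  define st where "st = (\<lambda>(i :: 'a) s. (tl (fst s) :: 'b list, snd s - 1 :: rat))"
  define s0 where "s0 i = (xs i, of_nat (k i) :: rat)" for i
  define R where "R i = {s :: 'b list \<times> rat. fst s \<noteq> []}" for i :: 'a
  define b where "b = (\<lambda>(i :: 'a) (s :: 'b list \<times> rat). 0 < snd s)"
  have S: "(st i ^^ n) (s0 i) = (drop n (xs i), of_nat (k i) - of_nat n)" for i n
    by (induction n) (auto simp: s0_def st_def drop_Suc tl_drop)
  have l: "ptime E (with_arg e es) (\<lambda>j. enc_list (map ex (fst (snd j))))" for E
    unfolding es_def by (rule ptime_Node1[OF ptime_inner])
  have ac: "ptime E (with_arg e es) (\<lambda>j. Atom (snd (snd j)))" for E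
    unfolding es_def by (rule ptime_Node2[OF ptime_inner])
  let ?s = "\<lambda>i. vsize (enc_list (map ex (xs i)))"
  have "ptime D e (\<lambda>i. es ((st i ^^ k i) (s0 i)))"
  proof (rule ptime_while[where R = R and b = b and B = "\<lambda>i. 1 + ?s i + (1 + 2 * (?s i + 1))"])
    show "ptime D e (\<lambda>i. es (s0 i))" unfolding es_def s0_def using xs k by (simp add: ptime_Node)
    show "ptime (Sigma D R) (with_arg e es) (\<lambda>j. tv (b (fst j) (snd j)))"
      unfolding b_def by (intro ptime_ops ac)
    show "ptime {j \<in> Sigma D R. b (fst j) (snd j)} (with_arg e es) (\<lambda>j. es (st (fst j) (snd j)))"
    proof -
      have "ptime {j \<in> Sigma D R. b (fst j) (snd j)} (with_arg e es)
        (\<lambda>j. Node (enc_list (map ex (tl (fst (snd j))))) (Atom (snd (snd j) - 1)))"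
        by (intro ptime_Node ptime_diff ac ptime_const ptime_tl[OF l]) (auto simp: R_def)
      then show ?thesis by (simp add: es_def st_def)
    qed
    show "(st i ^^ n) (s0 i) \<in> R i" if "i \<in> D" "n \<le> k i" for i n
      using kl[of i] that by (auto simp: S R_def)
    show "b i ((st i ^^ n) (s0 i))" if "i \<in> D" "n < k i" for i n
      using that by (auto simp: S b_def)
    show "\<not> b i ((st i ^^ k i) (s0 i))" for i by (auto simp: S b_def)
    show "pbound D (\<lambda>i. vsize (e i)) k"
      by (rule pbound_mono[OF ptime_size[OF xs]]) (metis kl length_le_vsize length_map less_imp_le order_trans)
    show "pbound D (\<lambda>i. vsize (e i)) (\<lambda>i. 1 + ?s i + (1 + 2 * (?s i + 1)))"
      by (intro pbound_intros ptime_size[OF xs])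
    show "vsize (es ((st i ^^ n) (s0 i))) \<le> 1 + ?s i + (1 + 2 * (?s i + 1))" if "i \<in> D" "n \<le> k i" for i n
    proof -
      have "(\<Sum>v\<leftarrow>map ex (drop n (xs i)). 1 + vsize v) \<le> (\<Sum>v\<leftarrow>map ex (xs i). 1 + vsize v)"
        by (metis append_take_drop_id drop_map le_add2 map_append sum_list_append)
      then have "vsize (enc_list (map ex (drop n (xs i)))) \<le> ?s i" by (simp add: vsize_enc_list)
      moreover have "vsize (Atom (of_nat (k i) - of_nat n)) \<le> 1 + 2 * (?s i + 1)"
      proof (rule vsize_le_of_rat_bits)
        have "k i - n < 2 ^ (k i - n)" by (rule less_exp)
        also have "k i - n \<le> ?s i + 1" using length_le_vsize[of "map ex (xs i)"] kl[OF that(1)] by simp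
        then have "(2::nat) ^ (k i - n) \<le> 2 ^ (?s i + 1)" by (intro power_increasing) auto
        finally have "\<bar>int (k i - n)\<bar> < 2 ^ (?s i + 1)"
          by (metis abs_of_nat of_nat_less_numeral_power_cancel_iff)
        then have "rat_bits (?s i + 1) (of_int (int (k i - n)))" by (rule rat_bits_of_int) simp
        then show "rat_bits (?s i + 1) (of_nat (k i) - of_nat n)" using that by (simp add: of_nat_diff)
      qed
      ultimately show ?thesis unfolding S es_def vsize.simps(2) fst_conv snd_conv by linarith
    qed
  qed
  then have "ptime D e (\<lambda>i. Node (enc_list (map ex (drop (k i) (xs i)))) (Atom 0))"
    by (rule ptime_cong) (simp add: S es_def)
  then have "ptime D e (\<lambda>i. enc_list (map ex (drop (k i) (xs i))))" by (rule ptime_Node1)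
  then have "ptime D e (\<lambda>i. ex (hd (drop (k i) (xs i))))" by (rule ptime_hd) (use kl in \<open>simp add: not_le\<close>)
  then show ?thesis by (rule ptime_cong) (simp add: kl hd_drop_conv_nth)
qed

abbreviation enc_nats :: "nat list \<Rightarrow> val" where
  "enc_nats ns \<equiv> enc_list (map (\<lambda>k. Atom (of_nat k)) ns)"

lemma vsize_of_nat_le: "vsize (Atom (of_nat n)) \<le> 1 + 2 * (n + 1)"
proof (rule vsize_le_of_rat_bits)
  have "n < 2 ^ (n + 1)" using less_exp[of "n + 1"] by linarith
  then have "\<bar>int n\<bar> < 2 ^ (n + 1)" by (metis abs_of_nat of_nat_less_numeral_power_cancel_iff)
  from rat_bits_of_int[OF this] show "rat_bits (n + 1) (of_nat n)" by simp
qed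

text \<open>The range is written out in full, so the value of \<open>n\<close> and not merely its
  number of digits has to be polynomial. Counting down makes the list come out in increasing
  order.\<close>

lemma ptime_upt:
  assumes n: "ptime D e (\<lambda>i. Atom (of_nat (n i)))" and pn: "pbound D (\<lambda>i. vsize (e i)) n"
  shows "ptime D e (\<lambda>i. enc_nats [0..<n i])"
proof -
  define es where "es = (\<lambda>s :: nat \<times> nat list. Node (Atom (of_nat (fst s))) (enc_nats (snd s)))"
  define st where "st = (\<lambda>(i :: 'a) s. (fst s - 1, (fst s - 1) # snd s) :: nat \<times> nat list)"
  define s0 where "s0 i = (n i, [] :: nat list)" for i
  define b where "b = (\<lambda>(i :: 'a) (s :: nat \<times> nat list). (0::rat) < of_nat (fst s))"
  have S: "(st i ^^ k) (s0 i) = (n i - k, [n i - k..<n i])" if "k \<le> n i" for i k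
    using that
  proof (induction k)
    case (Suc k)
    then have "[n i - Suc k..<n i] = (n i - Suc k) # [n i - k..<n i]"
      using upt_conv_Cons[of "n i - Suc k" "n i"] by (simp add: Suc_diff_Suc)
    with Suc show ?case by (simp add: st_def)
  qed (simp add: s0_def)
  have c: "ptime E (with_arg e es) (\<lambda>j. Atom (of_nat (fst (snd j))))" for E
    unfolding es_def by (rule ptime_Node1[OF ptime_inner])
  have ac: "ptime E (with_arg e es) (\<lambda>j. enc_nats (snd (snd j)))" for E
    unfolding es_def by (rule ptime_Node2[OF ptime_inner])
  let ?B = "\<lambda>i. 1 + (1 + 2 * (n i + 1)) + (2 + n i * (1 + (1 + 2 * (n i + 1))))"
  have "ptime D e (\<lambda>i. es ((st i ^^ n i) (s0 i)))"
  proof (rule ptime_while[where R = "\<lambda>i. UNIV" and b = b and B = ?B])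
    show "ptime D e (\<lambda>i. es (s0 i))" unfolding es_def s0_def using n by (simp add: ptime_Node ptime_const)
    show "ptime (D \<times> UNIV) (with_arg e es) (\<lambda>j. tv (b (fst j) (snd j)))"
      unfolding b_def by (intro ptime_ops c)
    let ?E = "{j \<in> D \<times> UNIV. b (fst j) (snd j)}"
    have "ptime ?E (with_arg e es) (\<lambda>j. Atom (of_nat (fst (snd j)) - 1))" by (intro ptime_ops c)
    then have "ptime ?E (with_arg e es) (\<lambda>j. Atom (of_nat (fst (snd j) - 1)))"
      by (rule ptime_cong) (auto simp: b_def of_nat_diff)
    then show "ptime ?E (with_arg e es) (\<lambda>j. es (st (fst j) (snd j)))"
      unfolding es_def st_def by (auto intro!: ptime_Node ac[unfolded es_def])
    show "b i ((st i ^^ k) (s0 i))" if "i \<in> D" "k < n i" for i k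
      using that by (auto simp: S b_def)
    show "\<not> b i ((st i ^^ n i) (s0 i))" for i by (auto simp: S b_def)
    show "pbound D (\<lambda>i. vsize (e i)) n" by (rule pn)
    show "pbound D (\<lambda>i. vsize (e i)) ?B" by (intro pbound_intros pn)
    show "vsize (es ((st i ^^ k) (s0 i))) \<le> ?B i" if "i \<in> D" "k \<le> n i" for i k
    proof -
      have "vsize (enc_nats [n i - k..<n i]) \<le> 2 + length (map (\<lambda>k. Atom (of_nat k)) [n i - k..<n i]) * (1 + (1 + 2 * (n i + 1)))"
      proof (rule vsize_enc_list_le)
        fix v assume "v \<in> set (map (\<lambda>k. Atom (of_nat k)) [n i - k..<n i])"
        then obtain l where "v = Atom (of_nat l)" "l < n i" by auto
        then show "vsize v \<le> 1 + 2 * (n i + 1)" using vsize_of_nat_le[of l] by (simp del: vsize.simps)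
      qed
      also have "\<dots> \<le> 2 + n i * (1 + (1 + 2 * (n i + 1)))" using that by (intro add_mono mult_right_mono) auto
      finally have 1: "vsize (enc_nats [n i - k..<n i]) \<le> 2 + n i * (1 + (1 + 2 * (n i + 1)))" .
      have "vsize (Atom (of_nat (n i - k))) \<le> 1 + 2 * (n i + 1)"
        using vsize_of_nat_le[of "n i - k"] by (simp del: vsize.simps)
      then show ?thesis using 1 that unfolding S[OF that(2)] es_def vsize.simps(2) fst_conv snd_conv by linarith
    qed
  qed auto
  then have "ptime D e (\<lambda>i. Node (Atom 0) (enc_nats [0..<n i]))"
    by (rule ptime_cong) (simp add: S es_def)
  then show ?thesis by (rule ptime_Node2)
qed

section \<open>Exact line search\<close>

text \<open>Gain, transport cost and weighted target scenarios of a plan. The search itself looks at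
  the first two components only; the third is carried along to assemble the final plan.\<close>

type_synonym plan_line = "rat \<times> rat \<times> (val \<times> rat) list"

abbreviation gain :: "plan_line \<Rightarrow> rat" where "gain L \<equiv> fst L"
abbreviation transport :: "plan_line \<Rightarrow> rat" where "transport L \<equiv> fst (snd L)"
abbreviation weights :: "plan_line \<Rightarrow> (val \<times> rat) list" where "weights L \<equiv> snd (snd L)"

text \<open>Left end, right end, and the lines that belong to them in the same order.\<close>

type_synonym bracket = "rat \<times> rat \<times> plan_line \<times> plan_line"

definition eval_line :: "rat \<Rightarrow> plan_line \<Rightarrow> rat \<Rightarrow> rat" where
  "eval_line r L y = gain L + y * (r - transport L)"

definition cross :: "plan_line \<Rightarrow> plan_line \<Rightarrow> rat" where
  "cross L L' = (gain L - gain L') / (transport L - transport L')"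

text \<open>The share of \<open>L\<close> at which the mixture uses the budget exactly. For equal
  transport costs the division yields 0, so a pair of two identical lines is read as that line
  alone.\<close>

definition mix_weight :: "rat \<Rightarrow> plan_line \<Rightarrow> plan_line \<Rightarrow> rat" where
  "mix_weight r L L' = (r - transport L') / (transport L - transport L')"

text \<open>The right end \<open>u = 0\<close> of a bracket stands for infinity.\<close>

definition inside :: "rat \<Rightarrow> rat \<Rightarrow> rat \<Rightarrow> bool" where
  "inside l u y \<longleftrightarrow> l < y \<and> (u = 0 \<or> y < u)"

definition bracket_cross :: "bracket \<Rightarrow> rat" where
  "bracket_cross s = cross (fst (snd (snd s))) (snd (snd (snd s)))"

text \<open>A line over budget decreases in the dual variable and belongs on the left, one within
  budget belongs on the right. The resulting pair again straddles the budget.\<close>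

definition replace_end :: "rat \<Rightarrow> plan_line \<Rightarrow> bracket \<Rightarrow> plan_line \<times> plan_line" where
  "replace_end r L s = (if r < transport L then (L, snd (snd (snd s))) else (fst (snd (snd s)), L))"

text \<open>One extra query at the crossing of the two end lines, provided that it falls strictly
  into the bracket. If the crossing does not move, the query there certifies the value of the
  mixture.\<close>

definition refined_pair :: "rat \<Rightarrow> (rat \<Rightarrow> plan_line) \<Rightarrow> bracket \<Rightarrow> plan_line \<times> plan_line" where
  "refined_pair r q s =
     (if inside (fst s) (fst (snd s)) (bracket_cross s) then replace_end r (q (bracket_cross s)) s
      else snd (snd s))"

text \<open>The search continues only while the query has produced a different crossing that also
  lies in the bracket. In every other case some queried point certifies the mixture, as
  \<open>finished_value\<close> shows.\<close>

definition unfinished :: "rat \<Rightarrow> (rat \<Rightarrow> plan_line) \<Rightarrow> bracket \<Rightarrow> bool" where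
  "unfinished r q s \<longleftrightarrow>
     (let y = cross (fst (refined_pair r q s)) (snd (refined_pair r q s))
      in y \<noteq> bracket_cross s \<and> inside (fst s) (fst (snd s)) y)"

text \<open>Without a right end the probes are 1, 3, 7 and so on, one less than the powers of two;
  afterwards the bracket is halved.\<close>

definition probe :: "bracket \<Rightarrow> rat" where
  "probe s = (if fst (snd s) = 0 then 2 * fst s + 1 else (fst s + fst (snd s)) / 2)"

definition bisect :: "rat \<Rightarrow> (rat \<Rightarrow> plan_line) \<Rightarrow> bracket \<Rightarrow> bracket" where
  "bisect r q s =
     (if r < transport (q (probe s)) then (probe s, fst (snd s), q (probe s), snd (snd (snd s)))
      else (fst s, probe s, fst (snd (snd s)), q (probe s)))"

text \<open>The right line is that of the empty plan, which has no gain and no transport cost. It is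
  within any nonnegative budget and needs no query.\<close>

definition first_bracket :: "(rat \<Rightarrow> plan_line) \<Rightarrow> bracket" where
  "first_bracket q = (0, 0, q 0, (0, 0, []))"

text \<open>That the set in question is nonempty depends on the hypotheses of
  \<open>line_search\<close> and on a left end over budget; \<open>search_terminates\<close>
  establishes it.\<close>

definition search_steps :: "rat \<Rightarrow> (rat \<Rightarrow> plan_line) \<Rightarrow> nat" where
  "search_steps r q = (LEAST n. \<not> unfinished r q ((bisect r q ^^ n) (first_bracket q)))"

definition search_pair :: "rat \<Rightarrow> (rat \<Rightarrow> plan_line) \<Rightarrow> plan_line \<times> plan_line" where
  "search_pair r q =
     (if transport (q 0) \<le> r then (q 0, q 0)
      else refined_pair r q ((bisect r q ^^ search_steps r q) (first_bracket q)))"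

definition mix_value :: "rat \<Rightarrow> plan_line \<times> plan_line \<Rightarrow> rat" where
  "mix_value r P = mix_weight r (fst P) (snd P) * gain (fst P)
     + (1 - mix_weight r (fst P) (snd P)) * gain (snd P)"

section \<open>Mixtures of two lines at their crossing\<close>

lemma mix_weight_bounds:
  assumes "transport L' \<le> r" "r < transport L"
  shows "0 \<le> mix_weight r L L'" "mix_weight r L L' \<le> 1"
    "mix_weight r L L' * transport L + (1 - mix_weight r L L') * transport L' = r"
proof -
  have d: "transport L - transport L' > 0" using assms by linarith
  show "0 \<le> mix_weight r L L'" "mix_weight r L L' \<le> 1"
    using assms d by (auto simp: mix_weight_def divide_simps)
  have "mix_weight r L L' * (transport L - transport L') = r - transport L'"
    using d by (simp add: mix_weight_def)
  then show "mix_weight r L L' * transport L + (1 - mix_weight r L L') * transport L' = r"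
    by (simp add: algebra_simps)
qed

text \<open>With these weights the slopes cancel, so the mixture of the two lines is constant. At
  the crossing both lines agree, hence both take that constant value there.\<close>

lemma eval_cross:
  assumes "transport L' \<le> r" "r < transport L"
  shows "eval_line r L (cross L L') = mix_value r (L, L')" "eval_line r L' (cross L L') = mix_value r (L, L')"
proof -
  have d: "transport L - transport L' > 0" using assms by linarith
  have c: "cross L L' * (transport L - transport L') = gain L - gain L'" using d by (simp add: cross_def)
  then have e: "eval_line r L (cross L L') = eval_line r L' (cross L L')"
    by (simp add: eval_line_def algebra_simps)
  let ?w = "mix_weight r L L'"
  have "eval_line r L (cross L L') = ?w * eval_line r L (cross L L') + (1 - ?w) * eval_line r L' (cross L L')"
    using e by (simp add: algebra_simps)
  also have "\<dots> = ?w * gain L + (1 - ?w) * gain L' +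
      cross L L' * (r - (?w * transport L + (1 - ?w) * transport L'))"
    by (simp add: eval_line_def algebra_simps)
  also have "\<dots> = mix_value r (L, L')" using mix_weight_bounds(3)[OF assms] by (simp add: mix_value_def)
  finally show "eval_line r L (cross L L') = mix_value r (L, L')" .
  with e show "eval_line r L' (cross L L') = mix_value r (L, L')" by simp
qed

lemma eval_line_antimono: "r < transport L \<Longrightarrow> y \<le> y' \<Longrightarrow> eval_line r L y' \<le> eval_line r L y"
  by (simp add: eval_line_def mult_right_mono_neg)

lemma eval_line_mono: "transport L \<le> r \<Longrightarrow> y \<le> y' \<Longrightarrow> eval_line r L y \<le> eval_line r L y'"
  by (simp add: eval_line_def mult_right_mono)

lemma exponent_le_of_power_less: "(2::rat) ^ k < 2 ^ b + 1 \<Longrightarrow> k \<le> b"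
proof (rule ccontr)
  assume h: "(2::rat) ^ k < 2 ^ b + 1" "\<not> k \<le> b"
  then have "(2::rat) ^ (b + 1) \<le> 2 ^ k" by (intro power_increasing) auto
  moreover have "(1::rat) \<le> 2 ^ b" by simp
  ultimately show False using h(1) by simp
qed

text \<open>\<open>T\<close> is the value that every answer guarantees at its own query point. The
  single number \<open>b\<close> bounds the sizes of all gains and transport costs and also tells
  from where on answers respect the budget.\<close>

locale line_search =
  fixes r :: rat and q :: "rat \<Rightarrow> plan_line" and T :: real and b :: nat
  assumes r_nonneg: "0 \<le> r"
    and query_value: "0 \<le> y \<Longrightarrow> T \<le> real_of_rat (eval_line r (q y) y)"
    and bits: "0 \<le> y \<Longrightarrow> rat_bits b (gain (q y))" "0 \<le> y \<Longrightarrow> rat_bits b (transport (q y))"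
    and far: "2 ^ b \<le> y \<Longrightarrow> transport (q y) \<le> r"
begin

definition found :: "plan_line set" where
  "found = insert (0, 0, []) (q ` {0..})"

text \<open>After \<open>k\<close> rounds both ends are multiples of 2 to the power
  -\<open>k\<close>, which controls their size. As long as no right end is known, the left end is
  the \<open>k\<close>-th probe; afterwards the width is at most 2 to the power 2 * \<open>b\<close>
  + 1 - \<open>k\<close>.\<close>

definition bracket_inv :: "nat \<Rightarrow> bracket \<Rightarrow> bool" where
  "bracket_inv k s \<longleftrightarrow>
     (let l = fst s; u = fst (snd s); L = fst (snd (snd s)); L' = snd (snd (snd s)) in
       0 \<le> l \<and> L = q l \<and> r < transport L \<and> transport L' \<le> r \<and> L' \<in> found \<and>
       (u = 0 \<longrightarrow> l = 2 ^ k - 1) \<and>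
       (u \<noteq> 0 \<longrightarrow> l < u \<and> u \<le> 2 ^ (b + 1) \<and> L' = q u \<and> 2 ^ k * (u - l) \<le> 2 ^ (2 * b + 1)) \<and>
       (\<exists>n. l * 2 ^ k = of_int n) \<and> (\<exists>n. u * 2 ^ k = of_int n))"

lemma b_pos: "1 \<le> b" using rat_bits_pos[OF bits(1)[of 0]] by simp

lemma found_bits: "L \<in> found \<Longrightarrow> rat_bits b (gain L)" "L \<in> found \<Longrightarrow> rat_bits b (transport L)"
  using bits b_pos rat_bits_of_int[of 0 b] by (auto simp: found_def)

lemma q_found: "0 \<le> y \<Longrightarrow> q y \<in> found" by (auto simp: found_def)

lemma cross_bits: "L \<in> found \<Longrightarrow> L' \<in> found \<Longrightarrow> rat_bits (4 * b + 2) (cross L L')"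
  unfolding cross_def
  by (rule rat_bits_mono[OF rat_bits_divide[OF rat_bits_diff rat_bits_diff]]) (auto intro: found_bits)

lemma left_bound: "0 \<le> y \<Longrightarrow> r < transport (q y) \<Longrightarrow> y < 2 ^ b"
  using far[of y] by force

lemma inv_first: "r < transport (q 0) \<Longrightarrow> bracket_inv 0 (first_bracket q)"
  using r_nonneg by (auto simp: bracket_inv_def first_bracket_def found_def intro: exI[of _ 0])

lemma inv_left: "bracket_inv k s \<Longrightarrow> 0 \<le> fst s \<and> fst s < 2 ^ b \<and> 0 \<le> fst (snd s) \<and> fst (snd s) \<le> 2 ^ (b + 1)"
proof -
  assume i: "bracket_inv k s"
  then have "0 \<le> fst s" "fst s < 2 ^ b" by (auto simp: bracket_inv_def Let_def intro!: left_bound)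
  moreover from this i have "0 \<le> fst (snd s) \<and> fst (snd s) \<le> 2 ^ (b + 1)"
    by (cases "fst (snd s) = 0") (auto simp: bracket_inv_def Let_def)
  ultimately show ?thesis by blast
qed

lemma probe_nonneg: "bracket_inv k s \<Longrightarrow> 0 \<le> probe s"
  using inv_left[of k s] by (auto simp: probe_def)

lemma inv_step: assumes i: "bracket_inv k s" shows "bracket_inv (Suc k) (bisect r q s)"
proof -
  obtain l u L L' where s: "s = (l, u, L, L')" by (cases s) auto
  have h: "0 \<le> l" "L = q l" "r < transport L" "transport L' \<le> r" "L' \<in> found"
      "u = 0 \<Longrightarrow> l = 2 ^ k - 1"
      "u \<noteq> 0 \<Longrightarrow> l < u \<and> u \<le> 2 ^ (b + 1) \<and> L' = q u \<and> 2 ^ k * (u - l) \<le> 2 ^ (2 * b + 1)"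
    and e: "\<exists>n. l * 2 ^ k = of_int n" "\<exists>n. u * 2 ^ k = of_int n"
    using i by (auto simp: bracket_inv_def s)
  obtain n1 n2 where n: "l * 2 ^ k = of_int n1" "u * 2 ^ k = of_int n2" using e by blast
  define m where "m = probe s"
  have m0: "0 \<le> m" using probe_nonneg[OF i] by (simp add: m_def)
  have lb: "l < 2 ^ b" using h left_bound by blast
  have em: "\<exists>n. m * 2 ^ Suc k = of_int n"
  proof (cases "u = 0")
    case True
    then have "m * 2 ^ Suc k = of_int (4 * n1 + 2 ^ Suc k)" using n by (simp add: m_def probe_def s algebra_simps)
    then show ?thesis by blast
  next
    case False
    then have "m * 2 ^ Suc k = of_int (n1 + n2)" using n by (simp add: m_def probe_def s algebra_simps)
    then show ?thesis by blast
  qed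
  have el: "\<exists>n. l * 2 ^ Suc k = of_int n" by (rule exI[of _ "2 * n1"]) (use n in \<open>simp add: algebra_simps\<close>)
  have eu: "\<exists>n. u * 2 ^ Suc k = of_int n" by (rule exI[of _ "2 * n2"]) (use n in \<open>simp add: algebra_simps\<close>)
  have mm: "u = 0 \<Longrightarrow> m = 2 ^ Suc k - 1" "u \<noteq> 0 \<Longrightarrow> m = (l + u) / 2"
    using h(6) by (auto simp: m_def probe_def s)
  have half: "2 ^ Suc k * (u - m) \<le> 2 ^ (2 * b + 1)" "2 ^ Suc k * (m - l) \<le> 2 ^ (2 * b + 1)" if "u \<noteq> 0"
  proof -
    have e: "u - m = (u - l) / 2" "m - l = (u - l) / 2" using mm(2)[OF that] by (simp_all add: field_simps)
    have "2 ^ Suc k * ((u - l) / 2) = 2 ^ k * (u - l)" by simp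
    then show "2 ^ Suc k * (u - m) \<le> 2 ^ (2 * b + 1)" "2 ^ Suc k * (m - l) \<le> 2 ^ (2 * b + 1)"
      using h(7)[OF that] unfolding e by simp_all
  qed
  \<comment> \<open>The first finite bracket has width 2 to the power \<open>k\<close>, where
    \<open>k\<close> is at most \<open>b\<close> since the left end is over budget. This is the
    origin of the exponent 2 * \<open>b\<close> + 1.\<close>
  have new: "2 ^ Suc k * (m - l) \<le> 2 ^ (2 * b + 1)" if "u = 0"
  proof -
    have "(2::rat) ^ k < 2 ^ b + 1" using lb h(6)[OF that] by linarith
    then have kb: "(2::rat) ^ k \<le> 2 ^ b" using exponent_le_of_power_less by simp
    have "m - l = 2 ^ k" using mm(1)[OF that] h(6)[OF that] by simp
    then have "2 ^ Suc k * (m - l) = 2 * (2 ^ k * 2 ^ k)" by simp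
    also have "\<dots> \<le> 2 * (2 ^ b * 2 ^ b)" using kb by (intro mult_left_mono mult_mono) auto
    also have "\<dots> = 2 ^ (b + b + 1)" by (simp add: power_add)
    also have "b + b + 1 = 2 * b + 1" by simp
    finally show ?thesis .
  qed
  show ?thesis
  proof (cases "r < transport (q m)")
    case True
    then have "bisect r q s = (m, u, q m, L')" by (simp add: bisect_def m_def) (simp add: s)
    then show ?thesis using True m0 em eu h(4,5,7) mm half by (auto simp: bracket_inv_def)
  next
    case False
    then have b': "bisect r q s = (l, m, L, q m)" by (simp add: bisect_def m_def) (simp add: s)
    have "l < m" using mm h(7) by (cases "u = 0") (auto simp: h(6))
    moreover have "m \<le> 2 ^ (b + 1)"
    proof (cases "u = 0")
      case True
      then have "m = 2 * l + 1" by (simp add: m_def probe_def s)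
      moreover have "l \<le> 2 ^ b - 1"
      proof -
        have "(2::rat) ^ k < 2 ^ b + 1" using lb h(6)[OF True] by linarith
        then show ?thesis using exponent_le_of_power_less h(6)[OF True] by simp
      qed
      ultimately show ?thesis by simp
    next
      case False
      then show ?thesis using mm(2) h(7) by simp
    qed
    moreover have "2 ^ Suc k * (m - l) \<le> 2 ^ (2 * b + 1)" using half new by blast
    ultimately show ?thesis using False m0 em el h(1,2,3) unfolding b'
      by (auto simp: bracket_inv_def q_found)
  qed
qed

lemma inv_all: "r < transport (q 0) \<Longrightarrow> bracket_inv k ((bisect r q ^^ k) (first_bracket q))"
  by (induction k) (auto simp: inv_first inv_step)

lemma refined_pair_found:
  assumes "bracket_inv k s"
  shows "fst (refined_pair r q s) \<in> found" "snd (refined_pair r q s) \<in> found"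
    "r < transport (fst (refined_pair r q s))" "transport (snd (refined_pair r q s)) \<le> r"
proof -
  have y: "inside (fst s) (fst (snd s)) (bracket_cross s) \<Longrightarrow> 0 \<le> bracket_cross s"
    using inv_left[OF assms] by (auto simp: inside_def)
  show "fst (refined_pair r q s) \<in> found" "snd (refined_pair r q s) \<in> found"
    "r < transport (fst (refined_pair r q s))" "transport (snd (refined_pair r q s)) \<le> r"
    using assms y by (auto simp: refined_pair_def replace_end_def bracket_inv_def Let_def q_found)
qed

text \<open>With a finite right end, being unfinished means that two different crossings lie in the
  bracket. Each has 4 * \<open>b\<close> + 2 bits, so they are more than 2 to the power -(8 *
  \<open>b\<close> + 4) apart; comparing this with the width in \<open>bracket_inv\<close> gives 10
  * \<open>b\<close> + 5.\<close>

lemma unfinished_bound: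
  assumes i: "bracket_inv k s" and un: "unfinished r q s" shows "k < 10 * b + 5"
proof (cases "fst (snd s) = 0")
  case True
  then have "(2::rat) ^ k - 1 < 2 ^ b" using inv_left[OF i] i by (auto simp: bracket_inv_def Let_def)
  then have "k \<le> b" by (intro exponent_le_of_power_less) simp
  then show ?thesis by simp
next
  case False
  let ?P = "refined_pair r q s"
  define y where "y = bracket_cross s"
  define y' where "y' = cross (fst ?P) (snd ?P)"
  have ne: "y' \<noteq> y" and in': "inside (fst s) (fst (snd s)) y'"
    using un by (auto simp: unfinished_def y_def y'_def Let_def)
  have "inside (fst s) (fst (snd s)) y"
  proof (rule ccontr)
    assume "\<not> inside (fst s) (fst (snd s)) y"
    then have "y' = y" by (simp add: y'_def y_def refined_pair_def bracket_cross_def)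
    with ne show False by simp
  qed
  then have d: "\<bar>y' - y\<bar> \<le> fst (snd s) - fst s" using in' False by (auto simp: inside_def)
  have "rat_bits (4 * b + 2) y'" unfolding y'_def using refined_pair_found[OF i] by (intro cross_bits) auto
  moreover have "rat_bits (4 * b + 2) y" unfolding y_def bracket_cross_def
    using i by (intro cross_bits) (auto simp: bracket_inv_def Let_def q_found)
  ultimately have "1 < 2 ^ ((4 * b + 2) + (4 * b + 2)) * \<bar>y' - y\<bar>" using ne by (rule rat_bits_separation)
  also have "\<dots> \<le> 2 ^ ((4 * b + 2) + (4 * b + 2)) * (fst (snd s) - fst s)" using d by (intro mult_left_mono) auto
  finally have 1: "1 < 2 ^ ((4 * b + 2) + (4 * b + 2)) * (fst (snd s) - fst s)" .
  have "(2::rat) ^ k * 1 < 2 ^ k * (2 ^ ((4 * b + 2) + (4 * b + 2)) * (fst (snd s) - fst s))"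
    using 1 by (intro mult_strict_left_mono) auto
  also have "\<dots> = 2 ^ ((4 * b + 2) + (4 * b + 2)) * (2 ^ k * (fst (snd s) - fst s))" by (simp only: ac_simps)
  also have "\<dots> \<le> 2 ^ ((4 * b + 2) + (4 * b + 2)) * 2 ^ (2 * b + 1)"
    using i False by (intro mult_left_mono) (auto simp: bracket_inv_def Let_def)
  also have "\<dots> = 2 ^ (10 * b + 5)" unfolding power_add[symmetric] by (rule arg_cong[of _ _ "(^) 2"]) simp
  finally have "(2::rat) ^ k < 2 ^ (10 * b + 5)" by simp
  then show ?thesis by simp
qed

lemma search_terminates:
  assumes "r < transport (q 0)"
  shows "search_steps r q \<le> 10 * b + 5"
    "\<not> unfinished r q ((bisect r q ^^ search_steps r q) (first_bracket q))"
    "k < search_steps r q \<Longrightarrow> unfinished r q ((bisect r q ^^ k) (first_bracket q))"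
proof -
  let ?P = "\<lambda>n. \<not> unfinished r q ((bisect r q ^^ n) (first_bracket q))"
  have P: "?P (10 * b + 5)" using unfinished_bound[OF inv_all[OF assms]] by blast
  show "search_steps r q \<le> 10 * b + 5" unfolding search_steps_def by (rule Least_le) (rule P)
  show "?P (search_steps r q)" unfolding search_steps_def by (rule LeastI[of ?P, OF P])
  show "k < search_steps r q \<Longrightarrow> unfinished r q ((bisect r q ^^ k) (first_bracket q))"
    unfolding search_steps_def using not_less_Least by blast
qed

text \<open>The mixture has the value of its two lines at their crossing. A line over budget is at
  least \<open>T\<close> everywhere to the left of its query point, a line within budget everywhere
  to the right. If the crossing stayed where it was queried or lies outside the bracket, it is on
  the good side of one of the queried points.\<close>

lemma finished_value:
  assumes i: "bracket_inv k s" and fin: "\<not> unfinished r q s"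
  shows "T \<le> real_of_rat (mix_value r (refined_pair r q s))"
proof -
  obtain l u L L' where s: "s = (l, u, L, L')" by (cases s) auto
  have h: "0 \<le> l" "L = q l" "r < transport L" "transport L' \<le> r" "u \<noteq> 0 \<Longrightarrow> L' = q u" "u \<noteq> 0 \<Longrightarrow> l < u"
    using i by (auto simp: bracket_inv_def s)
  have le: "T \<le> real_of_rat a \<Longrightarrow> a \<le> c \<Longrightarrow> T \<le> real_of_rat c" for a c
    using of_rat_less_eq order_trans by blast
  have vl: "T \<le> real_of_rat (eval_line r L l)" using h query_value by blast
  have vu: "u \<noteq> 0 \<Longrightarrow> T \<le> real_of_rat (eval_line r L' u)" using h query_value[of u] by fastforce
  let ?P = "refined_pair r q s"
  note P = refined_pair_found(3,4)[OF i]
  define y where "y = cross L L'"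
  define y' where "y' = cross (fst ?P) (snd ?P)"
  have ev: "eval_line r (fst ?P) y' = mix_value r ?P" "eval_line r (snd ?P) y' = mix_value r ?P"
    using eval_cross[OF P(2,1)] by (simp_all add: y'_def)
  have f: "y' = y \<or> \<not> inside l u y'"
    using fin by (auto simp: unfinished_def s bracket_cross_def Let_def y_def y'_def)
  show ?thesis
  proof (cases "inside l u y")
    case False
    then have Pe: "?P = (L, L')" by (simp add: refined_pair_def s bracket_cross_def y_def)
    then have yy: "y' = y" by (simp add: y'_def y_def)
    show ?thesis
    proof (cases "y \<le> l")
      case True
      then show ?thesis using le[OF vl eval_line_antimono[OF h(3), of y l]] ev(1) Pe yy by simp
    next
      case nl: False
      then have "u \<noteq> 0" "u \<le> y" using False by (auto simp: inside_def)
      then show ?thesis using le[OF vu eval_line_mono[OF h(4), of u y]] ev(2) Pe yy by simp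
    qed
  next
    case True
    then have y0: "0 \<le> y" "l < y" and yu: "u \<noteq> 0 \<Longrightarrow> y < u" using h(1) by (auto simp: inside_def)
    define M where "M = q y"
    have vM: "T \<le> real_of_rat (eval_line r M y)" using query_value y0 by (simp add: M_def)
    have Pe: "?P = (if r < transport M then (M, L') else (L, M))"
      using True by (simp add: refined_pair_def s bracket_cross_def y_def M_def replace_end_def)
    show ?thesis
    proof (cases "r < transport M")
      case Mr: True
      consider "y' \<le> y" | "y < y'" "u \<noteq> 0" "u \<le> y'" using f y0 by (fastforce simp: inside_def)
      then show ?thesis
      proof cases
        case 1
        then show ?thesis using le[OF vM eval_line_antimono[OF Mr 1]] ev(1) Pe Mr by simp
      next
        case 2
        then show ?thesis using le[OF vu[OF 2(2)] eval_line_mono[OF h(4) 2(3)]] ev(2) Pe Mr by simp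
      qed
    next
      case Mr: False
      then have Mr': "transport M \<le> r" by simp
      consider "y \<le> y'" | "y' \<le> l" using f y0 yu by (fastforce simp: inside_def)
      then show ?thesis
      proof cases
        case 1
        then show ?thesis using le[OF vM eval_line_mono[OF Mr' 1]] ev(2) Pe Mr by simp
      next
        case 2
        then show ?thesis using le[OF vl eval_line_antimono[OF h(3) 2]] ev(1) Pe Mr by simp
      qed
    qed
  qed
qed

lemma search_pair_correct:
  shows "fst (search_pair r q) \<in> found" "snd (search_pair r q) \<in> found"
    "transport (snd (search_pair r q)) \<le> r"
    "r < transport (fst (search_pair r q)) \<or> fst (search_pair r q) = snd (search_pair r q)"
    "T \<le> real_of_rat (mix_value r (search_pair r q))"
proof -
  let ?s = "(bisect r q ^^ search_steps r q) (first_bracket q)"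
  have "fst (search_pair r q) \<in> found \<and> snd (search_pair r q) \<in> found \<and>
    transport (snd (search_pair r q)) \<le> r \<and>
    (r < transport (fst (search_pair r q)) \<or> fst (search_pair r q) = snd (search_pair r q)) \<and>
    T \<le> real_of_rat (mix_value r (search_pair r q))"
  proof (cases "transport (q 0) \<le> r")
    case True
    then show ?thesis using query_value[of 0]
      by (auto simp: search_pair_def q_found mix_value_def mix_weight_def eval_line_def)
  next
    case False
    then have i: "bracket_inv (search_steps r q) ?s" using inv_all by simp
    show ?thesis
      using False refined_pair_found[OF i] finished_value[OF i] search_terminates(2) by (auto simp: search_pair_def)
  qed
  then show "fst (search_pair r q) \<in> found" "snd (search_pair r q) \<in> found"
    "transport (snd (search_pair r q)) \<le> r"
    "r < transport (fst (search_pair r q)) \<or> fst (search_pair r q) = snd (search_pair r q)"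
    "T \<le> real_of_rat (mix_value r (search_pair r q))" by blast+
qed

text \<open>Read off from the dyadic invariant; iterating the rules for sums and quotients would be
  far too weak.\<close>

lemma bracket_ends_bits:
  assumes "bracket_inv k s"
  shows "rat_bits (b + k + 2) (fst s)" "rat_bits (b + k + 2) (fst (snd s))"
proof -
  have i: "0 \<le> fst s" "fst s \<le> 2 ^ (b + 1)" "0 \<le> fst (snd s)" "fst (snd s) \<le> 2 ^ (b + 1)"
    using inv_left[OF assms] by auto
  obtain n1 n2 where n: "fst s * 2 ^ k = of_int n1" "fst (snd s) * 2 ^ k = of_int n2"
    using assms by (auto simp: bracket_inv_def Let_def)
  have "rat_bits ((b + 1) + (k + 1)) (fst s)"
    by (rule rat_bits_of_denominator[where y = "2 ^ k" and x = n1]) (use n i in auto)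
  then show "rat_bits (b + k + 2) (fst s)" by simp
  have "rat_bits ((b + 1) + (k + 1)) (fst (snd s))"
    by (rule rat_bits_of_denominator[where y = "2 ^ k" and x = n2]) (use n i in auto)
  then show "rat_bits (b + k + 2) (fst (snd s))" by simp
qed

end

section \<open>Cutting simplices through their centroids\<close>

definition in_simplex :: "nat \<Rightarrow> (nat \<Rightarrow> nat \<Rightarrow> real) \<Rightarrow> (nat \<Rightarrow> real) \<Rightarrow> bool" where
  "in_simplex m v p \<longleftrightarrow>
     (\<exists>l. (\<forall>i\<le>m. 0 \<le> l i) \<and> (\<Sum>i\<le>m. l i) = 1 \<and> (\<forall>j<m. p j = (\<Sum>i\<le>m. l i * v i j)))"

text \<open>Vertices as rows, each extended by a final 1. The absolute value of the determinant is
  the volume of the simplex times the factorial of \<open>m\<close>.\<close>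

definition homog :: "nat \<Rightarrow> (nat \<Rightarrow> nat \<Rightarrow> real) \<Rightarrow> real mat" where
  "homog m v = mat (Suc m) (Suc m) (\<lambda>(i, j). if j < m then v i j else 1)"

lemma homog_carrier: "homog m v \<in> carrier_mat (Suc m) (Suc m)"
  by (simp add: homog_def)

text \<open>The Leibniz expansion has \<open>fact n\<close> terms of absolute value at most 1. This
  crude estimate suffices, as only the \<open>m\<close>-th root of the factor matters later.\<close>

lemma abs_det_stochastic:
  fixes A :: "real mat"
  assumes A: "A \<in> carrier_mat n n" and e: "\<And>i j. i < n \<Longrightarrow> j < n \<Longrightarrow> 0 \<le> A $$ (i, j) \<and> A $$ (i, j) \<le> 1"
  shows "\<bar>det A\<bar> \<le> fact n"
proof -
  have "\<bar>det A\<bar> \<le> (\<Sum>p | p permutes {0..<n}. \<bar>signof p * (\<Prod>i = 0..<n. A $$ (i, p i))\<bar>)"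
    unfolding det_def'[OF A] by (rule sum_abs)
  also have "\<dots> \<le> (\<Sum>p | p permutes {0..<n}. 1)"
  proof (rule sum_mono)
    fix p assume "p \<in> {p. p permutes {0..<n}}"
    then have p: "p i < n" if "i < n" for i using that by (auto dest: permutes_in_image[of p _ i])
    have "(\<Prod>i = 0..<n. A $$ (i, p i)) \<le> 1" "0 \<le> (\<Prod>i = 0..<n. A $$ (i, p i))"
      using e p by (auto intro!: prod_le_1 prod_nonneg)
    moreover have "\<bar>signof p :: real\<bar> = 1" by (simp add: sign_def)
    ultimately show "\<bar>signof p * (\<Prod>i = 0..<n. A $$ (i, p i))\<bar> \<le> 1" by (simp add: abs_mult)
  qed
  also have "\<dots> = fact n" using card_permutations[of "{0..<n}" n] by simp
  finally show ?thesis .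
qed

text \<open>The matrix factors into a scaled simplex at the origin and a translation by
  \<open>c\<close>, both triangular. The vertex with index \<open>m\<close> is the corner
  \<open>c\<close> itself.\<close>

lemma det_corner_simplex: "det (homog m (\<lambda>k j. c j + (if j = k then \<eta> else 0))) = \<eta> ^ m"
proof -
  let ?U = "mat (Suc m) (Suc m) (\<lambda>(i, j). if j = m then 1 else if i = j then \<eta> else 0) :: real mat"
  let ?L = "mat (Suc m) (Suc m) (\<lambda>(i, j). if i = j then 1 else if i = m then c j else 0) :: real mat"
  have "homog m (\<lambda>k j. c j + (if j = k then \<eta> else 0)) = ?U * ?L"
  proof (rule eq_matI)
    fix i j assume ij: "i < dim_row (?U * ?L)" "j < dim_col (?U * ?L)"
    have "(?U * ?L) $$ (i, j) = (\<Sum>k = 0..<Suc m. ?U $$ (i, k) * ?L $$ (k, j))"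
      using ij by (simp add: scalar_prod_def)
    also have "\<dots> = (\<Sum>k = 0..<Suc m. (if k = m then (if j = m then 1 else c j) else 0) +
        (if k = j then (if k < m \<and> i = k then \<eta> else 0) else 0))"
      using ij by (intro sum.cong refl) auto
    also have "\<dots> = (if j = m then 1 else c j) + (if j < m \<and> i = j then \<eta> else 0)"
      using ij by (auto simp: sum.distrib)
    finally show "homog m (\<lambda>k j. c j + (if j = k then \<eta> else 0)) $$ (i, j) = (?U * ?L) $$ (i, j)"
      using ij by (auto simp: homog_def)
  qed (auto simp: homog_def)
  moreover have "det (?U * ?L) = det ?U * det ?L" by (rule det_mult[of _ "Suc m"]) auto
  moreover have "det ?U = \<eta> ^ m"
  proof -
    have "det ?U = prod_list (diag_mat ?U)" by (rule det_upper_triangular[of _ "Suc m"]) auto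
    also have "\<dots> = (\<Prod>i = 0..<Suc m. if i = m then 1 else \<eta>)"
      by (simp add: prod_list_diag_prod)
    also have "\<dots> = \<eta> ^ m" by simp
    finally show ?thesis .
  qed
  moreover have "det ?L = 1"
  proof -
    have "det ?L = prod_list (diag_mat ?L)" by (rule det_lower_triangular[of "Suc m"]) auto
    also have "\<dots> = 1" by (simp add: prod_list_diag_prod)
    finally show ?thesis .
  qed
  ultimately show ?thesis by simp
qed

text \<open>The barycentric coordinates of the corners form a matrix that maps the vertices of the
  large simplex to those of the small one. Its entries lie between 0 and 1, so its determinant is at
  most a factorial.\<close>

lemma det_lower_bound:
  assumes "\<And>k. k \<le> m \<Longrightarrow> in_simplex m v (\<lambda>j. c j + (if j = k then \<eta> else 0))"
  shows "\<bar>\<eta> ^ m\<bar> \<le> fact (Suc m) * \<bar>det (homog m v)\<bar>"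
proof -
  obtain l where l: "\<And>k. k \<le> m \<Longrightarrow> (\<forall>i\<le>m. 0 \<le> l k i) \<and> (\<Sum>i\<le>m. l k i) = 1 \<and>
      (\<forall>j<m. c j + (if j = k then \<eta> else 0) = (\<Sum>i\<le>m. l k i * v i j))"
    using assms unfolding in_simplex_def by metis
  let ?L = "mat (Suc m) (Suc m) (\<lambda>(k, i). l k i)"
  have "homog m (\<lambda>k j. c j + (if j = k then \<eta> else 0)) = ?L * homog m v"
  proof (rule eq_matI)
    fix i j assume ij: "i < dim_row (?L * homog m v)" "j < dim_col (?L * homog m v)"
    have "(?L * homog m v) $$ (i, j) = (\<Sum>k = 0..<Suc m. l i k * (if j < m then v k j else 1))"
      using ij by (simp add: scalar_prod_def homog_def)
    also have "\<dots> = (\<Sum>k\<le>m. l i k * (if j < m then v k j else 1))"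
      by (simp add: atLeast0LessThan lessThan_Suc_atMost)
    finally show "homog m (\<lambda>k j. c j + (if j = k then \<eta> else 0)) $$ (i, j) = (?L * homog m v) $$ (i, j)"
      using ij l[of i] by (auto simp: homog_def)
  qed (auto simp: homog_def)
  then have "\<eta> ^ m = det (?L * homog m v)" by (simp add: det_corner_simplex[symmetric, of _ m c])
  also have "\<dots> = det ?L * det (homog m v)" by (rule det_mult[of _ "Suc m"]) (auto simp: homog_def)
  finally have "\<bar>\<eta> ^ m\<bar> = \<bar>det ?L\<bar> * \<bar>det (homog m v)\<bar>" by (simp add: abs_mult)
  also have "\<dots> \<le> fact (Suc m) * \<bar>det (homog m v)\<bar>"
  proof (rule mult_right_mono[OF abs_det_stochastic])
    fix i j assume "i < Suc m" "j < Suc m"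
    moreover from this have "l i j \<le> (\<Sum>k\<le>m. l i k)" using l[of i] by (intro member_le_sum) auto
    ultimately show "0 \<le> ?L $$ (i, j) \<and> ?L $$ (i, j) \<le> 1" using l[of i] by auto
  qed auto
  finally show ?thesis .
qed

lemma in_simplex_cong:
  assumes "\<And>i j. i \<le> m \<Longrightarrow> j < m \<Longrightarrow> v i j = w i j" "in_simplex m v p"
  shows "in_simplex m w p"
proof -
  obtain l where l: "\<forall>i\<le>m. 0 \<le> l i" "(\<Sum>i\<le>m. l i) = 1" "\<forall>j<m. p j = (\<Sum>i\<le>m. l i * v i j)"
    using assms(2) unfolding in_simplex_def by blast
  have "(\<Sum>i\<le>m. l i * v i j) = (\<Sum>i\<le>m. l i * w i j)" if "j < m" for j
    by (rule sum.cong) (use assms(1) that in auto)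
  with l show ?thesis unfolding in_simplex_def by (intro exI[of _ l]) simp
qed

lemma homog_cong:
  "(\<And>i j. i \<le> m \<Longrightarrow> j < m \<Longrightarrow> v i j = w i j) \<Longrightarrow> homog m v = homog m w"
  by (rule eq_matI) (auto simp: homog_def)

text \<open>The simplex cut from the nonnegative orthant by a coordinate sum of at most
  \<open>m\<close> * \<open>r\<close> contains the whole box. The last coordinate belongs to the
  origin and takes the remaining weight.\<close>

lemma in_start_simplex:
  assumes "0 < r" "\<And>j. j < m \<Longrightarrow> 0 \<le> p j \<and> p j \<le> r"
  shows "in_simplex m (\<lambda>k j. if j = k then real m * r else 0) p"
proof -
  define l where "l i = (if i < m then p i / (real m * r) else 1 - (\<Sum>j<m. p j) / (real m * r))" for i
  have s: "(\<Sum>i\<le>m. f i) = (\<Sum>i<m. f i) + f m" for f :: "nat \<Rightarrow> real"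
    using sum.lessThan_Suc[of f m] by (simp add: lessThan_Suc_atMost)
  have sp: "(\<Sum>j<m. p j) \<le> real m * r" using sum_bounded_above[of "{..<m}" p r] assms by simp
  show ?thesis unfolding in_simplex_def
  proof (intro exI[of _ l] conjI allI impI)
    fix i assume "i \<le> m"
    show "0 \<le> l i"
    proof (cases "i < m")
      case True
      then show ?thesis using assms by (simp add: l_def)
    next
      case False
      have "(\<Sum>j<m. p j) / (real m * r) \<le> 1"
        using sp assms(1) by (cases "m = 0") (auto simp: divide_le_eq_1)
      then show ?thesis using False by (simp add: l_def)
    qed
  next
    show "(\<Sum>i\<le>m. l i) = 1" unfolding s by (simp add: l_def sum_divide_distrib)
    fix j assume j: "j < m"
    have "(\<Sum>i\<le>m. l i * (if j = i then real m * r else 0)) = l j * (real m * r)"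
    proof -
      have "(\<Sum>i\<le>m. l i * (if j = i then real m * r else 0)) = (\<Sum>i\<le>m. if i = j then l j * (real m * r) else 0)"
        by (rule sum.cong) auto
      then show ?thesis using j by simp
    qed
    then show "p j = (\<Sum>i\<le>m. l i * (if j = i then real m * r else 0))" using j assms(1) by (simp add: l_def)
  qed
qed

text \<open>Let l be barycentric coordinates. The kept half says that the sum of l i *
  \<open>a i\<close> over all i other than \<open>b\<close> is at most l b * (- \<open>a b\<close>).
  Rounded multiples \<open>\<beta> i\<close> of the ratios \<open>a i\<close> / (-
  \<open>a b\<close>) define a weaker inequality, and the new simplex arises by sliding each other
  vertex along its line through \<open>v b\<close>. The exact multiples sum to 2 * \<open>m\<close>,
  so rounding \<open>m\<close> of them down leaves at least \<open>m\<close>. \<open>M\<close> is so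
  large that second-order effects consume only half of the gain, and integrality of
  \<open>\<beta>\<close> and \<open>M\<close> keeps denominators small.\<close>

locale simplex_cut =
  fixes m :: nat and v :: "nat \<Rightarrow> nat \<Rightarrow> real" and d x a :: "nat \<Rightarrow> real" and b :: nat
    and \<beta> :: "nat \<Rightarrow> int" and M :: real
  assumes m: "1 \<le> m" and b: "b \<le> m"
    and x: "\<And>j. x j = (\<Sum>i\<le>m. v i j) / (real m + 1)"
    and a: "\<And>i. a i = (\<Sum>j<m. d j * (v i j - x j))"
    and a_min: "\<And>i. i \<le> m \<Longrightarrow> a b \<le> a i"
    and beta: "\<And>i. \<beta> i = (if i = b then 0 else \<lfloor>2 * real m * a i / (- a b)\<rfloor>)"
    and M: "M = 16 * real m ^ 4"
begin

definition v' where "v' i j = (real_of_int (\<beta> i) * v b j + M * v i j) / (M + real_of_int (\<beta> i))"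

lemma sum_a: "(\<Sum>i\<le>m. a i) = 0"
proof -
  have "(\<Sum>i\<le>m. a i) = (\<Sum>j<m. d j * (\<Sum>i\<le>m. v i j - x j))"
    unfolding a sum_distrib_left by (rule sum.swap)
  also have "\<dots> = 0"
  proof (rule sum.neutral, rule ballI)
    fix j
    have "real m + 1 \<noteq> 0" by linarith
    then have "(\<Sum>i\<le>m. v i j - x j) = 0" by (simp add: sum_subtractf x add.commute)
    then show "d j * (\<Sum>i\<le>m. v i j - x j) = 0" by simp
  qed
  finally show ?thesis .
qed

lemma a_b_nonpos: "a b \<le> 0"
proof (rule ccontr)
  assume "\<not> a b \<le> 0"
  then have "(\<Sum>i\<le>m. a i) > 0" using a_min by (intro sum_pos) (auto simp: not_le intro: order_less_le_trans)
  then show False using sum_a by simp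
qed

lemma sum_a_others: "(\<Sum>i\<in>{..m} - {b}. a i) = - a b"
  using sum_a sum.remove[of "{..m}" b a] b by simp

text \<open>All slopes add up to zero, as they are taken at the centroid, and each of the other
  \<open>m\<close> slopes is at least \<open>a b\<close>.\<close>

lemma a_upper: assumes "i \<le> m" shows "a i \<le> real m * (- a b)"
proof -
  have "(\<Sum>k\<in>{..m} - {i}. a b) \<le> (\<Sum>k\<in>{..m} - {i}. a k)" by (rule sum_mono) (use a_min in auto)
  moreover have "(\<Sum>k\<in>{..m} - {i}. a b) = real m * a b" using assms by (simp add: card_Diff_singleton)
  moreover have "a i + (\<Sum>k\<in>{..m} - {i}. a k) = 0" using sum_a sum.remove[of "{..m}" i a] assms by simp
  ultimately show ?thesis by linarith
qed

lemma beta_bounds: assumes "i \<le> m" shows "- 2 * int m \<le> \<beta> i" "\<beta> i \<le> 2 * int m ^ 2"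
proof -
  have "- 2 * int m \<le> \<beta> i \<and> \<beta> i \<le> 2 * int m ^ 2"
  proof (cases "i = b \<or> a b = 0")
    \<comment> \<open>For \<open>a b = 0\<close> the quotient is 0 by the convention for division.
      The size bounds for vertices also have to cover this degenerate cut.\<close>
    case True
    then show ?thesis by (auto simp: beta)
  next
    case False
    then have ab: "a b < 0" using a_b_nonpos by simp
    have "2 * real m * (-1) \<le> 2 * real m * (a i / (- a b))"
      using a_min[OF assms] ab by (intro mult_left_mono) (auto simp: divide_simps)
    then have "of_int (- 2 * int m) \<le> 2 * real m * a i / (- a b)" by simp
    then have 1: "- 2 * int m \<le> \<lfloor>2 * real m * a i / (- a b)\<rfloor>" by (rule le_floor_iff[THEN iffD2])
    have "2 * real m * (a i / (- a b)) \<le> 2 * real m * real m"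
      using a_upper[OF assms] ab by (intro mult_left_mono) (auto simp: divide_simps)
    then have "\<lfloor>2 * real m * a i / (- a b)\<rfloor> \<le> \<lfloor>real_of_int (2 * int m ^ 2)\<rfloor>"
      by (intro floor_mono) (simp add: power2_eq_square)
    then show ?thesis using 1 False by (simp add: beta del: of_int_mult)
  qed
  then show "- 2 * int m \<le> \<beta> i" "\<beta> i \<le> 2 * int m ^ 2" by auto
qed

lemma real_beta_bounds: assumes "i \<le> m" shows "- 2 * real m \<le> \<beta> i" "real_of_int (\<beta> i) \<le> 2 * real m ^ 2"
proof -
  have "real_of_int (- 2 * int m) \<le> \<beta> i" using beta_bounds(1)[OF assms] by (simp only: of_int_le_iff)
  then show "- 2 * real m \<le> \<beta> i" by simp
  have "real_of_int (\<beta> i) \<le> real_of_int (2 * int m ^ 2)" using beta_bounds(2)[OF assms] by (simp only: of_int_le_iff)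
  then show "real_of_int (\<beta> i) \<le> 2 * real m ^ 2" by simp
qed

lemma m_powers: "real m \<le> real m ^ 4" "real m ^ 2 \<le> real m ^ 4" "0 \<le> real m ^ 4"
  using m power_increasing[of 1 4 "real m"] power_increasing[of 2 4 "real m"] by auto

lemma M_pos: "M > 0" using m by (simp add: M)

lemma denominator_ge: "i \<le> m \<Longrightarrow> 14 * real m ^ 4 \<le> M + real_of_int (\<beta> i)"
  using real_beta_bounds(1)[of i] m_powers unfolding M by linarith

lemma denominator_pos: "i \<le> m \<Longrightarrow> 0 < M + real_of_int (\<beta> i)"
proof -
  assume "i \<le> m"
  moreover have "0 < 14 * real m ^ 4" using m by simp
  ultimately show ?thesis using denominator_ge by (metis order_less_le_trans)
qed

text \<open>\<open>\<beta> i\<close> may be negative, so a new vertex may leave the old simplex. Its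
  coefficients have absolute sum at most 18 / 14, since \<open>\<beta> i\<close> is at most an
  eighth of \<open>M\<close> in absolute value.\<close>

lemma v'_bound:
  assumes "i \<le> m" "\<bar>v i j\<bar> \<le> B" "\<bar>v b j\<bar> \<le> B" shows "\<bar>v' i j\<bar> \<le> 2 * B"
proof -
  have B: "0 \<le> B" using assms(2) by linarith
  have "\<bar>real_of_int (\<beta> i)\<bar> \<le> 2 * real m ^ 4"
    using real_beta_bounds[OF assms(1)] m_powers by linarith
  then have "\<bar>real_of_int (\<beta> i)\<bar> * \<bar>v b j\<bar> \<le> (2 * real m ^ 4) * B" using assms by (intro mult_mono) auto
  moreover have "M * \<bar>v i j\<bar> \<le> M * B" using assms M_pos by (intro mult_left_mono) auto
  moreover have "\<bar>real_of_int (\<beta> i) * v b j + M * v i j\<bar> \<le> \<bar>real_of_int (\<beta> i)\<bar> * \<bar>v b j\<bar> + M * \<bar>v i j\<bar>"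
    using abs_triangle_ineq[of "real_of_int (\<beta> i) * v b j" "M * v i j"] M_pos by (simp add: abs_mult)
  ultimately have "\<bar>real_of_int (\<beta> i) * v b j + M * v i j\<bar> \<le> (2 * real m ^ 4) * B + M * B" by linarith
  also have "\<dots> = 9 * (2 * real m ^ 4 * B)" by (simp add: M)
  also have "\<dots> \<le> 14 * (2 * real m ^ 4 * B)" using B by (intro mult_right_mono) auto
  also have "\<dots> = (2 * B) * (14 * real m ^ 4)" by simp
  also have "\<dots> \<le> (2 * B) * (M + real_of_int (\<beta> i))"
    using denominator_ge[OF assms(1)] B by (intro mult_left_mono) auto
  finally show ?thesis using denominator_pos[OF assms(1)]
    by (simp add: v'_def abs_divide pos_divide_le_eq)
qed

lemma slope_combination:
  assumes "(\<Sum>i\<le>m. l i) = 1" "\<forall>j<m. p j = (\<Sum>i\<le>m. l i * v i j)"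
  shows "(\<Sum>i\<le>m. l i * a i) = (\<Sum>j<m. d j * (p j - x j))"
proof -
  have "(\<Sum>i\<le>m. l i * a i) = (\<Sum>j<m. \<Sum>i\<le>m. l i * (d j * (v i j - x j)))"
    unfolding a sum_distrib_left by (rule sum.swap)
  also have "\<dots> = (\<Sum>j<m. d j * (p j - x j))"
  proof (rule sum.cong[OF refl])
    fix j assume "j \<in> {..<m}"
    then have "(\<Sum>i\<le>m. l i * (v i j - x j)) = p j - x j"
      using assms by (simp add: right_diff_distrib sum_subtractf flip: sum_distrib_right)
    then show "(\<Sum>i\<le>m. l i * (d j * (v i j - x j))) = d j * (p j - x j)"
      by (simp add: sum_distrib_left[of "d j", symmetric] mult.left_commute)
  qed
  finally show ?thesis .
qed

text \<open>A linear functional attains its minimum at a vertex. Applied to a point strictly inside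
  the kept half, this shows that \<open>a b\<close> is negative.\<close>

lemma slope_lower:
  assumes "in_simplex m v p" shows "a b \<le> (\<Sum>j<m. d j * (p j - x j))"
proof -
  obtain l where l: "\<forall>i\<le>m. 0 \<le> l i" "(\<Sum>i\<le>m. l i) = 1" "\<forall>j<m. p j = (\<Sum>i\<le>m. l i * v i j)"
    using assms unfolding in_simplex_def by blast
  have "a b = (\<Sum>i\<le>m. l i * a b)" using l(2) by (simp flip: sum_distrib_right)
  also have "\<dots> \<le> (\<Sum>i\<le>m. l i * a i)" using l(1) a_min by (intro sum_mono mult_left_mono) auto
  finally show ?thesis unfolding slope_combination[OF l(2,3)] .
qed

text \<open>The new coordinates are explicit: those other than \<open>b\<close> are scaled by
  (\<open>M\<close> + \<open>\<beta> i\<close>) / \<open>M\<close>, and coordinate \<open>b\<close>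
  pays for the difference. It stays nonnegative by the cut inequality, because
  \<open>\<beta>\<close> is rounded down.\<close>

lemma cut_mem:
  assumes p: "in_simplex m v p" and cut: "(\<Sum>j<m. d j * (p j - x j)) \<le> 0" and ab: "a b < 0"
  shows "in_simplex m v' p"
proof -
  obtain l where l: "\<forall>i\<le>m. 0 \<le> l i" "(\<Sum>i\<le>m. l i) = 1" "\<forall>j<m. p j = (\<Sum>i\<le>m. l i * v i j)"
    using p unfolding in_simplex_def by blast
  note la = slope_combination[OF l(2,3)]
  define c where "c = (\<Sum>i\<in>{..m} - {b}. l i * real_of_int (\<beta> i))"
  define l' where "l' i = (if i = b then l b - c / M else l i * (M + real_of_int (\<beta> i)) / M)" for i
  have "c \<le> (\<Sum>i\<in>{..m} - {b}. l i * (2 * real m * a i / (- a b)))"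
    unfolding c_def
  proof (rule sum_mono)
    fix i assume i: "i \<in> {..m} - {b}"
    then have "real_of_int (\<beta> i) \<le> 2 * real m * a i / (- a b)" by (simp add: beta)
    then show "l i * real_of_int (\<beta> i) \<le> l i * (2 * real m * a i / (- a b))"
      using l(1) i by (intro mult_left_mono) auto
  qed
  also have "\<dots> = 2 * real m / (- a b) * (\<Sum>i\<in>{..m} - {b}. l i * a i)"
    by (simp add: sum_distrib_left algebra_simps)
  also have "\<dots> \<le> 2 * real m / (- a b) * (l b * (- a b))"
  proof (rule mult_left_mono)
    have "l b * a b + (\<Sum>i\<in>{..m} - {b}. l i * a i) \<le> 0"
      using la cut b sum.remove[of "{..m}" b "\<lambda>i. l i * a i"] by simp
    then show "(\<Sum>i\<in>{..m} - {b}. l i * a i) \<le> l b * (- a b)" by simp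
    show "0 \<le> 2 * real m / (- a b)" using ab by (intro divide_nonneg_pos) auto
  qed
  also have "\<dots> = 2 * real m * l b" using ab by simp
  also have "\<dots> \<le> M * l b"
  proof (rule mult_right_mono)
    show "2 * real m \<le> M" using m_powers(1,3) unfolding M by linarith
  qed (use l(1) b in auto)
  finally have c: "c / M \<le> l b" using M_pos by (simp add: pos_divide_le_eq mult.commute)
  have nn: "\<forall>i\<le>m. 0 \<le> l' i"
    using c l(1) denominator_pos M_pos by (auto simp: l'_def intro!: divide_nonneg_pos mult_nonneg_nonneg intro: less_imp_le)
  \<comment> \<open>One identity for any quantity \<open>w\<close> attached to the vertices:
    constant 1 gives the total weight, and the vertex coordinates give the represented
    point.\<close>
  have key: "(\<Sum>i\<le>m. l' i * w' i) = (\<Sum>i\<le>m. l i * w i)"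
    if w': "\<And>i. i \<le> m \<Longrightarrow> w' i = (real_of_int (\<beta> i) * w b + M * w i) / (M + real_of_int (\<beta> i))" for w w'
  proof -
    have "w' b = w b" using w'[OF b] M_pos by (simp add: beta)
    then have "(\<Sum>i\<le>m. l' i * w' i) = (l b - c / M) * w b + (\<Sum>i\<in>{..m} - {b}. l' i * w' i)"
      using sum.remove[of "{..m}" b "\<lambda>i. l' i * w' i"] b by (simp add: l'_def)
    also have "(\<Sum>i\<in>{..m} - {b}. l' i * w' i) = (\<Sum>i\<in>{..m} - {b}. l i * real_of_int (\<beta> i) * (w b / M) + l i * w i)"
    proof (rule sum.cong[OF refl])
      fix i assume i: "i \<in> {..m} - {b}"
      then have n: "M + real_of_int (\<beta> i) \<noteq> 0" using denominator_pos[of i] by auto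
      have "l' i * w' i = l i * (M + real_of_int (\<beta> i)) / M *
          ((real_of_int (\<beta> i) * w b + M * w i) / (M + real_of_int (\<beta> i)))"
        using i w'[of i] by (simp add: l'_def)
      also have "\<dots> = l i * (real_of_int (\<beta> i) * w b + M * w i) / M" using n by simp
      also have "\<dots> = l i * real_of_int (\<beta> i) * (w b / M) + l i * w i" using M_pos by (simp add: field_simps)
      finally show "l' i * w' i = l i * real_of_int (\<beta> i) * (w b / M) + l i * w i" .
    qed
    also have "\<dots> = c * (w b / M) + (\<Sum>i\<in>{..m} - {b}. l i * w i)"
      by (simp only: sum.distrib c_def sum_distrib_right)
    also have "(l b - c / M) * w b + (c * (w b / M) + (\<Sum>i\<in>{..m} - {b}. l i * w i)) = (\<Sum>i\<le>m. l i * w i)"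
      using sum.remove[of "{..m}" b "\<lambda>i. l i * w i"] b by (simp add: algebra_simps)
    finally show ?thesis .
  qed
  have "(\<Sum>i\<le>m. l' i) = 1"
    using key[of "\<lambda>_. 1" "\<lambda>_. 1"] l(2) denominator_pos by (fastforce simp: add.commute)
  moreover have "\<forall>j<m. p j = (\<Sum>i\<le>m. l' i * v' i j)"
  proof (intro allI impI)
    fix j assume "j < m"
    have "(\<Sum>i\<le>m. l' i * v' i j) = (\<Sum>i\<le>m. l i * v i j)" by (rule key) (simp add: v'_def)
    with l(3) \<open>j < m\<close> show "p j = (\<Sum>i\<le>m. l' i * v' i j)" by simp
  qed
  ultimately show ?thesis unfolding in_simplex_def using nn by blast
qed

text \<open>The change of vertices is a matrix supported on the diagonal and column
  \<open>b\<close>, whose row \<open>b\<close> is a unit vector; its determinant is the product of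
  the diagonal.\<close>

lemma det_step: "det (homog m v') = (\<Prod>i\<le>m. M / (M + real_of_int (\<beta> i))) * det (homog m v)"
proof -
  define E where "E = mat (Suc m) (Suc m) (\<lambda>(i, k). if k = i then M / (M + real_of_int (\<beta> i))
     else if k = b then real_of_int (\<beta> i) / (M + real_of_int (\<beta> i)) else 0)"
  have E_nth: "E $$ (i, k) = (if k = i then M / (M + real_of_int (\<beta> i))
     else if k = b then real_of_int (\<beta> i) / (M + real_of_int (\<beta> i)) else 0)" if "i < Suc m" "k < Suc m" for i k
    using that by (simp add: E_def)
  have E: "E \<in> carrier_mat (Suc m) (Suc m)" by (simp add: E_def)
  have "homog m v' = E * homog m v"
  proof (rule eq_matI)
    fix i j assume ij: "i < dim_row (E * homog m v)" "j < dim_col (E * homog m v)"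
    then have i: "i \<le> m" and j: "j \<le> m" using E by (auto simp: homog_def)
    let ?w = "\<lambda>k. if j < m then v k j else 1"
    have "(E * homog m v) $$ (i, j) = (\<Sum>k = 0..<Suc m. E $$ (i, k) * ?w k)"
      using ij E by (simp add: scalar_prod_def homog_def)
    also have "\<dots> = (\<Sum>k = 0..<Suc m. (if k = i then M / (M + real_of_int (\<beta> i)) * ?w i else 0)
        + (if k = b then real_of_int (\<beta> i) / (M + real_of_int (\<beta> i)) * ?w b else 0))"
      using i by (intro sum.cong refl) (auto simp: beta E_nth)
    also have "\<dots> = M / (M + real_of_int (\<beta> i)) * ?w i + real_of_int (\<beta> i) / (M + real_of_int (\<beta> i)) * ?w b"
      using i b by (simp only: sum.distrib) simp
    also have "\<dots> = (real_of_int (\<beta> i) * ?w b + M * ?w i) / (M + real_of_int (\<beta> i))"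
      by (simp add: add_divide_distrib)
    also have "\<dots> = homog m v' $$ (i, j)"
      using i j denominator_pos[OF i] by (auto simp: homog_def v'_def add.commute)
    finally show "homog m v' $$ (i, j) = (E * homog m v) $$ (i, j)" by simp
  qed (use E in \<open>auto simp: homog_def\<close>)
  moreover have "det (E * homog m v) = det E * det (homog m v)"
    by (rule det_mult[OF E homog_carrier])
  moreover have "det E = (\<Prod>i\<le>m. M / (M + real_of_int (\<beta> i)))"
  proof -

    \<comment> \<open>A permutation with nonzero product must fix \<open>b\<close>, by the unit row.
      Every other index can then only be mapped to itself, as \<open>b\<close> is already
      taken.\<close>
    have z: "(\<Prod>i = 0..<Suc m. E $$ (i, p i)) = 0" if p: "p permutes {0..<Suc m}" "p \<noteq> id" for p
    proof (rule ccontr)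
      assume nz: "(\<Prod>i = 0..<Suc m. E $$ (i, p i)) \<noteq> 0"
      have im: "p i < Suc m" if "i < Suc m" for i using permutes_in_image[OF p(1), of i] that by simp
      have nz': "E $$ (i, p i) \<noteq> 0" if "i < Suc m" for i
      proof
        assume "E $$ (i, p i) = 0"
        then have "(\<Prod>i = 0..<Suc m. E $$ (i, p i)) = 0" using that by (intro prod_zero) auto
        then show False using nz by simp
      qed
      have pb: "p b = b"
      proof (rule ccontr)
        assume "p b \<noteq> b"
        then have "E $$ (b, p b) = 0" using im[of b] b by (simp add: beta E_nth)
        then show False using nz'[of b] b by simp
      qed
      have "p i = i" for i
      proof (cases "i < Suc m")
        case True
        show ?thesis
        proof (rule ccontr)
          assume ne: "p i \<noteq> i"
          have "p i \<noteq> b"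
          proof
            assume "p i = b"
            then have "p i = p b" using pb by simp
            then have "i = b" using permutes_inj[OF p(1)] by (simp add: inj_eq)
            then show False using ne pb by simp
          qed
          then have "E $$ (i, p i) = 0" using ne True im[OF True] by (simp add: E_nth)
          then show False using nz'[OF True] by simp
        qed
      next
        case False
        then show ?thesis using permutes_not_in[OF p(1), of i] by simp
      qed
      then have "p = id" by auto
      then show False using p(2) by simp
    qed
    have "det E = (\<Sum>p | p permutes {0..<Suc m}. signof p * (\<Prod>i = 0..<Suc m. E $$ (i, p i)))"
      by (rule det_def'[OF E])
    also have "\<dots> = (\<Sum>p\<in>{id}. signof p * (\<Prod>i = 0..<Suc m. E $$ (i, p i)))"
      by (rule sum.mono_neutral_right) (auto simp: finite_permutations permutes_id z simp del: prod.op_ivl_Suc)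
    also have "\<dots> = (\<Prod>i = 0..<Suc m. M / (M + real_of_int (\<beta> i)))"
      by (simp add: E_nth del: prod.op_ivl_Suc)
    finally show ?thesis by (simp only: atLeast0LessThan lessThan_Suc_atMost)
  qed
  ultimately show ?thesis by simp
qed

text \<open>The logarithm of the factor is minus the sum of ln (1 + \<open>y i\<close>), and ln (1 +
  y) is at least y - 2 * y^2 for small y. The rounded multiples provide the linear term, the size of
  \<open>M\<close> limits the quadratic one.\<close>

lemma volume_gain:
  assumes ab: "a b < 0"
  shows "0 < (\<Prod>i\<le>m. M / (M + real_of_int (\<beta> i)))"
    "(\<Prod>i\<le>m. M / (M + real_of_int (\<beta> i))) \<le> (32 * real m ^ 4 / (32 * real m ^ 4 + 1)) ^ m"
proof -
  define y where "y i = real_of_int (\<beta> i) / M" for i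
  have f: "M / (M + real_of_int (\<beta> i)) = inverse (1 + y i)" if "i \<le> m" for i
    using denominator_pos[OF that] M_pos by (simp add: y_def field_simps)
  show pos: "0 < (\<Prod>i\<le>m. M / (M + real_of_int (\<beta> i)))"
    using M_pos denominator_pos by (intro prod_pos) auto
  have y1: "\<bar>y i\<bar> \<le> 2 * real m ^ 2 / M" if "i \<le> m" for i
  proof -
    have "real m \<le> real m ^ 2" using m power_increasing[of 1 2 "real m"] by auto
    then have "\<bar>real_of_int (\<beta> i)\<bar> \<le> 2 * real m ^ 2" using real_beta_bounds[OF that] by linarith
    then show ?thesis using M_pos by (simp add: y_def abs_divide divide_right_mono)
  qed
  have "2 * real m ^ 2 \<le> 1 / 2 * M" using m_powers(2,3) unfolding M by linarith
  then have "2 * real m ^ 2 / M \<le> 1 / 2" using M_pos by (simp only: pos_divide_le_eq)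
  then have y2: "\<bar>y i\<bar> \<le> 1 / 2" if "i \<le> m" for i using y1[OF that] by linarith
  have lnb: "y i - 2 * (y i)\<^sup>2 \<le> ln (1 + y i)" if "i \<le> m" for i
    using abs_ln_one_plus_x_minus_x_bound[OF y2[OF that]] by linarith
  \<comment> \<open>The exact multiples sum to 2 * \<open>m\<close>, and each of the
    \<open>m\<close> floors loses at most 1.\<close>
  have s1: "real m \<le> (\<Sum>i\<le>m. real_of_int (\<beta> i))"
  proof -
    have "(\<Sum>i\<in>{..m} - {b}. 2 * real m * a i / (- a b) - 1) \<le> (\<Sum>i\<in>{..m} - {b}. real_of_int (\<beta> i))"
    proof (rule sum_mono)
      fix i assume "i \<in> {..m} - {b}"
      then have "\<beta> i = \<lfloor>2 * real m * a i / (- a b)\<rfloor>" by (simp add: beta)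
      then show "2 * real m * a i / (- a b) - 1 \<le> real_of_int (\<beta> i)" by linarith
    qed
    moreover have "(\<Sum>i\<in>{..m} - {b}. 2 * real m * a i / (- a b) - 1)
        = 2 * real m / (- a b) * (\<Sum>i\<in>{..m} - {b}. a i) - real m"
      using b by (simp add: sum_subtractf sum_distrib_left sum_negf sum_divide_distrib)
    moreover have "\<dots> = real m" using ab by (simp add: sum_a_others)
    moreover have "(\<Sum>i\<le>m. real_of_int (\<beta> i)) = (\<Sum>i\<in>{..m} - {b}. real_of_int (\<beta> i))"
      using sum.remove[of "{..m}" b "\<lambda>i. real_of_int (\<beta> i)"] b by (simp add: beta)
    ultimately show ?thesis by linarith
  qed
  have "real m / M \<le> (\<Sum>i\<le>m. y i)"
    using s1 M_pos unfolding y_def sum_divide_distrib[symmetric] by (simp add: divide_right_mono)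
  moreover have "(\<Sum>i\<le>m. (y i)\<^sup>2) \<le> real m * (2 * real m ^ 2 / M)\<^sup>2"
  proof -
    have "(\<Sum>i\<le>m. (y i)\<^sup>2) = (\<Sum>i\<in>{..m} - {b}. (y i)\<^sup>2)"
      using sum.remove[of "{..m}" b "\<lambda>i. (y i)\<^sup>2"] b by (simp add: y_def beta)
    also have "\<dots> \<le> (\<Sum>i\<in>{..m} - {b}. (2 * real m ^ 2 / M)\<^sup>2)"
    proof (rule sum_mono)
      fix i assume "i \<in> {..m} - {b}"
      then have "\<bar>y i\<bar> ^ 2 \<le> (2 * real m ^ 2 / M) ^ 2" using y1 by (intro power_mono) auto
      then show "(y i)\<^sup>2 \<le> (2 * real m ^ 2 / M)\<^sup>2" by simp
    qed
    also have "\<dots> = real m * (2 * real m ^ 2 / M)\<^sup>2" using b by simp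
    finally show ?thesis .
  qed
  ultimately have "real m / M - 2 * (real m * (2 * real m ^ 2 / M)\<^sup>2) \<le> (\<Sum>i\<le>m. y i) - 2 * (\<Sum>i\<le>m. (y i)\<^sup>2)"
    by linarith
  also have "\<dots> = (\<Sum>i\<le>m. y i - 2 * (y i)\<^sup>2)" by (simp add: sum_subtractf sum_distrib_left)
  also have "\<dots> \<le> (\<Sum>i\<le>m. ln (1 + y i))" by (rule sum_mono) (use lnb in auto)
  \<comment> \<open>The linear term is 1 / (16 * m^3) and the quadratic term is exactly half of it.
    The rest is written with the factor \<open>m\<close> so that an \<open>m\<close>-th power can be
    split off.\<close>
  also have "real m / M - 2 * (real m * (2 * real m ^ 2 / M)\<^sup>2) = real m * (1 / (32 * real m ^ 4))"
  proof -
    have "(2 * real m ^ 2 / M)\<^sup>2 = 4 * real m ^ 4 / (16 * real m ^ 4 * (16 * real m ^ 4))"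
      by (simp add: M power_divide power_mult_distrib power2_eq_square power4_eq_xxxx)
    also have "\<dots> = 1 / (64 * real m ^ 4)" using m by (simp add: divide_simps)
    finally show ?thesis using m by (simp add: M field_simps)
  qed
  finally have ln: "real m * (1 / (32 * real m ^ 4)) \<le> (\<Sum>i\<le>m. ln (1 + y i))" .
  have yp: "0 < 1 + y i" if "i \<le> m" for i using y2[OF that] by linarith
  have "(\<Prod>i\<le>m. M / (M + real_of_int (\<beta> i))) = (\<Prod>i\<le>m. exp (- ln (1 + y i)))"
    using f yp by (intro prod.cong) (auto simp: exp_minus)
  also have "\<dots> = exp (- (\<Sum>i\<le>m. ln (1 + y i)))" by (simp add: exp_sum[symmetric] sum_negf)
  also have "\<dots> \<le> exp (- (real m * (1 / (32 * real m ^ 4))))" using ln by simp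
  also have "\<dots> = exp (- (1 / (32 * real m ^ 4))) ^ m" by (simp add: exp_of_nat_mult[symmetric])
  \<comment> \<open>The exponential is replaced by a rational number, since a program has to keep
    track of the volume.\<close>
  also have "\<dots> \<le> (32 * real m ^ 4 / (32 * real m ^ 4 + 1)) ^ m"
  proof (rule power_mono)
    have "1 + 1 / (32 * real m ^ 4) \<le> exp (1 / (32 * real m ^ 4))" by (rule exp_ge_add_one_self)
    moreover have "0 < 1 + 1 / (32 * real m ^ 4)" by (simp add: add_pos_nonneg)
    ultimately have "exp (- (1 / (32 * real m ^ 4))) \<le> inverse (1 + 1 / (32 * real m ^ 4))"
      by (simp add: exp_minus le_imp_inverse_le)
    also have "\<dots> = 32 * real m ^ 4 / (32 * real m ^ 4 + 1)" using m by (simp add: field_simps)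
    finally show "exp (- (1 / (32 * real m ^ 4))) \<le> 32 * real m ^ 4 / (32 * real m ^ 4 + 1)" .
  qed simp
  finally show "(\<Prod>i\<le>m. M / (M + real_of_int (\<beta> i))) \<le> (32 * real m ^ 4 / (32 * real m ^ 4 + 1)) ^ m" .
qed

end

section \<open>Optimal plans for a fixed first-stage decision\<close>

abbreviation enc_rats :: "rat list \<Rightarrow> val" where
  "enc_rats xs \<equiv> enc_list (map Atom xs)"

abbreviation enc_weighted :: "val \<times> rat \<Rightarrow> val" where
  "enc_weighted \<equiv> \<lambda>w. Node (fst w) (Atom (snd w))"

definition rvec :: "rat list \<Rightarrow> real vec" where
  "rvec x = real_vec (vec_of_list x)"

abbreviation costs :: "'z dr_instance \<Rightarrow> rat list" where
  "costs I \<equiv> list_of_vec (first_cost I)"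

definition enc_line :: "plan_line \<Rightarrow> val" where
  "enc_line L = Node (Atom (gain L)) (Node (Atom (transport L)) (enc_list (map enc_weighted (weights L))))"

lemma enc_vec_of_list: "enc_vec (vec_of_list x) = enc_rats x"
  by (simp add: enc_vec_def list_vec)

lemma dim_rvec [simp]: "dim_vec (rvec x) = length x"
  by (simp add: rvec_def)

lemma rvec_nth [simp]: "j < length x \<Longrightarrow> rvec x $ j = of_rat (x ! j)"
  by (simp add: rvec_def vec_of_list_index)

lemma encode_eq: "encode I = Node (enc_rats (costs I)) (Node (enc_list (map enc_weighted (central I)))
   (Node (Atom (radius I)) (Node (Atom (kappa_max I)) (Node (Atom (inflation I))
   (Node (Atom (outer_radius I)) (Node (Atom (inner_radius I)) (Node (descr I) (Atom 0))))))))"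
  by (simp add: encode_def enc_vec_def case_prod_unfold)

lemma ptime_fields:
  assumes "ptime D e (\<lambda>i. encode (I i))"
  shows ptime_costs: "ptime D e (\<lambda>i. enc_rats (costs (I i)))"
    and ptime_central: "ptime D e (\<lambda>i. enc_list (map enc_weighted (central (I i))))"
    and ptime_radius: "ptime D e (\<lambda>i. Atom (radius (I i)))"
    and ptime_kappa_max: "ptime D e (\<lambda>i. Atom (kappa_max (I i)))"
    and ptime_inflation: "ptime D e (\<lambda>i. Atom (inflation (I i)))"
    and ptime_outer_radius: "ptime D e (\<lambda>i. Atom (outer_radius (I i)))"
    and ptime_inner_radius: "ptime D e (\<lambda>i. Atom (inner_radius (I i)))"
proof -
  note n1 = ptime_Node1 and n2 = ptime_Node2
  note h = assms[unfolded encode_eq]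
  show "ptime D e (\<lambda>i. enc_rats (costs (I i)))" by (rule n1[OF h])
  note h = n2[OF h]
  show "ptime D e (\<lambda>i. enc_list (map enc_weighted (central (I i))))" by (rule n1[OF h])
  note h = n2[OF h]
  show "ptime D e (\<lambda>i. Atom (radius (I i)))" by (rule n1[OF h])
  note h = n2[OF h]
  show "ptime D e (\<lambda>i. Atom (kappa_max (I i)))" by (rule n1[OF h])
  note h = n2[OF h]
  show "ptime D e (\<lambda>i. Atom (inflation (I i)))" by (rule n1[OF h])
  note h = n2[OF h]
  show "ptime D e (\<lambda>i. Atom (outer_radius (I i)))" by (rule n1[OF h])
  note h = n2[OF h]
  show "ptime D e (\<lambda>i. Atom (inner_radius (I i)))" by (rule n1[OF h])
qed

lemma ptime_dimension:
  assumes "ptime D e (\<lambda>i. encode (I i))"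
  shows "ptime D e (\<lambda>i. Atom (of_nat (dimension (I i))))"
  using ptime_length[OF ptime_costs[OF assms]] by simp

lemma dimension_le_input_size: "dimension I \<le> input_size I"
proof -
  have "dimension I \<le> vsize (enc_rats (costs I))" using length_le_vsize[of "map Atom (costs I)"] by simp
  also have "\<dots> \<le> input_size I" by (simp add: input_size_def encode_eq)
  finally show ?thesis .
qed

lemma pbound_dimension:
  assumes "ptime D e (\<lambda>i. encode (I i))"
  shows "pbound D (\<lambda>i. vsize (e i)) (\<lambda>i. dimension (I i))"
  by (rule pbound_mono[OF ptime_size[OF assms]]) (use dimension_le_input_size in \<open>simp add: input_size_def\<close>)

definition dot :: "nat \<Rightarrow> rat list \<Rightarrow> rat list \<Rightarrow> rat" where
  "dot m u v = (\<Sum>j\<leftarrow>[0..<m]. u ! j * v ! j)"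

lemma ptime_dot:
  assumes m: "ptime D e (\<lambda>i. Atom (of_nat (m i)))" and pm: "pbound D (\<lambda>i. vsize (e i)) m"
    and u: "ptime D e (\<lambda>i. enc_rats (u i))" and v: "ptime D e (\<lambda>i. enc_rats (v i))"
    and l: "\<And>i. i \<in> D \<Longrightarrow> m i \<le> length (u i) \<and> m i \<le> length (v i)"
  shows "ptime D e (\<lambda>i. Atom (dot (m i) (u i) (v i)))"
  unfolding dot_def
proof (rule ptime_sum_map[OF ptime_upt[OF m pm]])
  let ?E = "Sigma D (\<lambda>i. set [0..<m i])" and ?e = "with_arg e (\<lambda>k. Atom (of_nat k))"
  have k: "ptime ?E ?e (\<lambda>j. Atom (of_nat (snd j)))" by (rule ptime_inner)
  have u': "ptime ?E ?e (\<lambda>j. enc_rats (u (fst j)))" by (rule ptime_outer[OF u]) auto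
  have v': "ptime ?E ?e (\<lambda>j. enc_rats (v (fst j)))" by (rule ptime_outer[OF v]) auto
  show "ptime ?E ?e (\<lambda>j. Atom (u (fst j) ! snd j * v (fst j) ! snd j))"
    by (intro ptime_mult ptime_nth[OF u' k] ptime_nth[OF v' k]) (use l in fastforce)+
qed

lemma of_rat_sum_list: "real_of_rat (sum_list xs) = sum_list (map real_of_rat xs)"
  by (induction xs) (auto simp: of_rat_add)

text \<open>The assumed programs appear here as functions on lists of rationals. For rounding, the
  cost of integral actions is replaced by \<open>gcost\<close>, which it bounds from above, so that
  rounding compares values of one cost function.\<close>

locale dr_algorithms =
  fixes J :: "'z dr_instance set" and \<rho> \<beta>\<^sub>1 \<beta>\<^sub>2 :: "'z dr_instance \<Rightarrow> real"
    and Sep :: "'z dr_instance \<Rightarrow> rat list \<Rightarrow> val"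
    and Loc :: "'z dr_instance \<Rightarrow> rat list \<Rightarrow> rat list"
    and Apx :: "'z dr_instance \<Rightarrow> rat list \<Rightarrow> rat \<Rightarrow> val \<Rightarrow> val"
    and Gr :: "'z dr_instance \<Rightarrow> rat list \<Rightarrow> val \<Rightarrow> rat"
    and Kr :: "'z dr_instance \<Rightarrow> val \<Rightarrow> val \<Rightarrow> rat"
    and Sg :: "'z dr_instance \<Rightarrow> rat list \<Rightarrow> val \<Rightarrow> rat list"
  assumes wf: "I \<in> J \<Longrightarrow> well_formed I" and p1: "I \<in> J \<Longrightarrow> P1 I" and p2: "I \<in> J \<Longrightarrow> P2 I"
    and p3: "I \<in> J \<Longrightarrow> P3 I" and p4: "I \<in> J \<Longrightarrow> P4 I" and nonnull: "I \<in> J \<Longrightarrow> nonnull_cost_ge_1 I"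
    and scenario_size: "\<exists>q :: nat poly. \<forall>I\<in>J. \<forall>A\<in>scenarios I. vsize A \<le> poly q (input_size I)"
    and Sep_ptime: "ptime {j. fst j \<in> J \<and> length (snd j) = dimension (fst j)}
       (\<lambda>j. enc_list [encode (fst j), enc_rats (snd j)]) (\<lambda>j. Sep (fst j) (snd j))"
    and Sep: "I \<in> J \<Longrightarrow> length x = dimension I \<Longrightarrow>
       if rvec x \<in> feasible I then Sep I x = Atom 1
       else \<exists>d. length d = dimension I \<and> Sep I x = enc_rats d \<and>
          (\<forall>x'\<in>feasible I. rvec d \<bullet> x' < rvec d \<bullet> rvec x)"
    and Loc_ptime: "ptime {j. fst j \<in> J \<and> rvec (snd j) \<in> feasible (fst j)}
       (\<lambda>j. enc_list [encode (fst j), enc_rats (snd j)]) (\<lambda>j. enc_rats (Loc (fst j) (snd j)))"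
    and Loc: "I \<in> J \<Longrightarrow> rvec x \<in> feasible I \<Longrightarrow>
       rvec (Loc I x) \<in> int_feasible I \<and> cvec I \<bullet> rvec (Loc I x) \<le> \<rho> I * (cvec I \<bullet> rvec x) \<and>
       (\<forall>A\<in>scenarios I. gcost I (rvec (Loc I x)) A \<le> \<rho> I * gcost I (rvec x) A)"
    and betas: "I \<in> J \<Longrightarrow> 1 \<le> \<beta>\<^sub>1 I \<and> 1 \<le> \<beta>\<^sub>2 I"
    and Apx_ptime: "ptime {((I, x), (y, A)). I \<in> J \<and> rvec x \<in> int_feasible I \<and> 0 \<le> y \<and> A \<in> scenarios I}
       (\<lambda>j. enc_list [encode (fst (fst j)), enc_rats (snd (fst j)), Atom (fst (snd j)), snd (snd j)])
       (\<lambda>j. Apx (fst (fst j)) (snd (fst j)) (fst (snd j)) (snd (snd j)))"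
    and Apx: "I \<in> J \<Longrightarrow> rvec x \<in> int_feasible I \<Longrightarrow> 0 \<le> y \<Longrightarrow> A \<in> scenarios I \<Longrightarrow>
       Apx I x y A \<in> scenarios I \<and>
       (\<forall>A'\<in>scenarios I. gcost I (rvec x) A' / \<beta>\<^sub>1 I - \<beta>\<^sub>2 I * real_of_rat y * kappa I A A'
          \<le> gcost I (rvec x) (Apx I x y A) - real_of_rat y * kappa I A (Apx I x y A))"
    and Gr_ptime: "ptime {((I, x), A). I \<in> J \<and> rvec x \<in> feasible I \<and> A \<in> scenarios I}
       (\<lambda>j. enc_list [encode (fst (fst j)), enc_rats (snd (fst j)), snd j])
       (\<lambda>j. Atom (Gr (fst (fst j)) (snd (fst j)) (snd j)))"
    and Gr: "I \<in> J \<Longrightarrow> rvec x \<in> feasible I \<Longrightarrow> A \<in> scenarios I \<Longrightarrow>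
       real_of_rat (Gr I x A) = gcost I (rvec x) A"
    and Kr_ptime: "ptime {((I, A), A'). I \<in> J \<and> A \<in> scenarios I \<and> A' \<in> scenarios I}
       (\<lambda>j. enc_list [encode (fst (fst j)), snd (fst j), snd j])
       (\<lambda>j. Atom (Kr (fst (fst j)) (snd (fst j)) (snd j)))"
    and Kr: "I \<in> J \<Longrightarrow> A \<in> scenarios I \<Longrightarrow> A' \<in> scenarios I \<Longrightarrow>
       real_of_rat (Kr I A A') = kappa I A A'"
    and Sg_ptime: "ptime {((I, x), A). I \<in> J \<and> rvec x \<in> feasible I \<and> A \<in> scenarios I}
       (\<lambda>j. enc_list [encode (fst (fst j)), enc_rats (snd (fst j)), snd j])
       (\<lambda>j. enc_rats (Sg (fst (fst j)) (snd (fst j)) (snd j)))"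
    and Sg: "I \<in> J \<Longrightarrow> rvec x \<in> feasible I \<Longrightarrow> A \<in> scenarios I \<Longrightarrow>
       length (Sg I x A) = dimension I \<and>
       subgradient_at (feasible I) (\<lambda>x. gcost I x A) (rvec x) (rvec (Sg I x A))"
begin

lemma int_feasible_subset: "int_feasible I \<subseteq> feasible I"
  by (auto simp: int_feasible_def)

lemma feasible_carrier: "I \<in> J \<Longrightarrow> feasible I \<subseteq> carrier_vec (dimension I)"
  using wf[of I] unfolding well_formed_def polytope_vec_def convex_hull_vec_def by blast

lemma feasible_length: "I \<in> J \<Longrightarrow> rvec x \<in> feasible I \<Longrightarrow> length x = dimension I"
  using carrier_vecD[of "rvec x" "dimension I"] feasible_carrier[of I] by (simp add: subset_iff)

lemma int_feasible_length: "I \<in> J \<Longrightarrow> rvec x \<in> int_feasible I \<Longrightarrow> length x = dimension I"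
  by (rule feasible_length) (simp_all add: int_feasible_def)

lemma central_scenario: "I \<in> J \<Longrightarrow> w \<in> set (central I) \<Longrightarrow> fst w \<in> scenarios I"
proof -
  assume "I \<in> J" "w \<in> set (central I)"
  moreover from this have "support I \<subseteq> scenarios I" using wf[of I] unfolding well_formed_def by blast
  ultimately show ?thesis by (auto simp: support_def)
qed

subsection \<open>Calls of the given algorithms\<close>

context
  fixes D :: "'i set" and e :: "'i \<Rightarrow> val" and I :: "'i \<Rightarrow> 'z dr_instance"
  assumes I: "ptime D e (\<lambda>i. encode (I i))" and IJ: "\<And>i. i \<in> D \<Longrightarrow> I i \<in> J"
begin

lemma ptime_Sep:
  assumes "ptime D e (\<lambda>i. enc_rats (x i))" "\<And>i. i \<in> D \<Longrightarrow> length (x i) = dimension (I i)"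
  shows "ptime D e (\<lambda>i. Sep (I i) (x i))"
proof -
  have "ptime D e (\<lambda>i. enc_list [encode (I i), enc_rats (x i)])"
    unfolding enc_list.simps by (intro ptime_Node ptime_const I assms)
  then show ?thesis using ptime_comp[OF Sep_ptime, of D "\<lambda>i. (I i, x i)" e] assms(2) IJ by simp
qed

lemma ptime_Loc:
  assumes "ptime D e (\<lambda>i. enc_rats (x i))" "\<And>i. i \<in> D \<Longrightarrow> rvec (x i) \<in> feasible (I i)"
  shows "ptime D e (\<lambda>i. enc_rats (Loc (I i) (x i)))"
proof -
  have "ptime D e (\<lambda>i. enc_list [encode (I i), enc_rats (x i)])"
    unfolding enc_list.simps by (intro ptime_Node ptime_const I assms)
  then show ?thesis using ptime_comp[OF Loc_ptime, of D "\<lambda>i. (I i, x i)" e] assms(2) IJ by simp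
qed

lemma ptime_Apx:
  assumes "ptime D e (\<lambda>i. enc_rats (x i))" "ptime D e (\<lambda>i. Atom (y i))" "ptime D e (\<lambda>i. A i)"
    "\<And>i. i \<in> D \<Longrightarrow> rvec (x i) \<in> int_feasible (I i) \<and> 0 \<le> y i \<and> A i \<in> scenarios (I i)"
  shows "ptime D e (\<lambda>i. Apx (I i) (x i) (y i) (A i))"
proof -
  have "ptime D e (\<lambda>i. enc_list [encode (I i), enc_rats (x i), Atom (y i), A i])"
    unfolding enc_list.simps by (intro ptime_Node ptime_const I assms)
  then show ?thesis using ptime_comp[OF Apx_ptime, of D "\<lambda>i. ((I i, x i), (y i, A i))" e] assms(4) IJ by simp
qed

lemma ptime_Gr:
  assumes "ptime D e (\<lambda>i. enc_rats (x i))" "ptime D e (\<lambda>i. A i)"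
    "\<And>i. i \<in> D \<Longrightarrow> rvec (x i) \<in> feasible (I i) \<and> A i \<in> scenarios (I i)"
  shows "ptime D e (\<lambda>i. Atom (Gr (I i) (x i) (A i)))"
proof -
  have "ptime D e (\<lambda>i. enc_list [encode (I i), enc_rats (x i), A i])"
    unfolding enc_list.simps by (intro ptime_Node ptime_const I assms)
  then show ?thesis using ptime_comp[OF Gr_ptime, of D "\<lambda>i. ((I i, x i), A i)" e] assms(3) IJ by simp
qed

lemma ptime_Sg:
  assumes "ptime D e (\<lambda>i. enc_rats (x i))" "ptime D e (\<lambda>i. A i)"
    "\<And>i. i \<in> D \<Longrightarrow> rvec (x i) \<in> feasible (I i) \<and> A i \<in> scenarios (I i)"
  shows "ptime D e (\<lambda>i. enc_rats (Sg (I i) (x i) (A i)))"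
proof -
  have "ptime D e (\<lambda>i. enc_list [encode (I i), enc_rats (x i), A i])"
    unfolding enc_list.simps by (intro ptime_Node ptime_const I assms)
  then show ?thesis using ptime_comp[OF Sg_ptime, of D "\<lambda>i. ((I i, x i), A i)" e] assms(3) IJ by simp
qed

lemma ptime_Kr:
  assumes "ptime D e (\<lambda>i. A i)" "ptime D e (\<lambda>i. A' i)"
    "\<And>i. i \<in> D \<Longrightarrow> A i \<in> scenarios (I i) \<and> A' i \<in> scenarios (I i)"
  shows "ptime D e (\<lambda>i. Atom (Kr (I i) (A i) (A' i)))"
proof -
  have "ptime D e (\<lambda>i. enc_list [encode (I i), A i, A' i])"
    unfolding enc_list.simps by (intro ptime_Node ptime_const I assms)
  then show ?thesis using ptime_comp[OF Kr_ptime, of D "\<lambda>i. ((I i, A i), A' i)" e] assms(3) IJ by simp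
qed

end

subsection \<open>The linear program behind \<open>z_central\<close>\<close>

definition objective :: "'z dr_instance \<Rightarrow> real vec \<Rightarrow> (val \<Rightarrow> val \<Rightarrow> real) \<Rightarrow> real" where
  "objective I x \<gamma> = (\<Sum>A\<in>support I. \<Sum>A'\<in>scenarios I. \<gamma> A A' * gcost I x A')"

context
  fixes I :: "'z dr_instance" assumes I: "I \<in> J"
begin

lemma finite_scenarios: "finite (scenarios I)"
  and support_scenarios: "support I \<subseteq> scenarios I"
  and phat_pos: "A \<in> support I \<Longrightarrow> 0 < phat I A" and phat_sum: "(\<Sum>A\<in>support I. phat I A) = 1"
  and radius_pos: "0 < radius I" and distinct_central: "distinct (map fst (central I))"
  using wf[OF I] unfolding well_formed_def by blast+

lemma gcost_nonneg: "x \<in> feasible I \<Longrightarrow> A \<in> scenarios I \<Longrightarrow> 0 \<le> gcost I x A"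
  using p1[OF I] unfolding P1_def by blast

lemma kappa_le_max: "A \<in> scenarios I \<Longrightarrow> A' \<in> scenarios I \<Longrightarrow> kappa I A A' \<le> real_of_rat (kappa_max I)"
  using wf[OF I] unfolding well_formed_def by blast

lemma kappa_refl: "A \<in> scenarios I \<Longrightarrow> kappa I A A = 0"
  using wf[OF I] unfolding well_formed_def by blast

lemma zero_plan: "(\<lambda>_ _. 0) \<in> plans I"
  using phat_pos radius_pos by (auto simp: plans_def less_imp_le)

text \<open>Every entry of a plan is at most the mass of its row, so the objective is bounded above
  and the supremum in \<open>z_central\<close> really is an upper bound.\<close>

lemma objective_le_z:
  assumes "\<gamma> \<in> plans I" "x \<in> feasible I" shows "objective I x \<gamma> \<le> z_central I x"
proof -
  have "bdd_above ((\<lambda>\<gamma>. \<Sum>A\<in>support I. \<Sum>A'\<in>scenarios I. \<gamma> A A' * gcost I x A') ` plans I)"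
  proof (rule bdd_aboveI2[where M = "\<Sum>A\<in>support I. \<Sum>A'\<in>scenarios I. phat I A * gcost I x A'"], intro sum_mono)
    fix \<gamma> A A' assume g: "\<gamma> \<in> plans I" "A \<in> support I" "A' \<in> scenarios I"
    have "\<gamma> A A' \<le> (\<Sum>A'\<in>scenarios I. \<gamma> A A')"
      using g finite_scenarios by (intro member_le_sum) (auto simp: plans_def)
    also have "\<dots> \<le> phat I A" using g by (auto simp: plans_def)
    finally show "\<gamma> A A' * gcost I x A' \<le> phat I A * gcost I x A'"
      using gcost_nonneg[OF assms(2) g(3)] by (rule mult_right_mono)
  qed
  from cSUP_upper[OF assms(1) this] show ?thesis by (simp add: objective_def z_central_def)
qed

lemma z_leI: "(\<And>\<gamma>. \<gamma> \<in> plans I \<Longrightarrow> objective I x \<gamma> \<le> B) \<Longrightarrow> z_central I x \<le> B"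
  unfolding z_central_def objective_def using zero_plan by (intro cSUP_least) auto

lemma z_nonneg: "x \<in> feasible I \<Longrightarrow> 0 \<le> z_central I x"
  using objective_le_z[OF zero_plan, of x] by (simp add: objective_def)

lemma sum_central:
  fixes F :: "val \<Rightarrow> real"
  shows "(\<Sum>w\<leftarrow>central I. real_of_rat (snd w) * F (fst w)) = (\<Sum>A\<in>support I. phat I A * F A)"
proof -
  note d = distinct_central
  have ph: "phat I (fst w) = real_of_rat (snd w)" if "w \<in> set (central I)" for w
    using map_of_is_SomeI[OF d, of "fst w" "snd w"] that by (simp add: phat_def)
  have "(\<Sum>w\<leftarrow>central I. real_of_rat (snd w) * F (fst w)) = (\<Sum>w\<in>set (central I). real_of_rat (snd w) * F (fst w))"
    using d by (intro sum_list_distinct_conv_sum_set) (auto simp: distinct_map)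
  also have "\<dots> = (\<Sum>w\<in>set (central I). phat I (fst w) * F (fst w))" by (rule sum.cong) (auto simp: ph)
  also have "\<dots> = (\<Sum>A\<in>support I. phat I A * F A)"
    unfolding support_def using d by (subst sum.reindex) (auto simp: distinct_map)
  finally show ?thesis .
qed

end

definition line :: "'z dr_instance \<Rightarrow> rat list \<Rightarrow> rat \<Rightarrow> plan_line" where
  "line I x y =
     ((\<Sum>w\<leftarrow>central I. snd w * Gr I x (Apx I x y (fst w))),
      (\<Sum>w\<leftarrow>central I. snd w * Kr I (fst w) (Apx I x y (fst w))),
      map (\<lambda>w. (Apx I x y (fst w), snd w)) (central I))"

definition search :: "'z dr_instance \<Rightarrow> rat list \<Rightarrow> plan_line \<times> plan_line" where
  "search I x = search_pair (radius I) (line I x)"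

text \<open>Targets may occur several times in the two concatenated lists; this is harmless because
  plans are used only through weighted sums.\<close>

definition plan :: "'z dr_instance \<Rightarrow> rat list \<Rightarrow> (val \<times> rat) list" where
  "plan I x = (let L = fst (search I x); L' = snd (search I x); a = mix_weight (radius I) L L' in
     map (\<lambda>w. (fst w, a * snd w)) (weights L) @ map (\<lambda>w. (fst w, (1 - a) * snd w)) (weights L'))"

context
  fixes I :: "'z dr_instance" and x :: "rat list"
  assumes I: "I \<in> J" and x: "rvec x \<in> int_feasible I"
begin

lemma x_feasible: "rvec x \<in> feasible I" using x int_feasible_subset by blast

lemma Apx_scenario: "0 \<le> y \<Longrightarrow> A \<in> scenarios I \<Longrightarrow> Apx I x y A \<in> scenarios I"
  using Apx[OF I x] by blast

lemma line_gain:
  assumes "0 \<le> y"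
  shows "real_of_rat (gain (line I x y)) = (\<Sum>A\<in>support I. phat I A * gcost I (rvec x) (Apx I x y A))"
proof -
  have "real_of_rat (gain (line I x y)) =
      (\<Sum>w\<leftarrow>central I. real_of_rat (snd w) * gcost I (rvec x) (Apx I x y (fst w)))"
    unfolding line_def fst_conv of_rat_sum_list map_map
    by (rule arg_cong[of _ _ sum_list], rule map_cong)
      (use assms I x_feasible Apx_scenario central_scenario in \<open>auto simp: of_rat_mult Gr\<close>)
  also have "\<dots> = (\<Sum>A\<in>support I. phat I A * gcost I (rvec x) (Apx I x y A))"
    by (rule sum_central[OF I])
  finally show ?thesis .
qed

lemma line_transport:
  assumes "0 \<le> y"
  shows "real_of_rat (transport (line I x y)) = (\<Sum>A\<in>support I. phat I A * kappa I A (Apx I x y A))"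
proof -
  have "real_of_rat (transport (line I x y)) =
      (\<Sum>w\<leftarrow>central I. real_of_rat (snd w) * kappa I (fst w) (Apx I x y (fst w)))"
    unfolding line_def fst_conv snd_conv of_rat_sum_list map_map
    by (rule arg_cong[of _ _ sum_list], rule map_cong)
      (use assms I Apx_scenario central_scenario in \<open>auto simp: of_rat_mult Kr\<close>)
  also have "\<dots> = (\<Sum>A\<in>support I. phat I A * kappa I A (Apx I x y A))"
    by (rule sum_central[OF I])
  finally show ?thesis .
qed

text \<open>Compare the answer with staying at \<open>A\<close>, which costs no transport and has
  nonnegative gain.\<close>

lemma penalized_nonneg:
  assumes "0 \<le> y" "A \<in> scenarios I"
  shows "0 \<le> gcost I (rvec x) (Apx I x y A) - real_of_rat y * kappa I A (Apx I x y A)"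
proof -
  have "0 \<le> gcost I (rvec x) A / \<beta>\<^sub>1 I"
    using gcost_nonneg[OF I x_feasible assms(2)] betas[OF I] by simp
  then show ?thesis using Apx[OF I x assms] assms(2) kappa_refl[OF I assms(2)] by force
qed

text \<open>
  Scaling the dual variables \<open>\<theta>\<^sub>A\<close> by \<open>\<beta>\<^sub>1\<close> and \<open>y\<close> by \<open>\<beta>\<^sub>1 \<beta>\<^sub>2\<close> turns the answers of the
  approximation algorithm at \<open>y\<close> into a feasible solution of the dual linear program.
\<close>

lemma line_value:
  assumes y: "0 \<le> y"
  shows "z_central I (rvec x) \<le> \<beta>\<^sub>1 I * \<beta>\<^sub>2 I * real_of_rat (eval_line (radius I) (line I x y) y)"
proof (rule z_leI[OF I])
  fix \<gamma> assume g: "\<gamma> \<in> plans I"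
  define \<theta> where "\<theta> A = gcost I (rvec x) (Apx I x y A) - real_of_rat y * kappa I A (Apx I x y A)" for A
  have th: "0 \<le> \<theta> A" if "A \<in> scenarios I" for A using penalized_nonneg[OF y that] by (simp add: \<theta>_def)
  let ?b = "\<beta>\<^sub>1 I" and ?c = "\<beta>\<^sub>2 I" and ?y = "real_of_rat y" and ?r = "real_of_rat (radius I)"
  have b: "1 \<le> ?b" "1 \<le> ?c" using betas[OF I] by auto
  have y': "0 \<le> ?y" using y by simp
  have "objective I (rvec x) \<gamma> \<le> (\<Sum>A\<in>support I. \<Sum>A'\<in>scenarios I.
      ?b * (\<theta> A * \<gamma> A A') + ?b * ?c * ?y * (kappa I A A' * \<gamma> A A'))"
    unfolding objective_def
  proof (intro sum_mono)
    fix A A' assume A: "A \<in> support I" "A' \<in> scenarios I"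
    then have As: "A \<in> scenarios I" using support_scenarios[OF I] by blast
    have "gcost I (rvec x) A' / ?b \<le> \<theta> A + ?c * ?y * kappa I A A'"
      using Apx[OF I x y As] A(2) unfolding \<theta>_def by fastforce
    then have "gcost I (rvec x) A' \<le> ?b * (\<theta> A + ?c * ?y * kappa I A A')"
      using b by (simp add: divide_le_eq mult.commute)
    moreover have "0 \<le> \<gamma> A A'" using g A by (auto simp: plans_def)
    ultimately have "\<gamma> A A' * gcost I (rvec x) A' \<le> \<gamma> A A' * (?b * (\<theta> A + ?c * ?y * kappa I A A'))"
      by (rule mult_left_mono)
    then show "\<gamma> A A' * gcost I (rvec x) A'
       \<le> ?b * (\<theta> A * \<gamma> A A') + ?b * ?c * ?y * (kappa I A A' * \<gamma> A A')"
      by (simp add: algebra_simps)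
  qed
  also have "\<dots> = ?b * (\<Sum>A\<in>support I. \<theta> A * (\<Sum>A'\<in>scenarios I. \<gamma> A A'))
      + ?b * ?c * ?y * (\<Sum>A\<in>support I. \<Sum>A'\<in>scenarios I. kappa I A A' * \<gamma> A A')"
    by (simp only: sum.distrib sum_distrib_left)
  also have "\<dots> \<le> ?b * (\<Sum>A\<in>support I. \<theta> A * phat I A) + ?b * ?c * ?y * ?r"
  proof (intro add_mono mult_left_mono sum_mono)
    fix A assume "A \<in> support I"
    then show "(\<Sum>A'\<in>scenarios I. \<gamma> A A') \<le> phat I A" "0 \<le> \<theta> A"
      using g th support_scenarios[OF I] by (auto simp: plans_def)
  qed (use g b y' in \<open>auto simp: plans_def\<close>)
  \<comment> \<open>The first term is enlarged by \<open>\<beta>\<^sub>2\<close> only to share a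
    common factor with the second; this needs nonnegative \<open>\<theta>\<close>.\<close>
  also have "\<dots> \<le> ?b * ?c * (\<Sum>A\<in>support I. \<theta> A * phat I A) + ?b * ?c * ?y * ?r"
  proof -
    have "0 \<le> (\<Sum>A\<in>support I. \<theta> A * phat I A)"
      using th support_scenarios[OF I] phat_pos[OF I] by (intro sum_nonneg mult_nonneg_nonneg) (auto simp: less_imp_le)
    then have "?b * 1 * (\<Sum>A\<in>support I. \<theta> A * phat I A) \<le> ?b * ?c * (\<Sum>A\<in>support I. \<theta> A * phat I A)"
      using b by (intro mult_right_mono mult_left_mono) auto
    then show ?thesis by simp
  qed
  also have "(\<Sum>A\<in>support I. \<theta> A * phat I A) =
      real_of_rat (gain (line I x y)) - ?y * real_of_rat (transport (line I x y))"
    unfolding \<theta>_def line_gain[OF y] line_transport[OF y]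
    by (simp add: sum_subtractf sum_distrib_left algebra_simps)
  also have "?b * ?c * (real_of_rat (gain (line I x y)) - ?y * real_of_rat (transport (line I x y)))
      + ?b * ?c * ?y * ?r = ?b * ?c * real_of_rat (eval_line (radius I) (line I x y) y)"
    by (simp add: eval_line_def of_rat_add of_rat_mult of_rat_diff algebra_simps)
  finally show "objective I (rvec x) \<gamma> \<le> ?b * ?c * real_of_rat (eval_line (radius I) (line I x y) y)" .
qed

text \<open>Nonnegative penalized values say that \<open>y\<close> times the transport distance is
  at most the gain, hence below 2 to the power \<open>n\<close>. The radius is at least 2 to the
  power -\<open>k\<close>, so beyond the threshold every distance fits the budget.\<close>

lemma line_far:
  assumes n: "\<And>A. A \<in> scenarios I \<Longrightarrow> rat_bits n (Gr I x A)" and k: "rat_bits k (radius I)"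
    and y: "2 ^ (n + k) \<le> y"
  shows "transport (line I x y) \<le> radius I"
proof -
  have y0: "0 < y" using y by (rule less_le_trans[rotated]) simp
  have y0': "0 < real_of_rat y" using y0 by simp
  have "real_of_rat (transport (line I x y)) \<le> (\<Sum>A\<in>support I. phat I A * (2 ^ n / real_of_rat y))"
    unfolding line_transport[OF less_imp_le[OF y0]]
  proof (intro sum_mono mult_left_mono)
    fix A assume A: "A \<in> support I"
    then have As: "A \<in> scenarios I" using support_scenarios[OF I] by blast
    let ?B = "Apx I x y A"
    have B: "?B \<in> scenarios I" using Apx_scenario As y0 by simp
    have "Gr I x ?B \<le> 2 ^ n" using abs_less_of_rat_bits[OF n[OF B]] by linarith
    then have "real_of_rat (Gr I x ?B) \<le> real_of_rat (2 ^ n)" by (simp only: of_rat_less_eq)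
    then have "gcost I (rvec x) ?B \<le> 2 ^ n" using Gr[OF I x_feasible B] by (simp add: of_rat_power)
    moreover have "real_of_rat y * kappa I A ?B \<le> gcost I (rvec x) ?B"
      using penalized_nonneg[OF less_imp_le[OF y0] As] by simp
    ultimately show "kappa I A ?B \<le> 2 ^ n / real_of_rat y" using y0' by (simp add: le_divide_eq mult.commute)
    show "0 \<le> phat I A" using phat_pos[OF I A] by simp
  qed
  also have "\<dots> = 2 ^ n / real_of_rat y" using phat_sum[OF I] by (simp flip: sum_distrib_right sum_divide_distrib)
  also have "\<dots> \<le> real_of_rat (radius I)"
  proof -
    have "rat_bits k (inverse (radius I))" by (rule rat_bits_inverse[OF k])
    then have "\<bar>inverse (radius I)\<bar> < 2 ^ k" by (rule abs_less_of_rat_bits)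
    then have "inverse (radius I) \<le> 2 ^ k" by linarith
    then have "1 \<le> 2 ^ k * radius I" using radius_pos[OF I] by (simp add: field_simps)
    then have "2 ^ n * 1 \<le> 2 ^ n * (2 ^ k * radius I)" by (intro mult_left_mono) auto
    also have "\<dots> = 2 ^ (n + k) * radius I" by (simp add: power_add)
    also have "\<dots> \<le> y * radius I" using y radius_pos[OF I] by (intro mult_right_mono) auto
    finally have "real_of_rat (2 ^ n) \<le> real_of_rat (y * radius I)" by (simp only: of_rat_less_eq mult_1_right)
    then show ?thesis using y0' by (simp add: of_rat_mult of_rat_power divide_le_eq mult.commute)
  qed
  finally show ?thesis by (simp only: of_rat_less_eq)
qed

text \<open>Translates a list of weights back into a transport matrix, for the empty plan as well as
  for queried lines. The arbitrary \<open>F\<close> matters: the same plan is later evaluated at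
  decisions other than \<open>x\<close>.\<close>

lemma found_plan:
  assumes "L = (0, 0, []) \<or> (\<exists>y\<ge>0. L = line I x y)"
  obtains \<gamma> where "\<And>A A'. A \<in> support I \<Longrightarrow> 0 \<le> \<gamma> A A'"
    "\<And>A. A \<in> support I \<Longrightarrow> (\<Sum>A'\<in>scenarios I. \<gamma> A A') \<le> phat I A"
    "(\<Sum>A\<in>support I. \<Sum>A'\<in>scenarios I. kappa I A A' * \<gamma> A A') = real_of_rat (transport L)"
    "\<And>F. (\<Sum>A\<in>support I. \<Sum>A'\<in>scenarios I. \<gamma> A A' * F A') = (\<Sum>w\<leftarrow>weights L. real_of_rat (snd w) * F (fst w))"
    "\<And>w. w \<in> set (weights L) \<Longrightarrow> fst w \<in> scenarios I \<and> 0 \<le> snd w"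
    "real_of_rat (gain L) = (\<Sum>w\<leftarrow>weights L. real_of_rat (snd w) * gcost I (rvec x) (fst w))"
proof (cases "L = (0, 0, [])")
  case True
  show ?thesis
    by (rule that[of "\<lambda>_ _. 0"]) (use phat_pos[OF I] True in \<open>auto simp: less_imp_le\<close>)
next
  case False
  then obtain y where y: "0 \<le> y" "L = line I x y" using assms by blast
  define \<gamma> where "\<gamma> A A' = (if A' = Apx I x y A then phat I A else 0)" for A A'
  have B: "Apx I x y A \<in> scenarios I" if "A \<in> support I" for A
    using Apx_scenario that y support_scenarios[OF I] by blast
  have inner: "(\<Sum>A'\<in>scenarios I. \<gamma> A A' * F A') = phat I A * F (Apx I x y A)" if "A \<in> support I" for A and F :: "val \<Rightarrow> real"
  proof -
    have "(\<Sum>A'\<in>scenarios I. \<gamma> A A' * F A') = (\<Sum>A'\<in>scenarios I. if A' = Apx I x y A then phat I A * F (Apx I x y A) else 0)"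
      by (rule sum.cong) (auto simp: \<gamma>_def)
    then show ?thesis using B[OF that] finite_scenarios[OF I] by simp
  qed
  have w: "weights L = map (\<lambda>w. (Apx I x y (fst w), snd w)) (central I)" by (simp add: y line_def)
  have F: "(\<Sum>A\<in>support I. \<Sum>A'\<in>scenarios I. \<gamma> A A' * F A') = (\<Sum>w\<leftarrow>weights L. real_of_rat (snd w) * F (fst w))" for F
    using sum_central[OF I, of "\<lambda>A. F (Apx I x y A)"] by (simp add: inner w o_def)
  show ?thesis
  proof (rule that[of \<gamma>])
    show "0 \<le> \<gamma> A A'" if "A \<in> support I" for A A' using phat_pos[OF I that] by (simp add: \<gamma>_def)
    show "(\<Sum>A'\<in>scenarios I. \<gamma> A A') \<le> phat I A" if "A \<in> support I" for A
      using inner[OF that, of "\<lambda>_. 1"] by simp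
    show "(\<Sum>A\<in>support I. \<Sum>A'\<in>scenarios I. kappa I A A' * \<gamma> A A') = real_of_rat (transport L)"
      unfolding y(2) line_transport[OF y(1)]
      by (rule sum.cong[OF refl]) (subst inner[symmetric], simp, simp add: mult.commute)
    show "(\<Sum>A\<in>support I. \<Sum>A'\<in>scenarios I. \<gamma> A A' * F A') = (\<Sum>w\<leftarrow>weights L. real_of_rat (snd w) * F (fst w))" for F
      by (rule F)
    show "fst w' \<in> scenarios I \<and> 0 \<le> snd w'" if w': "w' \<in> set (weights L)" for w'
    proof -
      obtain u where u: "u \<in> set (central I)" "w' = (Apx I x y (fst u), snd u)" using w' by (auto simp: w)
      note d = distinct_central[OF I]
      have "phat I (fst u) = real_of_rat (snd u)"
        using map_of_is_SomeI[OF d, of "fst u" "snd u"] u(1) by (simp add: phat_def)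
      moreover have "fst u \<in> support I" using u(1) by (auto simp: support_def)
      ultimately have "0 < real_of_rat (snd u)" using phat_pos[OF I] by metis
      then show ?thesis using u B[OF \<open>fst u \<in> support I\<close>] by simp
    qed
    show "real_of_rat (gain L) = (\<Sum>w\<leftarrow>weights L. real_of_rat (snd w) * gcost I (rvec x) (fst w))"
      unfolding F[symmetric] unfolding y(2) line_gain[OF y(1)] by (simp add: inner)
  qed
qed

end

section \<open>Size bounds and running time of the line search\<close>

lemma ptime_line:
  assumes I: "ptime D e (\<lambda>i. encode (I i))" and x: "ptime D e (\<lambda>i. enc_rats (x i))"
    and y: "ptime D e (\<lambda>i. Atom (y i))"
    and D: "\<And>i. i \<in> D \<Longrightarrow> I i \<in> J \<and> rvec (x i) \<in> int_feasible (I i) \<and> 0 \<le> y i"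
  shows "ptime D e (\<lambda>i. enc_line (line (I i) (x i) (y i)))"
proof -
  let ?E = "Sigma D (\<lambda>i. set (central (I i)))" and ?e = "with_arg e enc_weighted"
  have I': "ptime ?E ?e (\<lambda>j. encode (I (fst j)))" by (rule ptime_outer[OF I]) auto
  have x': "ptime ?E ?e (\<lambda>j. enc_rats (x (fst j)))" by (rule ptime_outer[OF x]) auto
  have y': "ptime ?E ?e (\<lambda>j. Atom (y (fst j)))" by (rule ptime_outer[OF y]) auto
  have A: "ptime ?E ?e (\<lambda>j. fst (snd j))" by (rule ptime_Node1[OF ptime_inner])
  have p: "ptime ?E ?e (\<lambda>j. Atom (snd (snd j)))" by (rule ptime_Node2[OF ptime_inner])
  have IJ: "I (fst j) \<in> J" if "j \<in> ?E" for j using D that by auto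
  have As: "fst (snd j) \<in> scenarios (I (fst j))" if "j \<in> ?E" for j
    by (rule central_scenario) (use D that in auto)
  have xs: "rvec (x (fst j)) \<in> int_feasible (I (fst j))" "0 \<le> y (fst j)" if "j \<in> ?E" for j using D that by auto
  have B: "ptime ?E ?e (\<lambda>j. Apx (I (fst j)) (x (fst j)) (y (fst j)) (fst (snd j)))"
    by (rule ptime_Apx[OF I' IJ x' y' A]) (use xs As in auto)
  have Bs: "Apx (I (fst j)) (x (fst j)) (y (fst j)) (fst (snd j)) \<in> scenarios (I (fst j))" if "j \<in> ?E" for j
    using Apx_scenario[OF IJ[OF that] xs(1)[OF that] xs(2)[OF that] As[OF that]] .
  have G: "ptime ?E ?e (\<lambda>j. Atom (Gr (I (fst j)) (x (fst j)) (Apx (I (fst j)) (x (fst j)) (y (fst j)) (fst (snd j)))))"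
    by (rule ptime_Gr[OF I' IJ x' B]) (use xs Bs int_feasible_subset in blast)+
  have K: "ptime ?E ?e (\<lambda>j. Atom (Kr (I (fst j)) (fst (snd j)) (Apx (I (fst j)) (x (fst j)) (y (fst j)) (fst (snd j)))))"
    by (rule ptime_Kr[OF I' IJ A B]) (use As Bs in blast)+
  have c: "ptime D e (\<lambda>i. enc_list (map enc_weighted (central (I i))))" by (rule ptime_central[OF I])
  have "ptime D e (\<lambda>i. enc_list (map enc_weighted
      (map (\<lambda>w. (Apx (I i) (x i) (y i) (fst w), snd w)) (central (I i)))))"
    by (rule ptime_map[OF c]) (simp add: ptime_Node B p)
  then show ?thesis unfolding enc_line_def line_def fst_conv snd_conv
    by (intro ptime_Node ptime_sum_map[OF c] ptime_mult p G K)
qed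

definition DX :: "('z dr_instance \<times> rat list) set" where
  "DX = {i. fst i \<in> J \<and> rvec (snd i) \<in> int_feasible (fst i)}"

definition eX :: "'z dr_instance \<times> rat list \<Rightarrow> val" where
  "eX i = Node (encode (fst i)) (enc_rats (snd i))"

text \<open>The bounds do not involve \<open>y\<close>: the dual variable influences only which
  scenarios are returned, and scenarios, their costs and their distances have sizes bounded in
  advance.\<close>

lemma line_bounds:
  obtains b s where "pbound DX (\<lambda>i. vsize (eX i)) b" "pbound DX (\<lambda>i. vsize (eX i)) s"
    "\<And>i y. i \<in> DX \<Longrightarrow> 0 \<le> y \<Longrightarrow> rat_bits (b i) (gain (line (fst i) (snd i) y))"
    "\<And>i y. i \<in> DX \<Longrightarrow> 0 \<le> y \<Longrightarrow> rat_bits (b i) (transport (line (fst i) (snd i) y))"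
    "\<And>i y. i \<in> DX \<Longrightarrow> 2 ^ b i \<le> y \<Longrightarrow> transport (line (fst i) (snd i) y) \<le> radius (fst i)"
    "\<And>i y. i \<in> DX \<Longrightarrow> 0 \<le> y \<Longrightarrow> vsize (enc_line (line (fst i) (snd i) y)) \<le> s i"
proof -
  obtain q0 :: "nat poly" where q0: "\<And>I A. I \<in> J \<Longrightarrow> A \<in> scenarios I \<Longrightarrow> vsize A \<le> poly q0 (input_size I)"
    using scenario_size by blast
  obtain q1 where q1: "\<And>I x A. I \<in> J \<Longrightarrow> rvec x \<in> feasible I \<Longrightarrow> A \<in> scenarios I \<Longrightarrow>
      vsize (Atom (Gr I x A)) \<le> poly q1 (vsize (enc_list [encode I, enc_rats x, A]))"
    using ptime_size[OF Gr_ptime] unfolding pbound_def by fastforce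
  obtain q2 where q2: "\<And>I A A'. I \<in> J \<Longrightarrow> A \<in> scenarios I \<Longrightarrow> A' \<in> scenarios I \<Longrightarrow>
      vsize (Atom (Kr I A A')) \<le> poly q2 (vsize (enc_list [encode I, A, A']))"
    using ptime_size[OF Kr_ptime] unfolding pbound_def by fastforce
  define e where "e i = vsize (eX i)" for i
  define a where "a i = poly q0 (e i)" for i
  define n where "n i = poly q1 (e i + a i + 5)" for i
  define k where "k i = poly q2 (e i + 2 * a i + 5)" for i
  define b where "b i = e i * (e i + n i + k i + 1) + 1 + n i + e i" for i
  define s where "s i = 2 + 2 * (1 + 2 * b i) + (2 + e i * (1 + (1 + a i + e i)))" for i
  note defs = s_def b_def k_def n_def a_def e_def
  have z0: "vsize (Atom 0) = 2" by (simp add: int_bits_def bitlen_def floorlog_def)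
  have As: "vsize A \<le> a i" if "i \<in> DX" "A \<in> scenarios (fst i)" for i A
  proof -
    have "vsize A \<le> poly q0 (input_size (fst i))" using q0 that by (simp add: DX_def)
    also have "\<dots> \<le> a i" unfolding a_def e_def eX_def input_size_def by (intro poly_nat_mono) simp
    finally show ?thesis .
  qed
  have G: "rat_bits (n i) (Gr (fst i) (snd i) A)" if "i \<in> DX" "A \<in> scenarios (fst i)" for i A
  proof (rule rat_bits_of_vsize_le)
    have "vsize (Atom (Gr (fst i) (snd i) A)) \<le> poly q1 (vsize (enc_list [encode (fst i), enc_rats (snd i), A]))"
      using q1[of "fst i" "snd i" A] that int_feasible_subset[of "fst i"]
      by (simp add: DX_def subset_iff del: vsize.simps enc_list.simps)
    also have "\<dots> \<le> n i" unfolding n_def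
      using As[OF that] z0 by (intro poly_nat_mono) (simp add: e_def eX_def)
    finally show "vsize (Atom (Gr (fst i) (snd i) A)) \<le> n i" .
  qed
  have K: "rat_bits (k i) (Kr (fst i) A A')" if "i \<in> DX" "A \<in> scenarios (fst i)" "A' \<in> scenarios (fst i)" for i A A'
  proof (rule rat_bits_of_vsize_le)
    have "vsize (Atom (Kr (fst i) A A')) \<le> poly q2 (vsize (enc_list [encode (fst i), A, A']))"
      using q2[of "fst i" A A'] that by (simp add: DX_def del: vsize.simps enc_list.simps)
    also have "\<dots> \<le> k i" unfolding k_def
      using As[OF that(1,2)] As[OF that(1,3)] z0 by (intro poly_nat_mono) (simp add: e_def eX_def)
    finally show "vsize (Atom (Kr (fst i) A A')) \<le> k i" .
  qed
  have ce: "vsize (enc_list (map enc_weighted (central (fst i)))) \<le> e i" for i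
    by (simp add: e_def eX_def encode_eq)
  have len: "length (central (fst i)) \<le> e i" for i
    using length_le_vsize[of "map enc_weighted (central (fst i))"] ce[of i] by simp
  have ps: "vsize (Atom (snd w)) \<le> e i" if "w \<in> set (central (fst i))" for i w
    using vsize_mem_enc_list[of "enc_weighted w" "map enc_weighted (central (fst i))"] ce[of i] that by force
  have r: "rat_bits (e i) (radius (fst i))" for i
    by (rule rat_bits_of_vsize_le) (simp add: e_def eX_def encode_eq)
  have B: "Apx (fst i) (snd i) y (fst w) \<in> scenarios (fst i)" "fst w \<in> scenarios (fst i)"
    if "i \<in> DX" "0 \<le> y" "w \<in> set (central (fst i))" for i y w
    using Apx_scenario[of "fst i" "snd i" y "fst w"] central_scenario[of "fst i" w] that by (auto simp: DX_def)
  have gb: "rat_bits (b i) (gain (line (fst i) (snd i) y))" if "i \<in> DX" "0 \<le> y" for i y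
  proof (rule rat_bits_mono)
    show "rat_bits (length (map (\<lambda>w. snd w * Gr (fst i) (snd i) (Apx (fst i) (snd i) y (fst w))) (central (fst i)))
       * ((e i + n i) + 1) + 1) (gain (line (fst i) (snd i) y))"
      unfolding line_def fst_conv
    proof (rule rat_bits_sum_list)
      fix c assume "c \<in> set (map (\<lambda>w. snd w * Gr (fst i) (snd i) (Apx (fst i) (snd i) y (fst w))) (central (fst i)))"
      then obtain w where w: "w \<in> set (central (fst i))" "c = snd w * Gr (fst i) (snd i) (Apx (fst i) (snd i) y (fst w))"
        by auto
      show "rat_bits (e i + n i) c"
        unfolding w(2) by (rule rat_bits_mult[OF rat_bits_of_vsize_le[OF ps[OF w(1)]] G[OF that(1) B(1)[OF that w(1)]]])
    qed
    have "length (central (fst i)) * (e i + n i + 1) \<le> e i * (e i + n i + k i + 1)"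
      using len by (intro mult_mono) auto
    then show "length (map (\<lambda>w. snd w * Gr (fst i) (snd i) (Apx (fst i) (snd i) y (fst w))) (central (fst i)))
       * ((e i + n i) + 1) + 1 \<le> b i" unfolding b_def length_map by linarith
  qed
  have tb: "rat_bits (b i) (transport (line (fst i) (snd i) y))" if "i \<in> DX" "0 \<le> y" for i y
  proof (rule rat_bits_mono)
    show "rat_bits (length (map (\<lambda>w. snd w * Kr (fst i) (fst w) (Apx (fst i) (snd i) y (fst w))) (central (fst i)))
       * ((e i + k i) + 1) + 1) (transport (line (fst i) (snd i) y))"
      unfolding line_def fst_conv snd_conv
    proof (rule rat_bits_sum_list)
      fix c assume "c \<in> set (map (\<lambda>w. snd w * Kr (fst i) (fst w) (Apx (fst i) (snd i) y (fst w))) (central (fst i)))"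
      then obtain w where w: "w \<in> set (central (fst i))" "c = snd w * Kr (fst i) (fst w) (Apx (fst i) (snd i) y (fst w))"
        by auto
      show "rat_bits (e i + k i) c"
        unfolding w(2) by (rule rat_bits_mult[OF rat_bits_of_vsize_le[OF ps[OF w(1)]] K[OF that(1) B(2,1)[OF that w(1)]]])
    qed
    have "length (central (fst i)) * (e i + k i + 1) \<le> e i * (e i + n i + k i + 1)"
      using len by (intro mult_mono) auto
    then show "length (map (\<lambda>w. snd w * Kr (fst i) (fst w) (Apx (fst i) (snd i) y (fst w))) (central (fst i)))
       * ((e i + k i) + 1) + 1 \<le> b i" unfolding b_def length_map by linarith
  qed
  show ?thesis
  proof (rule that[of b s])
    show "pbound DX (\<lambda>i. vsize (eX i)) b" unfolding defs by (intro pbound_intros)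
    show "pbound DX (\<lambda>i. vsize (eX i)) s" unfolding defs by (intro pbound_intros)
    show "transport (line (fst i) (snd i) y) \<le> radius (fst i)" if "i \<in> DX" "2 ^ b i \<le> y" for i y
    proof (rule line_far)
      have "(2::rat) ^ (n i + e i) \<le> 2 ^ b i" unfolding b_def by (intro power_increasing) auto
      then show "2 ^ (n i + e i) \<le> y" using that(2) by linarith
    qed (use that(1) G r in \<open>auto simp: DX_def\<close>)
    show "vsize (enc_line (line (fst i) (snd i) y)) \<le> s i" if "i \<in> DX" "0 \<le> y" for i y
    proof -
      let ?ws = "map enc_weighted (map (\<lambda>w. (Apx (fst i) (snd i) y (fst w), snd w)) (central (fst i)))"
      have "vsize (enc_list ?ws) \<le> 2 + length ?ws * (1 + (1 + a i + e i))"
      proof (rule vsize_enc_list_le)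
        fix v assume "v \<in> set ?ws"
        then obtain w where w: "w \<in> set (central (fst i))" "v = Node (Apx (fst i) (snd i) y (fst w)) (Atom (snd w))"
          by auto
        then show "vsize v \<le> 1 + a i + e i"
          using As[OF that(1) B(1)[OF that w(1)]] ps[OF w(1)] by simp
      qed
      also have "\<dots> \<le> 2 + e i * (1 + (1 + a i + e i))" using len by (intro add_mono mult_mono) auto
      finally have 1: "vsize (enc_list ?ws) \<le> 2 + e i * (1 + (1 + a i + e i))" .
      have "vsize (enc_line (line (fst i) (snd i) y)) = 2 + vsize (Atom (gain (line (fst i) (snd i) y)))
          + vsize (Atom (transport (line (fst i) (snd i) y))) + vsize (enc_list ?ws)"
        by (simp add: enc_line_def) (simp add: line_def)
      moreover have "t = 2 + u + v + c \<Longrightarrow> c \<le> X \<Longrightarrow> u \<le> Y \<Longrightarrow> v \<le> Y \<Longrightarrow> t \<le> 2 + 2 * Y + X"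
        for t u v c X Y :: nat by linarith
      ultimately show ?thesis
        using 1 vsize_le_of_rat_bits[OF gb[OF that]] vsize_le_of_rat_bits[OF tb[OF that]]
        unfolding s_def by blast
    qed
  qed (use gb tb in auto)
qed

lemma line_search_instance:
  assumes "I \<in> J" "rvec x \<in> int_feasible I"
    "\<And>y. 0 \<le> y \<Longrightarrow> rat_bits b (gain (line I x y))" "\<And>y. 0 \<le> y \<Longrightarrow> rat_bits b (transport (line I x y))"
    "\<And>y. 2 ^ b \<le> y \<Longrightarrow> transport (line I x y) \<le> radius I"
  shows "line_search (radius I) (line I x) (z_central I (rvec x) / (\<beta>\<^sub>1 I * \<beta>\<^sub>2 I)) b"
proof
  show "0 \<le> radius I" using radius_pos[OF assms(1)] by simp
  fix y :: rat
  have "1 \<le> \<beta>\<^sub>1 I" "1 \<le> \<beta>\<^sub>2 I" using betas[OF assms(1)] by auto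
  then have "0 < \<beta>\<^sub>1 I * \<beta>\<^sub>2 I" by simp
  then show "0 \<le> y \<Longrightarrow> z_central I (rvec x) / (\<beta>\<^sub>1 I * \<beta>\<^sub>2 I) \<le> real_of_rat (eval_line (radius I) (line I x y) y)"
    using line_value[OF assms(1,2), of y] by (simp add: divide_le_eq mult.commute)
qed (use assms in auto)

text \<open>The mixture of the two matrices found by the search is again a feasible plan. The bound
  by \<open>z_central\<close> at an arbitrary feasible point is what turns it into a cutting plane;
  the last inequality is where exactness of the search is used.\<close>

lemma plan_properties:
  assumes I: "I \<in> J" and x: "rvec x \<in> int_feasible I"
  shows "w \<in> set (plan I x) \<Longrightarrow> fst w \<in> scenarios I \<and> 0 \<le> snd w"
    and "(\<Sum>w\<leftarrow>plan I x. real_of_rat (snd w)) \<le> 1"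
    and "x' \<in> feasible I \<Longrightarrow> (\<Sum>w\<leftarrow>plan I x. real_of_rat (snd w) * gcost I x' (fst w)) \<le> z_central I x'"
    and "z_central I (rvec x) \<le> \<beta>\<^sub>1 I * \<beta>\<^sub>2 I * (\<Sum>w\<leftarrow>plan I x. real_of_rat (snd w) * gcost I (rvec x) (fst w))"
proof -
  obtain b s where b: "\<And>i y. i \<in> DX \<Longrightarrow> 0 \<le> y \<Longrightarrow> rat_bits (b i) (gain (line (fst i) (snd i) y))"
    "\<And>i y. i \<in> DX \<Longrightarrow> 0 \<le> y \<Longrightarrow> rat_bits (b i) (transport (line (fst i) (snd i) y))"
    "\<And>i y. i \<in> DX \<Longrightarrow> 2 ^ b i \<le> y \<Longrightarrow> transport (line (fst i) (snd i) y) \<le> radius (fst i)"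
    using line_bounds by (metis (no_types, lifting))
  have iD: "(I, x) \<in> DX" using I x by (simp add: DX_def)
  interpret line_search "radius I" "line I x" "z_central I (rvec x) / (\<beta>\<^sub>1 I * \<beta>\<^sub>2 I)" "b (I, x)"
    by (rule line_search_instance[OF I x]) (use b[OF iD] in auto)
  note sp = search_pair_correct[folded search_def]
  define L where "L = fst (search I x)"
  define L' where "L' = snd (search I x)"
  define a where "a = mix_weight (radius I) L L'"
  have fnd: "L = (0, 0, []) \<or> (\<exists>y\<ge>0. L = line I x y)" "L' = (0, 0, []) \<or> (\<exists>y\<ge>0. L' = line I x y)"
    using sp(1,2) by (auto simp: found_def L_def L'_def)
  obtain \<gamma> where g: "\<And>A A'. A \<in> support I \<Longrightarrow> 0 \<le> \<gamma> A A'"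
    "\<And>A. A \<in> support I \<Longrightarrow> (\<Sum>A'\<in>scenarios I. \<gamma> A A') \<le> phat I A"
    "(\<Sum>A\<in>support I. \<Sum>A'\<in>scenarios I. kappa I A A' * \<gamma> A A') = real_of_rat (transport L)"
    "\<And>F. (\<Sum>A\<in>support I. \<Sum>A'\<in>scenarios I. \<gamma> A A' * F A') = (\<Sum>w\<leftarrow>weights L. real_of_rat (snd w) * F (fst w))"
    "\<And>w. w \<in> set (weights L) \<Longrightarrow> fst w \<in> scenarios I \<and> 0 \<le> snd w"
    "real_of_rat (gain L) = (\<Sum>w\<leftarrow>weights L. real_of_rat (snd w) * gcost I (rvec x) (fst w))"
    using found_plan[OF I x fnd(1)] by blast
  obtain \<gamma>' where g': "\<And>A A'. A \<in> support I \<Longrightarrow> 0 \<le> \<gamma>' A A'"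
    "\<And>A. A \<in> support I \<Longrightarrow> (\<Sum>A'\<in>scenarios I. \<gamma>' A A') \<le> phat I A"
    "(\<Sum>A\<in>support I. \<Sum>A'\<in>scenarios I. kappa I A A' * \<gamma>' A A') = real_of_rat (transport L')"
    "\<And>F. (\<Sum>A\<in>support I. \<Sum>A'\<in>scenarios I. \<gamma>' A A' * F A') = (\<Sum>w\<leftarrow>weights L'. real_of_rat (snd w) * F (fst w))"
    "\<And>w. w \<in> set (weights L') \<Longrightarrow> fst w \<in> scenarios I \<and> 0 \<le> snd w"
    "real_of_rat (gain L') = (\<Sum>w\<leftarrow>weights L'. real_of_rat (snd w) * gcost I (rvec x) (fst w))"
    using found_plan[OF I x fnd(2)] by blast
  have C': "transport L' \<le> radius I" using sp(3) by (simp add: L'_def)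
  have "0 \<le> a \<and> a \<le> 1 \<and> a * transport L + (1 - a) * transport L' \<le> radius I"
  proof (cases "radius I < transport L")
    case True
    then show ?thesis using mix_weight_bounds[OF C' True] by (simp add: a_def)
  next
    case False
    \<comment> \<open>The answers at 0 already met the budget. Then \<open>mix_weight\<close>
      divides by zero, so the weight is 0.\<close>
    then have "L = L'" using sp(4) by (simp add: L_def L'_def)
    then show ?thesis using C' by (simp add: a_def mix_weight_def)
  qed
  then have a: "0 \<le> a" "a \<le> 1" "a * transport L + (1 - a) * transport L' \<le> radius I" by auto
  let ?a = "real_of_rat a"
  have ra: "0 \<le> ?a" "?a \<le> 1" using a by auto
  have pl: "plan I x = map (\<lambda>w. (fst w, a * snd w)) (weights L) @ map (\<lambda>w. (fst w, (1 - a) * snd w)) (weights L')"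
    by (simp add: plan_def Let_def L_def L'_def a_def)
  have sum: "(\<Sum>w\<leftarrow>plan I x. real_of_rat (snd w) * F (fst w)) =
      ?a * (\<Sum>w\<leftarrow>weights L. real_of_rat (snd w) * F (fst w))
      + (1 - ?a) * (\<Sum>w\<leftarrow>weights L'. real_of_rat (snd w) * F (fst w))" for F
    by (simp add: pl o_def of_rat_mult of_rat_diff sum_list_const_mult[symmetric] mult.assoc)
  define \<delta> where "\<delta> A A' = ?a * \<gamma> A A' + (1 - ?a) * \<gamma>' A A'" for A A'
  have d_sum: "(\<Sum>A\<in>support I. \<Sum>A'\<in>scenarios I. \<delta> A A' * F A') = (\<Sum>w\<leftarrow>plan I x. real_of_rat (snd w) * F (fst w))" for F
    unfolding sum g(4)[symmetric] g'(4)[symmetric]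
    by (simp add: \<delta>_def distrib_right sum.distrib sum_distrib_left mult.assoc)
  have row: "(\<Sum>A'\<in>scenarios I. \<delta> A A') \<le> phat I A" if "A \<in> support I" for A
  proof -
    have "(\<Sum>A'\<in>scenarios I. \<delta> A A') = ?a * (\<Sum>A'\<in>scenarios I. \<gamma> A A') + (1 - ?a) * (\<Sum>A'\<in>scenarios I. \<gamma>' A A')"
      by (simp add: \<delta>_def sum.distrib sum_distrib_left)
    also have "\<dots> \<le> ?a * phat I A + (1 - ?a) * phat I A"
      using g(2) g'(2) that ra by (intro add_mono mult_left_mono) auto
    finally show ?thesis by (simp add: algebra_simps)
  qed
  have "\<delta> \<in> plans I"
    unfolding plans_def
  proof (intro CollectI conjI ballI)
    show "0 \<le> \<delta> A A'" if "A \<in> support I" for A A'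
      unfolding \<delta>_def using g(1)[OF that] g'(1)[OF that] ra by (intro add_nonneg_nonneg mult_nonneg_nonneg) auto
    have "(\<Sum>A\<in>support I. \<Sum>A'\<in>scenarios I. kappa I A A' * \<delta> A A') =
        ?a * (\<Sum>A\<in>support I. \<Sum>A'\<in>scenarios I. kappa I A A' * \<gamma> A A')
        + (1 - ?a) * (\<Sum>A\<in>support I. \<Sum>A'\<in>scenarios I. kappa I A A' * \<gamma>' A A')"
      by (simp add: \<delta>_def distrib_left sum.distrib sum_distrib_left mult.left_commute)
    also have "\<dots> = real_of_rat (a * transport L + (1 - a) * transport L')"
      unfolding g(3) g'(3) by (simp add: of_rat_add of_rat_mult of_rat_diff)
    also have "\<dots> \<le> real_of_rat (radius I)" using a(3) by (simp only: of_rat_less_eq)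
    finally show "(\<Sum>A\<in>support I. \<Sum>A'\<in>scenarios I. kappa I A A' * \<delta> A A') \<le> real_of_rat (radius I)" .
  qed (rule row)
  then show "x' \<in> feasible I \<Longrightarrow> (\<Sum>w\<leftarrow>plan I x. real_of_rat (snd w) * gcost I x' (fst w)) \<le> z_central I x'"
    using objective_le_z[OF I, of \<delta> x'] unfolding objective_def d_sum by blast
  have "(\<Sum>w\<leftarrow>plan I x. real_of_rat (snd w)) = (\<Sum>A\<in>support I. \<Sum>A'\<in>scenarios I. \<delta> A A')"
    using d_sum[of "\<lambda>_. 1"] by simp
  also have "\<dots> \<le> (\<Sum>A\<in>support I. phat I A)" by (rule sum_mono) (rule row)
  finally show "(\<Sum>w\<leftarrow>plan I x. real_of_rat (snd w)) \<le> 1" using phat_sum[OF I] by simp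
  show "w \<in> set (plan I x) \<Longrightarrow> fst w \<in> scenarios I \<and> 0 \<le> snd w"
    using g(5) g'(5) a by (auto simp: pl)
  have "real_of_rat (mix_value (radius I) (search I x)) = ?a * real_of_rat (gain L) + (1 - ?a) * real_of_rat (gain L')"
    by (simp add: mix_value_def L_def L'_def a_def of_rat_add of_rat_mult of_rat_diff)
  also have "\<dots> = (\<Sum>w\<leftarrow>plan I x. real_of_rat (snd w) * gcost I (rvec x) (fst w))"
    unfolding g(6) g'(6) sum ..
  finally have "z_central I (rvec x) / (\<beta>\<^sub>1 I * \<beta>\<^sub>2 I) \<le> (\<Sum>w\<leftarrow>plan I x. real_of_rat (snd w) * gcost I (rvec x) (fst w))"
    using sp(5) by simp
  moreover have "1 \<le> \<beta>\<^sub>1 I" "1 \<le> \<beta>\<^sub>2 I" using betas[OF I] by auto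
  then have "0 < \<beta>\<^sub>1 I * \<beta>\<^sub>2 I" by simp
  ultimately show "z_central I (rvec x) \<le> \<beta>\<^sub>1 I * \<beta>\<^sub>2 I * (\<Sum>w\<leftarrow>plan I x. real_of_rat (snd w) * gcost I (rvec x) (fst w))"
    by (simp add: divide_le_eq mult.commute)
qed

lemma ptime_line_parts:
  assumes "ptime D e (\<lambda>i. enc_line (L i))"
  shows "ptime D e (\<lambda>i. Atom (gain (L i)))" "ptime D e (\<lambda>i. Atom (transport (L i)))"
    "ptime D e (\<lambda>i. enc_list (map enc_weighted (weights (L i))))"
proof -
  note h = assms[unfolded enc_line_def]
  show "ptime D e (\<lambda>i. Atom (gain (L i)))" by (rule ptime_Node1[OF h])
  show "ptime D e (\<lambda>i. Atom (transport (L i)))" by (rule ptime_Node1[OF ptime_Node2[OF h]])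
  show "ptime D e (\<lambda>i. enc_list (map enc_weighted (weights (L i))))" by (rule ptime_Node2[OF ptime_Node2[OF h]])
qed

lemma ptime_cross:
  assumes "ptime D e (\<lambda>i. enc_line (L i))" "ptime D e (\<lambda>i. enc_line (L' i))"
  shows "ptime D e (\<lambda>i. Atom (cross (L i) (L' i)))"
  unfolding cross_def by (intro ptime_ops ptime_line_parts assms)

definition enc_pair :: "plan_line \<times> plan_line \<Rightarrow> val" where
  "enc_pair P = Node (enc_line (fst P)) (enc_line (snd P))"

definition enc_bracket :: "bracket \<Rightarrow> val" where
  "enc_bracket s = Node (Atom (fst s)) (Node (Atom (fst (snd s))) (enc_pair (snd (snd s))))"

lemma ptime_pair_parts:
  assumes "ptime D e (\<lambda>i. enc_pair (P i))"
  shows "ptime D e (\<lambda>i. enc_line (fst (P i)))" "ptime D e (\<lambda>i. enc_line (snd (P i)))"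
  using ptime_Node1[OF assms[unfolded enc_pair_def]] ptime_Node2[OF assms[unfolded enc_pair_def]] .

text \<open>The loop runs only on inputs whose first answers exceed the budget, since the invariant
  of the bracket presupposes this. Its states are small: the ends are dyadic, and each stored line
  is the empty plan or a direct answer to a query.\<close>

lemma ptime_search: "ptime DX eX (\<lambda>i. enc_pair (search (fst i) (snd i)))"
proof -
  obtain b s where bs: "pbound DX (\<lambda>i. vsize (eX i)) b" "pbound DX (\<lambda>i. vsize (eX i)) s"
    and b: "\<And>i y. i \<in> DX \<Longrightarrow> 0 \<le> y \<Longrightarrow> rat_bits (b i) (gain (line (fst i) (snd i) y))"
    "\<And>i y. i \<in> DX \<Longrightarrow> 0 \<le> y \<Longrightarrow> rat_bits (b i) (transport (line (fst i) (snd i) y))"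
    "\<And>i y. i \<in> DX \<Longrightarrow> 2 ^ b i \<le> y \<Longrightarrow> transport (line (fst i) (snd i) y) \<le> radius (fst i)"
    and s: "\<And>i y. i \<in> DX \<Longrightarrow> 0 \<le> y \<Longrightarrow> vsize (enc_line (line (fst i) (snd i) y)) \<le> s i"
    using line_bounds by blast
  have ls: "line_search (radius (fst i)) (line (fst i) (snd i)) (z_central (fst i) (rvec (snd i)) / (\<beta>\<^sub>1 (fst i) * \<beta>\<^sub>2 (fst i))) (b i)"
    if "i \<in> DX" for i
    by (rule line_search_instance) (use b[OF that] that in \<open>auto simp: DX_def\<close>)
  have cI: "ptime E eX (\<lambda>i. encode (fst i))" for E unfolding eX_def by (rule ptime_Node1[OF ptime_input])
  have cx: "ptime E eX (\<lambda>i. enc_rats (snd i))" for E unfolding eX_def by (rule ptime_Node2[OF ptime_input])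
  let ?r = "\<lambda>i. radius (fst i)" and ?q = "\<lambda>i. line (fst i) (snd i)"
  have l0: "ptime E eX (\<lambda>i. enc_line (?q i 0))" if "E \<subseteq> DX" for E
    by (rule ptime_line[OF cI cx ptime_const]) (use that in \<open>auto simp: DX_def\<close>)
  let ?D = "{i \<in> DX. \<not> transport (?q i 0) \<le> ?r i}"
  let ?fin = "\<lambda>i. (bisect (?r i) (?q i) ^^ search_steps (?r i) (?q i)) (first_bracket (?q i))"
  \<comment> \<open>Queries require a nonnegative dual variable; nothing else about the bracket is
    needed for guard and body to be computable.\<close>
  define R where "R i = {s :: bracket. 0 \<le> fst s \<and> 0 \<le> fst (snd s)}" for i :: "'z dr_instance \<times> rat list"
  let ?e = "with_arg eX enc_bracket"
  have I': "ptime E ?e (\<lambda>j. encode (fst (fst j)))" for E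
    unfolding eX_def by (rule ptime_Node1[OF ptime_Node1[OF ptime_input]])
  have x': "ptime E ?e (\<lambda>j. enc_rats (snd (fst j)))" for E
    unfolding eX_def by (rule ptime_Node2[OF ptime_Node1[OF ptime_input]])
  have l: "ptime E ?e (\<lambda>j. Atom (fst (snd j)))" for E
    unfolding enc_bracket_def by (rule ptime_Node1[OF ptime_inner])
  have u: "ptime E ?e (\<lambda>j. Atom (fst (snd (snd j))))" for E
    unfolding enc_bracket_def by (rule ptime_Node1[OF ptime_Node2[OF ptime_inner]])
  have P: "ptime E ?e (\<lambda>j. enc_pair (snd (snd (snd j))))" for E
    unfolding enc_bracket_def by (rule ptime_Node2[OF ptime_Node2[OF ptime_inner]])
  note LL = ptime_pair_parts[OF P]
  note rr = ptime_radius[OF I']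
  have y: "ptime E ?e (\<lambda>j. Atom (bracket_cross (snd j)))" for E
    unfolding bracket_cross_def by (intro ptime_cross LL)
  have ins: "ptime E ?e (\<lambda>j. tv (inside (fst (snd j)) (fst (snd (snd j))) (c j)))"
    if "ptime E ?e (\<lambda>j. Atom (c j))" for E c
    unfolding inside_def by (intro ptime_ops l u that)
  have rp: "ptime E ?e (\<lambda>j. enc_pair (refined_pair (?r (fst j)) (?q (fst j)) (snd j)))" if E: "E \<subseteq> Sigma DX R" for E
  proof -
    let ?in = "\<lambda>j. inside (fst (snd j)) (fst (snd (snd j))) (bracket_cross (snd j))"
    let ?E = "{j \<in> E. ?in j}"
    have M: "ptime ?E ?e (\<lambda>j. enc_line (?q (fst j) (bracket_cross (snd j))))"
      by (rule ptime_line[OF I' x' y]) (use E in \<open>force simp: DX_def R_def inside_def\<close>)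
    have "ptime ?E ?e (\<lambda>j. if ?r (fst j) < transport (?q (fst j) (bracket_cross (snd j)))
       then Node (enc_line (?q (fst j) (bracket_cross (snd j)))) (enc_line (snd (snd (snd (snd j)))))
       else Node (enc_line (fst (snd (snd (snd j))))) (enc_line (?q (fst j) (bracket_cross (snd j)))))"
      by (intro ptime_if' ptime_Node M LL ptime_less rr ptime_line_parts(2))
    then have "ptime ?E ?e (\<lambda>j. enc_pair (replace_end (?r (fst j)) (?q (fst j) (bracket_cross (snd j))) (snd j)))"
      by (rule ptime_cong) (simp add: replace_end_def enc_pair_def)
    then have "ptime E ?e (\<lambda>j. if ?in j then enc_pair (replace_end (?r (fst j)) (?q (fst j) (bracket_cross (snd j))) (snd j))
        else enc_pair (snd (snd (snd j))))"
      by (rule ptime_if[OF ins[OF y] _ P])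
    then show ?thesis by (rule ptime_cong) (simp add: refined_pair_def)
  qed
  have "ptime ?D eX (\<lambda>i. enc_bracket (?fin i))"
  proof (rule ptime_while[where R = R and b = "\<lambda>i. unfinished (?r i) (?q i)"
        and N = "\<lambda>i. search_steps (?r i) (?q i)"
        and B = "\<lambda>i. 2 + 2 * (1 + 2 * (b i + (10 * b i + 5) + 2)) + (1 + 2 * (s i + 8))"])
    have "ptime ?D eX (\<lambda>i. Node (Atom 0) (Node (Atom 0) (Node (enc_line (?q i 0)) (enc_line (0, 0, [])))))"
      by (intro ptime_Node ptime_const l0) auto
    then show "ptime ?D eX (\<lambda>i. enc_bracket (first_bracket (?q i)))"
      by (simp add: enc_bracket_def first_bracket_def enc_pair_def)
    show "ptime (Sigma ?D R) ?e (\<lambda>j. tv (unfinished (?r (fst j)) (?q (fst j)) (snd j)))"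
      unfolding unfinished_def Let_def
      by (intro ptime_conj ptime_not ptime_rat_eq ins ptime_cross ptime_pair_parts rp y) auto
    let ?E = "{j \<in> Sigma ?D R. unfinished (?r (fst j)) (?q (fst j)) (snd j)}"
    have pr: "ptime ?E ?e (\<lambda>j. Atom (probe (snd j)))"
    proof -
      have "ptime ?E ?e (\<lambda>j. if fst (snd (snd j)) = 0 then Atom (2 * fst (snd j) + 1)
          else Atom ((fst (snd j) + fst (snd (snd j))) / 2))"
        by (intro ptime_if' ptime_ops l u)
      then show ?thesis by (rule ptime_cong) (simp add: probe_def)
    qed
    have M: "ptime ?E ?e (\<lambda>j. enc_line (?q (fst j) (probe (snd j))))"
      by (rule ptime_line[OF I' x' pr]) (force simp: DX_def R_def probe_def)
    have "ptime ?E ?e (\<lambda>j. if ?r (fst j) < transport (?q (fst j) (probe (snd j)))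
       then Node (Atom (probe (snd j))) (Node (Atom (fst (snd (snd j))))
         (Node (enc_line (?q (fst j) (probe (snd j)))) (enc_line (snd (snd (snd (snd j)))))))
       else Node (Atom (fst (snd j))) (Node (Atom (probe (snd j)))
         (Node (enc_line (fst (snd (snd (snd j))))) (enc_line (?q (fst j) (probe (snd j)))))))"
      by (intro ptime_if' ptime_Node M LL l u pr ptime_less rr ptime_line_parts(2))
    then show "ptime ?E ?e (\<lambda>j. enc_bracket (bisect (?r (fst j)) (?q (fst j)) (snd j)))"
      by (rule ptime_cong) (simp add: bisect_def enc_bracket_def enc_pair_def)
    show "pbound ?D (\<lambda>i. vsize (eX i)) (\<lambda>i. search_steps (?r i) (?q i))"
    proof (rule pbound_mono)
      show "pbound ?D (\<lambda>i. vsize (eX i)) (\<lambda>i. 10 * b i + 5)"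
        by (intro pbound_intros pbound_subset[OF bs(1)]) auto
      show "search_steps (?r i) (?q i) \<le> 10 * b i + 5" if "i \<in> ?D" for i
        using line_search.search_terminates(1)[OF ls] that by auto
    qed
    show "pbound ?D (\<lambda>i. vsize (eX i)) (\<lambda>i. 2 + 2 * (1 + 2 * (b i + (10 * b i + 5) + 2)) + (1 + 2 * (s i + 8)))"
      by (intro pbound_intros pbound_subset[OF bs(1)] pbound_subset[OF bs(2)]) auto
    fix i k assume i: "i \<in> ?D"
    then have i': "i \<in> DX" "?r i < transport (?q i 0)" by auto
    let ?S = "\<lambda>k. (bisect (?r i) (?q i) ^^ k) (first_bracket (?q i))"
    note inv = line_search.inv_all[OF ls[OF i'(1)] i'(2)]
    show "?S k \<in> R i"
      using line_search.inv_left[OF ls[OF i'(1)] inv[of k]] by (simp add: R_def)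
    show "k < search_steps (?r i) (?q i) \<Longrightarrow> unfinished (?r i) (?q i) (?S k)"
      by (rule line_search.search_terminates(3)[OF ls[OF i'(1)] i'(2)])
    show "\<not> unfinished (?r i) (?q i) (?fin i)"
      by (rule line_search.search_terminates(2)[OF ls[OF i'(1)] i'(2)])
    assume k: "k \<le> search_steps (?r i) (?q i)"
    then have kb: "k \<le> 10 * b i + 5"
      using line_search.search_terminates(1)[OF ls[OF i'(1)] i'(2)] by linarith
    have fs: "vsize (enc_line L) \<le> s i + 8" if L: "L \<in> line_search.found (?q i)" for L
    proof (cases "L = (0, 0, [])")
      case True
      then show ?thesis by (simp add: enc_line_def int_bits_def bitlen_def floorlog_def)
    next
      case False
      then obtain y where "0 \<le> y" "L = ?q i y" using L by (auto simp: line_search.found_def[OF ls[OF i'(1)]])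
      then show ?thesis using s[OF i'(1)] by fastforce
    qed
    have f: "fst (snd (snd (?S k))) \<in> line_search.found (?q i)" "snd (snd (snd (?S k))) \<in> line_search.found (?q i)"
      using inv[of k] line_search.q_found[OF ls[OF i'(1)]]
      by (auto simp: line_search.bracket_inv_def[OF ls[OF i'(1)]] Let_def)
    have e: "rat_bits (b i + (10 * b i + 5) + 2) (fst (?S k))" "rat_bits (b i + (10 * b i + 5) + 2) (fst (snd (?S k)))"
      using line_search.bracket_ends_bits[OF ls[OF i'(1)] inv[of k]] kb by (auto elim!: rat_bits_mono)
    show "vsize (enc_bracket (?S k)) \<le> 2 + 2 * (1 + 2 * (b i + (10 * b i + 5) + 2)) + (1 + 2 * (s i + 8))"
    proof -
      define S where "S = ?S k"
      have "vsize (enc_bracket S) = 3 + vsize (Atom (fst S)) + vsize (Atom (fst (snd S)))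
          + vsize (enc_line (fst (snd (snd S)))) + vsize (enc_line (snd (snd (snd S))))"
        by (simp add: enc_bracket_def enc_pair_def del: vsize.simps(1))
      moreover have "t = 3 + a + b' + c + d \<Longrightarrow> c \<le> X \<Longrightarrow> d \<le> X \<Longrightarrow> a \<le> Y \<Longrightarrow> b' \<le> Y \<Longrightarrow>
          t \<le> 2 + 2 * Y + (1 + 2 * X)" for t a b' c d X Y :: nat
        by linarith
      ultimately show ?thesis
        using fs[OF f(1)] fs[OF f(2)] vsize_le_of_rat_bits[OF e(1)] vsize_le_of_rat_bits[OF e(2)]
        unfolding S_def[symmetric] by blast
    qed
  qed
  then have fin: "ptime ?D eX (\<lambda>i. with_arg eX enc_bracket (i, ?fin i))"
    using ptime_Node[OF ptime_input] by simp
  have "ptime ?D eX (\<lambda>i. (\<lambda>j. enc_pair (refined_pair (?r (fst j)) (?q (fst j)) (snd j))) (i, ?fin i))"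
  proof (rule ptime_comp[OF rp[OF order_refl] _ fin])
    fix i assume "i \<in> ?D"
    then have i': "i \<in> DX" "?r i < transport (?q i 0)" by auto
    show "(i, ?fin i) \<in> Sigma DX R"
      using line_search.inv_left[OF ls[OF i'(1)] line_search.inv_all[OF ls[OF i'(1)] i'(2)]] i'(1)
      by (simp add: R_def)
  qed
  then have "ptime ?D eX (\<lambda>i. enc_pair (refined_pair (?r i) (?q i) (?fin i)))" by simp
  moreover have "ptime {i \<in> DX. transport (?q i 0) \<le> ?r i} eX (\<lambda>i. Node (enc_line (?q i 0)) (enc_line (?q i 0)))"
    by (intro ptime_Node l0) auto
  moreover have "ptime DX eX (\<lambda>i. tv (transport (?q i 0) \<le> ?r i))"
    by (intro ptime_le ptime_line_parts(2) l0 ptime_radius[OF cI] order_refl)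
  ultimately have "ptime DX eX (\<lambda>i. if transport (?q i 0) \<le> ?r i then Node (enc_line (?q i 0)) (enc_line (?q i 0))
      else enc_pair (refined_pair (?r i) (?q i) (?fin i)))"
    by (intro ptime_if)
  then show ?thesis by (rule ptime_cong) (simp add: search_def search_pair_def enc_pair_def)
qed

lemma ptime_plan:
  assumes I: "ptime D e (\<lambda>i. encode (I i))" and x: "ptime D e (\<lambda>i. enc_rats (x i))"
    and D: "\<And>i. i \<in> D \<Longrightarrow> I i \<in> J \<and> rvec (x i) \<in> int_feasible (I i)"
  shows "ptime D e (\<lambda>i. enc_list (map enc_weighted (plan (I i) (x i))))"
proof -
  have "ptime D e (\<lambda>i. eX (I i, x i))" unfolding eX_def fst_conv snd_conv by (rule ptime_Node[OF I x])
  then have s: "ptime D e (\<lambda>i. enc_pair (search (I i) (x i)))"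
    using ptime_comp[OF ptime_search, of D "\<lambda>i. (I i, x i)" e] D by (simp add: DX_def)
  note L = ptime_pair_parts[OF s]
  define a where "a i = mix_weight (radius (I i)) (fst (search (I i) (x i))) (snd (search (I i) (x i)))" for i
  have a: "ptime D e (\<lambda>i. Atom (a i))"
    unfolding a_def mix_weight_def by (intro ptime_ops ptime_radius[OF I] ptime_line_parts L)
  have sc: "ptime D e (\<lambda>i. enc_list (map enc_weighted (map (\<lambda>w. (fst w, c i * snd w)) (W i))))"
    if W: "ptime D e (\<lambda>i. enc_list (map enc_weighted (W i)))" and c: "ptime D e (\<lambda>i. Atom (c i))" for W c
  proof (rule ptime_map[OF W])
    let ?E = "Sigma D (\<lambda>i. set (W i))" and ?e = "with_arg e enc_weighted"
    have "ptime ?E ?e (\<lambda>j. Atom (c (fst j)))" by (rule ptime_outer[OF c]) auto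
    then show "ptime ?E ?e (\<lambda>j. Node (fst (fst (snd j), c (fst j) * snd (snd j))) (Atom (snd (fst (snd j), c (fst j) * snd (snd j)))))"
      unfolding fst_conv snd_conv
      by (intro ptime_Node ptime_mult ptime_Node1[OF ptime_inner] ptime_Node2[OF ptime_inner])
  qed
  have "ptime D e (\<lambda>i. enc_list (map enc_weighted
    (map (\<lambda>w. (fst w, a i * snd w)) (weights (fst (search (I i) (x i)))) @
     map (\<lambda>w. (fst w, (1 - a i) * snd w)) (weights (snd (search (I i) (x i)))))))"
    by (intro ptime_append sc ptime_line_parts L a ptime_ops)
  then show ?thesis by (simp add: plan_def Let_def a_def)
qed

text \<open>The number reported for a decision \<open>x\<close>: its cost under its own plan, hence
  a lower bound on its true cost.\<close>

definition fval :: "'z dr_instance \<Rightarrow> rat list \<Rightarrow> rat" where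
  "fval I x = dot (dimension I) (costs I) x + (\<Sum>w\<leftarrow>plan I x. snd w * Gr I x (fst w))"

lemma ptime_fval:
  assumes I: "ptime D e (\<lambda>i. encode (I i))" and x: "ptime D e (\<lambda>i. enc_rats (x i))"
    and D: "\<And>i. i \<in> D \<Longrightarrow> I i \<in> J \<and> rvec (x i) \<in> int_feasible (I i)"
  shows "ptime D e (\<lambda>i. Atom (fval (I i) (x i)))"
  unfolding fval_def
proof (rule ptime_add)
  show "ptime D e (\<lambda>i. Atom (dot (dimension (I i)) (costs (I i)) (x i)))"
    by (rule ptime_dot[OF ptime_dimension[OF I] pbound_dimension[OF I] ptime_costs[OF I] x])
       (use D int_feasible_length in force)
  have p: "ptime D e (\<lambda>i. enc_list (map enc_weighted (plan (I i) (x i))))" by (rule ptime_plan[OF I x D])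
  let ?E = "Sigma D (\<lambda>i. set (plan (I i) (x i)))" and ?e = "with_arg e enc_weighted"
  have I': "ptime ?E ?e (\<lambda>j. encode (I (fst j)))" by (rule ptime_outer[OF I]) auto
  have x': "ptime ?E ?e (\<lambda>j. enc_rats (x (fst j)))" by (rule ptime_outer[OF x]) auto
  have "ptime ?E ?e (\<lambda>j. Atom (Gr (I (fst j)) (x (fst j)) (fst (snd j))))"
  proof (rule ptime_Gr[OF I' _ x' ptime_Node1[OF ptime_inner]])
    fix j assume j: "j \<in> ?E"
    then have d: "I (fst j) \<in> J" "rvec (x (fst j)) \<in> int_feasible (I (fst j))" using D by auto
    then show "I (fst j) \<in> J" by blast
    show "rvec (x (fst j)) \<in> feasible (I (fst j)) \<and> fst (snd j) \<in> scenarios (I (fst j))"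
      using plan_properties(1)[OF d, of "snd j"] d int_feasible_subset j by auto
  qed
  then show "ptime D e (\<lambda>i. Atom (\<Sum>w\<leftarrow>plan (I i) (x i). snd w * Gr (I i) (x i) (fst w)))"
    by (intro ptime_sum_map[OF p] ptime_mult ptime_Node2[OF ptime_inner])
qed

end

section \<open>The cutting simplex algorithm\<close>

abbreviation enc_simplex :: "rat list list \<Rightarrow> val" where
  "enc_simplex V \<equiv> enc_list (map (\<lambda>v. enc_rats v) V)"

definition simplex_list :: "nat \<Rightarrow> rat list list \<Rightarrow> bool" where
  "simplex_list m V \<longleftrightarrow> length V = Suc m \<and> (\<forall>v\<in>set V. length v = m)"

definition center :: "nat \<Rightarrow> rat list list \<Rightarrow> rat list" where
  "center m V = map (\<lambda>j. (\<Sum>v\<leftarrow>V. v ! j) / (of_nat m + 1)) [0..<m]"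

definition slopes :: "nat \<Rightarrow> rat list list \<Rightarrow> rat list \<Rightarrow> rat list \<Rightarrow> rat list" where
  "slopes m V d x = map (\<lambda>v. \<Sum>j\<leftarrow>[0..<m]. d ! j * (v ! j - x ! j)) V"

definition argmin :: "rat list \<Rightarrow> nat" where
  "argmin a = foldl (\<lambda>b i. if a ! i < a ! b then i else b) 0 [0..<length a]"

definition scale :: "nat \<Rightarrow> rat" where
  "scale m = 16 * of_nat m ^ 4"

definition shift :: "nat \<Rightarrow> rat list \<Rightarrow> nat \<Rightarrow> rat" where
  "shift m a i = (if i = argmin a then 0 else of_int \<lfloor>2 * of_nat m * a ! i / (- (a ! argmin a))\<rfloor>)"

definition cut_simplex :: "nat \<Rightarrow> rat list list \<Rightarrow> rat list \<Rightarrow> rat list list" where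
  "cut_simplex m V a =
     map (\<lambda>i. map (\<lambda>j. (shift m a i * V ! argmin a ! j + scale m * V ! i ! j) / (scale m + shift m a i)) [0..<m])
       [0..<length V]"

text \<open>Contraction of one cut per dimension: its \<open>m\<close>-th power is the volume factor
  of \<open>volume_gain\<close>. Tracking this length avoids computing determinants or
  roots.\<close>

definition shrink :: "nat \<Rightarrow> rat" where
  "shrink m = 2 * scale m / (2 * scale m + 1)"

section \<open>Polynomial time of a single cut\<close>

lemma argmin_fold:
  fixes a :: "rat list"
  assumes "a \<noteq> []" "n \<le> length a"
  shows "foldl (\<lambda>b i. if a ! i < a ! b then i else b) 0 [0..<n] < length a \<and>
     (\<forall>i<n. a ! foldl (\<lambda>b i. if a ! i < a ! b then i else b) 0 [0..<n] \<le> a ! i)"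
  using assms(2)
proof (induction n)
  case (Suc n)
  define b where "b = foldl (\<lambda>b i. if a ! i < a ! b then i else b) 0 [0..<n]"
  have b: "b < length a" "\<forall>i<n. a ! b \<le> a ! i" using Suc by (auto simp: b_def)
  have f: "foldl (\<lambda>b i. if a ! i < a ! b then i else b) 0 [0..<Suc n] = (if a ! n < a ! b then n else b)"
    by (simp add: b_def)
  show ?case
  proof (cases "a ! n < a ! b")
    case True
    have "a ! n \<le> a ! i" if "i < Suc n" for i
    proof (cases "i = n")
      case False
      then have "a ! b \<le> a ! i" using b(2) that by simp
      then show ?thesis using True by linarith
    qed simp
    then show ?thesis using True Suc.prems unfolding f by simp
  next
    case False
    then show ?thesis using b unfolding f by (auto simp: less_Suc_eq not_less)
  qed
qed (use assms(1) in auto)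

lemma argmin_props: "a \<noteq> [] \<Longrightarrow> argmin a < length a" "i < length a \<Longrightarrow> a ! argmin a \<le> a ! i"
  using argmin_fold[of a "length a"] by (cases "a = []"; auto simp: argmin_def)+

lemma ptime_power4: "ptime D e (\<lambda>i. Atom (a i)) \<Longrightarrow> ptime D e (\<lambda>i. Atom (a i ^ 4))"
  unfolding power4_eq_xxxx by (intro ptime_mult)

lemma ptime_scale: "ptime D e (\<lambda>i. Atom (of_nat (m i))) \<Longrightarrow> ptime D e (\<lambda>i. Atom (scale (m i)))"
  unfolding scale_def by (intro ptime_ops ptime_power4)

lemma ptime_shrink: "ptime D e (\<lambda>i. Atom (of_nat (m i))) \<Longrightarrow> ptime D e (\<lambda>i. Atom (shrink (m i)))"
  unfolding shrink_def by (intro ptime_ops ptime_scale)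

lemma ptime_argmin:
  assumes a: "ptime D e (\<lambda>i. enc_rats (a i))" and ne: "\<And>i. i \<in> D \<Longrightarrow> a i \<noteq> []"
  shows "ptime D e (\<lambda>i. Atom (of_nat (argmin (a i))))"
proof -
  have pl: "pbound D (\<lambda>i. vsize (e i)) (\<lambda>i. length (a i))"
    by (rule pbound_mono[OF ptime_size[OF a]]) (metis length_le_vsize length_map)
  have u: "ptime D e (\<lambda>i. enc_nats [0..<length (a i)])" by (rule ptime_upt[OF ptime_length[OF a] pl])
  let ?A = "\<lambda>i. {..<length (a i)}"
  let ?E = "Sigma (Sigma D (\<lambda>i. set [0..<length (a i)])) (\<lambda>j. ?A (fst j))"
  let ?n = "\<lambda>k. Atom (of_nat k)"
  let ?e = "with_arg (with_arg e ?n) ?n"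
  have a': "ptime ?E ?e (\<lambda>j. enc_rats (a (fst (fst j))))"
    by (rule ptime_outer[OF ptime_outer[OF a, of "Sigma D (\<lambda>i. set [0..<length (a i)])"]]) auto
  have b: "ptime ?E ?e (\<lambda>j. ?n (snd j))" by (rule ptime_inner)
  have k: "ptime ?E ?e (\<lambda>j. ?n (snd (fst j)))" by (rule ptime_Node2[OF ptime_Node1[OF ptime_input]])
  have step: "ptime ?E ?e (\<lambda>j. ?n (if a (fst (fst j)) ! snd (fst j) < a (fst (fst j)) ! snd j then snd (fst j) else snd j))"
  proof -
    have "ptime ?E ?e (\<lambda>j. if a (fst (fst j)) ! snd (fst j) < a (fst (fst j)) ! snd j then ?n (snd (fst j)) else ?n (snd j))"
      by (intro ptime_if' k b ptime_less ptime_nth[OF a' k] ptime_nth[OF a' b]) auto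
    then show ?thesis by (rule ptime_cong) simp
  qed
  show ?thesis unfolding argmin_def
  proof (rule ptime_foldl[where A = ?A and B = "\<lambda>i. 1 + 2 * (length (a i) + 1)"
        and st = "\<lambda>i x b. if a i ! x < a i ! b then x else b", OF u _ step])
    show "ptime D e (\<lambda>i. ?n 0)" by (rule ptime_const)
    show "pbound D (\<lambda>i. vsize (e i)) (\<lambda>i. 1 + 2 * (length (a i) + 1))" by (intro pbound_intros pl)
    fix i k assume i: "i \<in> D" and k: "k \<le> length [0..<length (a i)]"
    have t: "take k [0..<length (a i)] = [0..<k]" using k by (simp add: take_upt)
    show f: "foldl (\<lambda>b x. if a i ! x < a i ! b then x else b) 0 (take k [0..<length (a i)]) \<in> ?A i"
      unfolding t using argmin_fold[OF ne[OF i], of k] k by simp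
    show "vsize (?n (foldl (\<lambda>b x. if a i ! x < a i ! b then x else b) 0 (take k [0..<length (a i)])))
        \<le> 1 + 2 * (length (a i) + 1)"
      using f by (intro order_trans[OF vsize_of_nat_le]) auto
  qed
qed

context
  fixes D :: "'i set" and e :: "'i \<Rightarrow> val" and m :: "'i \<Rightarrow> nat" and V :: "'i \<Rightarrow> rat list list"
  assumes m: "ptime D e (\<lambda>i. Atom (of_nat (m i)))" and pm: "pbound D (\<lambda>i. vsize (e i)) m"
    and V: "ptime D e (\<lambda>i. enc_simplex (V i))" and D: "\<And>i. i \<in> D \<Longrightarrow> simplex_list (m i) (V i)"
begin

lemma ptime_center: "ptime D e (\<lambda>i. enc_rats (center (m i) (V i)))"
  unfolding center_def
proof (rule ptime_map[OF ptime_upt[OF m pm]])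
  let ?E = "Sigma D (\<lambda>i. set [0..<m i])" and ?e = "with_arg e (\<lambda>k. Atom (of_nat k))"
  have V': "ptime ?E ?e (\<lambda>j. enc_simplex (V (fst j)))" by (rule ptime_outer[OF V]) auto
  have m': "ptime ?E ?e (\<lambda>j. Atom (of_nat (m (fst j))))" by (rule ptime_outer[OF m]) auto
  let ?E' = "Sigma ?E (\<lambda>j. set (V (fst j)))" and ?e' = "with_arg ?e (\<lambda>v. enc_rats v)"
  have k: "ptime ?E' ?e' (\<lambda>j. Atom (of_nat (snd (fst j))))" by (rule ptime_Node2[OF ptime_Node1[OF ptime_input]])
  have v: "ptime ?E' ?e' (\<lambda>j. enc_rats (snd j))" by (rule ptime_inner)
  have "ptime ?E' ?e' (\<lambda>j. Atom (snd j ! snd (fst j)))"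
    by (rule ptime_nth[OF v k]) (use D in \<open>auto simp: simplex_list_def\<close>)
  then show "ptime ?E ?e (\<lambda>j. Atom ((\<Sum>v\<leftarrow>V (fst j). v ! snd j) / (of_nat (m (fst j)) + 1)))"
    by (intro ptime_divide ptime_add ptime_const m' ptime_sum_map[OF V'])
qed

lemma ptime_slopes:
  assumes d: "ptime D e (\<lambda>i. enc_rats (d i))" and x: "ptime D e (\<lambda>i. enc_rats (x i))"
    and l: "\<And>i. i \<in> D \<Longrightarrow> length (d i) = m i \<and> length (x i) = m i"
  shows "ptime D e (\<lambda>i. enc_rats (slopes (m i) (V i) (d i) (x i)))"
  unfolding slopes_def
proof (rule ptime_map[OF V])
  let ?E = "Sigma D (\<lambda>i. set (V i))" and ?e = "with_arg e (\<lambda>v. enc_rats v)"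
  have m': "ptime ?E ?e (\<lambda>j. Atom (of_nat (m (fst j))))" by (rule ptime_outer[OF m]) auto
  have d': "ptime ?E ?e (\<lambda>j. enc_rats (d (fst j)))" by (rule ptime_outer[OF d]) auto
  have x': "ptime ?E ?e (\<lambda>j. enc_rats (x (fst j)))" by (rule ptime_outer[OF x]) auto
  have v: "ptime ?E ?e (\<lambda>j. enc_rats (snd j))" by (rule ptime_inner)
  have pm': "pbound ?E (\<lambda>j. vsize (?e j)) (\<lambda>j. m (fst j))"
  proof (rule pbound_mono[OF ptime_size[OF d']])
    fix j assume "j \<in> ?E"
    then have "m (fst j) = length (map Atom (d (fst j)))" using l by auto
    then show "m (fst j) \<le> vsize (enc_rats (d (fst j)))" using length_le_vsize by metis
  qed
  let ?E' = "Sigma ?E (\<lambda>j. set [0..<m (fst j)])" and ?e' = "with_arg ?e (\<lambda>k. Atom (of_nat k))"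
  have k: "ptime ?E' ?e' (\<lambda>j. Atom (of_nat (snd j)))" by (rule ptime_inner)
  have v': "ptime ?E' ?e' (\<lambda>j. enc_rats (snd (fst j)))" by (rule ptime_outer[OF v]) auto
  have d'': "ptime ?E' ?e' (\<lambda>j. enc_rats (d (fst (fst j))))" by (rule ptime_outer[OF d']) auto
  have x'': "ptime ?E' ?e' (\<lambda>j. enc_rats (x (fst (fst j))))" by (rule ptime_outer[OF x']) auto
  have "ptime ?E' ?e' (\<lambda>j. Atom (d (fst (fst j)) ! snd j * (snd (fst j) ! snd j - x (fst (fst j)) ! snd j)))"
    by (intro ptime_mult ptime_diff ptime_nth[OF v' k] ptime_nth[OF d'' k] ptime_nth[OF x'' k])
       (use D l in \<open>auto simp: simplex_list_def\<close>)
  then show "ptime ?E ?e (\<lambda>j. Atom (\<Sum>k\<leftarrow>[0..<m (fst j)]. d (fst j) ! k * (snd j ! k - x (fst j) ! k)))"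
    by (rule ptime_sum_map[OF ptime_upt[OF m' pm']])
qed

lemma ptime_cut_simplex:
  assumes a: "ptime D e (\<lambda>i. enc_rats (a i))" and l: "\<And>i. i \<in> D \<Longrightarrow> length (a i) = Suc (m i)"
  shows "ptime D e (\<lambda>i. enc_simplex (cut_simplex (m i) (V i) (a i)))"
proof -
  have b: "ptime D e (\<lambda>i. Atom (of_nat (argmin (a i))))" by (rule ptime_argmin[OF a]) (use l in force)
  have bl: "argmin (a i) < Suc (m i)" if "i \<in> D" for i
    using argmin_props(1)[of "a i"] l[OF that] by (cases "a i") auto
  have pV: "pbound D (\<lambda>i. vsize (e i)) (\<lambda>i. length (V i))"
    by (rule pbound_mono[OF ptime_size[OF V]]) (metis length_le_vsize length_map)
  let ?n = "\<lambda>k. Atom (of_nat k)"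
  let ?E = "Sigma D (\<lambda>i. set [0..<length (V i)])" and ?e = "with_arg e ?n"
  have k: "ptime ?E ?e (\<lambda>j. ?n (snd j))" by (rule ptime_inner)
  have m': "ptime ?E ?e (\<lambda>j. ?n (m (fst j)))" by (rule ptime_outer[OF m]) auto
  have a': "ptime ?E ?e (\<lambda>j. enc_rats (a (fst j)))" by (rule ptime_outer[OF a]) auto
  have b': "ptime ?E ?e (\<lambda>j. ?n (argmin (a (fst j))))" by (rule ptime_outer[OF b]) auto
  have V': "ptime ?E ?e (\<lambda>j. enc_simplex (V (fst j)))" by (rule ptime_outer[OF V]) auto
  have pm': "pbound ?E (\<lambda>j. vsize (?e j)) (\<lambda>j. m (fst j))"
  proof (rule pbound_mono[OF ptime_size[OF V']])
    fix j assume "j \<in> ?E"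
    then have "m (fst j) \<le> length (map (\<lambda>v. enc_rats v) (V (fst j)))" using D by (auto simp: simplex_list_def)
    then show "m (fst j) \<le> vsize (enc_simplex (V (fst j)))" using length_le_vsize order_trans by blast
  qed
  have s: "ptime ?E ?e (\<lambda>j. Atom (shift (m (fst j)) (a (fst j)) (snd j)))"
  proof -
    have q: "ptime ?E ?e (\<lambda>j. Atom (2 * of_nat (m (fst j)) * a (fst j) ! snd j / (- (a (fst j) ! argmin (a (fst j))))))"
      by (intro ptime_divide ptime_mult ptime_uminus ptime_const m' ptime_nth[OF a' k] ptime_nth[OF a' b'])
         (use D l bl in \<open>auto simp: simplex_list_def\<close>)
    have "ptime ?E ?e (\<lambda>j. tv (?n (snd j) = ?n (argmin (a (fst j)))))" by (rule ptime_eq[OF k b'])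
    then have "ptime ?E ?e (\<lambda>j. tv (snd j = argmin (a (fst j))))" by simp
    from ptime_if'[OF this ptime_const ptime_floor[OF q], of "Atom 0"]
    show ?thesis by (rule ptime_cong) (simp add: shift_def)
  qed
  have Vb: "ptime ?E ?e (\<lambda>j. enc_rats (V (fst j) ! argmin (a (fst j))))"
    by (rule ptime_nth[OF V' b']) (use D bl in \<open>auto simp: simplex_list_def\<close>)
  have Vk: "ptime ?E ?e (\<lambda>j. enc_rats (V (fst j) ! snd j))"
    by (rule ptime_nth[OF V' k]) auto
  note sc = ptime_scale[OF m']
  let ?E' = "Sigma ?E (\<lambda>j. set [0..<m (fst j)])" and ?e' = "with_arg ?e ?n"
  have k': "ptime ?E' ?e' (\<lambda>j. ?n (snd j))" by (rule ptime_inner)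
  have s': "ptime ?E' ?e' (\<lambda>j. Atom (shift (m (fst (fst j))) (a (fst (fst j))) (snd (fst j))))"
    by (rule ptime_outer[OF s]) auto
  have sc': "ptime ?E' ?e' (\<lambda>j. Atom (scale (m (fst (fst j)))))" by (rule ptime_outer[OF sc]) auto
  have Vb': "ptime ?E' ?e' (\<lambda>j. enc_rats (V (fst (fst j)) ! argmin (a (fst (fst j)))))" by (rule ptime_outer[OF Vb]) auto
  have Vk': "ptime ?E' ?e' (\<lambda>j. enc_rats (V (fst (fst j)) ! snd (fst j)))" by (rule ptime_outer[OF Vk]) auto
  have len: "length (V i ! k) = m i" if "i \<in> D" "k < Suc (m i)" for i k
    using D[OF that(1)] that(2) by (auto simp: simplex_list_def)
  have entry: "ptime ?E' ?e' (\<lambda>j. Atom ((shift (m (fst (fst j))) (a (fst (fst j))) (snd (fst j)) * V (fst (fst j)) ! argmin (a (fst (fst j))) ! snd j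
      + scale (m (fst (fst j))) * V (fst (fst j)) ! snd (fst j) ! snd j)
      / (scale (m (fst (fst j))) + shift (m (fst (fst j))) (a (fst (fst j))) (snd (fst j)))))"
    by (intro ptime_divide ptime_add ptime_mult s' sc' ptime_nth[OF Vb' k'] ptime_nth[OF Vk' k'])
       (use D bl len in \<open>auto simp: simplex_list_def\<close>)
  have row: "ptime ?E ?e (\<lambda>j. enc_rats (map (\<lambda>l. (shift (m (fst j)) (a (fst j)) (snd j) * V (fst j) ! argmin (a (fst j)) ! l
      + scale (m (fst j)) * V (fst j) ! snd j ! l) / (scale (m (fst j)) + shift (m (fst j)) (a (fst j)) (snd j))) [0..<m (fst j)]))"
    by (rule ptime_map[OF ptime_upt[OF m' pm']]) (rule entry)
  show ?thesis unfolding cut_simplex_def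
    by (rule ptime_map[OF ptime_upt[OF ptime_length[OF V] pV]]) (rule row)
qed

end

context dr_algorithms
begin

text \<open>Two points are involved: the weights come from the plan of the rounded decision, the
  subgradients are taken at the unrounded \<open>x\<close>.\<close>

definition grad :: "'z dr_instance \<Rightarrow> rat list \<Rightarrow> rat list" where
  "grad I x = map (\<lambda>j. costs I ! j + (\<Sum>w\<leftarrow>plan I (Loc I x). snd w * Sg I x (fst w) ! j)) [0..<dimension I]"

text \<open>The answer to the separation query decides the kind of cut. \<open>THE\<close> decodes a
  separating vector; the encoding is injective.\<close>

definition cutvec :: "'z dr_instance \<Rightarrow> rat list \<Rightarrow> rat list" where
  "cutvec I x = (if Sep I x = Atom 1 then grad I x else (THE d. Sep I x = enc_rats d))"

lemma enc_rats_inject: "enc_rats x = enc_rats y \<longleftrightarrow> x = y"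
proof (induction x arbitrary: y)
  case Nil
  then show ?case by (cases y) auto
next
  case (Cons a x)
  then show ?case by (cases y) auto
qed

lemma enc_rats_not_one: "enc_rats x \<noteq> Atom 1"
  by (cases x) auto

lemma Sep_feasible:
  assumes "I \<in> J" "length x = dimension I" shows "Sep I x = Atom 1 \<longleftrightarrow> rvec x \<in> feasible I"
  using Sep[OF assms] enc_rats_not_one by (metis (full_types))

lemma cutvec_infeasible:
  assumes "I \<in> J" "length x = dimension I" "rvec x \<notin> feasible I"
  shows "length (cutvec I x) = dimension I" "Sep I x = enc_rats (cutvec I x)"
    "x' \<in> feasible I \<Longrightarrow> rvec (cutvec I x) \<bullet> x' < rvec (cutvec I x) \<bullet> rvec x"
proof -
  obtain d where d: "length d = dimension I" "Sep I x = enc_rats d"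
      "\<forall>x'\<in>feasible I. rvec d \<bullet> x' < rvec d \<bullet> rvec x"
    using Sep[OF assms(1,2)] assms(3) by auto
  have "cutvec I x = d"
    using d(2) Sep_feasible[OF assms(1,2)] assms(3) by (auto simp: cutvec_def enc_rats_inject)
  then show "length (cutvec I x) = dimension I" "Sep I x = enc_rats (cutvec I x)"
    "x' \<in> feasible I \<Longrightarrow> rvec (cutvec I x) \<bullet> x' < rvec (cutvec I x) \<bullet> rvec x" using d by auto
qed

lemma length_grad [simp]: "length (grad I x) = dimension I" by (simp add: grad_def)

lemma length_cutvec: "I \<in> J \<Longrightarrow> length x = dimension I \<Longrightarrow> length (cutvec I x) = dimension I"
  using cutvec_infeasible(1)[of I x] Sep_feasible[of I x]
  by (cases "rvec x \<in> feasible I") (auto simp: cutvec_def)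

context
  fixes D :: "'i set" and e :: "'i \<Rightarrow> val" and I :: "'i \<Rightarrow> 'z dr_instance" and x :: "'i \<Rightarrow> rat list"
  assumes I: "ptime D e (\<lambda>i. encode (I i))" and x: "ptime D e (\<lambda>i. enc_rats (x i))"
begin

lemma ptime_grad:
  assumes D: "\<And>i. i \<in> D \<Longrightarrow> I i \<in> J \<and> rvec (x i) \<in> feasible (I i)"
  shows "ptime D e (\<lambda>i. enc_rats (grad (I i) (x i)))"
proof -
  have lx: "ptime D e (\<lambda>i. enc_rats (Loc (I i) (x i)))" by (rule ptime_Loc[OF I _ x]) (use D in auto)
  have lf: "rvec (Loc (I i) (x i)) \<in> int_feasible (I i)" if "i \<in> D" for i using Loc D[OF that] by blast
  have p: "ptime D e (\<lambda>i. enc_list (map enc_weighted (plan (I i) (Loc (I i) (x i)))))"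
    by (rule ptime_plan[OF I lx]) (use D lf in auto)
  note m = ptime_dimension[OF I] and pm = pbound_dimension[OF I]
  let ?n = "\<lambda>k. Atom (of_nat k)"
  let ?E = "Sigma D (\<lambda>i. set [0..<dimension (I i)])" and ?e = "with_arg e ?n"
  have c': "ptime ?E ?e (\<lambda>j. enc_rats (costs (I (fst j))))" by (rule ptime_outer[OF ptime_costs[OF I]]) auto
  have p': "ptime ?E ?e (\<lambda>j. enc_list (map enc_weighted (plan (I (fst j)) (Loc (I (fst j)) (x (fst j))))))"
    by (rule ptime_outer[OF p]) auto
  have k: "ptime ?E ?e (\<lambda>j. ?n (snd j))" by (rule ptime_inner)
  have I': "ptime ?E ?e (\<lambda>j. encode (I (fst j)))" by (rule ptime_outer[OF I]) auto
  have x': "ptime ?E ?e (\<lambda>j. enc_rats (x (fst j)))" by (rule ptime_outer[OF x]) auto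
  let ?E' = "Sigma ?E (\<lambda>j. set (plan (I (fst j)) (Loc (I (fst j)) (x (fst j)))))" and ?e' = "with_arg ?e enc_weighted"
  have I'': "ptime ?E' ?e' (\<lambda>j. encode (I (fst (fst j))))" by (rule ptime_outer[OF I']) auto
  have x'': "ptime ?E' ?e' (\<lambda>j. enc_rats (x (fst (fst j))))" by (rule ptime_outer[OF x']) auto
  have k'': "ptime ?E' ?e' (\<lambda>j. ?n (snd (fst j)))" by (rule ptime_outer[OF k]) auto
  have dj: "I (fst (fst j)) \<in> J" "rvec (x (fst (fst j))) \<in> feasible (I (fst (fst j)))"
      "fst (snd j) \<in> scenarios (I (fst (fst j)))" if "j \<in> ?E'" for j
  proof -
    have i: "fst (fst j) \<in> D" "snd j \<in> set (plan (I (fst (fst j))) (Loc (I (fst (fst j))) (x (fst (fst j)))))"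
      using that by auto
    show 1: "I (fst (fst j)) \<in> J" "rvec (x (fst (fst j))) \<in> feasible (I (fst (fst j)))" using D[OF i(1)] by auto
    show "fst (snd j) \<in> scenarios (I (fst (fst j)))"
      using plan_properties(1)[OF 1(1) lf[OF i(1)] i(2)] by blast
  qed
  have g: "ptime ?E' ?e' (\<lambda>j. enc_rats (Sg (I (fst (fst j))) (x (fst (fst j))) (fst (snd j))))"
    by (rule ptime_Sg[OF I'' _ x'' ptime_Node1[OF ptime_inner]]) (use dj in auto)
  have "ptime ?E' ?e' (\<lambda>j. Atom (Sg (I (fst (fst j))) (x (fst (fst j))) (fst (snd j)) ! snd (fst j)))"
  proof (rule ptime_nth[OF g k''])
    fix j assume j: "j \<in> ?E'"
    then have "snd (fst j) < dimension (I (fst (fst j)))" by auto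
    then show "snd (fst j) < length (Sg (I (fst (fst j))) (x (fst (fst j))) (fst (snd j)))"
      using Sg[OF dj[OF j]] by simp
  qed
  then have s: "ptime ?E ?e (\<lambda>j. Atom (\<Sum>w\<leftarrow>plan (I (fst j)) (Loc (I (fst j)) (x (fst j))). snd w * Sg (I (fst j)) (x (fst j)) (fst w) ! snd j))"
    by (intro ptime_sum_map[OF p'] ptime_mult ptime_Node2[OF ptime_inner])
  have c: "ptime ?E ?e (\<lambda>j. Atom (costs (I (fst j)) ! snd j))" by (rule ptime_nth[OF c' k]) auto
  show ?thesis unfolding grad_def by (rule ptime_map[OF ptime_upt[OF m pm]]) (rule ptime_add[OF c s])
qed

end

lemma ptime_cutvec:
  assumes I: "ptime D e (\<lambda>i. encode (I i))" and x: "ptime D e (\<lambda>i. enc_rats (x i))"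
    and D: "\<And>i. i \<in> D \<Longrightarrow> I i \<in> J \<and> length (x i) = dimension (I i)"
  shows "ptime D e (\<lambda>i. enc_rats (cutvec (I i) (x i)))"
proof -
  have S: "ptime D e (\<lambda>i. Sep (I i) (x i))" by (rule ptime_Sep[OF I _ x]) (use D in auto)
  let ?D = "{i \<in> D. Sep (I i) (x i) = Atom 1}"
  have "ptime D e (\<lambda>i. if Sep (I i) (x i) = Atom 1 then enc_rats (cutvec (I i) (x i)) else enc_rats (cutvec (I i) (x i)))"
  proof (rule ptime_if)
    show "ptime D e (\<lambda>i. tv (Sep (I i) (x i) = Atom 1))" by (rule ptime_eq[OF S ptime_const])
    have "ptime ?D e (\<lambda>i. enc_rats (grad (I i) (x i)))"
      by (rule ptime_grad[OF ptime_subset[OF I] ptime_subset[OF x]]) (use D Sep_feasible in auto)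
    then show "ptime ?D e (\<lambda>i. enc_rats (cutvec (I i) (x i)))" by (rule ptime_cong) (simp add: cutvec_def)
    have "ptime {i \<in> D. Sep (I i) (x i) \<noteq> Atom 1} e (\<lambda>i. Sep (I i) (x i))" by (rule ptime_subset[OF S]) auto
    then show "ptime {i \<in> D. Sep (I i) (x i) \<noteq> Atom 1} e (\<lambda>i. enc_rats (cutvec (I i) (x i)))"
      by (rule ptime_cong) (use cutvec_infeasible(2) Sep_feasible D in auto)
  qed
  then show ?thesis by simp
qed

end

section \<open>Rational computation of the real cut\<close>

lemma floor_of_rat_eq: "\<lfloor>real_of_rat q\<rfloor> = \<lfloor>q\<rfloor>"
proof (rule floor_unique)
  have "real_of_rat (of_int \<lfloor>q\<rfloor>) \<le> real_of_rat q" by (simp only: of_rat_less_eq of_int_floor_le)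
  then show "real_of_int \<lfloor>q\<rfloor> \<le> real_of_rat q" by simp
  have "q < of_int \<lfloor>q\<rfloor> + 1" by linarith
  then have "real_of_rat q < real_of_rat (of_int \<lfloor>q\<rfloor> + 1)" by (simp only: of_rat_less)
  then show "real_of_rat q < real_of_int \<lfloor>q\<rfloor> + 1" by (simp add: of_rat_add)
qed

lemma of_rat_sum_map: "real_of_rat (\<Sum>x\<leftarrow>xs. f x) = (\<Sum>x\<leftarrow>xs. real_of_rat (f x))"
  by (simp add: of_rat_sum_list o_def)

lemma sum_list_upt: "(\<Sum>j\<leftarrow>[0..<n]. f j) = (\<Sum>j<n. f j)"
  by (simp add: interv_sum_list_conv_sum_set_nat atLeast0LessThan)

lemma sum_list_nth: "length V = Suc m \<Longrightarrow> (\<Sum>v\<leftarrow>V. f v) = (\<Sum>i\<le>m. f (V ! i))"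
  by (simp add: sum_list_sum_nth atLeast0LessThan lessThan_Suc_atMost)

lemma simplex_list_cut: "simplex_list m V \<Longrightarrow> simplex_list m (cut_simplex m V a)"
  by (auto simp: simplex_list_def cut_simplex_def)

text \<open>Connects the lists handled by the program with \<open>simplex_cut\<close>. The direction
  \<open>d\<close> is arbitrary, even zero, because sizes must be bounded before anything is known
  about the cut.\<close>

locale simplex_data =
  fixes m :: nat and V :: "rat list list" and d :: "rat list"
  assumes m_ge_1: "1 \<le> m" and V: "simplex_list m V" and d: "length d = m"
begin

abbreviation slo :: "rat list" where "slo \<equiv> slopes m V d (center m V)"

definition rv :: "nat \<Rightarrow> nat \<Rightarrow> real" where "rv i j = real_of_rat (V ! i ! j)"
definition rd :: "nat \<Rightarrow> real" where "rd j = real_of_rat (d ! j)"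
definition rx :: "nat \<Rightarrow> real" where "rx j = (\<Sum>i\<le>m. rv i j) / (real m + 1)"
definition ra :: "nat \<Rightarrow> real" where "ra i = (\<Sum>j<m. rd j * (rv i j - rx j))"
definition rb :: "nat \<Rightarrow> int" where
  "rb i = (if i = argmin slo then 0 else \<lfloor>2 * real m * ra i / (- ra (argmin slo))\<rfloor>)"

lemma length_V: "length V = Suc m" using V by (simp add: simplex_list_def)

lemma rx_eq: "j < m \<Longrightarrow> rx j = real_of_rat (center m V ! j)"
  by (simp add: rx_def center_def rv_def of_rat_divide of_rat_add of_rat_sum sum_list_nth[OF length_V])

lemma length_slo: "length slo = Suc m" using length_V by (simp add: slopes_def)

lemma ra_eq: "i \<le> m \<Longrightarrow> ra i = real_of_rat (slo ! i)"
  using length_V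
  by (simp add: ra_def slopes_def rd_def rv_def rx_eq of_rat_mult of_rat_diff of_rat_sum sum_list_upt)

lemma argmin_le: "argmin slo \<le> m"
  using argmin_props(1)[of slo] length_slo by (cases slo) auto

sublocale simplex_cut m rv rd rx ra "argmin slo" rb "16 * real m ^ 4"
proof
  fix i assume i: "i \<le> m"
  have "slo ! argmin slo \<le> slo ! i" using argmin_props(2)[of i slo] length_slo i by simp
  then have "real_of_rat (slo ! argmin slo) \<le> real_of_rat (slo ! i)" by (simp only: of_rat_less_eq)
  then show "ra (argmin slo) \<le> ra i" using ra_eq[OF i] ra_eq[OF argmin_le] by simp
qed (use m_ge_1 argmin_le in \<open>auto simp: rx_def ra_def rb_def\<close>)

lemma shift_eq: "i \<le> m \<Longrightarrow> shift m slo i = of_int (rb i)"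
proof -
  assume i: "i \<le> m"
  have "2 * real m * ra i / (- ra (argmin slo)) = real_of_rat (2 * of_nat m * slo ! i / (- (slo ! argmin slo)))"
    using ra_eq[OF i] ra_eq[OF argmin_le] by (simp add: of_rat_divide of_rat_mult of_rat_minus)
  then have "\<lfloor>2 * real m * ra i / (- ra (argmin slo))\<rfloor> = \<lfloor>2 * of_nat m * slo ! i / (- (slo ! argmin slo))\<rfloor>"
    by (simp only: floor_of_rat_eq)
  then show ?thesis by (simp add: shift_def rb_def)
qed

lemma cut_nth_rat:
  assumes "i \<le> m" "j < m"
  shows "cut_simplex m V slo ! i ! j =
    (of_int (rb i) * V ! argmin slo ! j + 16 * of_nat m ^ 4 * V ! i ! j) / (16 * of_nat m ^ 4 + of_int (rb i))"
proof -
  have "cut_simplex m V slo ! i ! j =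
    (shift m slo i * V ! argmin slo ! j + scale m * V ! i ! j) / (scale m + shift m slo i)"
    using assms length_V by (simp add: cut_simplex_def del: upt_Suc)
  then show ?thesis unfolding shift_eq[OF assms(1)] scale_def .
qed

lemma cut_nth: "i \<le> m \<Longrightarrow> j < m \<Longrightarrow> real_of_rat (cut_simplex m V slo ! i ! j) = v' i j"
  by (simp add: cut_nth_rat v'_def rv_def of_rat_divide of_rat_add of_rat_mult of_rat_power)

text \<open>Clears the denominators of all new vertices at once. Its bit length depends on the
  dimension alone, so the common denominator of the vertices grows by a fixed number of bits per
  cut.\<close>

definition denom_factor :: int where "denom_factor = (\<Prod>i\<le>m. 16 * int m ^ 4 + rb i)"

lemma denominator_int: "i \<le> m \<Longrightarrow> 0 < 16 * int m ^ 4 + rb i" "i \<le> m \<Longrightarrow> 16 * int m ^ 4 + rb i \<le> 2 ^ (5 + 4 * m)"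
proof -
  assume i: "i \<le> m"
  have "0 < real_of_int (16 * int m ^ 4 + rb i)" using denominator_pos[OF i] by simp
  then show "0 < 16 * int m ^ 4 + rb i" by (simp only: of_int_0_less_iff)
  have "int m ^ 2 \<le> int m ^ 4" using m_ge_1 by (intro power_increasing) auto
  moreover have "0 \<le> int m ^ 4" by simp
  ultimately have "16 * int m ^ 4 + rb i \<le> 32 * int m ^ 4" using beta_bounds(2)[OF i] by linarith
  also have "int m ^ 4 \<le> (2 ^ m) ^ 4"
  proof (rule power_mono)
    have "m \<le> 2 ^ m" by (rule less_imp_le[OF less_exp])
    then show "int m \<le> 2 ^ m" by (metis of_nat_le_iff of_nat_numeral of_nat_power)
  qed simp
  then have "32 * int m ^ 4 \<le> 32 * (2 ^ m) ^ 4" by simp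
  also have "(32::int) * (2 ^ m) ^ 4 = 2 ^ (5 + 4 * m)" by (simp add: power_add power_mult[symmetric] mult.commute)
  finally show "16 * int m ^ 4 + rb i \<le> 2 ^ (5 + 4 * m)" by simp
qed

lemma denom_factor_bounds: "0 < denom_factor" "denom_factor \<le> 2 ^ ((5 + 4 * m) * (m + 1))"
proof -
  show "0 < denom_factor" unfolding denom_factor_def using denominator_int by (intro prod_pos) auto
  have "denom_factor \<le> (\<Prod>i\<le>m. 2 ^ (5 + 4 * m))"
    unfolding denom_factor_def using denominator_int by (intro prod_mono) (auto simp: less_imp_le)
  also have "\<dots> = (2 ^ (5 + 4 * m)) ^ (m + 1)" by simp
  also have "\<dots> = 2 ^ ((5 + 4 * m) * (m + 1))" by (rule power_mult[symmetric])
  finally show "denom_factor \<le> 2 ^ ((5 + 4 * m) * (m + 1))" .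
qed

lemma cut_denominator:
  assumes i: "i \<le> m" and j: "j < m"
    and D: "\<And>i. i \<le> m \<Longrightarrow> \<exists>z. V ! i ! j * of_int D = of_int z"
  shows "\<exists>z. cut_simplex m V slo ! i ! j * of_int (D * denom_factor) = of_int z"
proof -
  obtain z1 z2 where z: "V ! i ! j * of_int D = of_int z1" "V ! argmin slo ! j * of_int D = of_int z2"
    using D[OF i] D[OF argmin_le] by blast
  let ?q = "16 * int m ^ 4 + rb i"
  let ?r = "\<Prod>k\<in>{..m} - {i}. 16 * int m ^ 4 + rb k"
  have f: "denom_factor = ?q * ?r" unfolding denom_factor_def using i by (subst prod.remove[of _ i]) auto
  have q: "(16 * of_nat m ^ 4 + of_int (rb i) :: rat) = of_int ?q" by simp
  have q0: "(of_int ?q :: rat) \<noteq> 0" using denominator_int(1)[OF i] by (metis less_irrefl of_int_eq_0_iff)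
  have "cut_simplex m V slo ! i ! j * of_int (D * denom_factor)
     = (of_int (rb i) * V ! argmin slo ! j + 16 * of_nat m ^ 4 * V ! i ! j) / of_int ?q * (of_int D * of_int ?q * of_int ?r)"
    unfolding cut_nth_rat[OF i j] q f by (simp only: of_int_mult mult.assoc)
  also have "\<dots> = (of_int (rb i) * (V ! argmin slo ! j * of_int D) + 16 * of_nat m ^ 4 * (V ! i ! j * of_int D)) * of_int ?r"
    using q0 by (simp add: field_simps)
  also have "\<dots> = of_int ((rb i * z2 + 16 * int m ^ 4 * z1) * ?r)" unfolding z by simp
  finally show ?thesis by blast
qed

lemma cut_abs_bound:
  assumes i: "i \<le> m" and j: "j < m" and B: "\<And>i. i \<le> m \<Longrightarrow> \<bar>V ! i ! j\<bar> \<le> B"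
  shows "\<bar>cut_simplex m V slo ! i ! j\<bar> \<le> 2 * B"
proof -
  have rB: "\<bar>rv k j\<bar> \<le> real_of_rat B" if "k \<le> m" for k
  proof -
    have "real_of_rat \<bar>V ! k ! j\<bar> \<le> real_of_rat B" using B[OF that] by (simp only: of_rat_less_eq)
    then show ?thesis by (simp add: rv_def)
  qed
  have "\<bar>v' i j\<bar> \<le> 2 * real_of_rat B" by (rule v'_bound[OF i rB[OF i] rB[OF argmin_le]])
  then have "real_of_rat \<bar>cut_simplex m V slo ! i ! j\<bar> \<le> real_of_rat (2 * B)"
    by (simp add: cut_nth[OF i j, symmetric] of_rat_mult)
  then show ?thesis by (simp only: of_rat_less_eq)
qed

end

definition start_simplex :: "nat \<Rightarrow> rat \<Rightarrow> rat list list" where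
  "start_simplex m R = map (\<lambda>i. map (\<lambda>j. if j = i then of_nat m * R else 0) [0..<m]) [0..<Suc m]"

lemma simplex_list_start: "simplex_list m (start_simplex m R)"
  by (auto simp: simplex_list_def start_simplex_def simp del: upt_Suc)

lemma start_nth: "i \<le> m \<Longrightarrow> j < m \<Longrightarrow> start_simplex m R ! i ! j = (if j = i then of_nat m * R else 0)"
  by (simp add: start_simplex_def del: upt_Suc)

lemma rat_bits_power: "rat_bits c a \<Longrightarrow> rat_bits (n * c + 1) (a ^ n)"
proof (induction n)
  case 0
  then show ?case using rat_bits_of_int[of 1 1] by simp
next
  case (Suc n)
  have "rat_bits (c + (n * c + 1)) (a * a ^ n)" by (rule rat_bits_mult) (use Suc in auto)
  then show ?case by (simp add: algebra_simps)
qed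

lemma ptime_start_simplex:
  assumes m: "ptime D e (\<lambda>i. Atom (of_nat (m i)))" and pm: "pbound D (\<lambda>i. vsize (e i)) m"
    and R: "ptime D e (\<lambda>i. Atom (R i))"
  shows "ptime D e (\<lambda>i. enc_simplex (start_simplex (m i) (R i)))"
proof -
  let ?n = "\<lambda>k. Atom (of_nat k)"
  have "ptime D e (\<lambda>i. Atom (of_nat (m i) + 1))" by (intro ptime_ops m)
  then have "ptime D e (\<lambda>i. ?n (Suc (m i)))" by (rule ptime_cong) simp
  then have u: "ptime D e (\<lambda>i. enc_nats [0..<Suc (m i)])" by (rule ptime_upt) (intro pbound_intros pm)
  let ?E = "Sigma D (\<lambda>i. set [0..<Suc (m i)])" and ?e = "with_arg e ?n"
  have m': "ptime ?E ?e (\<lambda>j. ?n (m (fst j)))" by (rule ptime_outer[OF m]) auto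
  have R': "ptime ?E ?e (\<lambda>j. Atom (R (fst j)))" by (rule ptime_outer[OF R]) auto
  have ev: "ptime ?E ?e (\<lambda>j. e (fst j))" by (rule ptime_Node1[OF ptime_input])
  have pm': "pbound ?E (\<lambda>j. vsize (?e j)) (\<lambda>j. m (fst j))"
    by (rule pbound_comp[OF pm _ ptime_size[OF ev]]) auto
  let ?E' = "Sigma ?E (\<lambda>j. set [0..<m (fst j)])" and ?e' = "with_arg ?e ?n"
  have i: "ptime ?E' ?e' (\<lambda>j. ?n (snd (fst j)))" by (rule ptime_Node2[OF ptime_Node1[OF ptime_input]])
  have k: "ptime ?E' ?e' (\<lambda>j. ?n (snd j))" by (rule ptime_inner)
  have v: "ptime ?E' ?e' (\<lambda>j. Atom (of_nat (m (fst (fst j))) * R (fst (fst j))))"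
    by (rule ptime_outer[OF ptime_mult[OF m' R']]) auto
  have "ptime ?E' ?e' (\<lambda>j. tv (?n (snd j) = ?n (snd (fst j))))" by (rule ptime_eq[OF k i])
  then have "ptime ?E' ?e' (\<lambda>j. tv (snd j = snd (fst j)))" by simp
  from ptime_if'[OF this v ptime_const, of "Atom 0"]
  have entry: "ptime ?E' ?e' (\<lambda>j. Atom (if snd j = snd (fst j) then of_nat (m (fst (fst j))) * R (fst (fst j)) else 0))"
    by (rule ptime_cong) simp
  have row: "ptime ?E ?e (\<lambda>j. enc_rats (map (\<lambda>l. if l = snd j then of_nat (m (fst j)) * R (fst j) else 0) [0..<m (fst j)]))"
    by (rule ptime_map[OF ptime_upt[OF m' pm']]) (rule entry)
  show ?thesis unfolding start_simplex_def by (rule ptime_map[OF u]) (rule row)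
qed

text \<open>The simplex, a number that serves as clock, and the best value so far with its decision.
  The clock is multiplied by \<open>shrink\<close> in each round, and the loop ends once it is below
  1.\<close>

type_synonym search_state = "rat list list \<times> rat \<times> rat \<times> rat list"

definition enc_state :: "search_state \<Rightarrow> val" where
  "enc_state s = Node (enc_simplex (fst s)) (Node (Atom (fst (snd s)))
     (Node (Atom (fst (snd (snd s)))) (enc_rats (snd (snd (snd s))))))"

context dr_algorithms
begin

definition zeros :: "'z dr_instance \<Rightarrow> rat list" where
  "zeros I = map (\<lambda>_. 0) (costs I)"

text \<open>
  \<open>precision I k\<close> is \<open>1 / s\<close>, where \<open>s\<close> is the ratio by which the feasible region has to be shrunk
  towards an optimal solution so that costs change by at most a factor of \<open>1 + 1 / k\<close>;
  \<open>radius / (radius + kappa_max)\<close> bounds the optimal value from below.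
\<close>

definition precision :: "'z dr_instance \<Rightarrow> rat \<Rightarrow> rat" where
  "precision I k = k * (inflation I + outer_radius I * sum_list (costs I) * ((radius I + kappa_max I) / radius I))"

text \<open>The ratio of the initial edge \<open>m\<close> * R, enlarged by \<open>m\<close> + 1, to
  the edge of the small simplex near an optimum. The factor \<open>m\<close> + 1 pays for the
  \<open>m\<close>-th root of the factorial in \<open>det_lower_bound\<close>.\<close>

definition start_width :: "'z dr_instance \<Rightarrow> rat \<Rightarrow> rat" where
  "start_width I k = (of_nat (dimension I) + 1) * (of_nat (dimension I) * outer_radius I)
     * precision I k / inner_radius I"

definition candidate :: "'z dr_instance \<Rightarrow> rat list \<Rightarrow> rat \<times> rat list \<Rightarrow> rat \<times> rat list" where
  "candidate I x b =
     (if Sep I x = Atom 1 then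
        if fval I (Loc I x) < fst b then (fval I (Loc I x), Loc I x) else b
      else b)"

definition outer_step :: "'z dr_instance \<Rightarrow> search_state \<Rightarrow> search_state" where
  "outer_step I s = (let m = dimension I; x = center m (fst s) in
     (cut_simplex m (fst s) (slopes m (fst s) (cutvec I x) x), fst (snd s) * shrink m, candidate I x (snd (snd s))))"

text \<open>The decision 0 is a candidate from the beginning, which settles the instances in which
  it is optimal.\<close>

definition start :: "'z dr_instance \<Rightarrow> rat \<Rightarrow> search_state" where
  "start I k = (start_simplex (dimension I) (outer_radius I), start_width I k, fval I (zeros I), zeros I)"

definition state :: "'z dr_instance \<Rightarrow> rat \<Rightarrow> nat \<Rightarrow> search_state" where
  "state I k n = (outer_step I ^^ n) (start I k)"

definition outer_steps :: "'z dr_instance \<Rightarrow> rat \<Rightarrow> nat" where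
  "outer_steps I k = (LEAST n. \<not> 1 \<le> start_width I k * shrink (dimension I) ^ n)"

definition D0 :: "('z dr_instance \<times> rat) set" where
  "D0 = {i. fst i \<in> J \<and> 1 \<le> snd i}"

definition e0 :: "'z dr_instance \<times> rat \<Rightarrow> val" where
  "e0 i = Node (encode (fst i)) (Atom (snd i))"

section \<open>Number of rounds and sizes of the states\<close>

lemma state_Suc: "state I k (Suc n) = outer_step I (state I k n)"
  by (simp add: state_def)

lemma state_width: "fst (snd (state I k n)) = start_width I k * shrink (dimension I) ^ n"
  by (induction n) (simp_all add: state_def start_def outer_step_def Let_def)

lemma state_simplex: "simplex_list (dimension I) (fst (state I k n))"
  by (induction n)
     (simp_all add: state_def start_def outer_step_def Let_def simplex_list_start simplex_list_cut)

lemma length_center [simp]: "length (center m V) = m" by (simp add: center_def)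

text \<open>\<open>shrink\<close> equals 1 - 1 / c with c = 32 * m^4 + 1, so c rounds contract by at
  least the factor e. As many batches of c rounds as the initial clock has bits therefore
  suffice.\<close>

lemma width_eventually_small:
  assumes "vsize (Atom (start_width I k)) \<le> w"
  shows "start_width I k * shrink (dimension I) ^ ((32 * dimension I ^ 4 + 1) * w) < 1"
proof -
  let ?m = "dimension I" and ?W = "real_of_rat (start_width I k)"
  define c where "c = 32 * real ?m ^ 4 + 1"
  have c: "1 \<le> c" by (simp add: c_def)
  have w1: "1 \<le> w" using assms vsize_pos[of "Atom (start_width I k)"] by linarith
  have sh: "real_of_rat (shrink ?m) = 1 - 1 / c"
  proof -
    have "real_of_rat (shrink ?m) = (c - 1) / ((c - 1) + 1)"
      by (simp add: shrink_def scale_def c_def of_rat_divide of_rat_mult of_rat_add of_rat_power)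
    also have "\<dots> = 1 - 1 / c" using c by (simp add: diff_divide_distrib)
    finally show ?thesis .
  qed
  have s0: "0 \<le> 1 - 1 / c" using c by simp
  have "(1 - 1 / c) ^ ((32 * ?m ^ 4 + 1) * w) \<le> exp (- (1 / c)) ^ ((32 * ?m ^ 4 + 1) * w)"
    using s0 exp_ge_add_one_self[of "- (1 / c)"] by (intro power_mono) auto
  also have "\<dots> = exp (- real w)"
  proof -
    have "real ((32 * ?m ^ 4 + 1) * w) = c * real w" by (simp add: c_def algebra_simps)
    then have "real ((32 * ?m ^ 4 + 1) * w) * - (1 / c) = - real w" using c by simp
    then show ?thesis by (simp only: exp_of_nat_mult[symmetric])
  qed
  also have "\<dots> \<le> (1 / 2) ^ w"
  proof -
    have "exp (- real w) = exp (- 1) ^ w" by (simp add: exp_of_nat_mult[symmetric])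
    also have "\<dots> \<le> (1 / 2) ^ w"
    proof (rule power_mono)
      have "(2::real) \<le> exp 1" using exp_ge_add_one_self[of 1] by simp
      then show "exp (- 1) \<le> (1 / 2 :: real)" by (simp add: exp_minus inverse_eq_divide divide_left_mono)
    qed simp
    finally show ?thesis .
  qed
  finally have 1: "(1 - 1 / c) ^ ((32 * ?m ^ 4 + 1) * w) \<le> (1 / 2) ^ w" .
  have "\<bar>start_width I k\<bar> < 2 ^ w"
    by (rule abs_less_of_rat_bits[OF rat_bits_of_vsize_le[OF assms]])
  then have "real_of_rat \<bar>start_width I k\<bar> < real_of_rat (2 ^ w)" by (simp only: of_rat_less)
  then have W: "\<bar>?W\<bar> < 2 ^ w" by (simp add: of_rat_power)
  have "?W * (1 - 1 / c) ^ ((32 * ?m ^ 4 + 1) * w) \<le> \<bar>?W\<bar> * (1 - 1 / c) ^ ((32 * ?m ^ 4 + 1) * w)"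
    by (intro mult_right_mono abs_ge_self zero_le_power s0)
  also have "\<dots> \<le> \<bar>?W\<bar> * (1 / 2) ^ w" using 1 by (intro mult_left_mono) auto
  also have "\<dots> < 2 ^ w * (1 / 2) ^ w" using W by (intro mult_strict_right_mono) auto
  also have "\<dots> = 1" by (simp add: power_mult_distrib[symmetric])
  finally have "real_of_rat (start_width I k * shrink ?m ^ ((32 * ?m ^ 4 + 1) * w)) < real_of_rat 1"
    by (simp add: of_rat_mult of_rat_power sh)
  then show ?thesis by (simp only: of_rat_less)
qed

lemma outer_steps_props:
  shows "outer_steps I k \<le> (32 * dimension I ^ 4 + 1) * vsize (Atom (start_width I k))"
    "\<not> 1 \<le> fst (snd (state I k (outer_steps I k)))"
    "n < outer_steps I k \<Longrightarrow> 1 \<le> fst (snd (state I k n))"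
proof -
  let ?P = "\<lambda>n. \<not> 1 \<le> start_width I k * shrink (dimension I) ^ n"
  have P: "?P ((32 * dimension I ^ 4 + 1) * vsize (Atom (start_width I k)))"
    using width_eventually_small[OF order_refl, of I k] by (simp add: not_le)
  show "outer_steps I k \<le> (32 * dimension I ^ 4 + 1) * vsize (Atom (start_width I k))"
    unfolding outer_steps_def by (rule Least_le) (rule P)
  show "\<not> 1 \<le> fst (snd (state I k (outer_steps I k)))"
    unfolding state_width outer_steps_def by (rule LeastI[of ?P, OF P])
  show "n < outer_steps I k \<Longrightarrow> 1 \<le> fst (snd (state I k n))"
    unfolding state_width outer_steps_def using not_less_Least by blast
qed

text \<open>A common denominator and a bound on absolute values are carried through the induction.
  One cut multiplies the former by \<open>denom_factor\<close> and at most doubles the latter, so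
  the number of bits grows linearly with the rounds.\<close>

lemma state_entries:
  assumes I: "I \<in> J" and c: "vsize (Atom (of_nat (dimension I) * outer_radius I)) \<le> c" and v: "v \<in> set (fst (state I k n))" "a \<in> set v"
  shows "rat_bits ((n + c) + (c + n * ((5 + 4 * dimension I) * (dimension I + 1)))) a"
proof -
  let ?m = "dimension I" and ?f = "(5 + 4 * dimension I) * (dimension I + 1)"
  let ?R = "of_nat ?m * outer_radius I"
  \<comment> \<open>An entry exists only if the vertices have positive length; the cut is analysed
    in positive dimension.\<close>
  have m1: "1 \<le> ?m"
  proof (rule ccontr)
    assume "\<not> 1 \<le> ?m"
    moreover have "length v = ?m" using state_simplex[of I k n] v(1) by (auto simp: simplex_list_def)
    ultimately have "length v = 0" by linarith
    then show False using v(2) by simp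
  qed
  have "\<exists>D :: int. 0 < D \<and> D < 2 ^ (c + n * ?f) \<and>
     (\<forall>i\<le>?m. \<forall>j<?m. (\<exists>z. fst (state I k n) ! i ! j * of_int D = of_int z) \<and> \<bar>fst (state I k n) ! i ! j\<bar> \<le> 2 ^ (n + c))"
  proof (induction n)
    case 0
    have rb: "rat_bits c ?R" by (rule rat_bits_of_vsize_le[OF c])
    then obtain z D where D: "?R = of_int z / of_int D" "0 < D" "D < 2 ^ c" unfolding rat_bits_def by blast
    have e: "fst (state I k 0) ! i ! j = (if j = i then ?R else 0)" if "i \<le> ?m" "j < ?m" for i j
      using that by (simp add: state_def start_def start_nth)
    have "\<bar>?R\<bar> \<le> 2 ^ c" using abs_less_of_rat_bits[OF rb] by simp
    moreover have "?R * of_int D = of_int z" using D(1,2) by simp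
    moreover have "(0::rat) * of_int D = of_int 0" by simp
    ultimately have "\<forall>i\<le>?m. \<forall>j<?m. (\<exists>z. fst (state I k 0) ! i ! j * of_int D = of_int z) \<and> \<bar>fst (state I k 0) ! i ! j\<bar> \<le> 2 ^ (0 + c)"
      using e by (smt (verit, best) add_0 abs_zero zero_le_power zero_le_numeral)
    then show ?case using D by (intro exI[of _ D]) simp
  next
    case (Suc n)
    let ?V = "fst (state I k n)"
    let ?d = "cutvec I (center ?m ?V)"
    interpret simplex_data ?m ?V ?d
      by unfold_locales (use m1 state_simplex length_cutvec[OF I] in auto)
    have S: "fst (state I k (Suc n)) = cut_simplex ?m ?V slo"
      by (simp add: state_Suc outer_step_def Let_def)
    obtain D :: int where D: "0 < D" "D < 2 ^ (c + n * ?f)"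
      "\<And>i j. i \<le> ?m \<Longrightarrow> j < ?m \<Longrightarrow> (\<exists>z. ?V ! i ! j * of_int D = of_int z)"
      "\<And>i j. i \<le> ?m \<Longrightarrow> j < ?m \<Longrightarrow> \<bar>?V ! i ! j\<bar> \<le> 2 ^ (n + c)"
      using Suc.IH by blast
    show ?case
    proof (rule exI[of _ "D * denom_factor"], intro conjI allI impI)
      show "0 < D * denom_factor" using D(1) denom_factor_bounds(1) by simp
      have "D * denom_factor < 2 ^ (c + n * ?f) * 2 ^ ?f"
        using D(1,2) denom_factor_bounds by (intro mult_less_le_imp_less) auto
      also have "\<dots> = 2 ^ (c + Suc n * ?f)" by (simp add: power_add[symmetric])
      finally show "D * denom_factor < 2 ^ (c + Suc n * ?f)" .
      fix i j assume ij: "i \<le> ?m" "j < ?m"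
      show "\<exists>z. fst (state I k (Suc n)) ! i ! j * of_int (D * denom_factor) = of_int z"
        unfolding S by (rule cut_denominator[OF ij D(3)[OF _ ij(2)]])
      have "\<bar>cut_simplex ?m ?V slo ! i ! j\<bar> \<le> 2 * 2 ^ (n + c)"
        by (rule cut_abs_bound[OF ij D(4)[OF _ ij(2)]])
      then show "\<bar>fst (state I k (Suc n)) ! i ! j\<bar> \<le> 2 ^ (Suc n + c)" unfolding S by simp
    qed
  qed
  then obtain D :: int where D: "0 < D" "D < 2 ^ (c + n * ?f)"
     "\<And>i j. i \<le> ?m \<Longrightarrow> j < ?m \<Longrightarrow> (\<exists>z. fst (state I k n) ! i ! j * of_int D = of_int z) \<and> \<bar>fst (state I k n) ! i ! j\<bar> \<le> 2 ^ (n + c)"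
    by blast
  obtain i where i: "i \<le> ?m" "fst (state I k n) ! i = v"
    using v(1) state_simplex[of I k n] by (auto simp: simplex_list_def in_set_conv_nth less_Suc_eq_le)
  obtain j where j: "j < ?m" "v ! j = a"
    using v state_simplex[of I k n] by (auto simp: simplex_list_def in_set_conv_nth)
  obtain z where "a * of_int D = of_int z" "\<bar>a\<bar> \<le> 2 ^ (n + c)" using D(3)[OF i(1) j(1)] i j by auto
  then show ?thesis using D(1,2) by (intro rat_bits_of_denominator[of a D z]) auto
qed

lemma zeros_feasible: "I \<in> J \<Longrightarrow> rvec (zeros I) \<in> int_feasible I"
proof -
  assume I: "I \<in> J"
  have "rvec (zeros I) = 0\<^sub>v (dimension I)" by (rule eq_vecI) (auto simp: zeros_def)
  then show ?thesis using p1[OF I] by (simp add: P1_def)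
qed

lemma ptime_zeros: "ptime D e (\<lambda>i. encode (I i)) \<Longrightarrow> ptime D e (\<lambda>i. enc_rats (zeros (I i)))"
  unfolding zeros_def by (rule ptime_map[OF ptime_costs]) (auto intro: ptime_const)

abbreviation enc_candidate :: "rat \<times> rat list \<Rightarrow> val" where
  "enc_candidate b \<equiv> Node (Atom (fst b)) (enc_rats (snd b))"

lemma Loc_int: "I \<in> J \<Longrightarrow> rvec x \<in> feasible I \<Longrightarrow> rvec (Loc I x) \<in> int_feasible I"
  using Loc by blast

lemma ptime_local_candidate:
  assumes I: "ptime D e (\<lambda>i. encode (I i))" and x: "ptime D e (\<lambda>i. enc_rats (x i))"
    and D: "\<And>i. i \<in> D \<Longrightarrow> I i \<in> J \<and> rvec (x i) \<in> feasible (I i)"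
  shows "ptime D e (\<lambda>i. enc_candidate (fval (I i) (Loc (I i) (x i)), Loc (I i) (x i)))"
proof -
  have l: "ptime D e (\<lambda>i. enc_rats (Loc (I i) (x i)))" by (rule ptime_Loc[OF I _ x]) (use D in auto)
  have "ptime D e (\<lambda>i. Atom (fval (I i) (Loc (I i) (x i))))"
    by (rule ptime_fval[OF I l]) (use D Loc_int in auto)
  then show ?thesis unfolding fst_conv snd_conv using l by (rule ptime_Node)
qed

lemma ptime_candidate:
  assumes I: "ptime D e (\<lambda>i. encode (I i))" and x: "ptime D e (\<lambda>i. enc_rats (x i))"
    and b: "ptime D e (\<lambda>i. enc_candidate (b i))"
    and D: "\<And>i. i \<in> D \<Longrightarrow> I i \<in> J \<and> length (x i) = dimension (I i)"
  shows "ptime D e (\<lambda>i. enc_candidate (candidate (I i) (x i) (b i)))"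
proof -
  have S: "ptime D e (\<lambda>i. Sep (I i) (x i))" by (rule ptime_Sep[OF I _ x]) (use D in auto)
  let ?D = "{i \<in> D. Sep (I i) (x i) = Atom 1}"
  let ?n = "\<lambda>i. (fval (I i) (Loc (I i) (x i)), Loc (I i) (x i))"
  have n: "ptime ?D e (\<lambda>i. enc_candidate (?n i))"
    by (rule ptime_local_candidate[OF ptime_subset[OF I] ptime_subset[OF x]]) (use D Sep_feasible in auto)
  have b': "ptime ?D e (\<lambda>i. enc_candidate (b i))" by (rule ptime_subset[OF b]) auto
  have "ptime ?D e (\<lambda>i. if fst (?n i) < fst (b i) then enc_candidate (?n i) else enc_candidate (b i))"
    by (rule ptime_if'[OF ptime_less[OF ptime_Node1[OF n] ptime_Node1[OF b']] n b'])
  then have "ptime D e (\<lambda>i. if Sep (I i) (x i) = Atom 1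
      then if fst (?n i) < fst (b i) then enc_candidate (?n i) else enc_candidate (b i) else enc_candidate (b i))"
    by (rule ptime_if[OF ptime_eq[OF S ptime_const] _ ptime_subset[OF b]]) auto
  then show ?thesis by (rule ptime_cong) (simp add: candidate_def)
qed

lemma ptime_start: "ptime D0 e0 (\<lambda>i. enc_state (start (fst i) (snd i)))"
  and ptime_start_width: "ptime D0 e0 (\<lambda>i. Atom (start_width (fst i) (snd i)))"
  and ptime_edge: "ptime D0 e0 (\<lambda>i. Atom (of_nat (dimension (fst i)) * outer_radius (fst i)))"
proof -
  have I: "ptime D0 e0 (\<lambda>i. encode (fst i))" unfolding e0_def by (rule ptime_Node1[OF ptime_input])
  have k: "ptime D0 e0 (\<lambda>i. Atom (snd i))" unfolding e0_def by (rule ptime_Node2[OF ptime_input])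
  note m = ptime_dimension[OF I] and pm = pbound_dimension[OF I]
  show e: "ptime D0 e0 (\<lambda>i. Atom (of_nat (dimension (fst i)) * outer_radius (fst i)))"
    by (intro ptime_ops m ptime_fields[OF I])
  show w: "ptime D0 e0 (\<lambda>i. Atom (start_width (fst i) (snd i)))"
    unfolding start_width_def precision_def
    by (intro ptime_ops m k ptime_fields[OF I] ptime_sum_list)
  have z: "ptime D0 e0 (\<lambda>i. enc_rats (zeros (fst i)))" by (rule ptime_zeros[OF I])
  have f: "ptime D0 e0 (\<lambda>i. Atom (fval (fst i) (zeros (fst i))))"
    by (rule ptime_fval[OF I z]) (auto simp: D0_def zeros_feasible)
  have V: "ptime D0 e0 (\<lambda>i. enc_simplex (start_simplex (dimension (fst i)) (outer_radius (fst i))))"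
    by (intro ptime_start_simplex m pm ptime_fields[OF I])
  show "ptime D0 e0 (\<lambda>i. enc_state (start (fst i) (snd i)))"
    unfolding enc_state_def start_def fst_conv snd_conv by (intro ptime_Node V w f z)
qed

definition RS :: "'z dr_instance \<times> rat \<Rightarrow> search_state set" where
  "RS i = {s. simplex_list (dimension (fst i)) (fst s)}"

lemma ptime_outer_step:
  "ptime (Sigma D0 RS) (with_arg e0 enc_state) (\<lambda>j. enc_state (outer_step (fst (fst j)) (snd j)))"
proof -
  let ?E = "Sigma D0 RS" and ?e = "with_arg e0 enc_state"
  let ?m = "\<lambda>j. dimension (fst (fst j))" and ?V = "\<lambda>j. fst (snd j)"
  have I: "ptime ?E ?e (\<lambda>j. encode (fst (fst j)))"
    unfolding e0_def by (rule ptime_Node1[OF ptime_Node1[OF ptime_input]])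
  note m = ptime_dimension[OF I] and pm = pbound_dimension[OF I]
  have V: "ptime ?E ?e (\<lambda>j. enc_simplex (?V j))"
    unfolding enc_state_def by (rule ptime_Node1[OF ptime_inner])
  have W: "ptime ?E ?e (\<lambda>j. Atom (fst (snd (snd j))))"
    unfolding enc_state_def by (rule ptime_Node1[OF ptime_Node2[OF ptime_inner]])
  have b: "ptime ?E ?e (\<lambda>j. enc_candidate (snd (snd (snd j))))"
    unfolding enc_state_def by (rule ptime_Node2[OF ptime_Node2[OF ptime_inner]])
  have E: "fst (fst j) \<in> J" "simplex_list (?m j) (?V j)" if "j \<in> ?E" for j
    using that by (auto simp: D0_def RS_def)
  have x: "ptime ?E ?e (\<lambda>j. enc_rats (center (?m j) (?V j)))" by (rule ptime_center[OF m pm V E(2)])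
  have d: "ptime ?E ?e (\<lambda>j. enc_rats (cutvec (fst (fst j)) (center (?m j) (?V j))))"
    by (rule ptime_cutvec[OF I x]) (use E in auto)
  have a: "ptime ?E ?e (\<lambda>j. enc_rats (slopes (?m j) (?V j) (cutvec (fst (fst j)) (center (?m j) (?V j))) (center (?m j) (?V j))))"
    by (rule ptime_slopes[OF m pm V E(2) d x]) (use E length_cutvec in auto)
  have V': "ptime ?E ?e (\<lambda>j. enc_simplex (cut_simplex (?m j) (?V j)
      (slopes (?m j) (?V j) (cutvec (fst (fst j)) (center (?m j) (?V j))) (center (?m j) (?V j)))))"
    by (rule ptime_cut_simplex[OF m pm V E(2) a]) (use E(2) in \<open>auto simp: slopes_def simplex_list_def\<close>)
  have b': "ptime ?E ?e (\<lambda>j. enc_candidate (candidate (fst (fst j)) (center (?m j) (?V j)) (snd (snd (snd j)))))"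
    by (rule ptime_candidate[OF I x b]) (use E in auto)
  from ptime_Node[OF V' ptime_Node[OF ptime_mult[OF W ptime_shrink[OF m]] b']] show ?thesis
    by (rule ptime_cong) (simp add: enc_state_def outer_step_def Let_def)
qed

text \<open>The three parts of the state are bounded in different ways: the simplex by its common
  denominator, the clock as an explicit power, and the candidate because it is either the initial
  one or the outcome of a single rounding at a centroid. Candidates thus never feed on one
  another.\<close>

lemma ptime_final: "ptime D0 e0 (\<lambda>i. enc_state (state (fst i) (snd i) (outer_steps (fst i) (snd i))))"
proof -
  let ?m = "\<lambda>i. dimension (fst i)" and ?N = "\<lambda>i. outer_steps (fst i) (snd i)"
  let ?s = "\<lambda>i. vsize (e0 i)"
  have I: "ptime D0 e0 (\<lambda>i. encode (fst i))" unfolding e0_def by (rule ptime_Node1[OF ptime_input])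
  note m = ptime_dimension[OF I] and pm = pbound_dimension[OF I]
  define w where "w i = vsize (Atom (start_width (fst i) (snd i)))" for i :: "'z dr_instance \<times> rat"
  define c where "c i = vsize (Atom (of_nat (?m i) * outer_radius (fst i)))" for i :: "'z dr_instance \<times> rat"
  define c' where "c' i = vsize (Atom (shrink (?m i)))" for i :: "'z dr_instance \<times> rat"
  have pw: "pbound D0 ?s w" unfolding w_def by (rule ptime_size[OF ptime_start_width])
  have pc: "pbound D0 ?s c" unfolding c_def by (rule ptime_size[OF ptime_edge])
  have pc': "pbound D0 ?s c'" unfolding c'_def by (rule ptime_size[OF ptime_shrink[OF m]])
  have pN: "pbound D0 ?s ?N"
    by (rule pbound_mono[of _ _ "\<lambda>i. (32 * ?m i ^ 4 + 1) * w i"])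
       (intro pbound_intros pm pw, unfold w_def, rule outer_steps_props(1))
  define v where "v i = (?N i + c i) + (c i + ?N i * ((5 + 4 * ?m i) * (?m i + 1)))" for i :: "'z dr_instance \<times> rat"
  define VB where "VB i = 2 + (?m i + 1) * (1 + (2 + ?m i * (1 + (1 + 2 * v i))))" for i :: "'z dr_instance \<times> rat"
  have pv: "pbound D0 ?s v" unfolding v_def by (intro pbound_intros pN pc pm)
  have pVB: "pbound D0 ?s VB" unfolding VB_def by (intro pbound_intros pv pm)
  have VB: "vsize (enc_simplex (fst (state (fst i) (snd i) n))) \<le> VB i" if i: "i \<in> D0" and n: "n \<le> ?N i" for i n
  proof -
    let ?V = "fst (state (fst i) (snd i) n)"
    have sl: "length ?V = ?m i + 1" "\<And>u. u \<in> set ?V \<Longrightarrow> length u = ?m i"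
      using state_simplex[of "fst i" "snd i" n] by (auto simp: simplex_list_def)
    have "vsize (enc_rats u) \<le> 2 + ?m i * (1 + (1 + 2 * v i))" if u: "u \<in> set ?V" for u
    proof -
      have "vsize (enc_rats u) \<le> 2 + length (map Atom u) * (1 + (1 + 2 * v i))"
      proof (rule vsize_enc_list_le)
        fix a assume "a \<in> set (map Atom u)"
        then obtain q where q: "q \<in> set u" "a = Atom q" by auto
        have "rat_bits ((n + c i) + (c i + n * ((5 + 4 * ?m i) * (?m i + 1)))) q"
          by (rule state_entries[OF _ _ u q(1)]) (use i in \<open>auto simp: D0_def c_def\<close>)
        then have "rat_bits (v i) q" by (rule rat_bits_mono) (use n in \<open>auto simp: v_def intro!: add_mono mult_right_mono\<close>)
        then show "vsize a \<le> 1 + 2 * v i" unfolding q(2) by (rule vsize_le_of_rat_bits)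
      qed
      then show ?thesis using sl(2)[OF u] by simp
    qed
    then have "vsize (enc_simplex ?V) \<le> 2 + length (map (\<lambda>u. enc_rats u) ?V) * (1 + (2 + ?m i * (1 + (1 + 2 * v i))))"
      by (intro vsize_enc_list_le) auto
    then show ?thesis using sl(1) by (simp add: VB_def)
  qed
  define WB where "WB i = 1 + 2 * (w i + (?N i * c' i + 1))" for i :: "'z dr_instance \<times> rat"
  have pWB: "pbound D0 ?s WB" unfolding WB_def by (intro pbound_intros pw pN pc')
  have WB: "vsize (Atom (fst (snd (state (fst i) (snd i) n)))) \<le> WB i" if n: "n \<le> ?N i" for i n
  proof -
    have "rat_bits (w i + (n * c' i + 1)) (start_width (fst i) (snd i) * shrink (?m i) ^ n)"
      unfolding w_def c'_def by (intro rat_bits_mult rat_bits_vsize rat_bits_power)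
    then have "rat_bits (w i + (?N i * c' i + 1)) (start_width (fst i) (snd i) * shrink (?m i) ^ n)"
      by (rule rat_bits_mono) (use n in \<open>auto intro!: mult_right_mono\<close>)
    then show ?thesis unfolding state_width WB_def by (rule vsize_le_of_rat_bits)
  qed
  \<comment> \<open>Ranging over all simplices and not only those reached yields a polynomial in the
    size of the simplex itself, which has just been bounded.\<close>
  let ?DV = "{j :: 'z dr_instance \<times> rat list list. simplex_list (dimension (fst j)) (snd j)}"
  let ?eV = "\<lambda>j :: 'z dr_instance \<times> rat list list. Node (encode (fst j)) (enc_simplex (snd j))"
  have IV: "ptime ?DV ?eV (\<lambda>j. encode (fst j))" by (rule ptime_Node1[OF ptime_input])
  have "ptime ?DV ?eV (\<lambda>j. enc_rats (center (dimension (fst j)) (snd j)))"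
    by (rule ptime_center[OF ptime_dimension[OF IV] pbound_dimension[OF IV] ptime_Node2[OF ptime_input]]) auto
  from ptime_size[OF this] obtain qc where "\<forall>j\<in>?DV. vsize (enc_rats (center (dimension (fst j)) (snd j))) \<le> poly qc (vsize (?eV j))"
    unfolding pbound_def by blast
  then have qc: "simplex_list (dimension I) V \<Longrightarrow>
      vsize (enc_rats (center (dimension I) V)) \<le> poly qc (vsize (Node (encode I) (enc_simplex V)))"
    for I :: "'z dr_instance" and V by auto
  let ?DF = "{j. fst j \<in> J \<and> rvec (snd j) \<in> feasible (fst j)}"
  let ?eF = "\<lambda>j :: 'z dr_instance \<times> rat list. Node (encode (fst j)) (enc_rats (snd j))"
  have "ptime ?DF ?eF (\<lambda>j. enc_candidate (fval (fst j) (Loc (fst j) (snd j)), Loc (fst j) (snd j)))"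
    by (rule ptime_local_candidate[OF ptime_Node1[OF ptime_input] ptime_Node2[OF ptime_input]]) auto
  from ptime_size[OF this] obtain qf where "\<forall>j\<in>?DF. vsize (enc_candidate (fval (fst j) (Loc (fst j) (snd j)), Loc (fst j) (snd j)))
      \<le> poly qf (vsize (?eF j))"
    unfolding pbound_def by blast
  then have qf: "I \<in> J \<Longrightarrow> rvec x \<in> feasible I \<Longrightarrow>
      vsize (enc_candidate (fval I (Loc I x), Loc I x)) \<le> poly qf (vsize (Node (encode I) (enc_rats x)))" for I x
    by auto
  define CB where "CB i = vsize (enc_state (start (fst i) (snd i)))
     + poly qf (1 + ?s i + poly qc (1 + ?s i + VB i))" for i :: "'z dr_instance \<times> rat"
  have pCB: "pbound D0 ?s CB" unfolding CB_def by (intro pbound_intros ptime_size[OF ptime_start] pVB)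
  \<comment> \<open>Induction, as a candidate is either kept or replaced by a fresh one; the bound
    does not change from round to round.\<close>
  have CB: "vsize (enc_candidate (snd (snd (state (fst i) (snd i) n)))) \<le> CB i" if i: "i \<in> D0" and n: "n \<le> ?N i" for i n
    using n
  proof (induction n)
    case 0
    have "vsize (enc_candidate (snd (snd s))) \<le> vsize (enc_state s)" for s
      by (simp add: enc_state_def)
    then have "vsize (enc_candidate (snd (snd (start (fst i) (snd i))))) \<le> vsize (enc_state (start (fst i) (snd i)))" .
    then show ?case unfolding CB_def state_def by (simp del: vsize.simps add: trans_le_add1)
  next
    case (Suc n)
    let ?V = "fst (state (fst i) (snd i) n)"
    let ?x = "center (?m i) ?V"
    have IJ: "fst i \<in> J" using i by (simp add: D0_def)
    have "vsize (enc_candidate (fval (fst i) (Loc (fst i) ?x), Loc (fst i) ?x)) \<le> CB i" if f: "rvec ?x \<in> feasible (fst i)"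
    proof -
      have se: "vsize (encode (fst i)) \<le> ?s i" by (simp add: e0_def)
      have "vsize (enc_rats ?x) \<le> poly qc (vsize (Node (encode (fst i)) (enc_simplex ?V)))"
        by (rule qc[OF state_simplex])
      also have "\<dots> \<le> poly qc (1 + ?s i + VB i)"
        using VB[OF i, of n] Suc.prems se by (intro poly_nat_mono) simp
      finally have x: "vsize (enc_rats ?x) \<le> poly qc (1 + ?s i + VB i)" .
      have "vsize (enc_candidate (fval (fst i) (Loc (fst i) ?x), Loc (fst i) ?x)) \<le> poly qf (vsize (Node (encode (fst i)) (enc_rats ?x)))"
        by (rule qf[OF IJ f])
      also have "\<dots> \<le> poly qf (1 + ?s i + poly qc (1 + ?s i + VB i))"
        using x se by (intro poly_nat_mono) simp
      finally show ?thesis unfolding CB_def by linarith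
    qed
    moreover have "snd (snd (state (fst i) (snd i) (Suc n))) = candidate (fst i) ?x (snd (snd (state (fst i) (snd i) n)))"
      by (simp add: state_Suc outer_step_def Let_def)
    ultimately show ?case
      using Suc Sep_feasible[OF IJ, of ?x] by (simp add: candidate_def del: vsize.simps)
  qed
  have "ptime D0 e0 (\<lambda>i. enc_state ((outer_step (fst i) ^^ ?N i) (start (fst i) (snd i))))"
  proof (rule ptime_while[where R = RS and b = "\<lambda>i s. 1 \<le> fst (snd s)" and B = "\<lambda>i. 2 + VB i + WB i + CB i"])
    show "ptime D0 e0 (\<lambda>i. enc_state (start (fst i) (snd i)))" by (rule ptime_start)
    have "ptime (Sigma D0 RS) (with_arg e0 enc_state) (\<lambda>j. Atom (fst (snd (snd j))))"
      unfolding enc_state_def by (rule ptime_Node1[OF ptime_Node2[OF ptime_inner]])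
    then show "ptime (Sigma D0 RS) (with_arg e0 enc_state) (\<lambda>j. tv (1 \<le> fst (snd (snd j))))"
      by (intro ptime_ops)
    show "ptime {j \<in> Sigma D0 RS. 1 \<le> fst (snd (snd j))} (with_arg e0 enc_state) (\<lambda>j. enc_state (outer_step (fst (fst j)) (snd j)))"
      by (rule ptime_subset[OF ptime_outer_step]) auto
    show "pbound D0 ?s ?N" by (rule pN)
    show "pbound D0 ?s (\<lambda>i. 2 + VB i + WB i + CB i)" by (intro pbound_intros pVB pWB pCB)
    fix i assume i: "i \<in> D0"
    show "(outer_step (fst i) ^^ n) (start (fst i) (snd i)) \<in> RS i" for n
      using state_simplex[of "fst i" "snd i" n] by (simp add: RS_def state_def)
    show "1 \<le> fst (snd ((outer_step (fst i) ^^ n) (start (fst i) (snd i))))" if "n < ?N i" for n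
      using outer_steps_props(3)[OF that] by (simp add: state_def)
    show "\<not> 1 \<le> fst (snd ((outer_step (fst i) ^^ ?N i) (start (fst i) (snd i))))"
      using outer_steps_props(2)[of "fst i" "snd i"] by (simp add: state_def)
    show "vsize (enc_state ((outer_step (fst i) ^^ n) (start (fst i) (snd i)))) \<le> 2 + VB i + WB i + CB i"
      if n: "n \<le> ?N i" for n
    proof -
      define S where "S = state (fst i) (snd i) n"
      have "vsize (enc_state S) = 2 + vsize (enc_simplex (fst S)) + vsize (Atom (fst (snd S))) + vsize (enc_candidate (snd (snd S)))"
        by (simp add: enc_state_def del: vsize.simps(1))
      moreover have "t = 2 + a + b' + c \<Longrightarrow> a \<le> X \<Longrightarrow> b' \<le> Y \<Longrightarrow> c \<le> Z \<Longrightarrow> t \<le> 2 + X + Y + Z"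
        for t a b' c X Y Z :: nat by linarith
      ultimately have "vsize (enc_state S) \<le> 2 + VB i + WB i + CB i"
        using VB[OF i n] WB[OF n] CB[OF i n] unfolding S_def[symmetric] by blast
      then show ?thesis by (simp add: S_def state_def)
    qed
  qed
  then show ?thesis by (simp add: state_def)
qed

lemma ptime_output:
  "ptime D0 e0 (\<lambda>i. let b = snd (snd (state (fst i) (snd i) (outer_steps (fst i) (snd i))))
     in Node (enc_rats (snd b)) (Atom (fst b)))"
proof -
  note h = ptime_Node2[OF ptime_Node2[OF ptime_final[unfolded enc_state_def]]]
  show ?thesis unfolding Let_def by (intro ptime_Node ptime_Node1[OF h] ptime_Node2[OF h])
qed

end

text \<open>The factors 2 up to \<open>m\<close> + 1 are \<open>m\<close> in number. The form as an
  \<open>m\<close>-th power allows volumes to be compared through edge lengths.\<close>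

lemma fact_Suc_le_power: "fact (Suc m) \<le> (real m + 1) ^ m"
proof (cases m)
  case (Suc n)
  have "fact (Suc (Suc n)) \<le> (real n + 2) ^ Suc n"
  proof (induction n)
    case 0
    then show ?case by simp
  next
    case (Suc n)
    have "fact (Suc (Suc (Suc n))) = (real n + 3) * fact (Suc (Suc n))" by (simp add: algebra_simps)
    also have "\<dots> \<le> (real n + 3) * (real n + 2) ^ Suc n" using Suc by (intro mult_left_mono) auto
    also have "\<dots> \<le> (real n + 3) * (real n + 3) ^ Suc n" by (intro mult_left_mono power_mono) auto
    finally show ?case by (simp add: add.commute)
  qed
  then show ?thesis by (simp add: Suc add.commute)
qed simp

lemma sum_sum_list_swap:
  "(\<Sum>j<m. (\<Sum>w\<leftarrow>ws. F w j) * \<delta> j) = (\<Sum>w\<leftarrow>ws. \<Sum>j<m. F w j * (\<delta> j :: real))"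
  by (induction ws) (auto simp: distrib_right sum.distrib)

text \<open>The plan is fixed while \<open>y\<close> varies: this is the convex minorant used for a
  cut.\<close>

definition hplan :: "'z dr_instance \<Rightarrow> (val \<times> rat) list \<Rightarrow> real vec \<Rightarrow> real" where
  "hplan I ws y = cvec I \<bullet> y + (\<Sum>w\<leftarrow>ws. real_of_rat (snd w) * gcost I y (fst w))"

definition opt :: "'z dr_instance \<Rightarrow> real" where
  "opt I = Min (h_central I ` int_feasible I)"

text \<open>Moving this fraction of the whole mass costs at most the radius, wherever it
  goes.\<close>

definition mu :: "'z dr_instance \<Rightarrow> real" where
  "mu I = real_of_rat (radius I) / (real_of_rat (radius I) + real_of_rat (kappa_max I))"

context dr_algorithms
begin

section \<open>Minorants of the cost, rounding and subgradients\<close>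

context
  fixes I :: "'z dr_instance" assumes I: "I \<in> J"
begin

lemma carrier: "x \<in> feasible I \<Longrightarrow> x \<in> carrier_vec (dimension I)"
  using feasible_carrier[OF I] by blast

lemma feasible_dim: "x \<in> feasible I \<Longrightarrow> dim_vec x = dimension I"
  using carrier carrier_vecD by blast

lemma cost_sum: "dim_vec x = dimension I \<Longrightarrow> cvec I \<bullet> x = (\<Sum>j<dimension I. real_of_rat (costs I ! j) * x $ j)"
  by (simp add: scalar_prod_def atLeast0LessThan list_of_vec_index)

lemma rvec_sum: "length d = dimension I \<Longrightarrow> dim_vec x = dimension I \<Longrightarrow> rvec d \<bullet> x = (\<Sum>j<dimension I. real_of_rat (d ! j) * x $ j)"
  by (simp add: scalar_prod_def atLeast0LessThan)

lemma costs_nonneg: "j < dimension I \<Longrightarrow> 0 \<le> real_of_rat (costs I ! j)"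
  using p1[OF I] by (simp add: P1_def less_eq_vec_def list_of_vec_index)

lemma feasible_nonneg: "x \<in> feasible I \<Longrightarrow> j < dimension I \<Longrightarrow> 0 \<le> x $ j"
proof -
  assume x: "x \<in> feasible I" "j < dimension I"
  then have "0\<^sub>v (dimension I) \<le> x" using wf[OF I] unfolding well_formed_def by blast
  then show ?thesis using x by (simp add: less_eq_vec_def feasible_dim)
qed

lemma R_pos: "0 < real_of_rat (outer_radius I)" using p3[OF I] by (simp add: P3_def)

lemma feasible_le_R: assumes x: "x \<in> feasible I" "j < dimension I" shows "x $ j \<le> real_of_rat (outer_radius I)"
proof -
  have "(x $ j)\<^sup>2 \<le> (\<Sum>i = 0..<dim_vec x. x $ i * x $ i)"
    using x feasible_dim[OF x(1)] member_le_sum[of j "{0..<dim_vec x}" "\<lambda>i. x $ i * x $ i"]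
    by (simp add: power2_eq_square)
  then have "(x $ j)\<^sup>2 \<le> x \<bullet> x" by (simp add: scalar_prod_def)
  then have "sqrt ((x $ j)\<^sup>2) \<le> sqrt (x \<bullet> x)" by (rule real_sqrt_le_mono)
  moreover have "vnorm x \<le> real_of_rat (outer_radius I)" using p3[OF I] x(1) unfolding P3_def by blast
  ultimately show ?thesis by (simp add: vnorm_def)
qed

lemma cost_nonneg: "x \<in> feasible I \<Longrightarrow> 0 \<le> cvec I \<bullet> x"
  unfolding cost_sum[OF feasible_dim]
  by (intro sum_nonneg mult_nonneg_nonneg costs_nonneg feasible_nonneg) auto

lemma feasible_convex:
  assumes x: "x \<in> feasible I" and y: "y \<in> feasible I" and u: "0 \<le> u" "u \<le> 1"
  shows "u \<cdot>\<^sub>v x + (1 - u) \<cdot>\<^sub>v y \<in> feasible I"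
proof -
  obtain W where W: "feasible I = convex_hull_vec (dimension I) W"
    using wf[OF I] unfolding well_formed_def polytope_vec_def by blast
  obtain a where a: "\<forall>w\<in>W. 0 \<le> a w" "(\<Sum>w\<in>W. a w) = 1" "\<forall>i<dimension I. x $ i = (\<Sum>w\<in>W. a w * w $ i)"
    using x unfolding W convex_hull_vec_def by blast
  obtain b where b: "\<forall>w\<in>W. 0 \<le> b w" "(\<Sum>w\<in>W. b w) = 1" "\<forall>i<dimension I. y $ i = (\<Sum>w\<in>W. b w * w $ i)"
    using y unfolding W convex_hull_vec_def by blast
  let ?c = "\<lambda>w. u * a w + (1 - u) * b w"
  have "\<forall>w\<in>W. 0 \<le> ?c w" using a(1) b(1) u by simp
  moreover have "(\<Sum>w\<in>W. ?c w) = 1" using a(2) b(2) by (simp add: sum.distrib flip: sum_distrib_left)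
  moreover have "\<forall>i<dimension I. (u \<cdot>\<^sub>v x + (1 - u) \<cdot>\<^sub>v y) $ i = (\<Sum>w\<in>W. ?c w * w $ i)"
    using a(3) b(3) feasible_dim[OF x] feasible_dim[OF y]
    by (simp add: distrib_right sum.distrib sum_distrib_left mult.assoc)
  moreover have "u \<cdot>\<^sub>v x + (1 - u) \<cdot>\<^sub>v y \<in> carrier_vec (dimension I)" using carrier[OF x] carrier[OF y] by simp
  ultimately show ?thesis unfolding W convex_hull_vec_def by (intro CollectI conjI exI[of _ ?c])
qed

lemma fval_eq:
  assumes x: "rvec x \<in> int_feasible I" shows "real_of_rat (fval I x) = hplan I (plan I x) (rvec x)"
proof -
  have xf: "rvec x \<in> feasible I" using x int_feasible_subset by blast
  have l: "length x = dimension I" by (rule int_feasible_length[OF I x])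
  have "real_of_rat (\<Sum>w\<leftarrow>plan I x. snd w * Gr I x (fst w)) = (\<Sum>w\<leftarrow>plan I x. real_of_rat (snd w) * gcost I (rvec x) (fst w))"
    unfolding of_rat_sum_map
    by (rule arg_cong[of _ _ sum_list], rule map_cong[OF refl])
       (use plan_properties(1)[OF I x] Gr[OF I xf] in \<open>auto simp: of_rat_mult\<close>)
  moreover have "real_of_rat (dot (dimension I) (costs I) x) = cvec I \<bullet> rvec x"
    using l by (simp add: cost_sum dot_def of_rat_sum of_rat_mult sum_list_upt)
  ultimately show ?thesis by (simp add: fval_def hplan_def of_rat_add)
qed

lemma hplan_le_h: "rvec x \<in> int_feasible I \<Longrightarrow> y \<in> feasible I \<Longrightarrow> hplan I (plan I x) y \<le> h_central I y"
  using plan_properties(3)[OF I] by (simp add: hplan_def h_central_def)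

lemma h_le_fval:
  assumes x: "rvec x \<in> int_feasible I"
  shows "h_central I (rvec x) \<le> \<beta>\<^sub>1 I * \<beta>\<^sub>2 I * real_of_rat (fval I x)"
proof -
  have "0 \<le> cvec I \<bullet> rvec x" using cost_nonneg x int_feasible_subset by blast
  moreover have "1 \<le> \<beta>\<^sub>1 I" "1 \<le> \<beta>\<^sub>2 I" using betas[OF I] by auto
  then have "1 * 1 \<le> \<beta>\<^sub>1 I * \<beta>\<^sub>2 I" by (intro mult_mono) auto
  ultimately have "1 * (cvec I \<bullet> rvec x) \<le> \<beta>\<^sub>1 I * \<beta>\<^sub>2 I * (cvec I \<bullet> rvec x)" by (intro mult_right_mono) auto
  then show ?thesis using plan_properties(4)[OF I x] unfolding fval_eq[OF x] hplan_def h_central_def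
    by (simp add: distrib_left)
qed

text \<open>Subgradients add up under nonnegative weights, and the first-stage cost is linear, hence
  its own gradient.\<close>

lemma grad_subgradient:
  assumes x: "rvec x \<in> feasible I" and y: "y \<in> feasible I"
  shows "(\<Sum>j<dimension I. real_of_rat (grad I x ! j) * (y $ j - real_of_rat (x ! j)))
    \<le> hplan I (plan I (Loc I x)) y - hplan I (plan I (Loc I x)) (rvec x)"
proof -
  let ?ws = "plan I (Loc I x)" and ?d = "\<lambda>j. y $ j - real_of_rat (x ! j)"
  have l: "length x = dimension I" by (rule feasible_length[OF I x])
  have L: "rvec (Loc I x) \<in> int_feasible I" by (rule Loc_int[OF I x])
  have ws: "fst w \<in> scenarios I" "0 \<le> snd w" if "w \<in> set ?ws" for w
    using plan_properties(1)[OF I L that] by auto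
  have gr: "real_of_rat (grad I x ! j) = real_of_rat (costs I ! j)
      + (\<Sum>w\<leftarrow>?ws. real_of_rat (snd w) * real_of_rat (Sg I x (fst w) ! j))" if "j < dimension I" for j
    using that by (simp add: grad_def of_rat_add of_rat_sum_list of_rat_mult o_def)
  have "(\<Sum>j<dimension I. real_of_rat (grad I x ! j) * ?d j) = (\<Sum>j<dimension I. real_of_rat (costs I ! j) * ?d j)
      + (\<Sum>j<dimension I. (\<Sum>w\<leftarrow>?ws. real_of_rat (snd w) * real_of_rat (Sg I x (fst w) ! j)) * ?d j)"
    by (simp add: gr distrib_right sum.distrib)
  also have "(\<Sum>j<dimension I. real_of_rat (costs I ! j) * ?d j) = cvec I \<bullet> y - cvec I \<bullet> rvec x"
    using l by (simp add: cost_sum feasible_dim[OF y] right_diff_distrib sum_subtractf)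
  also have "(\<Sum>j<dimension I. (\<Sum>w\<leftarrow>?ws. real_of_rat (snd w) * real_of_rat (Sg I x (fst w) ! j)) * ?d j)
      = (\<Sum>w\<leftarrow>?ws. \<Sum>j<dimension I. real_of_rat (snd w) * real_of_rat (Sg I x (fst w) ! j) * ?d j)"
    by (rule sum_sum_list_swap)
  also have "\<dots> \<le> (\<Sum>w\<leftarrow>?ws. real_of_rat (snd w) * gcost I y (fst w) - real_of_rat (snd w) * gcost I (rvec x) (fst w))"
  proof (rule sum_list_mono)
    fix w assume w: "w \<in> set ?ws"
    have s: "length (Sg I x (fst w)) = dimension I" "subgradient_at (feasible I) (\<lambda>x. gcost I x (fst w)) (rvec x) (rvec (Sg I x (fst w)))"
      using Sg[OF I x ws(1)[OF w]] by auto
    have "rvec (Sg I x (fst w)) \<bullet> (y - rvec x) \<le> gcost I y (fst w) - gcost I (rvec x) (fst w)"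
      using s(2) y unfolding subgradient_at_def by blast
    moreover have "rvec (Sg I x (fst w)) \<bullet> (y - rvec x) = (\<Sum>j<dimension I. real_of_rat (Sg I x (fst w) ! j) * ?d j)"
      using l s(1) feasible_dim[OF y] by (simp add: rvec_sum)
    ultimately have "real_of_rat (snd w) * (\<Sum>j<dimension I. real_of_rat (Sg I x (fst w) ! j) * ?d j)
        \<le> real_of_rat (snd w) * (gcost I y (fst w) - gcost I (rvec x) (fst w))"
      using ws(2)[OF w] by (intro mult_left_mono) auto
    then show "(\<Sum>j<dimension I. real_of_rat (snd w) * real_of_rat (Sg I x (fst w) ! j) * ?d j)
        \<le> real_of_rat (snd w) * gcost I y (fst w) - real_of_rat (snd w) * gcost I (rvec x) (fst w)"
      by (simp add: sum_distrib_left mult.assoc right_diff_distrib)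
  qed
  finally show ?thesis by (simp add: hplan_def sum_list_subtractf)
qed

text \<open>Rounding is guaranteed scenario by scenario, so its guarantee holds under every
  weighting, including a plan that is computed only after the rounding.\<close>

lemma Loc_fval:
  assumes x: "rvec x \<in> feasible I"
  shows "real_of_rat (fval I (Loc I x)) \<le> \<rho> I * hplan I (plan I (Loc I x)) (rvec x)"
proof -
  let ?ws = "plan I (Loc I x)"
  note L = Loc[OF I x]
  have Li: "rvec (Loc I x) \<in> int_feasible I" using L by blast
  have "(\<Sum>w\<leftarrow>?ws. real_of_rat (snd w) * gcost I (rvec (Loc I x)) (fst w))
      \<le> (\<Sum>w\<leftarrow>?ws. \<rho> I * (real_of_rat (snd w) * gcost I (rvec x) (fst w)))"
  proof (rule sum_list_mono)
    fix w assume "w \<in> set ?ws"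
    then have w: "fst w \<in> scenarios I" "0 \<le> snd w" using plan_properties(1)[OF I Li] by auto
    then have "real_of_rat (snd w) * gcost I (rvec (Loc I x)) (fst w) \<le> real_of_rat (snd w) * (\<rho> I * gcost I (rvec x) (fst w))"
      using L by (intro mult_left_mono) auto
    then show "real_of_rat (snd w) * gcost I (rvec (Loc I x)) (fst w) \<le> \<rho> I * (real_of_rat (snd w) * gcost I (rvec x) (fst w))"
      by (simp add: mult.left_commute)
  qed
  then show ?thesis using L unfolding fval_eq[OF Li] hplan_def
    by (simp add: distrib_left sum_list_const_mult)
qed

subsection \<open>Optimal first-stage decisions\<close>

text \<open>Integral points are lists of rationals. An optimal decision is therefore a legitimate
  input for the given algorithms, on which their guarantees can be invoked.\<close>

lemma int_feasible_rvec:
  assumes "x \<in> int_feasible I"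
  shows "x = rvec (map (\<lambda>i. of_int \<lfloor>x $ i\<rfloor>) [0..<dimension I])"
proof (rule eq_vecI)
  have x: "x \<in> feasible I" "\<forall>i<dimension I. x $ i \<in> \<int>" using assms by (auto simp: int_feasible_def)
  show d: "dim_vec x = dim_vec (rvec (map (\<lambda>i. of_int \<lfloor>x $ i\<rfloor>) [0..<dimension I]))" using feasible_dim[OF x(1)] by simp
  fix i assume "i < dim_vec (rvec (map (\<lambda>i. of_int \<lfloor>x $ i\<rfloor>) [0..<dimension I]))"
  then have "i < dimension I" by simp
  then have "x $ i \<in> \<int>" using x(2) by blast
  then show "x $ i = rvec (map (\<lambda>i. of_int \<lfloor>x $ i\<rfloor>) [0..<dimension I]) $ i" using \<open>i < dimension I\<close> by (auto elim: Ints_cases)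
qed

text \<open>The region lies in a box between 0 and the outer radius, so the minimum over integral
  decisions is attained.\<close>

lemma finite_int_feasible: "finite (int_feasible I)"
proof -
  let ?r = "\<lfloor>real_of_rat (outer_radius I)\<rfloor>"
  let ?L = "{zs. set zs \<subseteq> {0..?r} \<and> length zs = dimension I}"
  have "int_feasible I \<subseteq> (\<lambda>zs. rvec (map of_int zs)) ` ?L"
  proof
    fix x assume x: "x \<in> int_feasible I"
    then have xf: "x \<in> feasible I" using int_feasible_subset by blast
    have "\<lfloor>x $ i\<rfloor> \<in> {0..?r}" if "i < dimension I" for i
      unfolding atLeastAtMost_iff using feasible_nonneg[OF xf that] floor_mono[OF feasible_le_R[OF xf that]]
      by (metis zero_le_floor)
    then have "map (\<lambda>i. \<lfloor>x $ i\<rfloor>) [0..<dimension I] \<in> ?L" by (auto simp del: atLeastAtMost_iff)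
    moreover have "x = rvec (map of_int (map (\<lambda>i. \<lfloor>x $ i\<rfloor>) [0..<dimension I]))"
      using int_feasible_rvec[OF x] by (simp add: o_def)
    ultimately show "x \<in> (\<lambda>zs. rvec (map of_int zs)) ` ?L" by blast
  qed
  moreover have "finite ?L" by (rule finite_lists_length_eq) simp
  ultimately show ?thesis by (meson finite_imageI finite_subset)
qed

lemma zero_int_feasible: "0\<^sub>v (dimension I) \<in> int_feasible I" using p1[OF I] unfolding P1_def by blast

lemma opt_le: "x \<in> int_feasible I \<Longrightarrow> opt I \<le> h_central I x"
  using finite_int_feasible by (simp add: opt_def)

lemma opt_attained: obtains x where "rvec x \<in> int_feasible I" "h_central I (rvec x) = opt I"
proof -
  have "opt I \<in> h_central I ` int_feasible I" using finite_int_feasible zero_int_feasible unfolding opt_def by (intro Min_in) auto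
  then obtain x where "x \<in> int_feasible I" "h_central I x = opt I" by auto
  then show ?thesis using that int_feasible_rvec by metis
qed

lemma opt_nonneg: "0 \<le> opt I"
proof -
  obtain x where x: "rvec x \<in> int_feasible I" "h_central I (rvec x) = opt I" by (rule opt_attained)
  then have "rvec x \<in> feasible I" using int_feasible_subset by blast
  then show ?thesis using cost_nonneg z_nonneg[OF I] unfolding x(2)[symmetric] h_central_def by (simp add: add_nonneg_nonneg)
qed

text \<open>Rounding an optimal integral decision with a factor below 1 would produce a strictly
  cheaper one, since a factor that holds in every scenario carries over to
  \<open>z_central\<close>.\<close>

lemma rho_ge_1: assumes "0 < opt I" shows "1 \<le> \<rho> I"
proof (rule ccontr)
  assume "\<not> 1 \<le> \<rho> I"
  \<comment> \<open>Clipping at 0 covers negative factors, so that inequalities can be multiplied by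
    \<open>r\<close>.\<close>
  define r where "r = max (\<rho> I) 0"
  have r: "0 \<le> r" "r < 1" "\<rho> I \<le> r" using \<open>\<not> 1 \<le> \<rho> I\<close> by (auto simp: r_def)
  obtain x where x: "rvec x \<in> int_feasible I" "h_central I (rvec x) = opt I" by (rule opt_attained)
  then have xf: "rvec x \<in> feasible I" using int_feasible_subset by blast
  let ?x = "rvec (Loc I x)"
  note L = Loc[OF I xf]
  have "z_central I ?x \<le> r * z_central I (rvec x)"
  proof (rule z_leI[OF I])
    fix \<gamma> assume g: "\<gamma> \<in> plans I"
    have "objective I ?x \<gamma> \<le> r * objective I (rvec x) \<gamma>"
      unfolding objective_def sum_distrib_left
    proof (intro sum_mono)
      fix A A' assume A: "A \<in> support I" "A' \<in> scenarios I"
      have "0 \<le> \<gamma> A A'" using g A by (auto simp: plans_def)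
      moreover have "gcost I ?x A' \<le> r * gcost I (rvec x) A'"
        using L A(2) mult_right_mono[OF r(3) gcost_nonneg[OF I xf A(2)]] by fastforce
      ultimately have "\<gamma> A A' * gcost I ?x A' \<le> \<gamma> A A' * (r * gcost I (rvec x) A')" by (intro mult_left_mono)
      then show "\<gamma> A A' * gcost I ?x A' \<le> r * (\<gamma> A A' * gcost I (rvec x) A')" by (simp add: mult.left_commute)
    qed
    also have "\<dots> \<le> r * z_central I (rvec x)" using objective_le_z[OF I g xf] r(1) by (rule mult_left_mono)
    finally show "objective I ?x \<gamma> \<le> r * z_central I (rvec x)" .
  qed
  moreover have "cvec I \<bullet> ?x \<le> r * (cvec I \<bullet> rvec x)"
    using L mult_right_mono[OF r(3) cost_nonneg[OF xf]] by linarith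
  ultimately have "h_central I ?x \<le> r * opt I" unfolding x(2)[symmetric] h_central_def by (simp add: distrib_left)
  moreover have "opt I \<le> h_central I ?x" using L by (intro opt_le) blast
  moreover have "r * opt I < 1 * opt I" using r(2) assms by (rule mult_strict_right_mono)
  ultimately show False by linarith
qed

text \<open>If no scenario reacts to the first stage, \<open>z_central\<close> is constant and only
  the nonnegative first-stage cost remains.\<close>

lemma null_opt:
  assumes "\<forall>A\<in>scenarios I. null_scenario I A" shows "h_central I (0\<^sub>v (dimension I)) \<le> opt I"
proof -
  obtain x where x: "rvec x \<in> int_feasible I" "h_central I (rvec x) = opt I" by (rule opt_attained)
  then have xf: "rvec x \<in> feasible I" using int_feasible_subset by blast
  have "gcost I (rvec x) A = gcost I (0\<^sub>v (dimension I)) A" if "A \<in> scenarios I" for A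
    using assms that xf unfolding null_scenario_def by blast
  then have "z_central I (rvec x) = z_central I (0\<^sub>v (dimension I))" unfolding z_central_def by simp
  moreover have "cvec I \<bullet> 0\<^sub>v (dimension I) = 0" by (simp add: cost_sum)
  ultimately show ?thesis using cost_nonneg[OF xf] unfolding x(2)[symmetric] h_central_def by simp
qed

lemma kappa_max_nonneg: "0 \<le> real_of_rat (kappa_max I)"
proof -
  have "support I \<noteq> {}" using phat_sum[OF I] by force
  then obtain A where "A \<in> scenarios I" using support_scenarios[OF I] by blast
  then show ?thesis using kappa_le_max[OF I, of A A] kappa_refl[OF I, of A] by simp
qed

lemma mu_bounds: "0 < mu I" "mu I \<le> 1" "mu I * real_of_rat (kappa_max I) \<le> real_of_rat (radius I)"
proof -
  let ?r = "real_of_rat (radius I)" and ?k = "real_of_rat (kappa_max I)"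
  have r: "0 < ?r" using radius_pos[OF I] by simp
  have gen: "0 < a / (a + b) \<and> a / (a + b) \<le> 1 \<and> a / (a + b) * b \<le> a" if "0 < a" "0 \<le> b" for a b :: real
  proof -
    have "a * b \<le> a * (a + b)" using that by (intro mult_left_mono) auto
    then show ?thesis using that by (simp add: divide_le_eq)
  qed
  show "0 < mu I" "mu I \<le> 1" "mu I * ?k \<le> ?r" using gen[OF r kappa_max_nonneg] unfolding mu_def by blast+
qed

text \<open>Send the fraction \<open>mu I\<close> of every mass to \<open>A\<close>. This respects
  the budget by \<open>mu_bounds\<close> and yields \<open>mu I\<close> times the total cost in
  \<open>A\<close>, which is at least 1.\<close>

lemma nonnull_lower:
  assumes A: "A \<in> scenarios I" "\<not> null_scenario I A" and x: "x \<in> feasible I"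
  shows "mu I \<le> h_central I x"
proof -
  let ?g = "\<lambda>B A'. if A' = A then mu I * phat I B else 0"
  have s: "(\<Sum>A'\<in>scenarios I. ?g B A' * F A') = mu I * phat I B * F A" for B and F :: "val \<Rightarrow> real"
  proof -
    have "(\<Sum>A'\<in>scenarios I. ?g B A' * F A') = (\<Sum>A'\<in>scenarios I. if A' = A then mu I * phat I B * F A else 0)"
      by (rule sum.cong) auto
    then show ?thesis using A(1) finite_scenarios[OF I] by simp
  qed
  have "?g \<in> plans I"
    unfolding plans_def
  proof (intro CollectI conjI ballI)
    show "0 \<le> ?g B A'" if "B \<in> support I" for B A' using phat_pos[OF I that] mu_bounds(1) by simp
    show "(\<Sum>A'\<in>scenarios I. ?g B A') \<le> phat I B" if "B \<in> support I" for B
      using s[of B "\<lambda>_. 1"] mult_right_mono[OF mu_bounds(2), of "phat I B"] phat_pos[OF I that] by simp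
    have "(\<Sum>B\<in>support I. \<Sum>A'\<in>scenarios I. kappa I B A' * ?g B A') = (\<Sum>B\<in>support I. mu I * phat I B * kappa I B A)"
      by (rule sum.cong[OF refl]) (subst s[symmetric], simp add: mult.commute)
    also have "\<dots> \<le> (\<Sum>B\<in>support I. mu I * phat I B * real_of_rat (kappa_max I))"
    proof (intro sum_mono mult_left_mono)
      fix B assume B: "B \<in> support I"
      then show "kappa I B A \<le> real_of_rat (kappa_max I)" using support_scenarios[OF I] A(1) by (intro kappa_le_max[OF I]) auto
      show "0 \<le> mu I * phat I B" using phat_pos[OF I B] mu_bounds(1) by simp
    qed
    also have "\<dots> = mu I * real_of_rat (kappa_max I) * (\<Sum>B\<in>support I. phat I B)"
      by (simp add: sum_distrib_left mult.assoc mult.commute mult.left_commute)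
    also have "\<dots> \<le> real_of_rat (radius I)" using mu_bounds(3) phat_sum[OF I] by simp
    finally show "(\<Sum>B\<in>support I. \<Sum>A'\<in>scenarios I. kappa I B A' * ?g B A') \<le> real_of_rat (radius I)" .
  qed
  from objective_le_z[OF I this x] have "mu I * gcost I x A \<le> z_central I x"
    unfolding objective_def s using phat_sum[OF I] by (simp add: sum_distrib_left[symmetric] sum_distrib_right[symmetric])
  moreover have "mu I * (cvec I \<bullet> x) \<le> cvec I \<bullet> x"
    using mult_right_mono[OF mu_bounds(2) cost_nonneg[OF x]] by simp
  moreover have "1 \<le> cvec I \<bullet> x + gcost I x A" using nonnull[OF I] A x unfolding nonnull_cost_ge_1_def by blast
  then have "mu I * 1 \<le> mu I * (cvec I \<bullet> x + gcost I x A)" using mu_bounds(1) by (intro mult_left_mono) auto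
  ultimately show ?thesis by (simp add: h_central_def distrib_left)
qed

end

section \<open>Near-optimal corners and the volume argument\<close>

lemma candidate_props:
  assumes "I \<in> J" "length x = dimension I" "rvec (snd b) \<in> int_feasible I" "fst b = fval I (snd b)"
  shows "rvec (snd (candidate I x b)) \<in> int_feasible I" "fst (candidate I x b) = fval I (snd (candidate I x b))"
    "fst (candidate I x b) \<le> fst b"
    "rvec x \<in> feasible I \<Longrightarrow> fst (candidate I x b) \<le> fval I (Loc I x)"
  using assms Sep_feasible[OF assms(1,2)] Loc_int[OF assms(1), of x] by (auto simp: candidate_def)

context
  fixes I :: "'z dr_instance" assumes I: "I \<in> J"
begin

lemma state_candidate:
  "rvec (snd (snd (snd (state I k n)))) \<in> int_feasible I \<and>
   fst (snd (snd (state I k n))) = fval I (snd (snd (snd (state I k n)))) \<and>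
   fst (snd (snd (state I k n))) \<le> fval I (zeros I)"
proof (induction n)
  case 0
  then show ?case using zeros_feasible[OF I] by (simp add: state_def start_def)
next
  case (Suc n)
  have "snd (snd (state I k (Suc n))) = candidate I (center (dimension I) (fst (state I k n))) (snd (snd (state I k n)))"
    by (simp add: state_Suc outer_step_def Let_def)
  then show ?case using Suc candidate_props[OF I, of "center (dimension I) (fst (state I k n))" "snd (snd (state I k n))"]
    by (auto intro: order_trans)
qed

lemma precision_eq:
  "real_of_rat (precision I k) = real_of_rat k * (real_of_rat (inflation I)
     + real_of_rat (outer_radius I) * (\<Sum>j<dimension I. real_of_rat (costs I ! j)) / mu I)"
proof -
  have "sum_list (costs I) = (\<Sum>j<dimension I. costs I ! j)"
    by (simp add: sum_list_sum_nth atLeast0LessThan)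
  then show ?thesis
    by (simp add: precision_def mu_def of_rat_mult of_rat_add of_rat_divide of_rat_sum del: list_of_vec_index)
qed

lemma precision_ge_1: assumes "1 \<le> k" shows "1 \<le> real_of_rat (precision I k)"
proof -
  have "0 \<le> (\<Sum>j<dimension I. real_of_rat (costs I ! j))" by (rule sum_nonneg) (use costs_nonneg[OF I] in auto)
  then have "0 \<le> real_of_rat (outer_radius I) * (\<Sum>j<dimension I. real_of_rat (costs I ! j)) / mu I"
    using R_pos[OF I] mu_bounds(1)[OF I] by (intro divide_nonneg_pos mult_nonneg_nonneg) auto
  moreover have "1 \<le> real_of_rat (inflation I)" using p2[OF I] by (simp add: P2_def)
  ultimately have "1 \<le> real_of_rat (inflation I)
     + real_of_rat (outer_radius I) * (\<Sum>j<dimension I. real_of_rat (costs I ! j)) / mu I"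
    by linarith
  moreover have "1 \<le> real_of_rat k" using assms by simp
  moreover have "1 \<le> a * b" if "1 \<le> a" "1 \<le> b" for a b :: real
    using mult_mono[of 1 a 1 b] that by simp
  ultimately show ?thesis unfolding precision_eq by blast
qed

text \<open>By convexity a step of length \<open>s\<close> towards \<open>y\<close> changes the cost
  in a scenario by at most \<open>s\<close> times its increase from \<open>xs\<close> to
  \<open>y\<close>. By P1 and P2 that increase is at most \<open>inflation I\<close> times the
  first-stage cost of \<open>xs\<close>, as passing through 0 shows. The first-stage cost grows by
  at most \<open>s\<close> times its maximum over the box. The weights of a plan sum to at most 1,
  so the bounds add up.\<close>

lemma near_opt:
  assumes k: "1 \<le> k" and xs: "xs \<in> int_feasible I" "h_central I xs = opt I" and y: "y \<in> feasible I"
    and x: "rvec x \<in> int_feasible I" and mu: "mu I \<le> opt I"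
    and s: "s = 1 / real_of_rat (precision I k)"
  shows "hplan I (plan I x) ((1 - s) \<cdot>\<^sub>v xs + (1 - (1 - s)) \<cdot>\<^sub>v y) \<le> (1 + 1 / real_of_rat k) * opt I"
proof -
  let ?p = "(1 - s) \<cdot>\<^sub>v xs + (1 - (1 - s)) \<cdot>\<^sub>v y"
  let ?l = "real_of_rat (inflation I)" and ?R = "real_of_rat (outer_radius I)"
  let ?C = "\<Sum>j<dimension I. real_of_rat (costs I ! j)"
  have s01: "0 \<le> s" "s \<le> 1" using precision_ge_1[OF k] by (auto simp: s)
  have xf: "xs \<in> feasible I" using xs int_feasible_subset by blast
  have zf: "0\<^sub>v (dimension I) \<in> feasible I" using zero_int_feasible[OF I] int_feasible_subset by blast
  have l1: "1 \<le> ?l" using p2[OF I] by (simp add: P2_def)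
  have cx: "0 \<le> cvec I \<bullet> xs" by (rule cost_nonneg[OF I xf])
  have cx': "cvec I \<bullet> xs \<le> opt I" using z_nonneg[OF I xf] by (simp add: xs(2)[symmetric] h_central_def)
  have cp: "cvec I \<bullet> ?p \<le> cvec I \<bullet> xs + s * (cvec I \<bullet> y)"
  proof -
    have "cvec I \<bullet> ?p = (1 - s) * (cvec I \<bullet> xs) + s * (cvec I \<bullet> y)"
      using feasible_dim[OF I xf] feasible_dim[OF I y]
      by (simp add: cost_sum[OF I] distrib_left sum.distrib sum_distrib_left mult.left_commute)
    also have "\<dots> \<le> 1 * (cvec I \<bullet> xs) + s * (cvec I \<bullet> y)"
      using s01 cx by (intro add_right_mono mult_right_mono) auto
    finally show ?thesis by simp
  qed
  have cy: "cvec I \<bullet> y \<le> ?R * ?C"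
    unfolding cost_sum[OF I feasible_dim[OF I y]] sum_distrib_left
  proof (rule sum_mono)
    fix j assume "j \<in> {..<dimension I}"
    then have j: "j < dimension I" by simp
    show "real_of_rat (costs I ! j) * y $ j \<le> ?R * real_of_rat (costs I ! j)"
      using mult_left_mono[OF feasible_le_R[OF I y j] costs_nonneg[OF I j]] by (simp only: mult.commute)
  qed
  have C0: "0 \<le> ?R * ?C"
    using R_pos[OF I] costs_nonneg[OF I] by (intro mult_nonneg_nonneg sum_nonneg) auto
  have g: "gcost I ?p A \<le> gcost I xs A + s * ?l * (cvec I \<bullet> xs)" if A: "A \<in> scenarios I" for A
  proof -
    have conv: "convex_fun_on (feasible I) (\<lambda>x. gcost I x A)" using p4[OF I] A unfolding P4_def by blast
    have u: "0 \<le> 1 - s \<and> 1 - s \<le> 1" using s01 by auto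
    have "gcost I ?p A \<le> (1 - s) * gcost I xs A + (1 - (1 - s)) * gcost I y A"
      using conv xf y u unfolding convex_fun_on_def by blast
    moreover have "gcost I y A \<le> gcost I (0\<^sub>v (dimension I)) A" using p1[OF I] y A unfolding P1_def by blast
    moreover have "gcost I (0\<^sub>v (dimension I)) A \<le> gcost I xs A + ?l * (cvec I \<bullet> xs)"
      using p2[OF I] xf A unfolding P2_def by blast
    ultimately have "gcost I ?p A \<le> (1 - s) * gcost I xs A + s * (gcost I xs A + ?l * (cvec I \<bullet> xs))"
      using mult_left_mono[of "gcost I y A" "gcost I xs A + ?l * (cvec I \<bullet> xs)" s] s01 by simp
    then show ?thesis by (simp add: algebra_simps)
  qed
  let ?ws = "plan I x"
  have "(\<Sum>w\<leftarrow>?ws. real_of_rat (snd w) * gcost I ?p (fst w))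
      \<le> (\<Sum>w\<leftarrow>?ws. real_of_rat (snd w) * gcost I xs (fst w) + real_of_rat (snd w) * (s * ?l * (cvec I \<bullet> xs)))"
  proof (rule sum_list_mono)
    fix w assume "w \<in> set ?ws"
    then have w: "fst w \<in> scenarios I" "0 \<le> snd w" using plan_properties(1)[OF I x] by auto
    then have "real_of_rat (snd w) * gcost I ?p (fst w) \<le> real_of_rat (snd w) * (gcost I xs (fst w) + s * ?l * (cvec I \<bullet> xs))"
      using g by (intro mult_left_mono) auto
    then show "real_of_rat (snd w) * gcost I ?p (fst w)
       \<le> real_of_rat (snd w) * gcost I xs (fst w) + real_of_rat (snd w) * (s * ?l * (cvec I \<bullet> xs))"
      by (simp only: distrib_left)
  qed
  also have "\<dots> = (\<Sum>w\<leftarrow>?ws. real_of_rat (snd w) * gcost I xs (fst w))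
      + (\<Sum>w\<leftarrow>?ws. real_of_rat (snd w)) * (s * ?l * (cvec I \<bullet> xs))"
    by (simp add: sum_list_addf sum_list_mult_const)
  also have "\<dots> \<le> (\<Sum>w\<leftarrow>?ws. real_of_rat (snd w) * gcost I xs (fst w)) + 1 * (s * ?l * (cvec I \<bullet> xs))"
    using plan_properties(2)[OF I x] s01 l1 cx by (intro add_left_mono mult_right_mono) auto
  finally have "hplan I ?ws ?p \<le> hplan I ?ws xs + s * (cvec I \<bullet> y) + s * ?l * (cvec I \<bullet> xs)"
    using cp by (simp add: hplan_def)
  also have "\<dots> \<le> opt I + s * (?R * ?C) + s * ?l * opt I"
    using hplan_le_h[OF I x xf] xs(2) cy cx' s01 l1 by (intro add_mono mult_left_mono) auto
  also have "\<dots> \<le> opt I + s * (?R * ?C / mu I * opt I) + s * ?l * opt I"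
  \<comment> \<open>\<open>opt I / mu I\<close> is at least 1, which turns the absolute error of the
    first-stage cost into a relative one.\<close>
  proof -
    have "?R * ?C * 1 \<le> ?R * ?C * (opt I / mu I)"
      using C0 mu mu_bounds(1)[OF I] by (intro mult_left_mono) auto
    then show ?thesis using s01(1) by (intro add_right_mono add_left_mono mult_left_mono) auto
  qed
  also have "\<dots> = opt I + s * (?l + ?R * ?C / mu I) * opt I" by (simp add: algebra_simps)
  also have "s * (?l + ?R * ?C / mu I) = 1 / real_of_rat k"
  proof -
    have "?l + ?R * ?C / mu I \<noteq> 0" using precision_ge_1[OF k] unfolding precision_eq by auto
    then show ?thesis unfolding s precision_eq by simp
  qed
  finally show ?thesis by (simp add: distrib_right)
qed

lemma corner_feasible:
  assumes cen: "cen \<in> carrier_vec (dimension I)"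
    "\<forall>x\<in>carrier_vec (dimension I). vnorm (x - cen) \<le> real_of_rat (inner_radius I) \<longrightarrow> x \<in> feasible I"
  shows "vec (dimension I) (\<lambda>j. cen $ j + (if j = i then real_of_rat (inner_radius I) else 0)) \<in> feasible I"
proof -
  let ?V = "real_of_rat (inner_radius I)"
  let ?y = "vec (dimension I) (\<lambda>j. cen $ j + (if j = i then ?V else 0))"
  have V: "0 < ?V" using p3[OF I] by (simp add: P3_def)
  have "(?y - cen) \<bullet> (?y - cen) = (\<Sum>j = 0..<dimension I. if j = i then ?V * ?V else 0)"
    using cen(1) unfolding scalar_prod_def by (intro sum.cong) auto
  also have "\<dots> \<le> ?V * ?V" by simp
  finally have "vnorm (?y - cen) \<le> sqrt (?V * ?V)" unfolding vnorm_def by (rule real_sqrt_le_mono)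
  then have "vnorm (?y - cen) \<le> ?V" using V by simp
  moreover have "?y \<in> carrier_vec (dimension I)" by simp
  ultimately show ?thesis using cen(2) by blast
qed

definition bound :: "rat \<Rightarrow> real" where
  "bound k = \<rho> I * (1 + 1 / real_of_rat k) * opt I"

text \<open>The initial candidate is never worsened, so an optimal decision 0 already settles the
  matter. A positive optimum gives \<rho> at least 1; an optimum of 0 makes both sides
  collapse.\<close>

lemma trivial_solution:
  assumes k: "1 \<le> k" and h0: "h_central I (0\<^sub>v (dimension I)) \<le> opt I"
  shows "real_of_rat (fst (snd (snd (state I k n)))) \<le> bound k"
proof -
  have z: "rvec (zeros I) = 0\<^sub>v (dimension I)" by (rule eq_vecI) (auto simp: zeros_def)
  have zi: "rvec (zeros I) \<in> int_feasible I" by (rule zeros_feasible[OF I])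
  have "real_of_rat (fst (snd (snd (state I k n)))) \<le> real_of_rat (fval I (zeros I))"
    using conjunct2[OF conjunct2[OF state_candidate[of k n]]] by (simp only: of_rat_less_eq)
  also have "\<dots> \<le> h_central I (rvec (zeros I))"
    unfolding fval_eq[OF I zi] using zi int_feasible_subset by (intro hplan_le_h[OF I zi]) blast
  also have "\<dots> \<le> opt I" using h0 z by simp
  finally have f: "real_of_rat (fst (snd (snd (state I k n)))) \<le> opt I" .
  show ?thesis
  proof (cases "opt I = 0")
    case True
    then show ?thesis using f by (simp add: bound_def)
  next
    case False
    then have o: "0 < opt I" using opt_nonneg[OF I] by linarith
    have "1 * 1 \<le> \<rho> I * (1 + 1 / real_of_rat k)" using rho_ge_1[OF I o] k by (intro mult_mono) auto
    then have "1 * opt I \<le> \<rho> I * (1 + 1 / real_of_rat k) * opt I" using o by (intro mult_right_mono) auto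
    then show ?thesis using f by (simp add: bound_def)
  qed
qed

text \<open>
  The corners of a small simplex near an optimal solution stay inside the current simplex unless one
  of them is cut off; in the latter case, the decision rounded from the centroid is good enough.
\<close>

lemma solution_step:
  fixes p :: "nat \<Rightarrow> nat \<Rightarrow> real"
  defines "pv \<equiv> \<lambda>i. vec (dimension I) (p i)"
  assumes k: "1 \<le> k" and m: "1 \<le> dimension I" and rho: "0 \<le> \<rho> I"
    and pf: "\<And>i. pv i \<in> feasible I"
    and ph: "\<And>i x. rvec x \<in> int_feasible I \<Longrightarrow> hplan I (plan I x) (pv i) \<le> (1 + 1 / real_of_rat k) * opt I"
    and inv: "\<And>i. i \<le> dimension I \<Longrightarrow> in_simplex (dimension I) (\<lambda>a j. real_of_rat (fst (state I k n) ! a ! j)) (p i)"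
    and vol: "\<bar>det (homog (dimension I) (\<lambda>a j. real_of_rat (fst (state I k n) ! a ! j)))\<bar> \<le> B"
  shows "real_of_rat (fst (snd (snd (state I k (Suc n))))) \<le> bound k \<or>
    (\<forall>i\<le>dimension I. in_simplex (dimension I) (\<lambda>a j. real_of_rat (fst (state I k (Suc n)) ! a ! j)) (p i)) \<and>
    \<bar>det (homog (dimension I) (\<lambda>a j. real_of_rat (fst (state I k (Suc n)) ! a ! j)))\<bar>
      \<le> real_of_rat (shrink (dimension I)) ^ dimension I * B"
proof -
  let ?m = "dimension I" and ?V = "fst (state I k n)"
  define x where "x = center ?m ?V"
  define d where "d = cutvec I x"
  have lx: "length x = ?m" by (simp add: x_def)
  have ld: "length d = ?m" unfolding d_def by (rule length_cutvec[OF I lx])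
  interpret simplex_data ?m ?V d
    by unfold_locales (use m state_simplex ld in auto)
  have S: "fst (state I k (Suc n)) = cut_simplex ?m ?V slo"
    by (simp add: state_Suc outer_step_def Let_def d_def x_def)
  have b: "snd (snd (state I k (Suc n))) = candidate I x (snd (snd (state I k n)))"
    by (simp add: state_Suc outer_step_def Let_def x_def)
  have rv': "rv = (\<lambda>a j. real_of_rat (?V ! a ! j))" by (intro ext) (simp add: rv_def)
  have sl: "(\<Sum>j<?m. rd j * (p i j - rx j)) = (\<Sum>j<?m. real_of_rat (d ! j) * (pv i $ j - real_of_rat (x ! j)))" for i
    by (rule sum.cong) (auto simp: rd_def rx_eq pv_def x_def)
  show ?thesis
  \<comment> \<open>A corner on the cutting hyperplane counts as cut off. In the other case all
    corners are then strictly on the kept side, and the minimal slope is negative.\<close>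
  proof (cases "\<exists>i\<le>?m. 0 \<le> (\<Sum>j<?m. rd j * (p i j - rx j))")
    case True
    then obtain i where i: "0 \<le> (\<Sum>j<?m. real_of_rat (d ! j) * (pv i $ j - real_of_rat (x ! j)))"
      unfolding sl by blast
    have dv: "dim_vec (pv i) = ?m" by (simp add: pv_def)
    \<comment> \<open>A separating hyperplane keeps all feasible points strictly, and the corners
      are feasible. Hence the cut must have been an objective cut.\<close>
    have xf: "rvec x \<in> feasible I"
    proof (rule ccontr)
      assume "rvec x \<notin> feasible I"
      then have "rvec d \<bullet> pv i < rvec d \<bullet> rvec x"
        unfolding d_def using cutvec_infeasible(3)[OF I lx] pf by blast
      moreover have "rvec d \<bullet> pv i - rvec d \<bullet> rvec x = (\<Sum>j<?m. real_of_rat (d ! j) * (pv i $ j - real_of_rat (x ! j)))"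
        using ld lx dv by (simp add: rvec_sum[OF I] right_diff_distrib sum_subtractf)
      ultimately show False using i by linarith
    qed
    then have dg: "d = grad I x" using Sep_feasible[OF I lx] by (simp add: d_def cutvec_def)
    have L: "rvec (Loc I x) \<in> int_feasible I" by (rule Loc_int[OF I xf])
    have "hplan I (plan I (Loc I x)) (rvec x) \<le> hplan I (plan I (Loc I x)) (pv i)"
      using grad_subgradient[OF I xf pf[of i]] i unfolding dg by linarith
    also have "\<dots> \<le> (1 + 1 / real_of_rat k) * opt I" by (rule ph[OF L])
    finally have "\<rho> I * hplan I (plan I (Loc I x)) (rvec x) \<le> bound k"
      using rho unfolding bound_def mult.assoc by (rule mult_left_mono)
    then have "real_of_rat (fval I (Loc I x)) \<le> bound k" using Loc_fval[OF I xf] by linarith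
    moreover have "fst (snd (snd (state I k (Suc n)))) \<le> fval I (Loc I x)"
      unfolding b using candidate_props(4)[OF I lx _ _ xf] state_candidate[of k n] by blast
    then have "real_of_rat (fst (snd (snd (state I k (Suc n))))) \<le> real_of_rat (fval I (Loc I x))"
      by (simp only: of_rat_less_eq)
    ultimately show ?thesis by linarith
  next
    case False
    then have neg: "(\<Sum>j<?m. rd j * (p i j - rx j)) < 0" if "i \<le> ?m" for i using that by force
    have ins: "in_simplex ?m rv (p i)" if "i \<le> ?m" for i unfolding rv' by (rule inv[OF that])
    \<comment> \<open>The cut is proper, so the division by the minimal slope is genuine and the
      volume decreases.\<close>
    have ab: "ra (argmin slo) < 0" using slope_lower[OF ins[of 0]] neg[of 0] by simp
    have "in_simplex ?m (\<lambda>a j. real_of_rat (fst (state I k (Suc n)) ! a ! j)) (p i)" if "i \<le> ?m" for i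
      by (rule in_simplex_cong[OF _ cut_mem[OF ins[OF that] less_imp_le[OF neg[OF that]] ab]])
         (simp add: S cut_nth)
    moreover have "homog ?m (\<lambda>a j. real_of_rat (fst (state I k (Suc n)) ! a ! j)) = homog ?m v'"
      by (rule homog_cong) (simp add: S cut_nth)
    moreover have "\<bar>det (homog ?m v')\<bar> \<le> real_of_rat (shrink ?m) ^ ?m * B"
    proof -
      let ?P = "\<Prod>i\<le>?m. 16 * real ?m ^ 4 / (16 * real ?m ^ 4 + real_of_int (rb i))"
      have sh: "real_of_rat (shrink ?m) = 32 * real ?m ^ 4 / (32 * real ?m ^ 4 + 1)"
        by (simp add: shrink_def scale_def of_rat_divide of_rat_mult of_rat_add of_rat_power)
      have "\<bar>det (homog ?m v')\<bar> = ?P * \<bar>det (homog ?m rv)\<bar>"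
        unfolding det_step using volume_gain(1)[OF ab] by (simp add: abs_mult)
      also have "\<dots> \<le> real_of_rat (shrink ?m) ^ ?m * B"
        unfolding sh using volume_gain[OF ab] vol unfolding rv'
        by (intro mult_mono) (auto intro: less_imp_le)
      finally show ?thesis .
    qed
    ultimately show ?thesis by simp
  qed
qed

text \<open>If the bound failed at the end, no corner would ever have been cut off. The final
  simplex would contain the whole small simplex and yet be too small for it.\<close>

lemma solution:
  assumes k: "1 \<le> k"
  shows "real_of_rat (fst (snd (snd (state I k (outer_steps I k))))) \<le> bound k"
proof -
  let ?m = "dimension I" and ?R = "real_of_rat (outer_radius I)" and ?r = "real_of_rat (inner_radius I)"
  consider "?m = 0" | "\<forall>A\<in>scenarios I. null_scenario I A" | "1 \<le> ?m" "\<exists>A\<in>scenarios I. \<not> null_scenario I A"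
    by (cases "?m = 0") auto
  \<comment> \<open>Dimension 0 is separate because the cut needs at least one coordinate; the zero
    vector is then the only decision. The second case has no positive lower bound
    \<open>mu I\<close> on the optimum.\<close>
  then show ?thesis
  proof cases
    case 1
    obtain x where x: "rvec x \<in> int_feasible I" "h_central I (rvec x) = opt I" by (rule opt_attained[OF I])
    have "rvec x = 0\<^sub>v ?m" by (rule eq_vecI) (use int_feasible_length[OF I x(1)] 1 in auto)
    then show ?thesis using x(2) by (intro trivial_solution[OF k]) simp
  next
    case 2
    show ?thesis by (rule trivial_solution[OF k null_opt[OF I 2]])
  next
    case 3
    obtain A where A: "A \<in> scenarios I" "\<not> null_scenario I A" using 3 by blast
    obtain x where x: "rvec x \<in> int_feasible I" "h_central I (rvec x) = opt I" by (rule opt_attained[OF I])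
    have xf: "rvec x \<in> feasible I" using x int_feasible_subset by blast
    have mu: "mu I \<le> opt I" using nonnull_lower[OF I A xf] x(2) by simp
    then have rho: "0 \<le> \<rho> I" using rho_ge_1[OF I] mu_bounds(1)[OF I] by fastforce
    obtain cen where cen: "cen \<in> carrier_vec ?m"
      "\<forall>x\<in>carrier_vec ?m. vnorm (x - cen) \<le> ?r \<longrightarrow> x \<in> feasible I"
      using p3[OF I] unfolding P3_def by blast
    have r: "0 < ?r" using p3[OF I] by (simp add: P3_def)
    define s where "s = 1 / real_of_rat (precision I k)"
    have s: "0 < s" "s \<le> 1" using precision_ge_1[OF k] by (auto simp: s_def)
    define \<eta> where "\<eta> = s * ?r"
    have eta: "0 < \<eta>" using s r by (simp add: \<eta>_def)
    \<comment> \<open>Contraction towards the optimum by the factor \<open>s\<close>: it sends the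
      centre \<open>cen\<close> of the inner ball to \<open>c\<close> and the corners
      \<open>y i\<close> of a simplex in the ball to the corners \<open>p i\<close>, with edge
      \<open>\<eta>\<close>.\<close>
    define c where "c j = (1 - s) * rvec x $ j + s * cen $ j" for j
    define p where "p i j = c j + (if j = i then \<eta> else 0)" for i j
    define y where "y i = vec ?m (\<lambda>j. cen $ j + (if j = i then ?r else 0))" for i
    have yf: "y i \<in> feasible I" for i unfolding y_def by (rule corner_feasible[OF cen])
    have pe: "vec ?m (p i) = (1 - s) \<cdot>\<^sub>v rvec x + (1 - (1 - s)) \<cdot>\<^sub>v y i" for i
      by (rule eq_vecI) (use feasible_length[OF I xf] in \<open>auto simp: p_def c_def y_def \<eta>_def algebra_simps\<close>)
    have pf: "vec ?m (p i) \<in> feasible I" for i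
      unfolding pe by (rule feasible_convex[OF I xf yf]) (use s in auto)
    have ph: "hplan I (plan I z) (vec ?m (p i)) \<le> (1 + 1 / real_of_rat k) * opt I"
      if "rvec z \<in> int_feasible I" for i z
      unfolding pe by (rule near_opt[OF k x yf that mu s_def])
    let ?v = "\<lambda>n a j. real_of_rat (fst (state I k n) ! a ! j)"
    let ?t = "real_of_rat (shrink ?m)"
    \<comment> \<open>Either the goal has been reached, which later rounds preserve, or all corners
      are still inside and the determinant is below the \<open>m\<close>-th power of the current
      edge bound.\<close>
    have inv: "real_of_rat (fst (snd (snd (state I k n)))) \<le> bound k \<or>
      (\<forall>i\<le>?m. in_simplex ?m (?v n) (p i)) \<and> \<bar>det (homog ?m (?v n))\<bar> \<le> (real ?m * ?R * ?t ^ n) ^ ?m" for n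
    proof (induction n)
      case 0
      have v0: "?v 0 a j = (if j = a then real ?m * ?R else 0)" if "a \<le> ?m" "j < ?m" for a j
        using that by (simp add: state_def start_def start_nth of_rat_mult)
      have st: "in_simplex ?m (\<lambda>a j. if j = a then real ?m * ?R else 0) (p i)" for i
      proof (rule in_start_simplex[OF R_pos[OF I]])
        fix j assume j: "j < ?m"
        then have "p i j = vec ?m (p i) $ j" by simp
        then show "0 \<le> p i j \<and> p i j \<le> ?R" using feasible_nonneg[OF I pf j] feasible_le_R[OF I pf j] by simp
      qed
      have "in_simplex ?m (?v 0) (p i)" for i by (rule in_simplex_cong[OF _ st]) (rule v0[symmetric])
      \<comment> \<open>The start simplex is itself a corner simplex, with corner 0 and edge
        \<open>m\<close> * R.\<close>
      moreover have "homog ?m (?v 0) = homog ?m (\<lambda>a j. 0 + (if j = a then real ?m * ?R else 0))"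
        unfolding add_0 by (rule homog_cong) (rule v0)
      then have "det (homog ?m (?v 0)) = (real ?m * ?R) ^ ?m" by (simp only: det_corner_simplex)
      ultimately show ?case using R_pos[OF I] by simp
    next
      case (Suc n)
      show ?case
      proof (cases "real_of_rat (fst (snd (snd (state I k n)))) \<le> bound k")
        case True
        have "fst (snd (snd (state I k (Suc n)))) \<le> fst (snd (snd (state I k n)))"
          using candidate_props(3)[OF I, of "center ?m (fst (state I k n))" "snd (snd (state I k n))"] state_candidate[of k n]
          by (simp add: state_Suc outer_step_def Let_def)
        then have "real_of_rat (fst (snd (snd (state I k (Suc n))))) \<le> real_of_rat (fst (snd (snd (state I k n))))"
          by (simp only: of_rat_less_eq)
        then show ?thesis using True by linarith
      next
        case False
        then have "\<And>i. i \<le> ?m \<Longrightarrow> in_simplex ?m (?v n) (p i)" "\<bar>det (homog ?m (?v n))\<bar> \<le> (real ?m * ?R * ?t ^ n) ^ ?m"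
          using Suc.IH by blast+
        from solution_step[OF k 3(1) rho pf ph this]
        show ?thesis by (simp add: power_mult_distrib mult.assoc mult.left_commute mult.commute)
      qed
    qed
    show ?thesis
    proof (rule ccontr)
      let ?N = "outer_steps I k"
      assume "\<not> real_of_rat (fst (snd (snd (state I k ?N)))) \<le> bound k"
      then have i: "\<And>i. i \<le> ?m \<Longrightarrow> in_simplex ?m (?v ?N) (p i)"
          "\<bar>det (homog ?m (?v ?N))\<bar> \<le> (real ?m * ?R * ?t ^ ?N) ^ ?m" using inv[of ?N] by blast+
      define a where "a = real ?m * ?R * ?t ^ ?N"
      have a0: "0 \<le> a" unfolding a_def using R_pos[OF I]
        by (intro mult_nonneg_nonneg zero_le_power) (auto simp: shrink_def scale_def)
      have "\<bar>\<eta> ^ ?m\<bar> \<le> fact (Suc ?m) * \<bar>det (homog ?m (?v ?N))\<bar>"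
      proof (rule det_lower_bound[where c = c])
        have pd: "p i = (\<lambda>j. c j + (if j = i then \<eta> else 0))" for i by (rule ext) (simp add: p_def)
        show "in_simplex ?m (?v ?N) (\<lambda>j. c j + (if j = i then \<eta> else 0))" if "i \<le> ?m" for i
          using i(1)[OF that] unfolding pd .
      qed
      also have "\<dots> \<le> (real ?m + 1) ^ ?m * a ^ ?m"
        using fact_Suc_le_power i(2) unfolding a_def by (intro mult_mono) auto
      also have "\<dots> = ((real ?m + 1) * a) ^ ?m" by (simp add: power_mult_distrib)
      finally have 1: "\<eta> ^ ?m \<le> ((real ?m + 1) * a) ^ ?m" using eta by simp
      have "start_width I k * shrink ?m ^ ?N < 1"
        using outer_steps_props(2)[of I k] unfolding state_width by simp
      then have "real_of_rat (start_width I k * shrink ?m ^ ?N) < real_of_rat 1" by (simp only: of_rat_less)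
      \<comment> \<open>The exit condition of the loop, with \<open>start_width\<close> and
        \<open>s\<close> unfolded, says precisely that the edge bound has dropped below
        \<open>\<eta>\<close>.\<close>
      then have "(real ?m + 1) * a / \<eta> < 1"
        by (simp add: start_width_def a_def \<eta>_def s_def of_rat_mult of_rat_divide of_rat_add of_rat_power mult.assoc mult.left_commute mult.commute)
      then have "(real ?m + 1) * a < \<eta>" using eta by (simp add: divide_less_eq)
      then have "((real ?m + 1) * a) ^ ?m < \<eta> ^ ?m"
        using a0 3(1) by (intro power_strict_mono) auto
      then show False using 1 by linarith
    qed
  qed
qed

end

end

section \<open>From the assumed programs to functions, and the final bounds\<close>

lemma ptime_reindex:
  assumes "ptime D e F" "\<And>j. j \<in> E \<Longrightarrow> h j \<in> D" "\<And>j. j \<in> E \<Longrightarrow> e' j = e (h j)"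
  shows "ptime E e' (\<lambda>j. F (h j))"
  by (rule ptime_comp[where h = h, OF assms(1,2)]) (auto intro: ptime_cong[OF ptime_input assms(3)])

text \<open>Additionally chooses a decoding of each answer, so that later definitions work with
  numbers and lists instead of encoded values.\<close>

lemma ptime_of_polytime_solves_enc:
  assumes "polytime_solves p D e S" "\<And>i u. i \<in> D \<Longrightarrow> S i u \<Longrightarrow> \<exists>v. u = en v \<and> S' i v"
  obtains F where "ptime D e (\<lambda>i. en (F i))" "\<And>i. i \<in> D \<Longrightarrow> S' i (F i)"
proof -
  obtain G where G: "ptime D e G" "\<And>i. i \<in> D \<Longrightarrow> S i (G i)" using ptime_of_polytime_solves[OF assms(1)] by blast
  have "\<forall>i\<in>D. \<exists>v. G i = en v \<and> S' i v" using G(2) assms(2) by blast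
  then obtain F where F: "\<forall>i\<in>D. G i = en (F i) \<and> S' i (F i)" by metis
  show ?thesis by (rule that[of F]) (use F G(1) in \<open>auto intro: ptime_cong\<close>)
qed

lemma enc_vec_eq: "enc_vec d = enc_rats (list_of_vec d)"
  by (simp add: enc_vec_def)

lemma rvec_list_of_vec: "rvec (list_of_vec d) = real_vec d"
  by (simp add: rvec_def vec_list)

text \<open>The attained infimum is bounded below, so it is at most the cost of every admissible
  action, and integral actions are admissible.\<close>

lemma gcost_le_action:
  assumes "well_formed I" "x \<in> feasible I" "A \<in> scenarios I" "a \<in> integral_actions I x A"
  shows "gcost I x A \<le> action_cost I A a"
proof -
  have "\<forall>x\<in>feasible I. \<forall>A\<in>scenarios I. integral_actions I x A \<subseteq> actions I x A \<and>
        (\<exists>a\<in>actions I x A. \<forall>b\<in>actions I x A. action_cost I A a \<le> action_cost I A b)"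
    using assms(1) unfolding well_formed_def by blast
  then have "integral_actions I x A \<subseteq> actions I x A"
    "\<exists>a\<in>actions I x A. \<forall>b\<in>actions I x A. action_cost I A a \<le> action_cost I A b"
    using assms(2,3) by blast+
  then have "a \<in> actions I x A" "bdd_below (action_cost I A ` actions I x A)"
    using assms(4) by (auto simp: bdd_below_def)
  then show ?thesis unfolding gcost_def by (intro cINF_lower)
qed

lemma dr_algorithms_exist:
  fixes J :: "'z dr_instance set"
  assumes dr: "dr_problem J K" and sep: "separation_oracle J sep"
    and loc: "local_approximation J \<rho> loc" and apx: "penalized_approximation J \<beta>\<^sub>1 \<beta>\<^sub>2 apx"
  obtains Sep Loc Apx Gr Kr Sg where "dr_algorithms J \<rho> \<beta>\<^sub>1 \<beta>\<^sub>2 Sep Loc Apx Gr Kr Sg"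
proof -
  let ?v = "\<lambda>x :: rat list. vec_of_list x"
  note d = dr[unfolded dr_problem_def]
  obtain pg ps pk where p: "g_algorithm J pg" "subgradient_algorithm J K ps" "kappa_algorithm J pk"
    using d by blast
  have inst: "I \<in> J \<Longrightarrow> well_formed I \<and> P1 I \<and> P2 I \<and> P3 I \<and> P4 I \<and> nonnull_cost_ge_1 I" for I
    using d by blast
  obtain S where S: "ptime {(I, x). I \<in> J \<and> x \<in> carrier_vec (dimension I)}
       (\<lambda>(I, x). enc_list [encode I, enc_vec x]) S"
     "\<And>i. i \<in> {(I, x). I \<in> J \<and> x \<in> carrier_vec (dimension I)} \<Longrightarrow>
       (case i of (I, x) \<Rightarrow> (\<lambda>u. if real_vec x \<in> feasible I then u = Atom 1
        else \<exists>d\<in>carrier_vec (dimension I). u = enc_vec d \<and>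
          (\<forall>x'\<in>feasible I. real_vec d \<bullet> x' < real_vec d \<bullet> real_vec x))) (S i)"
    using ptime_of_polytime_solves[OF sep[unfolded separation_oracle_def]] by blast
  obtain L where L: "ptime {(I, x). I \<in> J \<and> real_vec x \<in> feasible I}
       (\<lambda>(I, x). enc_list [encode I, enc_vec x]) (\<lambda>i. enc_rats (L i))"
     "\<And>i. i \<in> {(I, x). I \<in> J \<and> real_vec x \<in> feasible I} \<Longrightarrow>
       (case i of (I, x) \<Rightarrow> (\<lambda>x'. rvec x' \<in> int_feasible I \<and> cvec I \<bullet> rvec x' \<le> \<rho> I * (cvec I \<bullet> real_vec x) \<and>
        (\<forall>A\<in>scenarios I. gcost I (rvec x') A \<le> \<rho> I * gcost I (real_vec x) A))) (L i)"
  proof (rule ptime_of_polytime_solves_enc[OF loc[unfolded local_approximation_def]])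
    fix i u assume i: "i \<in> {(I, x). I \<in> J \<and> real_vec x \<in> feasible I}"
    assume "(case i of (I, x) \<Rightarrow> \<lambda>u. \<exists>x'. u = enc_vec x' \<and> real_vec x' \<in> int_feasible I \<and>
        cvec I \<bullet> real_vec x' \<le> \<rho> I * (cvec I \<bullet> real_vec x) \<and>
        (\<forall>A\<in>scenarios I. \<exists>a\<in>integral_actions I (real_vec x') A.
           action_cost I A a \<le> \<rho> I * gcost I (real_vec x) A)) u"
    moreover obtain I x where ix: "i = (I, x)" by (cases i)
    ultimately obtain x' where x': "u = enc_vec x'" "real_vec x' \<in> int_feasible I"
        "cvec I \<bullet> real_vec x' \<le> \<rho> I * (cvec I \<bullet> real_vec x)"
        "\<forall>A\<in>scenarios I. \<exists>a\<in>integral_actions I (real_vec x') A. action_cost I A a \<le> \<rho> I * gcost I (real_vec x) A"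
      by auto
    have IJ: "I \<in> J" using i ix by simp
    have "gcost I (real_vec x') A \<le> \<rho> I * gcost I (real_vec x) A" if A: "A \<in> scenarios I" for A
    proof -
      obtain a where a: "a \<in> integral_actions I (real_vec x') A" "action_cost I A a \<le> \<rho> I * gcost I (real_vec x) A"
        using x'(4) A by blast
      have "real_vec x' \<in> feasible I" using x'(2) by (simp add: int_feasible_def)
      then show ?thesis using gcost_le_action[of I "real_vec x'" A a] inst[OF IJ] A a by force
    qed
    then show "\<exists>v. u = enc_rats v \<and> (case i of (I, x) \<Rightarrow> (\<lambda>x'. rvec x' \<in> int_feasible I \<and>
        cvec I \<bullet> rvec x' \<le> \<rho> I * (cvec I \<bullet> real_vec x) \<and>
        (\<forall>A\<in>scenarios I. gcost I (rvec x') A \<le> \<rho> I * gcost I (real_vec x) A))) v"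
      using x' by (intro exI[of _ "list_of_vec x'"]) (simp add: ix enc_vec_eq rvec_list_of_vec)
  qed blast
  obtain A where A: "ptime {(I, x, y, A). I \<in> J \<and> real_vec x \<in> int_feasible I \<and> 0 \<le> y \<and> A \<in> scenarios I}
     (\<lambda>(I, x, y, A). enc_list [encode I, enc_vec x, Atom y, A]) A"
    "\<And>i. i \<in> {(I, x, y, A). I \<in> J \<and> real_vec x \<in> int_feasible I \<and> 0 \<le> y \<and> A \<in> scenarios I} \<Longrightarrow>
     (case i of (I, x, y, A) \<Rightarrow> (\<lambda>B. B \<in> scenarios I \<and>
        (\<forall>A'\<in>scenarios I.
           gcost I (real_vec x) B - real_of_rat y * kappa I A B
             \<ge> gcost I (real_vec x) A' / \<beta>\<^sub>1 I - \<beta>\<^sub>2 I * real_of_rat y * kappa I A A'))) (A i)"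
    using ptime_of_polytime_solves[OF conjunct2[OF apx[unfolded penalized_approximation_def]]] by blast
  have betas: "\<forall>I\<in>J. 1 \<le> \<beta>\<^sub>1 I \<and> 1 \<le> \<beta>\<^sub>2 I" using apx unfolding penalized_approximation_def by blast
  let ?DG = "{(I, x, A). I \<in> J \<and> real_vec x \<in> feasible I \<and> A \<in> scenarios I}"
  obtain G where G: "ptime ?DG (\<lambda>(I, x, A). enc_list [encode I, enc_vec x, A]) (\<lambda>i. Atom (G i))"
     "\<And>i. i \<in> ?DG \<Longrightarrow> (case i of (I, x, A) \<Rightarrow> \<lambda>v. real_of_rat v = gcost I (real_vec x) A) (G i)"
    by (rule ptime_of_polytime_solves_enc[OF p(1)[unfolded g_algorithm_def], where en = Atom
          and S' = "\<lambda>i. case i of (I, x, A) \<Rightarrow> \<lambda>v. real_of_rat v = gcost I (real_vec x) A"]) auto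
  obtain Q where Q: "ptime {(I, A, A'). I \<in> J \<and> A \<in> scenarios I \<and> A' \<in> scenarios I}
       (\<lambda>(I, A, A'). enc_list [encode I, A, A']) (\<lambda>i. Atom (Q i))"
     "\<And>i. i \<in> {(I, A, A'). I \<in> J \<and> A \<in> scenarios I \<and> A' \<in> scenarios I} \<Longrightarrow>
        (case i of (I, A, A') \<Rightarrow> \<lambda>v. real_of_rat v = kappa I A A') (Q i)"
    by (rule ptime_of_polytime_solves_enc[OF p(3)[unfolded kappa_algorithm_def], where en = Atom
          and S' = "\<lambda>i. case i of (I, A, A') \<Rightarrow> \<lambda>v. real_of_rat v = kappa I A A'"]) auto
  obtain H where H: "ptime ?DG (\<lambda>(I, x, A). enc_list [encode I, enc_vec x, A]) (\<lambda>i. enc_rats (H i))"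
     "\<And>i. i \<in> ?DG \<Longrightarrow> (case i of (I, x, A) \<Rightarrow> \<lambda>v. length v = dimension I \<and>
        subgradient_at (feasible I) (\<lambda>x. gcost I x A) (real_vec x) (rvec v)) (H i)"
  proof (rule ptime_of_polytime_solves_enc[OF p(2)[unfolded subgradient_algorithm_def]])
    fix i u assume "(case i of (I, x, A) \<Rightarrow> \<lambda>u. \<exists>d\<in>carrier_vec (dimension I). u = enc_vec d \<and>
        subgradient_at (feasible I) (\<lambda>x. gcost I x A) (real_vec x) (real_vec d) \<and>
        vnorm (real_vec d) \<le> K I) u"
    moreover obtain I x A where ix: "i = (I, x, A)" by (cases i) auto
    ultimately obtain d where d: "d \<in> carrier_vec (dimension I)" "u = enc_vec d"
        "subgradient_at (feasible I) (\<lambda>x. gcost I x A) (real_vec x) (real_vec d)" by auto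
    then show "\<exists>v. u = enc_rats v \<and> (case i of (I, x, A) \<Rightarrow> \<lambda>v. length v = dimension I \<and>
        subgradient_at (feasible I) (\<lambda>x. gcost I x A) (real_vec x) (rvec v)) v"
      by (intro exI[of _ "list_of_vec d"]) (auto simp: ix enc_vec_eq rvec_list_of_vec)
  qed blast
  have rv: "real_vec (?v x) = rvec x" for x by (simp add: rvec_def)
  have "dr_algorithms J \<rho> \<beta>\<^sub>1 \<beta>\<^sub>2 (\<lambda>I x. S (I, ?v x)) (\<lambda>I x. L (I, ?v x)) (\<lambda>I x y B. A (I, ?v x, y, B))
     (\<lambda>I x B. G (I, ?v x, B)) (\<lambda>I B B'. Q (I, B, B')) (\<lambda>I x B. H (I, ?v x, B))"
  proof
    fix I assume I: "I \<in> J"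
    show "well_formed I" "P1 I" "P2 I" "P3 I" "P4 I" "nonnull_cost_ge_1 I" "1 \<le> \<beta>\<^sub>1 I \<and> 1 \<le> \<beta>\<^sub>2 I"
      using inst[OF I] betas I by auto
    fix x :: "rat list"
    show "if rvec x \<in> feasible I then S (I, ?v x) = Atom 1
       else \<exists>d. length d = dimension I \<and> S (I, ?v x) = enc_rats d \<and>
          (\<forall>x'\<in>feasible I. rvec d \<bullet> x' < rvec d \<bullet> rvec x)" if l: "length x = dimension I"
    proof -
      have "?v x \<in> carrier_vec (dimension I)" using l by (metis carrier_vecI dim_vec_of_list)
      then have s: "if rvec x \<in> feasible I then S (I, ?v x) = Atom 1
        else \<exists>d\<in>carrier_vec (dimension I). S (I, ?v x) = enc_vec d \<and>
          (\<forall>x'\<in>feasible I. real_vec d \<bullet> x' < real_vec d \<bullet> rvec x)"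
        using S(2)[of "(I, ?v x)", unfolded prod.case rv] I by simp
      show ?thesis
      proof (cases "rvec x \<in> feasible I")
        case False
        then obtain d where d: "d \<in> carrier_vec (dimension I)" "S (I, ?v x) = enc_vec d"
          "\<forall>x'\<in>feasible I. real_vec d \<bullet> x' < real_vec d \<bullet> rvec x" using s by auto
        then have "length (list_of_vec d) = dimension I \<and> S (I, ?v x) = enc_rats (list_of_vec d) \<and>
          (\<forall>x'\<in>feasible I. rvec (list_of_vec d) \<bullet> x' < rvec (list_of_vec d) \<bullet> rvec x)"
          by (simp add: enc_vec_eq rvec_list_of_vec)
        then show ?thesis unfolding if_not_P[OF False] by blast
      qed (use s in simp)
    qed
    show "rvec (L (I, ?v x)) \<in> int_feasible I \<and> cvec I \<bullet> rvec (L (I, ?v x)) \<le> \<rho> I * (cvec I \<bullet> rvec x) \<and>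
       (\<forall>A\<in>scenarios I. gcost I (rvec (L (I, ?v x))) A \<le> \<rho> I * gcost I (rvec x) A)" if "rvec x \<in> feasible I"
      using L(2)[of "(I, ?v x)"] I that by (simp add: rv)
    fix B
    show "A (I, ?v x, y, B) \<in> scenarios I \<and>
       (\<forall>A'\<in>scenarios I. gcost I (rvec x) A' / \<beta>\<^sub>1 I - \<beta>\<^sub>2 I * real_of_rat y * kappa I B A'
          \<le> gcost I (rvec x) (A (I, ?v x, y, B)) - real_of_rat y * kappa I B (A (I, ?v x, y, B)))"
      if "rvec x \<in> int_feasible I" "0 \<le> y" "B \<in> scenarios I" for y
      using A(2)[of "(I, ?v x, y, B)"] I that by (simp add: rv)
    show "real_of_rat (G (I, ?v x, B)) = gcost I (rvec x) B" if "rvec x \<in> feasible I" "B \<in> scenarios I"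
      using G(2)[of "(I, ?v x, B)"] I that by (simp add: rv)
    show "length (H (I, ?v x, B)) = dimension I \<and>
       subgradient_at (feasible I) (\<lambda>x. gcost I x B) (rvec x) (rvec (H (I, ?v x, B)))"
      if "rvec x \<in> feasible I" "B \<in> scenarios I"
      using H(2)[of "(I, ?v x, B)"] I that by (simp add: rv)
    show "real_of_rat (Q (I, B, B')) = kappa I B B'" if "B \<in> scenarios I" "B' \<in> scenarios I" for B'
      using Q(2)[of "(I, B, B')"] I that by simp
  next
    show "\<exists>q :: nat poly. \<forall>I\<in>J. \<forall>A\<in>scenarios I. vsize A \<le> poly q (input_size I)" using d by blast
    show "ptime {j. fst j \<in> J \<and> length (snd j) = dimension (fst j)}
       (\<lambda>j. enc_list [encode (fst j), enc_rats (snd j)]) (\<lambda>j. S (fst j, ?v (snd j)))"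
      by (rule ptime_reindex[OF S(1)]) (auto simp: enc_vec_of_list intro: carrier_vecI)
    show "ptime {j. fst j \<in> J \<and> rvec (snd j) \<in> feasible (fst j)}
       (\<lambda>j. enc_list [encode (fst j), enc_rats (snd j)]) (\<lambda>j. enc_rats (L (fst j, ?v (snd j))))"
      by (rule ptime_reindex[OF L(1)]) (auto simp: enc_vec_of_list rv)
    show "ptime {((I, x), (y, A)). I \<in> J \<and> rvec x \<in> int_feasible I \<and> 0 \<le> y \<and> A \<in> scenarios I}
       (\<lambda>j. enc_list [encode (fst (fst j)), enc_rats (snd (fst j)), Atom (fst (snd j)), snd (snd j)])
       (\<lambda>j. A (fst (fst j), ?v (snd (fst j)), fst (snd j), snd (snd j)))"
      by (rule ptime_reindex[OF A(1)]) (auto simp: enc_vec_of_list rv)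
    show "ptime {((I, x), A). I \<in> J \<and> rvec x \<in> feasible I \<and> A \<in> scenarios I}
       (\<lambda>j. enc_list [encode (fst (fst j)), enc_rats (snd (fst j)), snd j])
       (\<lambda>j. Atom (G (fst (fst j), ?v (snd (fst j)), snd j)))"
      by (rule ptime_reindex[OF G(1)]) (auto simp: enc_vec_of_list rv)
    show "ptime {((I, A), A'). I \<in> J \<and> A \<in> scenarios I \<and> A' \<in> scenarios I}
       (\<lambda>j. enc_list [encode (fst (fst j)), snd (fst j), snd j])
       (\<lambda>j. Atom (Q (fst (fst j), snd (fst j), snd j)))"
      by (rule ptime_reindex[OF Q(1)]) auto
    show "ptime {((I, x), A). I \<in> J \<and> rvec x \<in> feasible I \<and> A \<in> scenarios I}
       (\<lambda>j. enc_list [encode (fst (fst j)), enc_rats (snd (fst j)), snd j])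
       (\<lambda>j. enc_rats (H (fst (fst j), ?v (snd (fst j)), snd j)))"
      by (rule ptime_reindex[OF H(1)]) (auto simp: enc_vec_of_list rv)
  qed
  then show ?thesis by (rule that)
qed

text \<open>The integer is at most 2 to the power \<open>?L\<close>. Truncation by
  \<open>nat\<close> covers \<epsilon> of at least 1, where the logarithm is not positive and the
  integer is 1.\<close>

lemma vsize_ceiling_inverse:
  assumes "0 < (\<epsilon> :: real)"
  shows "vsize (Atom (of_int \<lceil>1 / \<epsilon>\<rceil>)) \<le> 2 * nat \<lceil>log 2 (1 / \<epsilon>)\<rceil> + 3"
proof -
  let ?L = "nat \<lceil>log 2 (1 / \<epsilon>)\<rceil>"
  have "1 / \<epsilon> = 2 powr (log 2 (1 / \<epsilon>))" using assms by simp
  also have "\<dots> \<le> 2 powr (real ?L)" by (intro powr_mono) linarith+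
  also have "\<dots> = 2 ^ ?L" by (simp add: powr_realpow)
  finally have "\<lceil>1 / \<epsilon>\<rceil> \<le> \<lceil>real_of_int (2 ^ ?L)\<rceil>" by (intro ceiling_mono) simp
  then have "\<lceil>1 / \<epsilon>\<rceil> \<le> 2 ^ ?L" by (simp only: ceiling_of_int)
  moreover have "0 \<le> \<lceil>1 / \<epsilon>\<rceil>" using assms by (simp add: less_imp_le order_less_le_trans[of "-1" 0])
  moreover have "(2::int) ^ ?L < 2 ^ (?L + 1)" by simp
  ultimately have "\<bar>\<lceil>1 / \<epsilon>\<rceil>\<bar> < 2 ^ (?L + 1)" by linarith
  then have "rat_bits (?L + 1) (of_int \<lceil>1 / \<epsilon>\<rceil>)" by (rule rat_bits_of_int) simp
  from vsize_le_of_rat_bits[OF this] show ?thesis by (simp del: vsize.simps)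
qed

theorem theorem3p7:
  fixes J :: "'z dr_instance set"
    and K \<rho> \<beta>\<^sub>1 \<beta>\<^sub>2 :: "'z dr_instance \<Rightarrow> real"
    and sep loc apx :: prog
  assumes "dr_problem J K"
    and "separation_oracle J sep"
    and "local_approximation J \<rho> loc"
    and "penalized_approximation J \<beta>\<^sub>1 \<beta>\<^sub>2 apx"
  shows "\<exists>alg (q :: nat poly). \<forall>I\<in>J. \<forall>\<epsilon>>0. \<exists>x f t.
    runs alg (Node (encode I) (Atom (of_int \<lceil>1 / \<epsilon>\<rceil>))) (Node (enc_vec x) (Atom f)) t \<and>
    t \<le> poly q (input_size I + nat \<lceil>log 2 (1 / \<epsilon>)\<rceil>) \<and>
    real_vec x \<in> int_feasible I \<and>
    real_of_rat f \<le> h_central I (real_vec x) \<and>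
    h_central I (real_vec x) \<le> \<beta>\<^sub>1 I * \<beta>\<^sub>2 I * real_of_rat f \<and>
    real_of_rat f \<le> \<rho> I * (1 + \<epsilon>) * Min (h_central I ` int_feasible I)"
proof -
  obtain Sep Loc Apx Gr Kr Sg where "dr_algorithms J \<rho> \<beta>\<^sub>1 \<beta>\<^sub>2 Sep Loc Apx Gr Kr Sg"
    using dr_algorithms_exist[OF assms] by blast
  then interpret dr_algorithms J \<rho> \<beta>\<^sub>1 \<beta>\<^sub>2 Sep Loc Apx Gr Kr Sg .
  let ?b = "\<lambda>I k. snd (snd (state I k (outer_steps I k)))"
  obtain alg T q where alg: "\<And>i. i \<in> D0 \<Longrightarrow> runs alg (e0 i)
      (Node (enc_rats (snd (?b (fst i) (snd i)))) (Atom (fst (?b (fst i) (snd i))))) (T i)"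
    "\<And>i. i \<in> D0 \<Longrightarrow> T i \<le> poly q (vsize (e0 i))"
    using ptime_output unfolding ptime_def pbound_def Let_def by blast
  show ?thesis
  \<comment> \<open>The substituted polynomial 4 + 2 * n bounds the size of the complete input:
    instance, pair constructor, and the integer for the accuracy.\<close>
  proof (intro exI[of _ alg] exI[of _ "pcompose q [:4, 2:]"] ballI allI impI)
    fix I and \<epsilon> :: real assume I: "I \<in> J" and e: "0 < \<epsilon>"
    define k :: rat where "k = of_int \<lceil>1 / \<epsilon>\<rceil>"
    let ?L = "nat \<lceil>log 2 (1 / \<epsilon>)\<rceil>"
    have "0 < \<lceil>1 / \<epsilon>\<rceil>" using e by simp
    then have "(of_int 1 :: rat) \<le> of_int \<lceil>1 / \<epsilon>\<rceil>" by (intro iffD2[OF of_int_le_iff]) linarith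
    then have k1: "1 \<le> k" by (simp add: k_def)
    have rk: "1 / \<epsilon> \<le> real_of_rat k" by (simp add: k_def)
    have ke: "1 / real_of_rat k \<le> \<epsilon>"
    proof -
      have "0 < real_of_rat k" using k1 by simp
      then show ?thesis using rk e by (simp add: divide_le_eq mult.commute)
    qed
    have iD: "(I, k) \<in> D0" using I k1 by (simp add: D0_def)
    have "T (I, k) \<le> poly q (vsize (Node (encode I) (Atom k)))" using alg(2)[OF iD] by (simp add: e0_def)
    also have "\<dots> \<le> poly q (4 + 2 * (input_size I + ?L))"
      using vsize_ceiling_inverse[OF e] by (intro poly_nat_mono) (simp add: input_size_def k_def del: vsize.simps(1))
    finally have t: "T (I, k) \<le> poly (pcompose q [:4, 2:]) (input_size I + ?L)"
      by (simp add: poly_pcompose algebra_simps)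
    note c = state_candidate[OF I, of k "outer_steps I k"]
    have xi: "rvec (snd (?b I k)) \<in> int_feasible I" and fe: "fst (?b I k) = fval I (snd (?b I k))" using c by auto
    have xf: "rvec (snd (?b I k)) \<in> feasible I" using xi int_feasible_subset by blast
    have "real_of_rat (fst (?b I k)) \<le> \<rho> I * (1 + 1 / real_of_rat k) * opt I"
      using solution[OF I k1] by (simp add: bound_def[OF I])
    also have "\<dots> \<le> \<rho> I * (1 + \<epsilon>) * opt I"
    \<comment> \<open>The right-hand side is monotone in the accuracy only for nonnegative \<rho>,
      which is known once the optimum is positive; otherwise both sides vanish.\<close>
    proof (cases "opt I = 0")
      case False
      then have o: "0 < opt I" using opt_nonneg[OF I] by linarith
      then have "0 \<le> \<rho> I" using rho_ge_1[OF I] by linarith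
      then show ?thesis using o ke by (intro mult_right_mono mult_left_mono) auto
    qed simp
    finally have f: "real_of_rat (fst (?b I k)) \<le> \<rho> I * (1 + \<epsilon>) * Min (h_central I ` int_feasible I)"
      by (simp add: opt_def)
    have "runs alg (Node (encode I) (Atom k)) (Node (enc_vec (vec_of_list (snd (?b I k)))) (Atom (fst (?b I k)))) (T (I, k))"
      using alg(1)[OF iD] by (simp add: e0_def enc_vec_of_list)
    moreover have "real_of_rat (fst (?b I k)) \<le> h_central I (rvec (snd (?b I k)))"
      unfolding fe fval_eq[OF I xi] by (rule hplan_le_h[OF I xi xf])
    moreover have "h_central I (rvec (snd (?b I k))) \<le> \<beta>\<^sub>1 I * \<beta>\<^sub>2 I * real_of_rat (fst (?b I k))"
      unfolding fe by (rule h_le_fval[OF I xi])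
    ultimately show "\<exists>x f t. runs alg (Node (encode I) (Atom (of_int \<lceil>1 / \<epsilon>\<rceil>))) (Node (enc_vec x) (Atom f)) t \<and>
      t \<le> poly (pcompose q [:4, 2:]) (input_size I + ?L) \<and> real_vec x \<in> int_feasible I \<and>
      real_of_rat f \<le> h_central I (real_vec x) \<and>
      h_central I (real_vec x) \<le> \<beta>\<^sub>1 I * \<beta>\<^sub>2 I * real_of_rat f \<and>
      real_of_rat f \<le> \<rho> I * (1 + \<epsilon>) * Min (h_central I ` int_feasible I)"
      using t xi f unfolding k_def rvec_def by blast
  qed
qed

end
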